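(* Let $\Psi(T^n)$ be the total path length of a random split tree $T^n$ of cardinality $n$ with split vector $\mathcal V=(V_1,\ldots,V_b)$, where $\mathbf P(\exists i: V_i=1)<1$. Let $$X_n:=\frac{\Psi(T^n)-\mathbf E[\Psi(T^n)]}{n}\qquad\text{and}\qquad C(\mathcal V):=1+\frac1\mu\sum_{i=1}^b V_i\ln V_i .$$ If $C(\mathcal V)\neq 0$ with positive probability, then $X_n\to X$ in distribution as $n\to\infty$, where $X$ is the unique (in distribution) solution of the fixed point equation $$X\stackrel{d}{=}\sum_{k=1}^b V_kX^{(k)}+C(\mathcal V)$$ satisfying $\mathbf E[X]=0$ and $\mathbf{Var}(X)<\infty$; here $X^{(1)},\ldots,X^{(b)}$ are i.i.d. copies of $X$, independent of $\mathcal V$. Furthermore, exponential moments of $X_n$ exist and converge: $\mathbf E[e^{\lambda X_n}]\to\mathbf E[e^{\lambda X}]$ for any $\lambda\in\mathbb R$.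
   Context: Split trees. Fix integers $b\ge 2$, $s\ge 0$, $s_0\ge0$, $s_1\ge 0$ with $0\le bs_1\le s+1-s_0$ and $(s,s_0)\ne(0,0)$, and a random vector $\mathcal V=(V_1,\ldots,V_b)$ with $V_i\ge 0$, $\sum_i V_i=1$ and $\mathbf P(\exists i: V_i=1)<1$. Let $\mathcal U=\bigcup_{k\ge0}\{1,\ldots,b\}^k$ be the nodes of the infinite rooted $b$-ary tree (root $\varnothing$, depth of $u$ denoted $|u|$). Each node $u\in\mathcal U$ receives an independent copy $\mathcal V_u$ of $\mathcal V$. The number $n_u$ of items in the subtree rooted at $u$ is defined by $n_\varnothing=n$ and recursively: if $n_v>s$, then given $n_v$ and $\mathcal V_v=(V_1,\ldots,V_b)$, the cardinalities $(n_{v_1},\ldots,n_{v_b})$ of the children $v_1,\ldots,v_b$ of $v$ are distributed as $\mathrm{Mult}(n_v-s_0-bs_1;V_1,\ldots,V_b)+(s_1,\ldots,s_1)$, and $v$ itself stores $s_0$ items; if $n_v\le s$, then $v$ stores all its $n_v$ items and all its strict descendants $w$ have $n_w=0$. The split tree $T^n$ of cardinality $n$ is the set of nodes $u$ with $n_u>0$. Total path length. $\Psi(T^n)$ is the sum over the $n$ items of the depth of the node storing the item; equivalently $\Psi(T^n)=\sum_{u\ne\varnothing}n_u$. Constants. $V$ denotes a uniformly random component of $\mathcal V$ and $\mu:=b\,\mathbf E[-V\ln V]\in(0,\infty)$, with the convention $0\ln 0=0$.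
   Formalization: Exponential moments can be infinite (X_n if s0=s1=0; X if P(∃i:V_i=1)e^λ≥1), so convergence is stated in [0,∞] for every λ, with finiteness for all n if s0>0 or s1>0, and for large n and X if P(∃i:V_i=1)e^λ<1. *)

theory Defs
  imports "HOL-Probability.Probability"
begin

(* The children of a node are indexed by the finite type 'b, so b = CARD('b). A node of the
   infinite b-ary tree is the list u :: 'b list of child indices on the path from the root:
   the root is [], the i-th child of u is u @ [i], and the depth of u is length u.
   The split vector enters through its law D, a probability measure on real ^ 'b. *)

definition split_vector_law :: "(real ^ 'b::finite) measure \<Rightarrow> bool" where
  "split_vector_law D \<longleftrightarrow>
     prob_space D \<and> sets D = sets borel \<and>
     (AE v in D. (\<forall>i. 0 \<le> v $ i) \<and> (\<Sum>i\<in>UNIV. v $ i) = 1)"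

definition multinomial_prob :: "nat \<Rightarrow> real ^ 'b::finite \<Rightarrow> ('b \<Rightarrow> nat) \<Rightarrow> real" where
  "multinomial_prob m v c =
     (if (\<Sum>i\<in>UNIV. c i) = m
      then fact m / (\<Prod>i\<in>UNIV. fact (c i)) * (\<Prod>i\<in>UNIV. (v $ i) ^ c i)
      else 0)"

(* Probability that a node with m items and split vector v has child cardinalities c.
   The natural-number subtraction is exact when s0 + b * s1 \<le> s + 1. *)
definition child_prob ::
  "nat \<Rightarrow> nat \<Rightarrow> nat \<Rightarrow> nat \<Rightarrow> real ^ 'b::finite \<Rightarrow> ('b \<Rightarrow> nat) \<Rightarrow> real" where
  "child_prob s s0 s1 m v c =
     (if s < m
      then (if \<forall>i. s1 \<le> c i
            then multinomial_prob (m - s0 - CARD('b) * s1) v (\<lambda>i. c i - s1)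
            else 0)
      else (if \<forall>i. c i = 0 then 1 else 0))"

(* The sigma-algebra generated by all split vectors and by the cardinalities n_u with |u| \<le> k. *)
definition split_history ::
  "'a measure \<Rightarrow> ('b::finite list \<Rightarrow> 'a \<Rightarrow> real ^ 'b) \<Rightarrow> ('b list \<Rightarrow> 'a \<Rightarrow> nat) \<Rightarrow> nat \<Rightarrow> 'a measure" where
  "split_history M V N k =
     sigma (space M)
       ({V u -` B \<inter> space M | u B. B \<in> sets borel} \<union>
        {N u -` B \<inter> space M | u B. length u \<le> k})"

(* A realisation, on a probability space M, of the split vectors V u and the subtree
   cardinalities N u of a random split tree with n items. By children_law, given all split
   vectors and the cardinalities down to depth k, the families of child cardinalities of the
   nodes at depth k are independent and follow the splitting rule; together with the other
   assumptions this determines the joint law of V and N. *)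
locale split_tree = prob_space M for M :: "'a measure" +
  fixes D :: "(real ^ 'b::finite) measure" and s s0 s1 n :: nat
    and V :: "'b list \<Rightarrow> 'a \<Rightarrow> real ^ 'b" and N :: "'b list \<Rightarrow> 'a \<Rightarrow> nat"
  assumes V_measurable: "V u \<in> borel_measurable M"
    and N_measurable: "N u \<in> measurable M (count_space UNIV)"
    and V_law: "distr M borel (V u) = D"
    and V_indep: "indep_vars (\<lambda>_. borel) V UNIV"
    and root: "AE \<omega> in M. N [] \<omega> = n"
    and children_law:
      "AE \<omega> in M.
         real_cond_exp M (split_history M V N k)
           (indicator {\<omega> \<in> space M. \<forall>u i. length u = k \<longrightarrow> N (u @ [i]) \<omega> = c u i}) \<omega> =
         (\<Prod>u | length u = k. child_prob s s0 s1 (N u \<omega>) (V u \<omega>) (c u))"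

definition tree_nodes :: "('b list \<Rightarrow> nat) \<Rightarrow> 'b list set" where
  "tree_nodes N = {u. 0 < N u}"

definition stored :: "nat \<Rightarrow> nat \<Rightarrow> nat \<Rightarrow> nat" where
  "stored s s0 m = (if s < m then s0 else m)"

definition total_path_length :: "nat \<Rightarrow> nat \<Rightarrow> ('b list \<Rightarrow> nat) \<Rightarrow> real" where
  "total_path_length s s0 N =
     (\<Sum>\<^sub>\<infinity>u\<in>tree_nodes N. real (length u) * real (stored s s0 (N u)))"

definition normalized_path_length ::
  "'a measure \<Rightarrow> nat \<Rightarrow> nat \<Rightarrow> nat \<Rightarrow> ('b list \<Rightarrow> 'a \<Rightarrow> nat) \<Rightarrow> 'a \<Rightarrow> real" where
  "normalized_path_length M s s0 n N \<omega> =
     (total_path_length s s0 (\<lambda>u. N u \<omega>)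
       - (\<integral>\<omega>'. total_path_length s s0 (\<lambda>u. N u \<omega>') \<partial>M)) / real n"

(* mu = b E[- V ln V], with V a uniformly random component of the split vector;
   0 * ln 0 = 0 as intended. *)
definition split_mu :: "(real ^ 'b::finite) measure \<Rightarrow> real" where
  "split_mu D =
     real CARD('b) *
     (\<integral>(v, i). - (v $ i * ln (v $ i)) \<partial>(D \<Otimes>\<^sub>M measure_pmf (pmf_of_set (UNIV :: 'b set))))"

definition split_C :: "(real ^ 'b::finite) measure \<Rightarrow> real ^ 'b \<Rightarrow> real" where
  "split_C D v = 1 + 1 / split_mu D * (\<Sum>i\<in>UNIV. v $ i * ln (v $ i))"

(* L is the law of a real random variable X with E[X] = 0 and Var(X) < infinity that satisfies
   the fixed point equation. In the product measure the split vector v and the i.i.d. family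
   (x k) of L-distributed variables are independent. *)
definition fixed_point_law :: "(real ^ 'b::finite) measure \<Rightarrow> real measure \<Rightarrow> bool" where
  "fixed_point_law D L \<longleftrightarrow>
     prob_space L \<and> sets L = sets borel \<and>
     integrable L (\<lambda>x. x) \<and> (\<integral>x. x \<partial>L) = 0 \<and> integrable L (\<lambda>x. x ^ 2) \<and>
     L = distr (D \<Otimes>\<^sub>M Pi\<^sub>M (UNIV :: 'b set) (\<lambda>_. L)) borel
           (\<lambda>(v, x). (\<Sum>k\<in>UNIV. v $ k * x k) + split_C D v)"

end

theory Submission
  imports Defs "HOL-Real_Asymp.Real_Asymp"
begin

text \<open>Let \<open>a n\<close> be the expected path length of a tree with \<open>n\<close> items. The path length minus its mean is
  the limit of the martingale that adds, level by level, the tolls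
  \<open>toll n c = (\<Sum>i. c i + a (c i)) - a n\<close> of the nodes, so the theorem is about the recursion
  \<open>X(n) = (\<Sum>i. X(c i)) + toll n c\<close>.

  For the convergence of \<open>toll n c / n\<close> to \<open>split_C\<close> one needs \<open>a n = n ln n / \<mu> + n g(n)\<close> where \<open>g\<close> oscillates
  negligibly between \<open>n\<close> and \<open>n v i\<close>. Coupling \<open>n\<close> and \<open>n + 1\<close> items shows that the increments of \<open>a\<close>
  satisfy a recursion along the Markov chain of a size-biased path; a Lyapunov function bounds them up to
  \<open>ln n / \<mu>\<close>, and \<open>g\<close> is then bounded, slowly varying and asymptotically harmonic on the logarithmic
  scale, so that an \<open>L\<^sup>2\<close> argument of Choquet--Deny type takes the place of the renewal theorem.

  Weak convergence is a contraction argument for characteristic functions in the metric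
  \<open>sup |\<phi>(t) - \<psi>(t)| / t\<^sup>2\<close>, whose contraction factor is \<open>E[\<Sum>i. (v i)\<^sup>2] < 1\<close>. Moment generating
  functions satisfy bounds \<open>exp (K w\<^sup>2 n\<^sup>2)\<close> by induction over the depth as long as \<open>p exp t < 1\<close>, where \<open>p\<close> is
  the mass of the vertices of the simplex; this gives uniform integrability. For \<open>p exp t \<ge> 1\<close> the
  limit law has no exponential moment of order \<open>t\<close> and both sides are infinite in the limit.\<close>

section \<open>Multinomial weights\<close>

text \<open>Two features of the model shape the argument. If \<open>s0 = s1 = 0\<close>, a node may
  pass all its items to one child: the recursion need not decrease the cardinality, and the height
  has no deterministic bound. Hence the mean path length is built as a limit over the truncation
  depth, and bounds by induction on the cardinality rely on \<open>stay_prob\<close>: such a step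
  has probability below 1. Secondly, the split vector may be a vertex of the simplex with positive
  probability; there the fixed-point equation shifts by 1 without shrinking, which limits the
  exponential moments.

  Every strict inequality for the split vector has one source, \<open>integral_D_less_1\<close>.
  Applied to the sum of squares it gives the contraction, to the entropy \<open>mu > 0\<close>, to
  the number of nonzero components the Lyapunov function \<open>1 / (n + 1)\<close>.

  Increments are studied instead of \<open>a\<close> because differencing replaces the
  \<open>b\<close> children by a single path and the toll by the constant 1. On this path the
  logarithm drops by about \<open>mu\<close> per step on average, so \<open>ln n / mu\<close>
  compensates the constant and leaves an error of order \<open>1 / n\<close>, small enough for the
  Lyapunov function.\<close>

lemma finite_bounded_functions [simp]: "finite {c :: 'b::finite \<Rightarrow> nat. \<forall>i. c i \<le> m}"
proof -
  have "{c :: 'b \<Rightarrow> nat. \<forall>i. c i \<le> m} = PiE UNIV (\<lambda>_. {..m})"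
    by (auto simp: PiE_def Pi_def)
  then show ?thesis by (simp add: finite_PiE)
qed

definition compositions :: "nat \<Rightarrow> ('b::finite \<Rightarrow> nat) set" where
  "compositions m = {c. (\<Sum>i\<in>UNIV. c i) = m}"

lemma composition_le: "c \<in> compositions m \<Longrightarrow> c i \<le> m"
  unfolding compositions_def using member_le_sum[of i UNIV c] by auto

lemma finite_compositions [simp]: "finite (compositions m :: ('b::finite \<Rightarrow> nat) set)"
  by (rule finite_subset[OF _ finite_bounded_functions[of m]]) (auto intro: composition_le)

text \<open>A finite sum instead of an integral, so that linearity and reindexing raise no question
  of integrability.\<close>

definition multinomial_expectation ::
  "nat \<Rightarrow> real ^ 'b::finite \<Rightarrow> (('b \<Rightarrow> nat) \<Rightarrow> real) \<Rightarrow> real" where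
  "multinomial_expectation m v F = (\<Sum>c\<in>compositions m. multinomial_prob m v c * F c)"

section \<open>Size biasing and moments of multinomial weights\<close>

lemma sum_fun_upd_Suc:
  "(\<Sum>j\<in>UNIV. (c(i := Suc (c i))) j) = Suc (\<Sum>j\<in>UNIV. (c :: 'b::finite \<Rightarrow> nat) j)"
  by (simp add: sum.remove[of UNIV i])

text \<open>One more ball in cell \<open>i\<close> multiplies the multinomial coefficient by
  \<open>Suc m / Suc (c i)\<close> and the monomial by \<open>v $ i\<close>. The form without
  division also covers vectors that are not compositions of \<open>m\<close>, where both sides
  vanish.\<close>

lemma multinomial_prob_Suc:
  fixes v :: "real ^ 'b::finite"
  shows "multinomial_prob (Suc m) v (c(i := Suc (c i))) * real (Suc (c i))
    = real (Suc m) * v $ i * multinomial_prob m v c"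
proof (cases "(\<Sum>j\<in>UNIV. c j) = m")
  case True
  have s: "(\<Sum>j\<in>UNIV. (c(i := Suc (c i))) j) = Suc m" using True by (subst sum_fun_upd_Suc) simp
  have f: "(\<Prod>j\<in>UNIV. fact ((c(i := Suc (c i))) j)) = (real (Suc (c i)) * (\<Prod>j\<in>UNIV. fact (c j)) :: real)"
    by (simp add: prod.remove[of UNIV i])
  have p: "(\<Prod>j\<in>UNIV. (v $ j) ^ (c(i := Suc (c i))) j) = v $ i * (\<Prod>j\<in>UNIV. (v $ j) ^ c j)"
    by (simp add: prod.remove[of UNIV i])
  have nz: "(\<Prod>j\<in>UNIV. fact (c j)) \<noteq> (0 :: real)" by simp
  show ?thesis
    unfolding multinomial_prob_def s f p using True nz
    by (simp add: divide_simps)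
next
  case False
  then show ?thesis unfolding multinomial_prob_def sum_fun_upd_Suc by simp
qed

text \<open>Weighting by \<open>c i\<close> marks one ball of cell \<open>i\<close>. Removing the
  marked ball leaves a throw of \<open>m\<close> balls, and the factor in front is the mean number
  of balls that can be marked.\<close>

lemma multinomial_size_bias:
  fixes v :: "real ^ 'b::finite"
  shows "multinomial_expectation (Suc m) v (\<lambda>c. real (c i) * F c)
    = real (Suc m) * v $ i * multinomial_expectation m v (\<lambda>c. F (c(i := Suc (c i))))"
proof -
  let ?up = "\<lambda>c :: 'b \<Rightarrow> nat. c(i := Suc (c i))"
  have "multinomial_expectation (Suc m) v (\<lambda>c. real (c i) * F c)
      = (\<Sum>c\<in>?up ` compositions m. multinomial_prob (Suc m) v c * (real (c i) * F c))"
    unfolding multinomial_expectation_def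
  proof (rule sum.mono_neutral_right)
    show "?up ` compositions m \<subseteq> compositions (Suc m)"
      by (auto simp: compositions_def simp del: fun_upd_apply simp: sum_fun_upd_Suc)
    \<comment> \<open>Compositions outside the image have an empty cell \<open>i\<close>, so the
      factor \<open>c i\<close> removes them.\<close>
    show "\<forall>c\<in>compositions (Suc m) - ?up ` compositions m. multinomial_prob (Suc m) v c * (real (c i) * F c) = 0"
    proof
      fix c :: "'b \<Rightarrow> nat" assume c: "c \<in> compositions (Suc m) - ?up ` compositions m"
      have "c i = 0"
      proof (rule ccontr)
        assume "c i \<noteq> 0"
        then have eq: "c = ?up (c(i := c i - 1))" by (auto simp: fun_eq_iff)
        have "(\<Sum>j\<in>UNIV. c j) = Suc (\<Sum>j\<in>UNIV. (c(i := c i - 1)) j)"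
          by (subst eq) (rule sum_fun_upd_Suc)
        with c have "c(i := c i - 1) \<in> compositions m" by (simp add: compositions_def)
        with eq c show False by blast
      qed
      then show "multinomial_prob (Suc m) v c * (real (c i) * F c) = 0" by simp
    qed
  qed simp
  also have "\<dots> = (\<Sum>c\<in>compositions m. multinomial_prob (Suc m) v (?up c) * (real (?up c i) * F (?up c)))"
    by (rule sum.reindex_cong[of ?up]) (auto simp: inj_on_def fun_eq_iff split: if_splits)
  also have "\<dots> = (\<Sum>c\<in>compositions m. real (Suc m) * v $ i * multinomial_prob m v c * F (?up c))"
    by (rule sum.cong) (use multinomial_prob_Suc[of m v _ i] in \<open>simp_all add: mult.assoc[symmetric]\<close>)
  also have "\<dots> = real (Suc m) * v $ i * multinomial_expectation m v (\<lambda>c. F (?up c))"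
    unfolding multinomial_expectation_def by (simp add: sum_distrib_left mult_ac)
  finally show ?thesis .
qed

lemma multinomial_expectation_sum:
  "multinomial_expectation m v (\<lambda>c. \<Sum>i\<in>I. F i c) = (\<Sum>i\<in>I. multinomial_expectation m v (F i))"
  unfolding multinomial_expectation_def by (simp add: sum_distrib_left sum.swap[of _ I])

lemma multinomial_expectation_cmult:
  "multinomial_expectation m v (\<lambda>c. a * F c) = a * multinomial_expectation m v F"
  unfolding multinomial_expectation_def by (simp add: sum_distrib_left mult_ac)

lemma multinomial_expectation_add:
  "multinomial_expectation m v (\<lambda>c. F c + G c) = multinomial_expectation m v F + multinomial_expectation m v G"
  unfolding multinomial_expectation_def by (simp add: sum.distrib algebra_simps)

lemma multinomial_expectation_diff:
  "multinomial_expectation m v (\<lambda>c. F c - G c) = multinomial_expectation m v F - multinomial_expectation m v G"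
  unfolding multinomial_expectation_def by (simp add: sum_subtractf algebra_simps)

lemma multinomial_expectation_cong:
  "(\<And>c. c \<in> compositions m \<Longrightarrow> F c = G c) \<Longrightarrow> multinomial_expectation m v F = multinomial_expectation m v G"
  unfolding multinomial_expectation_def by (rule sum.cong) auto

text \<open>The size-bias identity is summed over the cells, whose counts add up to
  \<open>Suc m\<close>. The result throws the last ball separately, into cell \<open>i\<close> with
  weight \<open>v $ i\<close>; this is the coupling behind \<open>increment_rec\<close>.\<close>

lemma multinomial_expectation_Suc:
  fixes v :: "real ^ 'b::finite"
  shows "multinomial_expectation (Suc m) v F
    = (\<Sum>i\<in>UNIV. v $ i * multinomial_expectation m v (\<lambda>c. F (c(i := Suc (c i)))))"
proof -
  have "real (Suc m) * multinomial_expectation (Suc m) v F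
      = multinomial_expectation (Suc m) v (\<lambda>c. real (Suc m) * F c)"
    by (simp add: multinomial_expectation_cmult)
  also have "\<dots> = multinomial_expectation (Suc m) v (\<lambda>c. \<Sum>i\<in>UNIV. real (c i) * F c)"
  proof (rule multinomial_expectation_cong)
    fix c :: "'b \<Rightarrow> nat" assume "c \<in> compositions (Suc m)"
    then have "real (Suc m) = (\<Sum>i\<in>UNIV. real (c i))"
      by (simp add: compositions_def flip: of_nat_sum)
    then show "real (Suc m) * F c = (\<Sum>i\<in>UNIV. real (c i) * F c)" by (simp add: sum_distrib_right)
  qed
  also have "\<dots> = real (Suc m) * (\<Sum>i\<in>UNIV. v $ i * multinomial_expectation m v (\<lambda>c. F (c(i := Suc (c i)))))"
    by (simp only: multinomial_expectation_sum multinomial_size_bias sum_distrib_left mult.assoc)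
  finally show ?thesis by simp
qed

lemma multinomial_expectation_0:
  fixes v :: "real ^ 'b::finite"
  shows "multinomial_expectation 0 v F = F (\<lambda>_. 0)"
proof -
  have "compositions 0 = {\<lambda>_ :: 'b. 0 :: nat}" by (auto simp: compositions_def fun_eq_iff)
  then show ?thesis unfolding multinomial_expectation_def by (simp add: multinomial_prob_def)
qed

lemma multinomial_expectation_const:
  "(\<Sum>i\<in>UNIV. v $ i) = 1 \<Longrightarrow> multinomial_expectation m v (\<lambda>_. a) = a"
  by (induction m) (simp_all add: multinomial_expectation_0 multinomial_expectation_Suc flip: sum_distrib_right)

lemma multinomial_expectation_coord:
  assumes "(\<Sum>i\<in>UNIV. v $ i) = 1"
  shows "multinomial_expectation m v (\<lambda>c. real (c i)) = real m * v $ i"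
proof (cases m)
  case (Suc k)
  then show ?thesis
    using multinomial_size_bias[of k v i "\<lambda>_. 1"] multinomial_expectation_const[OF assms, of k 1] by simp
qed (simp add: multinomial_expectation_0)

lemma multinomial_expectation_coord_square:
  assumes "(\<Sum>i\<in>UNIV. v $ i) = 1"
  shows "multinomial_expectation m v (\<lambda>c. real (c i) * real (c i)) = real m * v $ i * ((real m - 1) * v $ i + 1)"
proof (cases m)
  case (Suc k)
  have "multinomial_expectation k v (\<lambda>c. real ((c(i := Suc (c i))) i)) = real k * v $ i + 1"
    using multinomial_expectation_add[of k v "\<lambda>_. 1" "\<lambda>c. real (c i)"]
      multinomial_expectation_const[OF assms, of k 1] multinomial_expectation_coord[OF assms, of k i]
    by simp
  then show ?thesis
    using Suc multinomial_size_bias[of k v i "\<lambda>c. real (c i)"] by simp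
qed (simp add: multinomial_expectation_0)

lemma multinomial_variance:
  assumes "(\<Sum>i\<in>UNIV. v $ i) = 1"
  shows "multinomial_expectation m v (\<lambda>c. (real (c i) - real m * v $ i)\<^sup>2) = real m * v $ i * (1 - v $ i)"
proof -
  have "multinomial_expectation m v (\<lambda>c. (real (c i) - real m * v $ i)\<^sup>2)
     = multinomial_expectation m v (\<lambda>c. real (c i) * real (c i) + ((- 2 * (real m * v $ i)) * real (c i) + (real m * v $ i)\<^sup>2))"
    by (rule multinomial_expectation_cong) (simp add: power2_eq_square algebra_simps)
  then show ?thesis
    unfolding multinomial_expectation_add multinomial_expectation_cmult
      multinomial_expectation_coord[OF assms] multinomial_expectation_coord_square[OF assms]
      multinomial_expectation_const[OF assms]
    by (simp add: power2_eq_square algebra_simps)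
qed

lemma multinomial_prob_nonneg: "(\<And>i. 0 \<le> v $ i) \<Longrightarrow> 0 \<le> multinomial_prob m v c"
  unfolding multinomial_prob_def by (auto intro!: mult_nonneg_nonneg divide_nonneg_nonneg prod_nonneg)

lemma multinomial_expectation_mono:
  assumes "\<And>i. 0 \<le> v $ i" "\<And>c. c \<in> compositions m \<Longrightarrow> F c \<le> G c"
  shows "multinomial_expectation m v F \<le> multinomial_expectation m v G"
  unfolding multinomial_expectation_def
  by (intro sum_mono mult_left_mono assms multinomial_prob_nonneg)

section \<open>Cardinalities of the children of one node\<close>

lemma multinomial_prob_measurable [measurable]:
  "(\<lambda>v. multinomial_prob m v c) \<in> borel_measurable (borel :: (real ^ 'b::finite) measure)"
  unfolding multinomial_prob_def by measurable

lemma child_prob_measurable [measurable]: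
  "(\<lambda>v. child_prob s s0 s1 m v c) \<in> borel_measurable (borel :: (real ^ 'b::finite) measure)"
  unfolding child_prob_def by measurable

lemma child_prob_nonneg: "(\<And>i. 0 \<le> v $ i) \<Longrightarrow> 0 \<le> child_prob s s0 s1 n v c"
  unfolding child_prob_def by (auto intro!: multinomial_prob_nonneg)

text \<open>The box \<open>c i \<le> n\<close> contains the support and does not depend on
  \<open>v\<close>, so it can serve as a finite sample space for all split vectors at once. On the
  support, subtracting the \<open>s1\<close> items that each child gets in advance leaves a
  multinomial vector.\<close>

lemma sum_child_prob:
  fixes v :: "real ^ 'b::finite"
  assumes n: "s < n" "s0 + CARD('b) * s1 \<le> n"
  shows "(\<Sum>c | \<forall>i. c i \<le> n. child_prob s s0 s1 n v c * F c)
    = multinomial_expectation (n - s0 - CARD('b) * s1) v (\<lambda>B. F (\<lambda>i. s1 + B i))"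
proof -
  let ?m = "n - s0 - CARD('b) * s1" and ?sh = "\<lambda>B :: 'b \<Rightarrow> nat. \<lambda>i. s1 + B i"
  have le: "s1 + B i \<le> n" if "B \<in> compositions ?m" for B :: "'b \<Rightarrow> nat" and i
  proof -
    have "s1 \<le> CARD('b) * s1" using zero_less_card_finite[where 'a = 'b] by (cases "CARD('b)") auto
    then show ?thesis using composition_le[OF that, of i] n by linarith
  qed
  have "(\<Sum>c | \<forall>i. c i \<le> n. child_prob s s0 s1 n v c * F c)
      = (\<Sum>c\<in>?sh ` compositions ?m. child_prob s s0 s1 n v c * F c)"
  proof (rule sum.mono_neutral_right)
    show "\<forall>c\<in>{c. \<forall>i. c i \<le> n} - ?sh ` compositions ?m. child_prob s s0 s1 n v c * F c = 0"
    proof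
      fix c assume c: "c \<in> {c. \<forall>i. c i \<le> n} - ?sh ` compositions ?m"
      have "child_prob s s0 s1 n v c = 0"
      proof (rule ccontr)
        assume nz: "child_prob s s0 s1 n v c \<noteq> 0"
        then have s1: "\<forall>i. s1 \<le> c i" and "multinomial_prob ?m v (\<lambda>i. c i - s1) \<noteq> 0"
          using n by (auto simp: child_prob_def split: if_splits)
        then have "(\<lambda>i. c i - s1) \<in> compositions ?m"
          by (auto simp: multinomial_prob_def compositions_def split: if_splits)
        then have "?sh (\<lambda>i. c i - s1) \<in> ?sh ` compositions ?m" by (rule imageI)
        moreover have "?sh (\<lambda>i. c i - s1) = c" using s1 by (auto simp: fun_eq_iff)
        ultimately show False using c by simp
      qed
      then show "child_prob s s0 s1 n v c * F c = 0" by simp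
    qed
  qed (auto intro: le)
  also have "\<dots> = (\<Sum>B\<in>compositions ?m. child_prob s s0 s1 n v (?sh B) * F (?sh B))"
    by (rule sum.reindex_cong[of ?sh]) (auto simp: inj_on_def fun_eq_iff)
  also have "\<dots> = multinomial_expectation ?m v (\<lambda>B. F (?sh B))"
    unfolding multinomial_expectation_def using n by (simp add: child_prob_def)
  finally show ?thesis .
qed

lemma child_prob_support:
  assumes "child_prob s s0 s1 n (v :: real ^ 'b::finite) c \<noteq> 0" "s0 + CARD('b) * s1 \<le> s + 1"
  shows "s < n \<Longrightarrow> (\<Sum>i\<in>UNIV. c i) = n - s0" "s < n \<Longrightarrow> s1 \<le> c i" "n \<le> s \<Longrightarrow> c i = 0"
    "c i \<le> n"
proof -
  have A: "(\<Sum>i\<in>UNIV. c i) = n - s0 \<and> (\<forall>i. s1 \<le> c i)" if "s < n"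
  proof -
    from that assms have 1: "\<forall>i. s1 \<le> c i" and 2: "(\<Sum>i\<in>UNIV. c i - s1) = n - s0 - CARD('b) * s1"
      by (auto simp: child_prob_def multinomial_prob_def split: if_splits)
    have "(\<Sum>i\<in>UNIV. c i) = (\<Sum>i\<in>UNIV. (c i - s1) + s1)" using 1 by simp
    also have "\<dots> = n - s0" using 2 assms that by (simp add: sum.distrib)
    finally show ?thesis using 1 by simp
  qed
  show "s < n \<Longrightarrow> (\<Sum>i\<in>UNIV. c i) = n - s0" "s < n \<Longrightarrow> s1 \<le> c i" using A by auto
  show B: "n \<le> s \<Longrightarrow> c i = 0" using assms by (auto simp: child_prob_def split: if_splits)
  show "c i \<le> n" using A B member_le_sum[of i UNIV c] by (cases "s < n") auto
qed

section \<open>The law of a split\<close>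

text \<open>Only the law of the split vector and the parameters: the mean, the tolls and the fixed
  point are analysed before any probability space carrying a tree is fixed.\<close>

locale split_parameters =
  fixes D :: "(real ^ 'b::finite) measure" and s s0 s1 :: nat
  assumes b2: "2 \<le> CARD('b)"
    and s_bound: "s0 + CARD('b) * s1 \<le> s + 1"
    and s_nontrivial: "(s, s0) \<noteq> (0, 0)"
    and D_law: "split_vector_law D"
    and D_vertex: "measure D {v. \<exists>i. v $ i = 1} < 1"
begin

sublocale D: prob_space D
  using D_law by (simp add: split_vector_law_def)

lemma sets_D [measurable_cong, simp]: "sets D = sets borel"
  using D_law by (simp add: split_vector_law_def)

lemma measurable_D [simp]: "measurable D N = measurable borel N"
  by (rule measurable_cong_sets) simp_all

lemma space_D [simp]: "space D = UNIV"
  using sets_eq_imp_space_eq[OF sets_D] by simp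

definition prob_vectors :: "(real ^ 'b) set" where
  "prob_vectors = {v. (\<forall>i. 0 \<le> v $ i) \<and> (\<Sum>i\<in>UNIV. v $ i) = 1}"

lemma prob_vectorsD:
  assumes "v \<in> prob_vectors"
  shows "0 \<le> v $ i" "v $ i \<le> 1" "(\<Sum>i\<in>UNIV. v $ i) = 1" "\<bar>v $ i\<bar> = v $ i"
  using assms member_le_sum[of i UNIV "\<lambda>i. v $ i"] by (auto simp: prob_vectors_def)

lemma AE_D_prob_vectors: "AE v in D. v \<in> prob_vectors"
  using D_law by (simp add: split_vector_law_def prob_vectors_def)

lemma integrable_D_bounded:
  assumes [measurable]: "f \<in> borel_measurable borel" and "\<And>v. v \<in> prob_vectors \<Longrightarrow> norm (f v) \<le> B"
  shows "integrable D (f :: _ \<Rightarrow> 'c::{banach, second_countable_topology})"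
  by (rule D.integrable_const_bound[where B = B]) (use AE_D_prob_vectors assms(2) in auto)

lemma prob_vector_vertex:
  assumes "v \<in> prob_vectors" "v $ i = 1"
  shows "j \<noteq> i \<Longrightarrow> v $ j = 0"
proof -
  assume "j \<noteq> i"
  have "(\<Sum>k\<in>{i, j}. v $ k) \<le> (\<Sum>k\<in>UNIV. v $ k)"
    by (rule sum_mono2) (use assms in \<open>auto simp: prob_vectors_def\<close>)
  with \<open>j \<noteq> i\<close> assms show ?thesis using prob_vectorsD[OF assms(1)] by (auto intro!: antisym)
qed

section \<open>Joint law of the child cardinalities and the split vector of a node\<close>

abbreviation "child_sizes n \<equiv> {c :: 'b \<Rightarrow> nat. \<forall>i. c i \<le> n}"

text \<open>The two coordinates are kept on one space because the toll depends on the cardinalities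
  while its limit \<open>split_C\<close> depends on the split vector. As the first coordinate is
  finite, measurability need only be checked for each fixed \<open>c\<close>.\<close>

definition joint_law :: "nat \<Rightarrow> (('b \<Rightarrow> nat) \<times> (real ^ 'b)) measure" where
  "joint_law n = density (count_space (child_sizes n) \<Otimes>\<^sub>M D)
     (\<lambda>x. ennreal (child_prob s s0 s1 n (snd x) (fst x)))"

definition offspring_prob :: "nat \<Rightarrow> ('b \<Rightarrow> nat) \<Rightarrow> real" where
  "offspring_prob n c = (\<integral>v. child_prob s s0 s1 n v c \<partial>D)"

lemma sets_joint_law [measurable_cong]: "sets (joint_law n) = sets (count_space (child_sizes n) \<Otimes>\<^sub>M borel)"
  unfolding joint_law_def sets_density by (rule sets_pair_measure_cong) simp_all

lemma measurable_joint:
  fixes F :: "('b \<Rightarrow> nat) \<times> (real ^ 'b) \<Rightarrow> 'c::topological_space"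
  assumes "\<And>c. (\<lambda>v. F (c, v)) \<in> borel_measurable borel"
  shows "F \<in> borel_measurable (joint_law n)"
proof -
  have "F \<in> borel_measurable (count_space (child_sizes n) \<Otimes>\<^sub>M borel)"
    by (rule measurable_pair_measure_countable1) (auto intro!: countable_finite assms)
  then show ?thesis by (simp cong: measurable_cong_sets[OF sets_joint_law])
qed

lemma measurable_child_prob_pair:
  "(\<lambda>x. child_prob s s0 s1 n (snd x) (fst x)) \<in> borel_measurable (count_space (child_sizes n) \<Otimes>\<^sub>M D)"
  by (rule measurable_pair_measure_countable1) (auto intro!: countable_finite)

lemma pair_sf: "pair_sigma_finite (count_space (child_sizes n)) D"
  by (intro pair_sigma_finite.intro sigma_finite_measure_count_space_finite)
    (auto intro: D.sigma_finite_measure)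

lemma nn_integral_joint_law:
  assumes "\<And>c. (\<lambda>v. F (c, v)) \<in> borel_measurable borel"
  shows "(\<integral>\<^sup>+x. F x \<partial>joint_law n)
    = (\<integral>\<^sup>+v. (\<Sum>c\<in>child_sizes n. ennreal (child_prob s s0 s1 n v c) * F (c, v)) \<partial>D)"
proof -
  interpret pair_sigma_finite "count_space (child_sizes n)" D by (rule pair_sf)
  have [measurable]: "F \<in> borel_measurable (count_space (child_sizes n) \<Otimes>\<^sub>M D)"
    by (rule measurable_pair_measure_countable1) (auto intro!: countable_finite assms)
  note measurable_child_prob_pair[measurable]
  have "(\<integral>\<^sup>+x. F x \<partial>joint_law n)
      = (\<integral>\<^sup>+x. ennreal (child_prob s s0 s1 n (snd x) (fst x)) * F x \<partial>(count_space (child_sizes n) \<Otimes>\<^sub>M D))"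
    unfolding joint_law_def by (rule nn_integral_density) measurable
  also have "\<dots> = (\<integral>\<^sup>+v. \<integral>\<^sup>+c. ennreal (child_prob s s0 s1 n v c) * F (c, v) \<partial>count_space (child_sizes n) \<partial>D)"
    by (subst nn_integral_snd[symmetric]) auto
  finally show ?thesis by (simp add: nn_integral_count_space_finite)
qed

lemma sum_child_prob_1:
  assumes "v \<in> prob_vectors"
  shows "(\<Sum>c\<in>child_sizes n. child_prob s s0 s1 n v c) = 1"
proof (cases "s < n")
  case True
  then show ?thesis
    using sum_child_prob[of s n s0 s1 v "\<lambda>_. 1"] s_bound assms
    by (simp add: multinomial_expectation_const prob_vectors_def)
next
  case False
  then have "(\<Sum>c\<in>child_sizes n. child_prob s s0 s1 n v c) = (\<Sum>c\<in>{\<lambda>_. 0}. child_prob s s0 s1 n v c)"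
    by (intro sum.mono_neutral_right) (auto simp: child_prob_def fun_eq_iff)
  with False show ?thesis by (simp add: child_prob_def)
qed

lemma child_prob_vector_nonneg: "v \<in> prob_vectors \<Longrightarrow> 0 \<le> child_prob s s0 s1 n v c"
  by (rule child_prob_nonneg) (auto simp: prob_vectors_def)

lemma child_prob_le_1:
  assumes "v \<in> prob_vectors"
  shows "child_prob s s0 s1 n v c \<le> 1"
proof (cases "child_prob s s0 s1 n v c = 0")
  case False
  then have "c \<in> child_sizes n" using child_prob_support(4)[OF False s_bound] by auto
  then have "child_prob s s0 s1 n v c \<le> (\<Sum>c\<in>child_sizes n. child_prob s s0 s1 n v c)"
    by (intro member_le_sum child_prob_vector_nonneg assms) auto
  then show ?thesis by (simp add: sum_child_prob_1[OF assms])
qed simp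

sublocale J: prob_space "joint_law n" for n
proof
  have "emeasure (joint_law n) (space (joint_law n)) = (\<integral>\<^sup>+x. 1 \<partial>joint_law n)" by simp
  also have "\<dots> = (\<integral>\<^sup>+v. (\<Sum>c\<in>child_sizes n. ennreal (child_prob s s0 s1 n v c) * 1) \<partial>D)"
    by (rule nn_integral_joint_law) simp
  also have "\<dots> = (\<integral>\<^sup>+v. 1 \<partial>D)"
  proof (rule nn_integral_cong_AE, use AE_D_prob_vectors in eventually_elim)
    case (elim v)
    then show ?case using child_prob_vector_nonneg[OF elim] sum_child_prob_1[OF elim]
      by (simp add: sum_ennreal)
  qed
  also have "\<dots> = 1" using D.emeasure_space_1 by simp
  finally show "emeasure (joint_law n) (space (joint_law n)) = 1" .
qed

lemma AE_joint_law:
  "AE x in joint_law n. snd x \<in> prob_vectors \<and> fst x \<in> child_sizes n \<and>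
     child_prob s s0 s1 n (snd x) (fst x) \<noteq> 0"
proof -
  interpret pair_sigma_finite "count_space (child_sizes n)" D by (rule pair_sf)
  note measurable_child_prob_pair[measurable]
  have m: "{x \<in> space (count_space (child_sizes n) \<Otimes>\<^sub>M D). snd x \<in> prob_vectors} \<in> sets (count_space (child_sizes n) \<Otimes>\<^sub>M D)"
    unfolding prob_vectors_def by measurable
  have 1: "AE x in count_space (child_sizes n) \<Otimes>\<^sub>M D. snd x \<in> prob_vectors"
    by (rule AE_pair_measure[OF m]) (use AE_D_prob_vectors in auto)
  have "AE x in count_space (child_sizes n) \<Otimes>\<^sub>M D. x \<in> child_sizes n \<times> UNIV"
    by (rule AE_I2) (auto simp: space_pair_measure)
  with 1 have "AE x in count_space (child_sizes n) \<Otimes>\<^sub>M D. 0 < ennreal (child_prob s s0 s1 n (snd x) (fst x)) \<longrightarrow>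
     snd x \<in> prob_vectors \<and> fst x \<in> child_sizes n \<and> child_prob s s0 s1 n (snd x) (fst x) \<noteq> 0"
    by eventually_elim auto
  then show ?thesis unfolding joint_law_def by (subst AE_density) measurable
qed

text \<open>Almost every pair consists of a probability vector and cardinalities of positive
  probability, so a pointwise estimate may use all deterministic rules of a split. Most comparisons
  of integrals below go through this rule.\<close>

lemma AE_joint_lawI:
  assumes "\<And>c v. v \<in> prob_vectors \<Longrightarrow> (\<And>i. c i \<le> n) \<Longrightarrow> (s < n \<Longrightarrow> (\<Sum>i\<in>UNIV. c i) = n - s0)
    \<Longrightarrow> (\<And>i. s < n \<Longrightarrow> s1 \<le> c i) \<Longrightarrow> (\<And>i. n \<le> s \<Longrightarrow> c i = 0) \<Longrightarrow> P (c, v)"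
  shows "AE x in joint_law n. P x"
  using AE_joint_law
proof eventually_elim
  case (elim x)
  then have nz: "child_prob s s0 s1 n (snd x) (fst x) \<noteq> 0" by simp
  show ?case using assms[of "snd x" "fst x"] child_prob_support[OF nz s_bound] elim by auto
qed

lemma integrable_joint_bounded:
  fixes F :: "_ \<Rightarrow> 'c::{banach, second_countable_topology}"
  assumes "\<And>c. (\<lambda>v. F (c, v)) \<in> borel_measurable borel"
    and "\<And>c v. v \<in> prob_vectors \<Longrightarrow> c \<in> child_sizes n \<Longrightarrow> norm (F (c, v)) \<le> B"
  shows "integrable (joint_law n) F"
  by (rule J.integrable_const_bound[where B = B, OF AE_joint_lawI measurable_joint]) (use assms in auto)

lemma integral_joint_law:
  fixes F :: "_ \<Rightarrow> 'c::{banach, second_countable_topology}"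
  assumes meas: "\<And>c. (\<lambda>v. F (c, v)) \<in> borel_measurable borel"
    and bound: "\<And>c v. v \<in> prob_vectors \<Longrightarrow> c \<in> child_sizes n \<Longrightarrow> norm (F (c, v)) \<le> B"
  shows "(\<integral>x. F x \<partial>joint_law n) = (\<Sum>c\<in>child_sizes n. \<integral>v. child_prob s s0 s1 n v c *\<^sub>R F (c, v) \<partial>D)"
    and "(\<integral>x. F x \<partial>joint_law n) = (\<integral>v. (\<Sum>c\<in>child_sizes n. child_prob s s0 s1 n v c *\<^sub>R F (c, v)) \<partial>D)"
proof -
  interpret pair_sigma_finite "count_space (child_sizes n)" D by (rule pair_sf)
  have [measurable]: "F \<in> borel_measurable (count_space (child_sizes n) \<Otimes>\<^sub>M D)"
    by (rule measurable_pair_measure_countable1) (auto intro!: countable_finite assms)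
  note measurable_child_prob_pair[measurable]
  have m: "{x \<in> space (count_space (child_sizes n) \<Otimes>\<^sub>M D). snd x \<in> prob_vectors} \<in> sets (count_space (child_sizes n) \<Otimes>\<^sub>M D)"
    unfolding prob_vectors_def by measurable
  have 1: "AE x in count_space (child_sizes n) \<Otimes>\<^sub>M D. snd x \<in> prob_vectors"
    by (rule AE_pair_measure[OF m]) (use AE_D_prob_vectors in auto)
  have eq: "(\<integral>x. F x \<partial>joint_law n)
      = (\<integral>x. child_prob s s0 s1 n (snd x) (fst x) *\<^sub>R F x \<partial>(count_space (child_sizes n) \<Otimes>\<^sub>M D))"
    unfolding joint_law_def
    by (rule integral_density) (use 1 child_prob_vector_nonneg in \<open>auto elim!: eventually_mono\<close>)
  have int: "integrable (count_space (child_sizes n) \<Otimes>\<^sub>M D)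
      (\<lambda>(c, v). child_prob s s0 s1 n v c *\<^sub>R F (c, v))"
  proof -
    have "integrable (density (count_space (child_sizes n) \<Otimes>\<^sub>M D)
     (\<lambda>x. ennreal (child_prob s s0 s1 n (snd x) (fst x)))) F"
      using integrable_joint_bounded[OF assms] by (simp add: joint_law_def)
    then have "integrable (count_space (child_sizes n) \<Otimes>\<^sub>M D)
      (\<lambda>x. child_prob s s0 s1 n (snd x) (fst x) *\<^sub>R F x)"
      by (subst (asm) integrable_density) (use 1 child_prob_vector_nonneg in \<open>auto elim!: eventually_mono\<close>)
    then show ?thesis by (simp add: case_prod_beta')
  qed
  have intc: "integrable D (\<lambda>v. child_prob s s0 s1 n v c *\<^sub>R F (c, v))" if "c \<in> child_sizes n" for c
  proof (rule integrable_D_bounded[where B = B])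
    note meas[measurable]
    show "(\<lambda>v. child_prob s s0 s1 n v c *\<^sub>R F (c, v)) \<in> borel_measurable borel" by measurable
    fix v assume v: "v \<in> prob_vectors"
    have "norm (child_prob s s0 s1 n v c *\<^sub>R F (c, v)) \<le> 1 * norm (F (c, v))"
      using child_prob_le_1[OF v, of n c] child_prob_vector_nonneg[OF v, of n c]
      by (simp add: mult_left_le_one_le)
    with bound[OF v that] show "norm (child_prob s s0 s1 n v c *\<^sub>R F (c, v)) \<le> B" by simp
  qed
  show A: "(\<integral>x. F x \<partial>joint_law n) = (\<Sum>c\<in>child_sizes n. \<integral>v. child_prob s s0 s1 n v c *\<^sub>R F (c, v) \<partial>D)"
    unfolding eq using integral_fst[OF int]
    by (simp add: lebesgue_integral_count_space_finite case_prod_beta')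
  show "(\<integral>x. F x \<partial>joint_law n) = (\<integral>v. (\<Sum>c\<in>child_sizes n. child_prob s s0 s1 n v c *\<^sub>R F (c, v)) \<partial>D)"
    unfolding A by (rule Bochner_Integration.integral_sum[symmetric]) (rule intc)
qed

lemma integral_joint_fst:
  fixes F :: "_ \<Rightarrow> 'c::{banach, second_countable_topology}"
  shows "(\<integral>x. F (fst x) \<partial>joint_law n) = (\<Sum>c\<in>child_sizes n. offspring_prob n c *\<^sub>R F c)"
proof -
  have "(\<integral>x. F (fst x) \<partial>joint_law n) = (\<Sum>c\<in>child_sizes n. \<integral>v. child_prob s s0 s1 n v c *\<^sub>R F c \<partial>D)"
    by (subst integral_joint_law(1)[where B = "Max ((\<lambda>c. norm (F c)) ` child_sizes n)"]) auto
  also have "\<dots> = (\<Sum>c\<in>child_sizes n. offspring_prob n c *\<^sub>R F c)"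
    unfolding offspring_prob_def
    by (intro sum.cong refl integral_scaleR_left integrable_D_bounded[where B = 1])
       (auto simp: child_prob_vector_nonneg child_prob_le_1)
  finally show ?thesis .
qed

lemma distr_joint_snd: "distr (joint_law n) D snd = D"
proof (rule measure_eqI)
  fix A assume "A \<in> sets (distr (joint_law n) D snd)"
  then have A [measurable]: "A \<in> sets borel" by simp
  have "emeasure (distr (joint_law n) D snd) A = (\<integral>\<^sup>+x. indicator A (snd x) \<partial>joint_law n)"
    by (subst emeasure_distr) (auto simp: nn_integral_indicator[symmetric] simp del: nn_integral_indicator
      intro!: nn_integral_cong split: split_indicator)
  also have "\<dots> = (\<integral>\<^sup>+v. (\<Sum>c\<in>child_sizes n. ennreal (child_prob s s0 s1 n v c) * indicator A (snd (c, v))) \<partial>D)"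
    by (rule nn_integral_joint_law) simp
  also have "\<dots> = (\<integral>\<^sup>+v. indicator A v \<partial>D)"
  proof (rule nn_integral_cong_AE, use AE_D_prob_vectors in eventually_elim)
    case (elim v)
    then show ?case using child_prob_vector_nonneg[OF elim] sum_child_prob_1[OF elim]
      by (simp add: sum_ennreal flip: sum_distrib_right)
  qed
  also have "\<dots> = emeasure D A" by simp
  finally show "emeasure (distr (joint_law n) D snd) A = emeasure D A" .
qed simp

lemma integral_joint_snd:
  fixes f :: "_ \<Rightarrow> 'c::{banach, second_countable_topology}"
  assumes "f \<in> borel_measurable borel"
  shows "(\<integral>x. f (snd x) \<partial>joint_law n) = (\<integral>v. f v \<partial>D)"
proof -
  have "(\<integral>v. f v \<partial>D) = (\<integral>v. f v \<partial>distr (joint_law n) D snd)" by (simp add: distr_joint_snd)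
  also have "\<dots> = (\<integral>x. f (snd x) \<partial>joint_law n)"
    by (rule integral_distr) (use assms in auto)
  finally show ?thesis by simp
qed

text \<open>The subtraction is exact because \<open>s0 + b * s1 \<le> s + 1 \<le> n\<close>. The
  factor \<open>s + 2\<close> converts errors of order \<open>1 / (m + 1)\<close>, with
  \<open>m\<close> the number of freely distributed items, into errors of order
  \<open>1 / (n + 1)\<close>.\<close>

lemma balls_bound: "s < n \<Longrightarrow> n + 1 \<le> (s + 2) * (n - s0 - CARD('b) * s1 + 1)" "s < n \<Longrightarrow> Suc n - s0 - CARD('b) * s1 = Suc (n - s0 - CARD('b) * s1)"
  "s < n \<Longrightarrow> n = (n - s0 - CARD('b) * s1) + (s0 + CARD('b) * s1)"
proof -
  assume n: "s < n"
  show 1: "n = (n - s0 - CARD('b) * s1) + (s0 + CARD('b) * s1)" using n s_bound by linarith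
  have "n + 1 = (n - s0 - CARD('b) * s1) + 1 + (s0 + CARD('b) * s1)" using 1 by simp
  also have "\<dots> \<le> (n - s0 - CARD('b) * s1) + 1 + (s + 1) * 1" using s_bound by simp
  also have "\<dots> \<le> (n - s0 - CARD('b) * s1) + 1 + (s + 1) * (n - s0 - CARD('b) * s1 + 1)" by (intro add_left_mono mult_left_mono) auto
  finally show "n + 1 \<le> (s + 2) * (n - s0 - CARD('b) * s1 + 1)" by simp
  show "Suc n - s0 - CARD('b) * s1 = Suc (n - s0 - CARD('b) * s1)" using n s_bound by linarith
qed

lemma integral_joint_multinomial:
  fixes F :: "_ \<Rightarrow> real"
  assumes "s < n" and "\<And>c. (\<lambda>v. F (c, v)) \<in> borel_measurable borel"
    and "\<And>c v. v \<in> prob_vectors \<Longrightarrow> c \<in> child_sizes n \<Longrightarrow> norm (F (c, v)) \<le> B"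
  shows "(\<integral>x. F x \<partial>joint_law n)
    = (\<integral>v. multinomial_expectation (n - s0 - CARD('b) * s1) v (\<lambda>c. F (\<lambda>i. s1 + c i, v)) \<partial>D)"
proof -
  have "(\<Sum>c\<in>child_sizes n. child_prob s s0 s1 n v c *\<^sub>R F (c, v))
      = multinomial_expectation (n - s0 - CARD('b) * s1) v (\<lambda>c. F (\<lambda>i. s1 + c i, v))" for v
    using sum_child_prob[of s n s0 s1 v "\<lambda>c. F (c, v)"] assms(1) s_bound by simp
  then show ?thesis by (subst integral_joint_law(2)[where B = B]) (use assms in simp_all)
qed

end

section \<open>The mean path length and its increments\<close>

context split_parameters
begin

lemma integrable_joint_fst [simp]:
  fixes F :: "_ \<Rightarrow> 'c::{banach, second_countable_topology}"
  shows "integrable (joint_law n) (\<lambda>x. F (fst x))"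
proof (rule integrable_joint_bounded)
  show "norm (F (fst (c, v))) \<le> Max ((\<lambda>c. norm (F c)) ` child_sizes n)"
    if "c \<in> child_sizes n" for c v using that by simp
qed simp

lemma weighted_bound:
  fixes H :: "'b \<Rightarrow> ('b \<Rightarrow> nat) \<Rightarrow> real"
  assumes "v \<in> prob_vectors" "c \<in> child_sizes n"
  shows "norm (\<Sum>i\<in>UNIV. v $ i * H i c) \<le> (\<Sum>c\<in>child_sizes n. \<Sum>i\<in>UNIV. \<bar>H i c\<bar>)"
proof -
  have "norm (\<Sum>i\<in>UNIV. v $ i * H i c) \<le> (\<Sum>i\<in>UNIV. \<bar>v $ i * H i c\<bar>)"
    using sum_abs by simp
  also have "\<dots> \<le> (\<Sum>i\<in>UNIV. 1 * \<bar>H i c\<bar>)"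
    unfolding abs_mult by (intro sum_mono mult_right_mono) (use prob_vectorsD[OF assms(1)] in auto)
  also have "\<dots> \<le> (\<Sum>c\<in>child_sizes n. \<Sum>i\<in>UNIV. \<bar>H i c\<bar>)"
    using assms(2) by (simp, intro member_le_sum[of c _ "\<lambda>c. \<Sum>i\<in>UNIV. \<bar>H i c\<bar>"]) (auto intro: sum_nonneg)
  finally show ?thesis .
qed

lemma integrable_joint_weighted [simp]:
  "integrable (joint_law n) (\<lambda>x. \<Sum>i\<in>UNIV. snd x $ i * H i (fst x))"
  by (rule integrable_joint_bounded[OF _ weighted_bound]) auto

lemma integral_joint_weighted:
  assumes "s < n"
  shows "(\<integral>x. (\<Sum>i\<in>UNIV. snd x $ i * H i (fst x)) \<partial>joint_law n)
    = (\<integral>v. (\<Sum>i\<in>UNIV. v $ i * multinomial_expectation (n - s0 - CARD('b) * s1) v (\<lambda>c. H i (\<lambda>j. s1 + c j))) \<partial>D)"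
  by (subst integral_joint_multinomial[OF assms, where B = "\<Sum>c\<in>child_sizes n. \<Sum>i\<in>UNIV. \<bar>H i c\<bar>"])
     (use weighted_bound[of _ _ n H] in \<open>auto simp: multinomial_expectation_sum multinomial_expectation_cmult\<close>)

section \<open>Strict inequalities from the non-degeneracy of the split vector\<close>

lemma integral_D_less_1:
  fixes f :: "_ \<Rightarrow> real"
  assumes [measurable]: "f \<in> borel_measurable borel"
    and bound: "\<And>v. v \<in> prob_vectors \<Longrightarrow> \<bar>f v\<bar> \<le> B"
    and le: "\<And>v. v \<in> prob_vectors \<Longrightarrow> f v \<le> 1"
    and eq: "\<And>v. v \<in> prob_vectors \<Longrightarrow> f v = 1 \<Longrightarrow> \<exists>i. v $ i = 1"
  shows "(\<integral>v. f v \<partial>D) < 1"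
proof (rule ccontr)
  assume "\<not> (\<integral>v. f v \<partial>D) < 1"
  moreover have int: "integrable D f" by (rule integrable_D_bounded) (use bound in auto)
  moreover have "(\<integral>v. f v \<partial>D) \<le> (\<integral>v. 1 \<partial>D)"
    by (rule integral_mono_AE) (use int le AE_D_prob_vectors in auto)
  \<comment> \<open>A nonnegative function with zero integral vanishes almost everywhere, so a mean
    of at least 1 would put all of \<open>D\<close> on the vertices.\<close>
  ultimately have "(\<integral>v. 1 - f v \<partial>D) = 0" using D.prob_space by simp
  moreover have "AE v in D. 0 \<le> 1 - f v" using AE_D_prob_vectors le by auto
  ultimately have "AE v in D. 1 - f v = 0"
    using int by (subst (asm) integral_nonneg_eq_0_iff_AE) auto
  then have "AE v in D. \<exists>i. v $ i = 1" using AE_D_prob_vectors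
    by eventually_elim (use eq in auto)
  moreover have "{v. \<exists>i. v $ i = 1} \<in> sets D" by simp
  ultimately have "measure D {v. \<exists>i. v $ i = 1} = 1"
    using D.prob_Collect_eq_1[of "\<lambda>v. \<exists>i. v $ i = 1"] by simp
  with D_vertex show False by simp
qed

lemma prob_vector_01:
  assumes "v \<in> prob_vectors" "\<And>i. v $ i = 0 \<or> v $ i = 1"
  shows "\<exists>i. v $ i = 1"
proof (rule ccontr)
  assume "\<nexists>i. v $ i = 1"
  with assms(2) have "\<And>i. v $ i = 0" by blast
  with assms(1) show False by (simp add: prob_vectors_def)
qed

lemma sum_square_le_1: "v \<in> prob_vectors \<Longrightarrow> (\<Sum>i\<in>UNIV. (v $ i)\<^sup>2) \<le> 1"
  using sum_mono[of UNIV "\<lambda>i. (v $ i)\<^sup>2" "\<lambda>i. v $ i"] prob_vectorsD[of v]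
  by (auto simp: power2_eq_square mult_left_le_one_le)

lemma sum_square_eq_1:
  assumes "v \<in> prob_vectors" "(\<Sum>i\<in>UNIV. (v $ i)\<^sup>2) = 1"
  shows "\<exists>i. v $ i = 1"
proof (rule prob_vector_01[OF assms(1)])
  fix i
  have "(\<Sum>i\<in>UNIV. v $ i * (1 - v $ i)) = 0"
    using assms prob_vectorsD(3)[OF assms(1)]
    by (simp add: right_diff_distrib sum_subtractf power2_eq_square)
  then have "v $ i * (1 - v $ i) = 0"
    by (subst (asm) sum_nonneg_eq_0_iff) (use prob_vectorsD[OF assms(1)] in auto)
  then show "v $ i = 0 \<or> v $ i = 1" by simp
qed

lemma sum_square_mean: "(\<integral>v. (\<Sum>i\<in>UNIV. (v $ i)\<^sup>2) \<partial>D) < 1"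
  by (rule integral_D_less_1[where B = 1])
     (use sum_square_le_1 sum_square_eq_1 in \<open>auto simp: abs_of_nonneg sum_nonneg\<close>)

lemma offspring_prob_nonneg: "0 \<le> offspring_prob n c"
  unfolding offspring_prob_def
  by (rule integral_nonneg_AE) (use AE_D_prob_vectors child_prob_vector_nonneg in auto)

lemma offspring_prob_sum: "(\<Sum>c\<in>child_sizes n. offspring_prob n c) = 1"
  using integral_joint_fst[of n "\<lambda>_. 1 :: real"] J.prob_space by simp

lemma offspring_support:
  assumes "offspring_prob n c \<noteq> 0"
  shows "s < n \<Longrightarrow> (\<Sum>i\<in>UNIV. c i) = n - s0" "s < n \<Longrightarrow> s1 \<le> c i" "n \<le> s \<Longrightarrow> c i = 0" "c i \<le> n"
proof -
  obtain v where "child_prob s s0 s1 n (v :: real ^ 'b) c \<noteq> 0"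
  proof (rule ccontr)
    assume "\<not> thesis"
    with that have "\<And>v. child_prob s s0 s1 n (v :: real ^ 'b) c = 0" by blast
    then show False using assms by (simp add: offspring_prob_def)
  qed
  note child_prob_support[OF this s_bound]
  then show "s < n \<Longrightarrow> (\<Sum>i\<in>UNIV. c i) = n - s0" "s < n \<Longrightarrow> s1 \<le> c i" "n \<le> s \<Longrightarrow> c i = 0" "c i \<le> n"
    by auto
qed

text \<open>Some item always goes elsewhere: either the node itself keeps \<open>s0 > 0\<close>
  items, or a second child, which exists since \<open>b \<ge> 2\<close>, receives at least
  \<open>s1 > 0\<close> items.\<close>

lemma child_less:
  fixes c :: "'b \<Rightarrow> nat"
  assumes "s < n" "(\<Sum>i\<in>UNIV. c i) = n - s0" "\<And>i. s1 \<le> c i" "0 < s0 \<or> 0 < s1"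
  shows "c i < n"
proof (cases "0 < s0")
  case True
  have "c i \<le> n - s0" using member_le_sum[of i UNIV c] assms(2) by simp
  then show ?thesis using True assms(1) by linarith
next
  case False
  obtain j where "j \<noteq> i" using b2
    by (metis UNIV_I card_1_singleton_iff card_2_iff' ex_card less_eq_Suc_le not_less_eq_eq numeral_2_eq_2 is_singletonI' is_singleton_altdef)
  then have "(\<Sum>k\<in>{i, j}. c k) \<le> (\<Sum>k\<in>UNIV. c k)" by (intro sum_mono2) auto
  then have "c i + c j \<le> n" using \<open>j \<noteq> i\<close> assms(2) by simp
  then show ?thesis using False assms(3)[of j] assms(4) by linarith
qed

text \<open>If items are stored or handed out in advance, no child can receive all \<open>n\<close>.
  Otherwise the ordered pairs of distinct items sharing a child are counted: their proportion is 1
  when one child takes everything, and its mean is that of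
  \<open>\<Sum>i. (v $ i)^2\<close>.\<close>

lemma stay_prob:
  assumes n: "s < n"
  shows "(\<integral>x. of_bool (\<exists>i. fst x i = n) \<partial>joint_law n) < (1::real)"
proof (cases "0 < s0 \<or> 0 < s1")
  case True
  have "c i \<noteq> n" if "(\<Sum>i\<in>UNIV. c i) = n - s0" "\<And>i. s1 \<le> c i" for c :: "'b \<Rightarrow> nat" and i
    using child_less[OF n that True, of i] by simp
  then have "AE x in joint_law n. of_bool (\<exists>i. fst x i = n) = (0 :: real)"
    using n by (intro AE_joint_lawI) simp
  then have "(\<integral>x. of_bool (\<exists>i. fst x i = n) \<partial>joint_law n) = (\<integral>x. 0 \<partial>joint_law n :: real)"
    by (intro integral_cong_AE) (auto intro!: measurable_joint)
  then show ?thesis by simp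
next
  case False
  \<comment> \<open>Here \<open>s0 = 0\<close>, so \<open>s_nontrivial\<close> gives
    \<open>s \<ge> 1\<close> and there are pairs of items to count.\<close>
  then have n2: "2 \<le> n" using n s_nontrivial by auto
  have "(\<integral>x. of_bool (\<exists>i. fst x i = n) \<partial>joint_law n)
      \<le> (\<integral>x. (\<Sum>i\<in>UNIV. real (fst x i) * real (fst x i) - real (fst x i)) / (real n * (real n - 1)) \<partial>joint_law n)"
  proof (rule integral_mono_AE)
    show "AE x in joint_law n. of_bool (\<exists>i. fst x i = n)
       \<le> (\<Sum>i\<in>UNIV. real (fst x i) * real (fst x i) - real (fst x i)) / (real n * (real n - 1))"
    proof (rule AE_joint_lawI)
      fix c :: "'b \<Rightarrow> nat" and v :: "real ^ 'b"
      have nn: "0 \<le> real (c i) * real (c i) - real (c i)" for i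
        by (cases "c i") (auto simp: algebra_simps)
      have "real n * (real n - 1) \<le> (\<Sum>i\<in>UNIV. real (c i) * real (c i) - real (c i))" if "c i = n" for i
        using member_le_sum[of i UNIV "\<lambda>i. real (c i) * real (c i) - real (c i)"] nn that
        by (simp add: algebra_simps)
      then show "of_bool (\<exists>i. fst (c, v) i = n)
         \<le> (\<Sum>i\<in>UNIV. real (fst (c, v) i) * real (fst (c, v) i) - real (fst (c, v) i)) / (real n * (real n - 1))"
        using n2 nn by (auto simp: field_simps intro!: divide_nonneg_nonneg sum_nonneg)
    qed
  qed (simp_all add: integrable_joint_fst[where F = "\<lambda>c :: 'b \<Rightarrow> nat. of_bool (\<exists>i. c i = n)"]
        integrable_joint_fst[where F = "\<lambda>c :: 'b \<Rightarrow> nat. (\<Sum>i\<in>UNIV. real (c i) * real (c i) - real (c i)) / (real n * (real n - 1))"])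
  also have "\<dots> = (\<integral>v. multinomial_expectation n v (\<lambda>c. (\<Sum>i\<in>UNIV. real (c i) * real (c i) - real (c i)) / (real n * (real n - 1))) \<partial>D)"
    using False
    by (subst integral_joint_multinomial[OF n, where B = "Max ((\<lambda>c. norm ((\<Sum>i\<in>UNIV. real (c i) * real (c i) - real (c i)) / (real n * (real n - 1)))) ` child_sizes n)"])
       (auto intro!: Max_ge)
  also have "\<dots> = (\<integral>v. (\<Sum>i\<in>UNIV. (v $ i)\<^sup>2) \<partial>D)"
  proof (rule integral_cong_AE)
    show "AE v in D. multinomial_expectation n v (\<lambda>c. (\<Sum>i\<in>UNIV. real (c i) * real (c i) - real (c i)) / (real n * (real n - 1)))
       = (\<Sum>i\<in>UNIV. (v $ i)\<^sup>2)"
      using AE_D_prob_vectors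
    proof eventually_elim
      case (elim v)
      have 1: "(\<Sum>i\<in>UNIV. v $ i) = 1" using prob_vectorsD(3)[OF elim] .
      have "multinomial_expectation n v (\<lambda>c. (\<Sum>i\<in>UNIV. real (c i) * real (c i) - real (c i)) / (real n * (real n - 1)))
        = multinomial_expectation n v (\<lambda>c. (1 / (real n * (real n - 1))) * (\<Sum>i\<in>UNIV. real (c i) * real (c i) - real (c i)))"
        by simp
      also have "\<dots> = (1 / (real n * (real n - 1))) * (\<Sum>i\<in>UNIV. real n * v $ i * ((real n - 1) * v $ i + 1) - real n * v $ i)"
        unfolding multinomial_expectation_cmult multinomial_expectation_sum multinomial_expectation_diff
          multinomial_expectation_coord[OF 1] multinomial_expectation_coord_square[OF 1] ..
      also have "\<dots> = (1 / (real n * (real n - 1))) * (\<Sum>i\<in>UNIV. (real n * (real n - 1)) * (v $ i)\<^sup>2)"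
        by (simp add: algebra_simps power2_eq_square)
      also have "\<dots> = (\<Sum>i\<in>UNIV. (v $ i)\<^sup>2)"
        using n2 by (simp flip: sum_distrib_left)
      finally show ?case .
    qed
  qed (simp_all add: multinomial_expectation_def)
  also have "\<dots> < 1" by (rule sum_square_mean)
  finally show ?thesis .
qed

section \<open>Mean path length by truncation in the depth\<close>

primrec mean_trunc :: "nat \<Rightarrow> nat \<Rightarrow> real" where
  "mean_trunc 0 n = 0"
| "mean_trunc (Suc k) n =
    (\<Sum>c\<in>child_sizes n. offspring_prob n c * (\<Sum>i\<in>UNIV. real (c i) + mean_trunc k (c i)))"

lemma mean_trunc_nonneg: "0 \<le> mean_trunc k n"
  by (induction k arbitrary: n) (auto intro!: sum_nonneg mult_nonneg_nonneg offspring_prob_nonneg add_nonneg_nonneg)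

lemma mean_trunc_mono: "mean_trunc k n \<le> mean_trunc (Suc k) n"
proof (induction k arbitrary: n)
  case (Suc k)
  show ?case
    unfolding mean_trunc.simps(2)[of "Suc k" n] mean_trunc.simps(2)[of k n]
    by (intro sum_mono mult_left_mono add_left_mono offspring_prob_nonneg Suc.IH)
qed (use mean_trunc_nonneg[of 1] in simp)

lemma mean_trunc_small: "n \<le> s \<Longrightarrow> mean_trunc k n = 0"
proof (induction k arbitrary: n)
  case (Suc k)
  have "offspring_prob n c * (\<Sum>i\<in>UNIV. real (c i) + mean_trunc k (c i)) = 0" for c
    using offspring_support(3)[of n c] Suc by (cases "offspring_prob n c = 0") auto
  then show ?case by (subst mean_trunc.simps) (intro sum.neutral ballI)
qed simp

text \<open>Strong induction on \<open>n\<close>: smaller children are covered by the induction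
  hypothesis, and the self-reference through a child with all \<open>n\<close> items carries only
  the weight \<open>\<beta> < 1\<close>.\<close>

lemma mean_trunc_bounded: "\<exists>B. \<forall>k. mean_trunc k n \<le> B"
proof (induction n rule: less_induct)
  case (less n)
  show ?case
  proof (cases "s < n")
    case n: True
    from less.IH obtain B where B: "\<And>m k. m < n \<Longrightarrow> mean_trunc k m \<le> B m" by metis
    define M where "M = Max (insert 0 (B ` {..<n}))"
    have M: "mean_trunc k m \<le> M" if "m < n" for m k
      unfolding M_def using B[OF that, of k] that by (meson Max_ge finite_imageI finite_insert finite_lessThan imageI insertI2 lessThan_iff order_trans)
    have M0: "0 \<le> M" unfolding M_def by simp
    define \<beta> where "\<beta> = (\<Sum>c\<in>child_sizes n. offspring_prob n c * of_bool (\<exists>i. c i = n))"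
    have \<beta>: "\<beta> < 1" using stay_prob[OF n]
      by (simp add: integral_joint_fst[where F = "\<lambda>c :: 'b \<Rightarrow> nat. of_bool (\<exists>i. c i = n) :: real"] \<beta>_def)
    have \<beta>0: "0 \<le> \<beta>" unfolding \<beta>_def by (intro sum_nonneg mult_nonneg_nonneg offspring_prob_nonneg) auto
    \<comment> \<open>\<open>X\<close> solves \<open>X = n + b * M + \<beta> * X\<close>, so as a
      bound it reproduces itself under the recursion.\<close>
    define X where "X = (real n + CARD('b) * M) / (1 - \<beta>)"
    have X: "real n + CARD('b) * M + \<beta> * X = X" using \<beta> by (simp add: X_def field_simps)
    have X0: "0 \<le> X" unfolding X_def using \<beta> M0 by simp
    have "mean_trunc k n \<le> X" for k
    proof (induction k)
      case (Suc k)
      have "mean_trunc (Suc k) n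
         \<le> (\<Sum>c\<in>child_sizes n. offspring_prob n c * (real n + CARD('b) * M + of_bool (\<exists>i. c i = n) * X))"
        unfolding mean_trunc.simps
      proof (rule sum_mono)
        fix c
        show "offspring_prob n c * (\<Sum>i\<in>UNIV. real (c i) + mean_trunc k (c i))
          \<le> offspring_prob n c * (real n + CARD('b) * M + of_bool (\<exists>i. c i = n) * X)"
        proof (cases "offspring_prob n c = 0")
          case nz: False
          have s: "(\<Sum>i\<in>UNIV. c i) = n - s0" using offspring_support(1)[OF nz n] .
          then have "(\<Sum>i\<in>UNIV. real (c i)) \<le> real n" by (simp flip: of_nat_sum)
          moreover have "(\<Sum>i\<in>UNIV. mean_trunc k (c i)) \<le> CARD('b) * M + of_bool (\<exists>i. c i = n) * X"
          proof (cases "\<exists>i. c i = n")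
            case True
            then obtain i where i: "c i = n" ..
            \<comment> \<open>If child \<open>i\<close> holds all \<open>n\<close> items, its
              siblings are empty and only the term of \<open>i\<close> escapes the bound
              \<open>M\<close>.\<close>
            have "(\<Sum>j\<in>UNIV - {i}. mean_trunc k (c j)) \<le> (\<Sum>j\<in>UNIV - {i}. M)"
            proof (rule sum_mono)
              fix j assume "j \<in> UNIV - {i}"
              then have "(\<Sum>l\<in>{i, j}. c l) \<le> n"
                using sum_mono2[of UNIV "{i, j}" c] s by auto
              then have "c j = 0" using i \<open>j \<in> UNIV - {i}\<close> by simp
              then show "mean_trunc k (c j) \<le> M" using M0 by (simp add: mean_trunc_small)
            qed
            also have "\<dots> \<le> CARD('b) * M" using M0 by (simp add: mult_right_mono)
            finally have "(\<Sum>j\<in>UNIV. mean_trunc k (c j)) \<le> mean_trunc k n + CARD('b) * M"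
              using i by (simp add: sum.remove[of UNIV i])
            then show ?thesis using True Suc.IH by simp
          next
            case False
            have "(\<Sum>i\<in>UNIV. mean_trunc k (c i)) \<le> (\<Sum>i\<in>(UNIV :: 'b set). M)"
            proof (rule sum_mono)
              fix i show "mean_trunc k (c i) \<le> M"
                using False offspring_support(4)[OF nz, of i] by (intro M) (metis le_neq_implies_less)
            qed
            then show ?thesis using False by simp
          qed
          ultimately show ?thesis
            by (intro mult_left_mono offspring_prob_nonneg) (simp add: sum.distrib)
        qed simp
      qed
      also have "\<dots> = (real n + CARD('b) * M) * (\<Sum>c\<in>child_sizes n. offspring_prob n c) + \<beta> * X"
        unfolding \<beta>_def
        by (simp add: distrib_left sum.distrib sum_distrib_left sum_distrib_right mult_ac del: sum_mult_of_bool_eq sum_of_bool_mult_eq)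
      also have "\<dots> = X" using X by (simp add: offspring_prob_sum)
      finally show ?case .
    qed (simp add: X0)
    then show ?thesis by blast
  qed (auto simp: mean_trunc_small)
qed

text \<open>A limit instead of a recursion on \<open>n\<close>, because a child can be as large as
  its parent. Its identification with the mean of the path length of an actual tree is
  \<open>expectation_path_length\<close>.\<close>

definition mean_length :: "nat \<Rightarrow> real" where
  "mean_length n = lim (\<lambda>k. mean_trunc k n)"

lemma mean_trunc_tendsto: "(\<lambda>k. mean_trunc k n) \<longlonglongrightarrow> mean_length n"
proof -
  obtain B where B: "\<And>k. mean_trunc k n \<le> B" using mean_trunc_bounded by blast
  have "incseq (\<lambda>k. mean_trunc k n)" by (intro incseq_SucI mean_trunc_mono)
  then have "convergent (\<lambda>k. mean_trunc k n)"
    using B by (metis convergentI incseq_convergent)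
  then show ?thesis unfolding mean_length_def by (simp add: convergent_LIMSEQ_iff)
qed

lemma mean_trunc_le: "mean_trunc k n \<le> mean_length n"
  by (rule incseq_le[OF _ mean_trunc_tendsto]) (intro incseq_SucI mean_trunc_mono)

lemma mean_length_nonneg: "0 \<le> mean_length n"
  using mean_trunc_le[of 0 n] by simp

lemma mean_length_small [simp]: "n \<le> s \<Longrightarrow> mean_length n = 0"
  by (rule LIMSEQ_unique[OF mean_trunc_tendsto]) (simp add: mean_trunc_small)

lemma mean_length_rec:
  "mean_length n = (\<Sum>c\<in>child_sizes n. offspring_prob n c * (\<Sum>i\<in>UNIV. real (c i) + mean_length (c i)))"
proof (rule LIMSEQ_unique)
  show "(\<lambda>k. mean_trunc (Suc k) n) \<longlonglongrightarrow> mean_length n"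
    using mean_trunc_tendsto by (rule LIMSEQ_Suc)
  show "(\<lambda>k. mean_trunc (Suc k) n)
      \<longlonglongrightarrow> (\<Sum>c\<in>child_sizes n. offspring_prob n c * (\<Sum>i\<in>UNIV. real (c i) + mean_length (c i)))"
    unfolding mean_trunc.simps by (intro tendsto_intros mean_trunc_tendsto)
qed

lemma mean_length_joint:
  "mean_length n = (\<integral>x. (\<Sum>i\<in>UNIV. real (fst x i) + mean_length (fst x i)) \<partial>joint_law n)"
  using integral_joint_fst[of n "\<lambda>c. \<Sum>i\<in>UNIV. real (c i) + mean_length (c i)"] mean_length_rec[of n] by simp

section \<open>Increments of the mean along a size-biased path\<close>

definition increment :: "nat \<Rightarrow> real" where
  "increment n = mean_length (Suc n) - mean_length n"

text \<open>Sampling the last of the \<open>n + 1\<close> items separately couples the multinomial vectors of two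
  consecutive cardinalities; hence the increments obey a recursion along a Markov chain.\<close>

lemma increment_rec:
  assumes n: "s < n"
  shows "increment n = 1 + (\<integral>x. (\<Sum>i\<in>UNIV. snd x $ i * increment (fst x i)) \<partial>joint_law n)"
proof -
  let ?m = "n - s0 - CARD('b) * s1"
  define h where "h k = real k + mean_length k" for k
  let ?up = "\<lambda>c :: 'b \<Rightarrow> nat. \<lambda>i. c(i := Suc (c i))"
  have sN: "s < Suc n" using n by simp
  have "mean_length (Suc n) = (\<integral>x. (\<Sum>j\<in>UNIV. h (fst x j)) \<partial>joint_law (Suc n))"
    by (subst mean_length_joint) (simp add: h_def)
  also have "\<dots> = (\<integral>v. multinomial_expectation (Suc ?m) v (\<lambda>c. \<Sum>j\<in>UNIV. h (s1 + c j)) \<partial>D)"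
    by (subst integral_joint_multinomial[OF sN, where B = "Max ((\<lambda>c. norm (\<Sum>j\<in>UNIV. h (c j))) ` child_sizes (Suc n))"])
       (auto simp: balls_bound(2)[OF n] simp del: diff_diff_left intro!: Max_ge)
  also have "\<dots> = (\<integral>v. (\<Sum>i\<in>UNIV. v $ i * multinomial_expectation ?m v (\<lambda>c. \<Sum>j\<in>UNIV. h (?up (\<lambda>j. s1 + c j) i j))) \<partial>D)"
    unfolding multinomial_expectation_Suc
    by (intro Bochner_Integration.integral_cong refl sum.cong arg_cong2[where f = "(*)"] multinomial_expectation_cong arg_cong[where f = h])
       auto
  also have "\<dots> = (\<integral>x. (\<Sum>i\<in>UNIV. snd x $ i * (\<Sum>j\<in>UNIV. h (?up (fst x) i j))) \<partial>joint_law n)"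
    using integral_joint_weighted[OF n, of "\<lambda>i c. \<Sum>j\<in>UNIV. h (?up c i j)"] by simp
  finally have 1: "mean_length (Suc n) = (\<integral>x. (\<Sum>i\<in>UNIV. snd x $ i * (\<Sum>j\<in>UNIV. h (?up (fst x) i j))) \<partial>joint_law n)" .
  have 2: "mean_length n = (\<integral>x. (\<Sum>j\<in>UNIV. h (fst x j)) \<partial>joint_law n)"
    by (subst mean_length_joint) (simp add: h_def)
  have "increment n = (\<integral>x. (\<Sum>i\<in>UNIV. snd x $ i * (\<Sum>j\<in>UNIV. h (?up (fst x) i j))) - (\<Sum>j\<in>UNIV. h (fst x j)) \<partial>joint_law n)"
    unfolding increment_def 1 2
    by (rule Bochner_Integration.integral_diff[symmetric])
       (simp_all add: integrable_joint_weighted[of n "\<lambda>i c. \<Sum>j\<in>UNIV. h (?up c i j)"]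
          integrable_joint_fst[where F = "\<lambda>c :: 'b \<Rightarrow> nat. \<Sum>j\<in>UNIV. h (c j)"] del: fun_upd_apply)
  also have "\<dots> = (\<integral>x. 1 + (\<Sum>i\<in>UNIV. snd x $ i * increment (fst x i)) \<partial>joint_law n)"
  proof (rule integral_cong_AE)
    show "AE x in joint_law n. (\<Sum>i\<in>UNIV. snd x $ i * (\<Sum>j\<in>UNIV. h (?up (fst x) i j))) - (\<Sum>j\<in>UNIV. h (fst x j))
        = 1 + (\<Sum>i\<in>UNIV. snd x $ i * increment (fst x i))"
    proof (rule AE_joint_lawI)
      fix c :: "'b \<Rightarrow> nat" and v :: "real ^ 'b" assume v: "v \<in> prob_vectors"
      have "(\<Sum>j\<in>UNIV. h (?up c i j)) = (\<Sum>j\<in>UNIV. h (c j)) + (1 + increment (c i))" for i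
        by (simp add: sum.remove[of UNIV i] h_def increment_def)
      then have "(\<Sum>i\<in>UNIV. v $ i * (\<Sum>j\<in>UNIV. h (?up c i j)))
         = (\<Sum>i\<in>UNIV. v $ i) * (\<Sum>j\<in>UNIV. h (c j)) + (\<Sum>i\<in>UNIV. v $ i) + (\<Sum>i\<in>UNIV. v $ i * increment (c i))"
        by (simp add: distrib_left sum.distrib sum_distrib_right)
      then show "(\<Sum>i\<in>UNIV. snd (c, v) $ i * (\<Sum>j\<in>UNIV. h (?up (fst (c, v)) i j))) - (\<Sum>j\<in>UNIV. h (fst (c, v) j))
        = 1 + (\<Sum>i\<in>UNIV. snd (c, v) $ i * increment (fst (c, v) i))"
        using v by (simp add: prob_vectors_def)
    qed
  qed (rule measurable_joint, simp del: fun_upd_apply)+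
  also have "\<dots> = 1 + (\<integral>x. (\<Sum>i\<in>UNIV. snd x $ i * increment (fst x i)) \<partial>joint_law n)"
    by (subst Bochner_Integration.integral_add)
       (simp_all add: J.prob_space integrable_joint_weighted[of n "\<lambda>i c. increment (c i)"])
  finally show ?thesis .
qed

text \<open>The chain moves from \<open>n\<close> to the cardinality of child \<open>i\<close> with
  weight \<open>snd x $ i\<close>. It never moves up, and it stays at \<open>n\<close> with
  probability \<open>\<gamma> < 1\<close>, so a value above all earlier ones would exceed its own
  average.\<close>

lemma chain_max_principle:
  assumes n0: "s < n0"
    and u: "\<And>n. n0 \<le> n \<Longrightarrow> u n \<le> (\<integral>x. (\<Sum>i\<in>UNIV. snd x $ i * u (fst x i)) \<partial>joint_law n)"
  shows "\<exists>B. \<forall>n. u n \<le> B"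
proof -
  define B where "B = Max (u ` {..n0})"
  have "u n \<le> B" for n
  proof (induction n rule: less_induct)
    case (less n)
    show ?case
    proof (cases "n \<le> n0")
      case False
      then have n: "s < n" "n0 \<le> n" using n0 by auto
      define \<gamma> where "\<gamma> = (\<integral>x. (\<Sum>i\<in>UNIV. snd x $ i * of_bool (fst x i = n)) \<partial>joint_law n)"
      have "\<gamma> \<le> (\<integral>x. of_bool (\<exists>i. fst x i = n) \<partial>joint_law n)"
        unfolding \<gamma>_def
      proof (rule integral_mono_AE)
        show "AE x in joint_law n. (\<Sum>i\<in>UNIV. snd x $ i * of_bool (fst x i = n)) \<le> of_bool (\<exists>i. fst x i = n)"
        proof (rule AE_joint_lawI)
          fix c :: "'b \<Rightarrow> nat" and v :: "real ^ 'b" assume v: "v \<in> prob_vectors"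
          have "(\<Sum>i\<in>UNIV. v $ i * of_bool (c i = n)) \<le> (\<Sum>i\<in>UNIV. v $ i * of_bool (\<exists>i. c i = n))"
            by (intro sum_mono mult_left_mono) (use prob_vectorsD[OF v] in auto)
          then show "(\<Sum>i\<in>UNIV. snd (c, v) $ i * of_bool (fst (c, v) i = n)) \<le> of_bool (\<exists>i. fst (c, v) i = n)"
            using prob_vectorsD(3)[OF v] by (simp flip: sum_distrib_right)
        qed
      qed (simp_all add: integrable_joint_fst[where F = "\<lambda>c :: 'b \<Rightarrow> nat. of_bool (\<exists>i. c i = n)"]
          integrable_joint_weighted[where H = "\<lambda>i (c :: 'b \<Rightarrow> nat). of_bool (c i = n)"] del: sum_mult_of_bool_eq sum_of_bool_mult_eq)
      also have "\<dots> < 1" by (rule stay_prob[OF n(1)])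
      finally have \<gamma>: "\<gamma> < 1" .
      show ?thesis
      proof (rule ccontr)
        assume "\<not> u n \<le> B"
        then have gt: "0 < u n - B" by simp
        have "u n \<le> (\<integral>x. (\<Sum>i\<in>UNIV. snd x $ i * u (fst x i)) \<partial>joint_law n)" by (rule u[OF n(2)])
        also have "\<dots> \<le> (\<integral>x. B + (\<Sum>i\<in>UNIV. snd x $ i * of_bool (fst x i = n)) * (u n - B) \<partial>joint_law n)"
        proof (rule integral_mono_AE)
          show "AE x in joint_law n. (\<Sum>i\<in>UNIV. snd x $ i * u (fst x i))
              \<le> B + (\<Sum>i\<in>UNIV. snd x $ i * of_bool (fst x i = n)) * (u n - B)"
          proof (rule AE_joint_lawI)
            fix c :: "'b \<Rightarrow> nat" and v :: "real ^ 'b" assume v: "v \<in> prob_vectors" and c: "\<And>i. c i \<le> n"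
            have "u (c i) \<le> B + of_bool (c i = n) * (u n - B)" for i
              using less.IH[of "c i"] c[of i] by (cases "c i = n") auto
            then have "(\<Sum>i\<in>UNIV. v $ i * u (c i)) \<le> (\<Sum>i\<in>UNIV. v $ i * (B + of_bool (c i = n) * (u n - B)))"
              by (intro sum_mono mult_left_mono) (use prob_vectorsD[OF v] in auto)
            also have "\<dots> = (\<Sum>i\<in>UNIV. v $ i) * B + (\<Sum>i\<in>UNIV. v $ i * of_bool (c i = n)) * (u n - B)"
              by (simp add: distrib_left sum.distrib sum_distrib_right sum_distrib_left mult_ac del: sum_mult_of_bool_eq sum_of_bool_mult_eq)
            finally show "(\<Sum>i\<in>UNIV. snd (c, v) $ i * u (fst (c, v) i))
              \<le> B + (\<Sum>i\<in>UNIV. snd (c, v) $ i * of_bool (fst (c, v) i = n)) * (u n - B)"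
              using prob_vectorsD(3)[OF v] by simp
          qed
        qed (simp_all add: integrable_joint_weighted[where H = "\<lambda>i (c :: 'b \<Rightarrow> nat). of_bool (c i = n)"]
              integrable_joint_weighted[where H = "\<lambda>i (c :: 'b \<Rightarrow> nat). u (c i)"] del: sum_mult_of_bool_eq sum_of_bool_mult_eq)
        also have "\<dots> = B + \<gamma> * (u n - B)"
          unfolding \<gamma>_def
          by (simp add: J.prob_space integrable_joint_weighted[where H = "\<lambda>i (c :: 'b \<Rightarrow> nat). of_bool (c i = n)"] del: sum_mult_of_bool_eq sum_of_bool_mult_eq)
        also have "\<dots> < B + 1 * (u n - B)" using \<gamma> gt by (intro add_strict_left_mono mult_strict_right_mono)
        finally show False by simp
      qed
    qed (simp add: B_def)
  qed
  then show ?thesis by blast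
qed

end

section \<open>Logarithmic growth of the increments\<close>

lemma xlnx_bounds:
  fixes x :: real
  assumes "0 \<le> x" "x \<le> 1"
  shows "x * ln x \<le> 0" "\<bar>x * ln x\<bar> \<le> 1"
proof -
  show 1: "x * ln x \<le> 0"
    using assms by (cases "x = 0") (auto simp: mult_nonneg_nonpos)
  have 2: "-1 \<le> x * ln x"
  proof (cases "x = 0")
    case False
    with assms have x: "0 < x" by simp
    have "ln (1 / x) \<le> 1 / x - 1" using x by (intro ln_le_minus_one) simp
    then have "x * (1 - 1 / x) \<le> x * ln x" using x by (intro mult_left_mono) (auto simp: ln_div)
    with x show ?thesis by (simp add: right_diff_distrib)
  qed simp
  show "\<bar>x * ln x\<bar> \<le> 1" using 1 2 by simp
qed

lemma ln_ge_1_minus_inverse: "0 < x \<Longrightarrow> 1 - 1 / x \<le> ln (x :: real)"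
  using ln_le_minus_one[of "1 / x"] by (simp add: ln_div)

context split_parameters
begin

lemma balls_bound_real:
  assumes "s < n"
  shows "real n + 1 \<le> (real s + 2) * (real (n - s0 - CARD('b) * s1) + 1)"
proof -
  define m where "m = n - s0 - CARD('b) * s1"
  have "real (n + 1) \<le> real ((s + 2) * (m + 1))"
    using balls_bound(1)[OF assms] unfolding m_def[symmetric] by (simp only: of_nat_le_iff)
  then show ?thesis unfolding m_def[symmetric] by (simp only: of_nat_mult of_nat_add of_nat_numeral of_nat_1)
qed

section \<open>Entropy of the split vector and the drift \<open>mu\<close>\<close>

definition mu :: real where "mu = split_mu D"

definition entropy_sum :: "real ^ 'b \<Rightarrow> real" where
  "entropy_sum v = (\<Sum>i\<in>UNIV. v $ i * ln (v $ i))"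

lemma entropy_sum_measurable [measurable]: "entropy_sum \<in> borel_measurable borel"
  unfolding entropy_sum_def by measurable

lemma entropy_sum_bounds:
  assumes "v \<in> prob_vectors"
  shows "entropy_sum v \<le> 0" "\<bar>entropy_sum v\<bar> \<le> CARD('b)"
proof -
  show "entropy_sum v \<le> 0" unfolding entropy_sum_def
    using xlnx_bounds(1) prob_vectorsD[OF assms] by (intro sum_nonpos) auto
  have "\<bar>entropy_sum v\<bar> \<le> (\<Sum>i\<in>UNIV. \<bar>v $ i * ln (v $ i)\<bar>)" unfolding entropy_sum_def by (rule sum_abs)
  also have "\<dots> \<le> (\<Sum>i\<in>(UNIV :: 'b set). 1)"
    using xlnx_bounds(2) prob_vectorsD[OF assms] by (intro sum_mono) auto
  finally show "\<bar>entropy_sum v\<bar> \<le> CARD('b)" by simp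
qed

lemma integrable_entropy_sum [simp]: "integrable D entropy_sum"
  by (rule integrable_D_bounded[where B = "CARD('b)"]) (use entropy_sum_bounds in auto)

lemma mu_eq: "mu = - (\<integral>v. entropy_sum v \<partial>D)"
proof -
  let ?U = "measure_pmf (pmf_of_set (UNIV :: 'b set))"
  interpret pair_prob_space D ?U ..
  let ?f = "\<lambda>x :: (real ^ 'b) \<times> 'b. - (fst x $ snd x * ln (fst x $ snd x))"
  have [measurable]: "?f \<in> borel_measurable (D \<Otimes>\<^sub>M ?U)"
  proof -
    \<comment> \<open>The index is moved to the first factor, since joint measurability is checked
      slice by slice over a countable first coordinate.\<close>
    have "(\<lambda>y. ?f (snd y, fst y)) \<in> borel_measurable (count_space UNIV \<Otimes>\<^sub>M borel)"
      by (rule measurable_pair_measure_countable1) (auto intro!: countable_finite)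
    from measurable_compose[OF measurable_pair_swap' this]
    have "?f \<in> borel_measurable (borel \<Otimes>\<^sub>M count_space UNIV)"
      by (simp add: case_prod_beta')
    moreover have "sets (D \<Otimes>\<^sub>M ?U) = sets (borel \<Otimes>\<^sub>M count_space UNIV)"
      by (intro sets_pair_measure_cong) auto
    ultimately show ?thesis by (simp cong: measurable_cong_sets)
  qed
  have "AE x in D \<Otimes>\<^sub>M ?U. norm (?f x) \<le> 1"
  proof (rule AE_pair_measure)
    show "{x \<in> space (D \<Otimes>\<^sub>M ?U). norm (?f x) \<le> 1} \<in> sets (D \<Otimes>\<^sub>M ?U)" by measurable
    show "AE x in D. AE y in ?U. norm (?f (x, y)) \<le> 1"
      using AE_D_prob_vectors
      by eventually_elim (use xlnx_bounds(2) prob_vectorsD in auto)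
  qed
  then have "integrable (D \<Otimes>\<^sub>M ?U) ?f" by (rule P.integrable_const_bound) measurable
  then have int: "integrable (D \<Otimes>\<^sub>M ?U) (\<lambda>(v, i). - (v $ i * ln (v $ i)))"
    by (simp add: case_prod_beta')
  have "split_mu D = CARD('b) * (\<integral>v. \<integral>i. - (v $ i * ln (v $ i)) \<partial>?U \<partial>D)"
    unfolding split_mu_def using integral_fst[OF int] by simp
  also have "\<dots> = CARD('b) * (\<integral>v. - entropy_sum v / CARD('b) \<partial>D)"
    by (simp add: integral_pmf_of_set entropy_sum_def sum_negf)
  also have "\<dots> = - (\<integral>v. entropy_sum v \<partial>D)" by simp
  finally show ?thesis by (simp add: mu_def)
qed

text \<open>\<open>1 + entropy_sum\<close> is at most 1, and equality makes every
  \<open>v $ i * ln (v $ i)\<close> vanish, so that each component is 0 or 1.\<close>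

lemma mu_pos: "0 < mu"
proof -
  have "(\<integral>v. 1 + entropy_sum v \<partial>D) < 1"
  proof (rule integral_D_less_1[where B = "1 + CARD('b)"])
    fix v assume v: "v \<in> prob_vectors"
    show "\<bar>1 + entropy_sum v\<bar> \<le> 1 + CARD('b)" "1 + entropy_sum v \<le> 1"
      using entropy_sum_bounds[OF v] by auto
    assume "1 + entropy_sum v = 1"
    then have "(\<Sum>i\<in>UNIV. - (v $ i * ln (v $ i))) = 0" by (simp add: entropy_sum_def sum_negf)
    then have "\<And>i. v $ i * ln (v $ i) = 0"
      by (subst (asm) sum_nonneg_eq_0_iff) (use xlnx_bounds(1) prob_vectorsD[OF v] in auto)
    then have "\<And>i. v $ i = 0 \<or> v $ i = 1"
      using prob_vectorsD(1)[OF v] by (metis ln_eq_zero_iff mult_eq_0_iff order_le_less)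
    then show "\<exists>i. v $ i = 1" by (rule prob_vector_01[OF v])
  qed simp
  moreover have "(\<integral>v. 1 + entropy_sum v \<partial>D) = 1 - mu"
    by (subst Bochner_Integration.integral_add) (auto simp: mu_eq D.prob_space[simplified])
  ultimately show ?thesis by simp
qed

lemma split_C_eq: "split_C D v = 1 + entropy_sum v / mu"
  by (simp add: split_C_def entropy_sum_def mu_def)

text \<open>Bounds for the expected logarithm of \<open>s1 + 1\<close> plus a binomial variable: the size-bias
  identity gives \<open>(m + 1) v E[1 / (B + 1)] \<le> 1\<close>, which makes the lower bound exact.\<close>

lemma multinomial_inverse:
  assumes v: "v \<in> prob_vectors"
  shows "real (Suc m) * v $ i * multinomial_expectation m v (\<lambda>c. 1 / (real (c i) + 1)) \<le> 1"
proof -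
  have v0: "\<And>i. 0 \<le> v $ i" and v1: "(\<Sum>i\<in>UNIV. v $ i) = 1" using prob_vectorsD[OF v] by auto
  have "real (Suc m) * v $ i * multinomial_expectation m v (\<lambda>c. 1 / (real (c i) + 1))
     = multinomial_expectation (Suc m) v (\<lambda>c. real (c i) * (1 / real (c i)))"
    using multinomial_size_bias[of m v i "\<lambda>c. 1 / real (c i)"] by (simp add: add.commute)
  also have "\<dots> \<le> multinomial_expectation (Suc m) v (\<lambda>c. 1)"
    by (intro multinomial_expectation_mono v0) auto
  finally show ?thesis by (simp add: multinomial_expectation_const[OF v1])
qed

lemma multinomial_ln_bounds:
  fixes v :: "real ^ 'b" and m :: nat
  assumes v: "v \<in> prob_vectors"
  defines "L \<equiv> \<lambda>i. v $ i * multinomial_expectation m v (\<lambda>c. ln (real (s1 + c i) + 1))"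
  shows "v $ i * ln (real (Suc m)) + v $ i * ln (v $ i) \<le> L i"
    and "L i \<le> v $ i * ln (real (Suc m)) + v $ i * ln (v $ i) + (real s1 + 1) / real (Suc m)"
proof -
  have v0: "\<And>i. 0 \<le> v $ i" and v1: "(\<Sum>i\<in>UNIV. v $ i) = 1" using prob_vectorsD[OF v] by auto
  have "v $ i * ln (real (Suc m)) + v $ i * ln (v $ i) \<le> L i \<and>
     L i \<le> v $ i * ln (real (Suc m)) + v $ i * ln (v $ i) + (real s1 + 1) / real (Suc m)"
  proof (cases "v $ i = 0")
    case False
    then have vp: "0 < v $ i" using v0[of i] by simp
    define x where "x = real (Suc m) * v $ i"
    have x: "0 < x" using vp by (simp add: x_def)
    have lnx: "ln x = ln (real (Suc m)) + ln (v $ i)" unfolding x_def using vp by (simp add: ln_mult)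
    \<comment> \<open>The inequality \<open>ln y \<ge> ln x + 1 - x / y\<close> is averaged with
      \<open>y = c i + 1\<close> and \<open>x = (m + 1) * v $ i\<close>; by
      \<open>multinomial_inverse\<close> the correction has nonnegative mean.\<close>
    have lo: "ln x \<le> multinomial_expectation m v (\<lambda>c. ln (real (s1 + c i) + 1))"
    proof -
      have "ln x \<le> ln x + (1 - x * multinomial_expectation m v (\<lambda>c. 1 / (real (c i) + 1)))"
        using multinomial_inverse[OF v, of m i] by (simp add: x_def)
      also have "\<dots> = multinomial_expectation m v (\<lambda>c. (ln x + 1) - x * (1 / (real (c i) + 1)))"
        by (simp only: multinomial_expectation_diff multinomial_expectation_cmult multinomial_expectation_const[OF v1])
      also have "\<dots> \<le> multinomial_expectation m v (\<lambda>c. ln (real (s1 + c i) + 1))"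
      proof (intro multinomial_expectation_mono v0)
        fix c :: "'b \<Rightarrow> nat"
        have "1 - 1 / ((real (c i) + 1) / x) \<le> ln ((real (c i) + 1) / x)"
          using x by (intro ln_ge_1_minus_inverse) (auto intro!: divide_pos_pos)
        also have "\<dots> = ln (real (c i) + 1) - ln x" using x by (simp add: ln_div)
        also have "ln (real (c i) + 1) \<le> ln (real (s1 + c i) + 1)" by (subst ln_le_cancel_iff) auto
        finally show "(ln x + 1) - x * (1 / (real (c i) + 1)) \<le> ln (real (s1 + c i) + 1)" by simp
      qed
      finally show ?thesis .
    qed
    have hi: "multinomial_expectation m v (\<lambda>c. ln (real (s1 + c i) + 1)) \<le> ln x + (real s1 + 1) / x"
    proof -
      have "multinomial_expectation m v (\<lambda>c. ln (real (s1 + c i) + 1))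
         \<le> multinomial_expectation m v (\<lambda>c. (ln x + (real s1 + 1) / x - 1) + (1 / x) * real (c i))"
      proof (intro multinomial_expectation_mono v0)
        fix c :: "'b \<Rightarrow> nat"
        have "ln ((real (s1 + c i) + 1) / x) \<le> (real (s1 + c i) + 1) / x - 1"
          using x by (intro ln_le_minus_one divide_pos_pos) auto
        then have "ln (real (s1 + c i) + 1) - ln x \<le> (real (s1 + c i) + 1) / x - 1"
          using x by (simp add: ln_div)
        then show "ln (real (s1 + c i) + 1) \<le> (ln x + (real s1 + 1) / x - 1) + (1 / x) * real (c i)"
          by (simp add: add_divide_distrib)
      qed
      also have "\<dots> = (ln x + (real s1 + 1) / x - 1) + (1 / x) * (real m * v $ i)"
        by (simp only: multinomial_expectation_add multinomial_expectation_cmult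
            multinomial_expectation_const[OF v1] multinomial_expectation_coord[OF v1])
      also have "(1 / x) * (real m * v $ i) \<le> 1" using x vp by (simp add: x_def field_simps)
      finally show ?thesis by simp
    qed
    have "v $ i * ln x \<le> L i" unfolding L_def using lo v0 by (intro mult_left_mono) auto
    moreover have "L i \<le> v $ i * (ln x + (real s1 + 1) / x)"
      unfolding L_def using hi v0 by (intro mult_left_mono) auto
    \<comment> \<open>The weight \<open>v $ i\<close> cancels the same factor in \<open>x\<close>,
      which is why the error is uniform in \<open>v\<close>.\<close>
    moreover have "v $ i * ((real s1 + 1) / x) = (real s1 + 1) / real (Suc m)"
      using vp by (simp add: x_def)
    ultimately show ?thesis by (simp add: lnx distrib_left)
  qed (simp add: L_def)
  then show "v $ i * ln (real (Suc m)) + v $ i * ln (v $ i) \<le> L i"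
    "L i \<le> v $ i * ln (real (Suc m)) + v $ i * ln (v $ i) + (real s1 + 1) / real (Suc m)" by auto
qed

text \<open>One step of the size-biased path lowers the mean logarithm by \<open>mu\<close> up to
  order \<open>1 / n\<close>. Hence \<open>ln (n + 1) / mu\<close> almost solves the recursion of
  \<open>increment\<close>, whose toll is 1.\<close>

lemma ln_chain_error:
  assumes n: "s < n"
  defines "m \<equiv> n - s0 - CARD('b) * s1"
  defines "L \<equiv> (\<integral>x. (\<Sum>i\<in>UNIV. snd x $ i * ln (real (fst x i) + 1)) \<partial>joint_law n)"
  shows "ln (real (Suc m)) - mu \<le> L" "L \<le> ln (real (Suc m)) - mu + CARD('b) * (real s1 + 1) / real (Suc m)"
proof -
  let ?E = "\<lambda>v. \<Sum>i\<in>UNIV. v $ i * multinomial_expectation m v (\<lambda>c. ln (real (s1 + c i) + 1))"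
  have L: "L = (\<integral>v. ?E v \<partial>D)"
    unfolding L_def m_def by (rule integral_joint_weighted[OF n])
  have b1: "ln (real (Suc m)) + entropy_sum v \<le> ?E v" if v: "v \<in> prob_vectors" for v
  proof -
    have "(\<Sum>i\<in>UNIV. v $ i * ln (real (Suc m)) + v $ i * ln (v $ i)) \<le> ?E v"
      by (intro sum_mono multinomial_ln_bounds(1) v)
    then show ?thesis using prob_vectorsD(3)[OF v]
      by (simp add: sum.distrib entropy_sum_def flip: sum_distrib_right)
  qed
  have b2: "?E v \<le> ln (real (Suc m)) + entropy_sum v + CARD('b) * (real s1 + 1) / real (Suc m)" if v: "v \<in> prob_vectors" for v
  proof -
    have "?E v \<le> (\<Sum>i\<in>UNIV. v $ i * ln (real (Suc m)) + v $ i * ln (v $ i) + (real s1 + 1) / real (Suc m))"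
      by (intro sum_mono multinomial_ln_bounds(2) v)
    then show ?thesis using prob_vectorsD(3)[OF v]
      by (simp add: sum.distrib entropy_sum_def flip: sum_distrib_right)
  qed
  have int: "integrable D ?E"
  proof (rule integrable_D_bounded)
    show "?E \<in> borel_measurable borel" unfolding multinomial_expectation_def by measurable
    fix v assume v: "v \<in> prob_vectors"
    have "0 \<le> CARD('b) * (real s1 + 1) / real (Suc m)" by simp
    then show "norm (?E v) \<le> \<bar>ln (real (Suc m))\<bar> + CARD('b) + CARD('b) * (real s1 + 1) / real (Suc m)"
      using b1[OF v] b2[OF v] entropy_sum_bounds(2)[OF v] unfolding real_norm_def by linarith
  qed
  have "ln (real (Suc m)) - mu = (\<integral>v. ln (real (Suc m)) + entropy_sum v \<partial>D)"
    by (subst Bochner_Integration.integral_add) (auto simp: mu_eq D.prob_space[simplified])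
  also have "\<dots> \<le> L" unfolding L
    by (rule integral_mono_AE) (use int b1 AE_D_prob_vectors in auto)
  finally show "ln (real (Suc m)) - mu \<le> L" .
  have "L \<le> (\<integral>v. ln (real (Suc m)) + entropy_sum v + CARD('b) * (real s1 + 1) / real (Suc m) \<partial>D)" unfolding L
    by (rule integral_mono_AE) (use int b2 AE_D_prob_vectors in auto)
  also have "\<dots> = ln (real (Suc m)) - mu + CARD('b) * (real s1 + 1) / real (Suc m)"
    by (auto simp: mu_eq D.prob_space[simplified])
  finally show "L \<le> ln (real (Suc m)) - mu + CARD('b) * (real s1 + 1) / real (Suc m)" .
qed

text \<open>By convexity the mean of \<open>1 / (s1 + 1 + c i)\<close> is at least the reciprocal of
  the mean. Multiplied by \<open>n + 1\<close>, the weighted sum of these reciprocals tends to the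
  number of nonzero components of \<open>v\<close>, whose mean exceeds 1. So
  \<open>1 / (n + 1)\<close> is strictly subharmonic for large \<open>n\<close> and can absorb
  errors of its own order.\<close>

lemma lyapunov_function:
  "\<exists>\<eta>>0. \<exists>n0>s. \<forall>n\<ge>n0. (1 + \<eta>) / (real n + 1) \<le> (\<integral>x. (\<Sum>i\<in>UNIV. snd x $ i * (1 / (real (fst x i) + 1))) \<partial>joint_law n)"
proof -
  define f where "f n v = (\<Sum>i\<in>UNIV. (real n + 1) * (v $ i / (real s1 + 1 + real (n - s0 - CARD('b) * s1) * v $ i)))" for n and v :: "real ^ 'b"
  define f' where "f' v = (\<Sum>i\<in>UNIV. of_bool (v $ i \<noteq> 0) :: real)" for v :: "real ^ 'b"
  have f'_bounds: "1 \<le> f' v" "f' v \<le> CARD('b)" if v: "v \<in> prob_vectors" for v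
  proof -
    have "(\<Sum>i\<in>UNIV. v $ i) \<le> f' v" unfolding f'_def using prob_vectorsD[OF v] by (intro sum_mono) auto
    then show "1 \<le> f' v" using prob_vectorsD(3)[OF v] by simp
    have "f' v \<le> (\<Sum>i\<in>(UNIV :: 'b set). 1)" unfolding f'_def by (intro sum_mono) auto
    then show "f' v \<le> CARD('b)" by simp
  qed
  have f'_meas [measurable]: "f' \<in> borel_measurable borel" unfolding f'_def by measurable
  have f'_int: "integrable D f'" by (rule integrable_D_bounded[where B = "CARD('b)"]) (use f'_bounds in \<open>fastforce+\<close>)
  \<comment> \<open>\<open>2 - f' v\<close> equals 1 only if a single component is nonzero, that is
    at a vertex.\<close>
  have "(\<integral>v. 2 - f' v \<partial>D) < 1"
  proof (rule integral_D_less_1[where B = "2 + CARD('b)"])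
    fix v assume v: "v \<in> prob_vectors"
    show "\<bar>2 - f' v\<bar> \<le> real (2 + CARD('b))" "2 - f' v \<le> 1" using f'_bounds[OF v] by auto
    assume "2 - f' v = 1"
    then have "(\<Sum>i\<in>UNIV. of_bool (v $ i \<noteq> 0) - v $ i) = 0"
      using prob_vectorsD(3)[OF v] by (simp add: f'_def sum_subtractf)
    then have "\<And>i. of_bool (v $ i \<noteq> 0) - v $ i = 0"
      by (subst (asm) sum_nonneg_eq_0_iff) (use prob_vectorsD[OF v] in auto)
    then have "v $ i = 0 \<or> v $ i = 1" for i by (metis diff_eq_diff_eq eq_iff_diff_eq_0 of_bool_eq(2))
    then show "\<exists>i. v $ i = 1" by (rule prob_vector_01[OF v])
  qed simp
  then have gt: "1 < (\<integral>v. f' v \<partial>D)"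
    using f'_int D.prob_space by (subst (asm) Bochner_Integration.integral_diff) auto
  have f_meas [measurable]: "f n \<in> borel_measurable borel" for n unfolding f_def by measurable
  \<comment> \<open>The shift by \<open>Suc s\<close> makes the domination hold for every term of
    the sequence, since it requires more than \<open>s\<close> items.\<close>
  have lim: "(\<lambda>n. \<integral>v. f (n + Suc s) v \<partial>D) \<longlonglongrightarrow> (\<integral>v. f' v \<partial>D)"
  proof (rule integral_dominated_convergence[where w = "\<lambda>_. CARD('b) * (real s + 2)"])
    show "AE v in D. (\<lambda>n. f (n + Suc s) v) \<longlonglongrightarrow> f' v"
      using AE_D_prob_vectors
    proof eventually_elim
      case (elim v)
      have "(\<lambda>n. f n v) \<longlonglongrightarrow> f' v"
        unfolding f_def f'_def
      proof (rule tendsto_sum)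
        fix i
        show "(\<lambda>n. (real n + 1) * (v $ i / (real s1 + 1 + real (n - s0 - CARD('b) * s1) * v $ i))) \<longlonglongrightarrow> of_bool (v $ i \<noteq> 0)"
        proof (cases "v $ i = 0")
          case False
          then have vp: "0 < v $ i" using prob_vectorsD(1)[OF elim, of i] by simp
          define p q where "p = v $ i" and "q = real s0 + CARD('b) * real s1"
          have "0 < p" using vp by (simp add: p_def)
          then have "(\<lambda>n. (real n + 1) * (p / (real s1 + 1 + (real n - q) * p))) \<longlonglongrightarrow> 1"
            by real_asymp
          moreover have "\<forall>\<^sub>F n in sequentially. (real n + 1) * (p / (real s1 + 1 + (real n - q) * p))
             = (real n + 1) * (v $ i / (real s1 + 1 + real (n - s0 - CARD('b) * s1) * v $ i))"
            using eventually_ge_at_top[of "s0 + CARD('b) * s1"]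
            by eventually_elim (simp add: p_def q_def of_nat_diff)
          ultimately show ?thesis using False by (simp add: filterlim_cong[OF refl refl])
        qed simp
      qed
      then show ?case by (rule LIMSEQ_ignore_initial_segment)
    qed
    show "AE v in D. norm (f (n + Suc s) v) \<le> CARD('b) * (real s + 2)" for n
      using AE_D_prob_vectors
    proof eventually_elim
      case (elim v)
      define N where "N = n + Suc s"
      define m where "m = N - s0 - CARD('b) * s1"
      have Nm: "real N + 1 \<le> (real s + 2) * (real m + 1)"
        using balls_bound_real[of N] by (simp add: N_def m_def)
      have t: "0 \<le> (real N + 1) * (v $ i / (real s1 + 1 + real m * v $ i)) \<and>
         (real N + 1) * (v $ i / (real s1 + 1 + real m * v $ i)) \<le> real s + 2" for i
      proof -
        have v: "0 \<le> v $ i" "v $ i \<le> 1" using prob_vectorsD[OF elim] by auto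
        have d: "(real m + 1) * v $ i \<le> real s1 + 1 + real m * v $ i" using v by (simp add: algebra_simps)
        have "0 \<le> real m * v $ i" using v by simp
        then have d0: "0 < real s1 + 1 + real m * v $ i" by linarith
        have "(real N + 1) * v $ i \<le> (real s + 2) * (real m + 1) * v $ i"
          using Nm v by (intro mult_right_mono) auto
        also have "\<dots> \<le> (real s + 2) * (real s1 + 1 + real m * v $ i)"
          using d by (simp only: mult.assoc) (intro mult_left_mono, auto)
        finally show ?thesis using d0 v by (auto simp: pos_divide_le_eq)
      qed
      have "0 \<le> f N v" unfolding f_def m_def[symmetric] using t by (intro sum_nonneg) auto
      moreover have "f N v \<le> (\<Sum>i\<in>(UNIV :: 'b set). real s + 2)"
        unfolding f_def m_def[symmetric] using t by (intro sum_mono) auto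
      ultimately show ?case by (simp add: N_def)
    qed
  qed auto
  define \<eta> where "\<eta> = ((\<integral>v. f' v \<partial>D) - 1) / 2"
  have \<eta>: "0 < \<eta>" "1 + \<eta> < (\<integral>v. f' v \<partial>D)" using gt by (auto simp: \<eta>_def field_simps)
  have "\<forall>\<^sub>F n in sequentially. 1 + \<eta> < (\<integral>v. f (n + Suc s) v \<partial>D)"
    using order_tendstoD(1)[OF lim \<eta>(2)] .
  then obtain n1 where n1: "\<And>n. n1 \<le> n \<Longrightarrow> 1 + \<eta> < (\<integral>v. f (n + Suc s) v \<partial>D)"
    by (auto simp: eventually_sequentially)
  have "(1 + \<eta>) / (real n + 1) \<le> (\<integral>x. (\<Sum>i\<in>UNIV. snd x $ i * (1 / (real (fst x i) + 1))) \<partial>joint_law n)"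
    if n: "n1 + Suc s \<le> n" for n
  proof -
    have sn: "s < n" using n by simp
    define m where "m = n - s0 - CARD('b) * s1"
    let ?E = "\<lambda>v. \<Sum>i\<in>UNIV. v $ i * multinomial_expectation m v (\<lambda>c. 1 / (real (s1 + c i) + 1))"
    have bd: "f n v / (real n + 1) \<le> ?E v" if v: "v \<in> prob_vectors" for v
    proof -
      have v0: "\<And>i. 0 \<le> v $ i" and v1: "(\<Sum>i\<in>UNIV. v $ i) = 1" using prob_vectorsD[OF v] by auto
      have "f n v / (real n + 1) = (\<Sum>i\<in>UNIV. v $ i * (1 / (real s1 + 1 + real m * v $ i)))"
        using of_nat_0_le_iff[of n, where 'a = real] unfolding f_def m_def[symmetric] by (simp add: sum_divide_distrib)
      also have "\<dots> \<le> ?E v"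
      proof (intro sum_mono mult_left_mono v0)
        fix i
        define x where "x = real s1 + 1 + real m * v $ i"
        have "0 \<le> real m * v $ i" using v0 by simp
        then have x: "0 < x" unfolding x_def by linarith
        \<comment> \<open>This is the value at the mean of the tangent of \<open>1 / y\<close> at
          \<open>x\<close>, the mean of \<open>y = s1 + 1 + c i\<close>. Written as an affine
          function of \<open>c i\<close>, it has expectation exactly \<open>1 / x\<close>.\<close>
        have "1 / x = (2 / x - (real s1 + 1) / x\<^sup>2) - (1 / x\<^sup>2) * (real m * v $ i)"
        proof -
          define q r where "q = real m * v $ i" and "r = real s1 + 1"
          have q: "q = x - r" by (simp add: x_def q_def r_def)
          have "1 / x = (2 / x - r / x\<^sup>2) - (1 / x\<^sup>2) * q"
            using x unfolding q by (simp add: field_simps power2_eq_square)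
          then show ?thesis by (simp only: q_def r_def)
        qed
        also have "\<dots> = multinomial_expectation m v (\<lambda>c. (2 / x - (real s1 + 1) / x\<^sup>2) - (1 / x\<^sup>2) * real (c i))"
          by (simp only: multinomial_expectation_diff multinomial_expectation_cmult
              multinomial_expectation_const[OF v1] multinomial_expectation_coord[OF v1])
        also have "\<dots> \<le> multinomial_expectation m v (\<lambda>c. 1 / (real (s1 + c i) + 1))"
        proof (intro multinomial_expectation_mono v0)
          fix c :: "'b \<Rightarrow> nat"
          define y where "y = real (s1 + c i) + 1"
          have y: "0 < y" by (simp add: y_def)
          have "0 \<le> (x - y)\<^sup>2 / (x\<^sup>2 * y)" using x y by (intro divide_nonneg_nonneg mult_nonneg_nonneg) auto
          also have "\<dots> = 1 / y - (2 / x - y / x\<^sup>2)"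
            using x y by (simp add: field_simps power2_eq_square)
          also have "2 / x - y / x\<^sup>2 = (2 / x - (real s1 + 1) / x\<^sup>2) - (1 / x\<^sup>2) * real (c i)"
            by (simp add: y_def add_divide_distrib)
          finally show "(2 / x - (real s1 + 1) / x\<^sup>2) - (1 / x\<^sup>2) * real (c i) \<le> 1 / (real (s1 + c i) + 1)"
            by (simp add: y_def)
        qed
        finally show "1 / (real s1 + 1 + real m * v $ i) \<le> multinomial_expectation m v (\<lambda>c. 1 / (real (s1 + c i) + 1))"
          by (simp add: x_def)
      qed
      finally show ?thesis .
    qed
    have f0: "0 \<le> f n v" if "v \<in> prob_vectors" for v
      unfolding f_def using prob_vectorsD[OF that]
      by (intro sum_nonneg mult_nonneg_nonneg divide_nonneg_nonneg add_nonneg_nonneg) auto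
    have E_le: "?E v \<le> 1" if v: "v \<in> prob_vectors" for v
    proof -
      have v0: "\<And>i. 0 \<le> v $ i" and v1: "(\<Sum>i\<in>UNIV. v $ i) = 1" using prob_vectorsD[OF v] by auto
      have "?E v \<le> (\<Sum>i\<in>UNIV. v $ i * multinomial_expectation m v (\<lambda>c. 1))"
        by (intro sum_mono mult_left_mono v0 multinomial_expectation_mono) auto
      then show ?thesis by (simp add: multinomial_expectation_const[OF v1] v1)
    qed
    have intE: "integrable D ?E"
    proof (rule integrable_D_bounded[where B = 1])
      show "?E \<in> borel_measurable borel" unfolding multinomial_expectation_def by measurable
      fix v assume v: "v \<in> prob_vectors"
      have "0 \<le> f n v / (real n + 1)" using f0[OF v] by simp
      then show "norm (?E v) \<le> 1" using E_le[OF v] bd[OF v] by simp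
    qed
    have "(1 + \<eta>) / (real n + 1) \<le> (\<integral>v. f n v \<partial>D) / (real n + 1)"
    proof (intro divide_right_mono)
      have "n1 \<le> n - Suc s" "n - Suc s + Suc s = n" using n by linarith+
      then show "1 + \<eta> \<le> (\<integral>v. f n v \<partial>D)" using n1[of "n - Suc s"] by simp
    qed simp
    also have "\<dots> = (\<integral>v. f n v / (real n + 1) \<partial>D)" by simp
    also have "\<dots> \<le> (\<integral>v. ?E v \<partial>D)"
    proof (rule integral_mono_AE)
      show "integrable D (\<lambda>v. f n v / (real n + 1))"
      proof (rule integrable_D_bounded[where B = 1])
        fix v assume v: "v \<in> prob_vectors"
        have "0 \<le> f n v / (real n + 1)" using f0[OF v] by simp
        then show "norm (f n v / (real n + 1)) \<le> 1" using E_le[OF v] bd[OF v] unfolding real_norm_def by linarith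
      qed simp
    qed (use intE bd AE_D_prob_vectors in auto)
    also have "\<dots> = (\<integral>x. (\<Sum>i\<in>UNIV. snd x $ i * (1 / (real (fst x i) + 1))) \<partial>joint_law n)"
      unfolding m_def by (rule integral_joint_weighted[OF sn, symmetric])
    finally show ?thesis .
  qed
  then show ?thesis using \<eta>(1) by (intro exI[of _ \<eta>] conjI exI[of _ "n1 + Suc s"] allI impI) auto
qed

text \<open>The difference \<open>\<delta>\<close> is harmonic up to \<open>A / (n + 1)\<close>.
  Adding the multiple \<open>A / \<eta>\<close> of the Lyapunov function makes both
  \<open>\<delta>\<close> and \<open>- \<delta>\<close> subharmonic for large \<open>n\<close>, and
  the maximum principle bounds each from above.\<close>

lemma increment_bounded: "\<exists>B. \<forall>n. \<bar>increment n - ln (real n + 1) / mu\<bar> \<le> B"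
proof -
  define \<delta> where "\<delta> n = increment n - ln (real n + 1) / mu" for n
  \<comment> \<open>The first summand is the error of \<open>ln_chain_error\<close>, the second the
    cost of replacing \<open>ln (m + 1)\<close> by \<open>ln (n + 1)\<close>; the factor
    \<open>s + 2\<close> comes from \<open>balls_bound_real\<close>.\<close>
  define A where "A = (CARD('b) * (real s1 + 1) + (real s + 1)) * (real s + 2) / mu"
  have A: "0 \<le> A" using mu_pos by (simp add: A_def)
  obtain \<eta> n0 where \<eta>: "0 < \<eta>" and n0: "s < n0" and
    lyap: "\<And>n. n0 \<le> n \<Longrightarrow> (1 + \<eta>) / (real n + 1) \<le> (\<integral>x. (\<Sum>i\<in>UNIV. snd x $ i * (1 / (real (fst x i) + 1))) \<partial>joint_law n)"
    using lyapunov_function by blast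
  have err: "\<bar>\<delta> n - (\<integral>x. (\<Sum>i\<in>UNIV. snd x $ i * \<delta> (fst x i)) \<partial>joint_law n)\<bar> \<le> A / (real n + 1)" if n: "s < n" for n
  proof -
    define m where "m = n - s0 - CARD('b) * s1"
    define L where "L = (\<integral>x. (\<Sum>i\<in>UNIV. snd x $ i * ln (real (fst x i) + 1)) \<partial>joint_law n)"
    have nm: "n = m + (s0 + CARD('b) * s1)" using balls_bound(3)[OF n] by (simp only: m_def)
    have "(\<integral>x. (\<Sum>i\<in>UNIV. snd x $ i * \<delta> (fst x i)) \<partial>joint_law n)
      = (\<integral>x. (\<Sum>i\<in>UNIV. snd x $ i * increment (fst x i)) - (\<Sum>i\<in>UNIV. snd x $ i * ln (real (fst x i) + 1)) / mu \<partial>joint_law n)"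
      by (simp add: \<delta>_def right_diff_distrib sum_subtractf sum_divide_distrib)
    also have "\<dots> = (increment n - 1) - L / mu"
      using increment_rec[OF n]
      by (subst Bochner_Integration.integral_diff)
         (auto simp: L_def integrable_joint_weighted[where H = "\<lambda>i c. increment (c i)"]
            integrable_joint_weighted[where H = "\<lambda>i c. ln (real (c i) + 1)"] intro!: integrable_divide)
    finally have eq: "\<delta> n - (\<integral>x. (\<Sum>i\<in>UNIV. snd x $ i * \<delta> (fst x i)) \<partial>joint_law n) = (mu + L - ln (real n + 1)) / mu"
      using mu_pos by (simp add: \<delta>_def field_simps)
    have L: "ln (real (Suc m)) - mu \<le> L" "L \<le> ln (real (Suc m)) - mu + CARD('b) * (real s1 + 1) / real (Suc m)"
      using ln_chain_error[OF n] by (simp_all add: m_def L_def)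
    have "real (Suc m) \<le> real n + 1" by (simp add: nm)
    then have up: "ln (real (Suc m)) \<le> ln (real n + 1)" by (subst ln_le_cancel_iff) linarith+
    have lo: "ln (real n + 1) \<le> ln (real (Suc m)) + (real s + 1) / real (Suc m)"
    proof -
      have "ln ((real n + 1) / real (Suc m)) \<le> (real n + 1) / real (Suc m) - 1"
        by (intro ln_le_minus_one divide_pos_pos) auto
      also have "\<dots> = (real s0 + real CARD('b) * real s1) / real (Suc m)"
        by (simp add: nm field_simps)
      also have "\<dots> \<le> (real s + 1) / real (Suc m)"
        using of_nat_mono[OF s_bound, where 'a = real] by (intro divide_right_mono) auto
      finally show ?thesis by (simp add: ln_div)
    qed
    have "\<bar>mu + L - ln (real n + 1)\<bar> \<le> (CARD('b) * (real s1 + 1) + (real s + 1)) / real (Suc m)"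
    proof -
      have "0 \<le> CARD('b) * (real s1 + 1) / real (Suc m)" "0 \<le> (real s + 1) / real (Suc m)" by auto
      then show ?thesis using L up lo by (simp only: abs_le_iff add_divide_distrib) linarith
    qed
    also have "\<dots> \<le> (CARD('b) * (real s1 + 1) + (real s + 1)) * ((real s + 2) / (real n + 1))"
    proof -
      have "real n + 1 \<le> (real s + 2) * real (Suc m)"
        using balls_bound_real[OF n] by (simp add: m_def add.commute)
      then have "1 / real (Suc m) \<le> (real s + 2) / (real n + 1)" by (simp add: divide_simps mult.commute)
      then have "(CARD('b) * (real s1 + 1) + (real s + 1)) * (1 / real (Suc m))
         \<le> (CARD('b) * (real s1 + 1) + (real s + 1)) * ((real s + 2) / (real n + 1))"
        by (intro mult_left_mono) auto
      then show ?thesis by simp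
    qed
    finally show ?thesis unfolding eq using mu_pos by (simp add: A_def divide_simps)
  qed
  define w where "w n = A / \<eta> * (1 / (real n + 1))" for n
  have w0: "0 \<le> w n" for n using A \<eta> by (simp add: w_def)
  have w: "w n + A / (real n + 1) \<le> (\<integral>x. (\<Sum>i\<in>UNIV. snd x $ i * w (fst x i)) \<partial>joint_law n)" if "n0 \<le> n" for n
  proof -
    have "w n + A / (real n + 1) = A / \<eta> * ((1 + \<eta>) / (real n + 1))"
    proof -
      define r where "r = real n + 1"
      have "0 < r" by (simp add: r_def)
      then show ?thesis using \<eta> unfolding w_def r_def[symmetric] by (simp add: field_simps)
    qed
    also have "\<dots> \<le> A / \<eta> * (\<integral>x. (\<Sum>i\<in>UNIV. snd x $ i * (1 / (real (fst x i) + 1))) \<partial>joint_law n)"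
      using A \<eta> lyap[OF that] by (intro mult_left_mono) auto
    also have "\<dots> = (\<integral>x. A / \<eta> * (\<Sum>i\<in>UNIV. snd x $ i * (1 / (real (fst x i) + 1))) \<partial>joint_law n)" by simp
    also have "\<dots> = (\<integral>x. (\<Sum>i\<in>UNIV. snd x $ i * w (fst x i)) \<partial>joint_law n)"
      by (simp add: w_def sum_distrib_left mult_ac)
    finally show ?thesis .
  qed
  have max: "\<exists>B. \<forall>n. \<sigma> * \<delta> n + w n \<le> B" if \<sigma>: "\<sigma> = 1 \<or> \<sigma> = -1" for \<sigma> :: real
  proof (rule chain_max_principle[OF n0])
    fix n assume n: "n0 \<le> n"
    have "\<sigma> * \<delta> n \<le> (\<integral>x. (\<Sum>i\<in>UNIV. snd x $ i * (\<sigma> * \<delta> (fst x i))) \<partial>joint_law n) + A / (real n + 1)"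
    proof -
      have "(\<integral>x. (\<Sum>i\<in>UNIV. snd x $ i * (\<sigma> * \<delta> (fst x i))) \<partial>joint_law n)
         = \<sigma> * (\<integral>x. (\<Sum>i\<in>UNIV. snd x $ i * \<delta> (fst x i)) \<partial>joint_law n)"
        by (subst integral_mult_right_zero[symmetric]) (simp add: sum_distrib_left mult_ac)
      then show ?thesis using err[of n] n n0 \<sigma> by (auto simp: abs_le_iff)
    qed
    also have "\<dots> \<le> (\<integral>x. (\<Sum>i\<in>UNIV. snd x $ i * (\<sigma> * \<delta> (fst x i))) \<partial>joint_law n)
        + ((\<integral>x. (\<Sum>i\<in>UNIV. snd x $ i * w (fst x i)) \<partial>joint_law n) - w n)"
      using w[OF n] by simp
    also have "\<dots> = (\<integral>x. (\<Sum>i\<in>UNIV. snd x $ i * (\<sigma> * \<delta> (fst x i))) + (\<Sum>i\<in>UNIV. snd x $ i * w (fst x i)) \<partial>joint_law n) - w n"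
      by (subst Bochner_Integration.integral_add)
         (auto simp: integrable_joint_weighted[where H = "\<lambda>i c. \<sigma> * \<delta> (c i)"]
            integrable_joint_weighted[where H = "\<lambda>i c. w (c i)"])
    also have "\<dots> = (\<integral>x. (\<Sum>i\<in>UNIV. snd x $ i * (\<sigma> * \<delta> (fst x i) + w (fst x i))) \<partial>joint_law n) - w n"
      by (simp add: distrib_left sum.distrib)
    finally show "\<sigma> * \<delta> n + w n \<le> (\<integral>x. (\<Sum>i\<in>UNIV. snd x $ i * (\<sigma> * \<delta> (fst x i) + w (fst x i))) \<partial>joint_law n)"
      by simp
  qed
  obtain B1 B2 where "\<And>n. 1 * \<delta> n + w n \<le> B1" "\<And>n. (-1) * \<delta> n + w n \<le> B2"
    using max[of 1] max[of "-1"] by auto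
  then have "\<bar>\<delta> n\<bar> \<le> max B1 B2" for n using w0[of n] by (smt (verit) mult_1 mult_minus1)
  then show ?thesis unfolding \<delta>_def by blast
qed

end

section \<open>Asymptotically harmonic functions\<close>

text \<open>An \<open>L\<^sup>2\<close> version of the Choquet--Deny lemma. Up to vanishing errors, the mean square
  oscillation \<open>Q\<close> of an asymptotically harmonic \<open>f\<close> satisfies \<open>Q \<le> P Q\<close> by Jensen's inequality
  and commutativity, while \<open>Q = P f\<^sup>2 - f\<^sup>2\<close>; iterating the first and summing the second along
  the chain bounds \<open>k Q\<close> by a constant for every \<open>k\<close>. This replaces the renewal theorem and
  makes no distinction between lattice and non-lattice distributions.\<close>

lemma bounded_tendsto_average:
  fixes \<sigma> :: "real measure" and g :: "real \<Rightarrow> real"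
  assumes "prob_space \<sigma>" and [measurable_cong]: "sets \<sigma> = sets borel" and pos: "AE y in \<sigma>. 0 < y"
    and [measurable]: "g \<in> borel_measurable borel" and b: "\<And>x. \<bar>g x\<bar> \<le> B" and lim: "(g \<longlongrightarrow> 0) at_top"
  shows "((\<lambda>x. \<integral>y. g (x * y) \<partial>\<sigma>) \<longlongrightarrow> 0) at_top"
proof -
  interpret prob_space \<sigma> by fact
  have "((\<lambda>x. \<integral>y. g (x * y) \<partial>\<sigma>) \<longlongrightarrow> (\<integral>y. 0 \<partial>\<sigma>)) at_top"
  proof (rule integral_dominated_convergence_at_top[where w = "\<lambda>_. B"])
    show "\<forall>\<^sub>F x in at_top. AE y in \<sigma>. norm (g (x * y)) \<le> B" using b by simp
    show "AE y in \<sigma>. ((\<lambda>x. g (x * y)) \<longlongrightarrow> 0) at_top"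
      using pos
    proof eventually_elim
      case (elim y)
      have "filterlim (\<lambda>x. x * y) at_top at_top"
        using elim by real_asymp
      then show ?case by (rule filterlim_compose[OF lim])
    qed
  qed auto
  then show ?thesis by simp
qed

lemma choquet_deny_L2:
  fixes \<sigma> :: "real measure" and f :: "real \<Rightarrow> real"
  assumes \<sigma>: "prob_space \<sigma>" and sets [measurable_cong]: "sets \<sigma> = sets borel" and pos: "AE y in \<sigma>. 0 < y"
    and f [measurable]: "f \<in> borel_measurable borel" and fB: "\<And>x. \<bar>f x\<bar> \<le> B"
    and lim: "((\<lambda>x. f x - (\<integral>y. f (x * y) \<partial>\<sigma>)) \<longlongrightarrow> 0) at_top"
  shows "((\<lambda>x. \<integral>y. (f (x * y) - f x)\<^sup>2 \<partial>\<sigma>) \<longlongrightarrow> 0) at_top"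
proof -
  interpret prob_space \<sigma> by fact
  interpret PP: pair_sigma_finite \<sigma> \<sigma> ..
  define P where "P g x = (\<integral>y. g (x * y) \<partial>\<sigma>)" for g :: "real \<Rightarrow> real" and x
  define e where "e x = f x - P f x" for x
  define Q where "Q x = (\<integral>y. (f (x * y) - f x)\<^sup>2 \<partial>\<sigma>)" for x
  have B0: "0 \<le> B" using fB[of 0] by simp
  have P_meas [measurable]: "P g \<in> borel_measurable borel" if [measurable]: "g \<in> borel_measurable borel" for g
    unfolding P_def by measurable
  have int: "integrable \<sigma> (\<lambda>y. g (x * y))" if [measurable]: "g \<in> borel_measurable borel" and "\<And>x. \<bar>g x\<bar> \<le> K" for g :: "real \<Rightarrow> real" and x K
    by (rule integrable_const_bound[where B = K]) (use that(2) in auto)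
  have P_mono: "P g x \<le> P h x" if "g \<in> borel_measurable borel" "\<And>x. \<bar>g x\<bar> \<le> K" "h \<in> borel_measurable borel" "\<And>x. \<bar>h x\<bar> \<le> L"
      "\<And>x. g x \<le> h x" for g h K L x
    unfolding P_def by (rule integral_mono) (use that in \<open>auto intro!: int\<close>)
  have P_bound: "\<bar>P g x\<bar> \<le> K" if "g \<in> borel_measurable borel" "\<And>x. \<bar>g x\<bar> \<le> K" for g K x
  proof -
    have "\<bar>P g x\<bar> \<le> (\<integral>y. \<bar>g (x * y)\<bar> \<partial>\<sigma>)" unfolding P_def by (rule integral_abs_bound)
    also have "\<dots> \<le> (\<integral>y. K \<partial>\<sigma>)" by (rule integral_mono) (use that in \<open>auto intro!: int integrable_abs\<close>)
    finally show ?thesis by (simp add: prob_space)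
  qed
  have e_meas [measurable]: "e \<in> borel_measurable borel" unfolding e_def by measurable
  have eB: "\<bar>e x\<bar> \<le> 2 * B" for x using fB[of x] P_bound[OF f fB, of x] by (simp add: e_def)
  have e_lim: "((\<lambda>x. \<bar>e x\<bar>) \<longlongrightarrow> 0) at_top" using lim by (intro tendsto_rabs_zero) (simp add: e_def[abs_def] P_def)
  have osc: "\<bar>(f x - f y)\<^sup>2\<bar> \<le> (2 * B)\<^sup>2" for x y
  proof -
    have "\<bar>f x - f y\<bar> \<le> 2 * B" using fB[of x] fB[of y] by linarith
    then show ?thesis using power_mono[of "\<bar>f x - f y\<bar>" "2 * B" 2] by simp
  qed
  have Q_meas [measurable]: "Q \<in> borel_measurable borel" unfolding Q_def by measurable
  have QB: "\<bar>Q x\<bar> \<le> (2 * B)\<^sup>2" for x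
  proof -
    have "\<bar>Q x\<bar> \<le> (\<integral>y. (2 * B)\<^sup>2 \<partial>\<sigma>)" unfolding Q_def
      by (rule order_trans[OF integral_abs_bound], rule integral_mono)
         (use osc in \<open>auto intro!: int[of "\<lambda>z. (f z - f x)\<^sup>2"]\<close>)
    then show ?thesis by (simp add: prob_space)
  qed
  have f2: "\<bar>(f x)\<^sup>2\<bar> \<le> B\<^sup>2" for x using fB[of x] B0 by (simp add: abs_le_square_iff[symmetric])
  \<comment> \<open>Expanding the square gives the identity \<open>Q = P f^2 - f^2 + 2 f e\<close>;
    only its last term is estimated.\<close>
  have Q_eq: "Q x \<le> P (\<lambda>x. (f x)\<^sup>2) x - (f x)\<^sup>2 + 2 * B * \<bar>e x\<bar>" for x
  proof -
    have i1: "integrable \<sigma> (\<lambda>y. (f (x * y))\<^sup>2)" using f2 by (intro int[of "\<lambda>x. (f x)\<^sup>2"]) auto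
    have i2: "integrable \<sigma> (\<lambda>y. f (x * y))" by (rule int[OF f fB])
    have "Q x = (\<integral>y. (f (x * y))\<^sup>2 - 2 * f x * f (x * y) + (f x)\<^sup>2 \<partial>\<sigma>)"
      unfolding Q_def by (simp add: power2_diff algebra_simps)
    also have "\<dots> = P (\<lambda>x. (f x)\<^sup>2) x - 2 * f x * P f x + (f x)\<^sup>2"
      using i1 i2 by (simp add: P_def prob_space)
    also have "\<dots> = P (\<lambda>x. (f x)\<^sup>2) x - (f x)\<^sup>2 + 2 * (f x * e x)"
      by (simp add: e_def algebra_simps power2_eq_square)
    also have "f x * e x \<le> B * \<bar>e x\<bar>"
      using mult_right_mono[OF fB[of x], of "\<bar>e x\<bar>"] abs_le_D1[of "f x * e x"] by (simp add: abs_mult)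
    finally show ?thesis by simp
  qed
  define E where "E x = 4 * B * (P (\<lambda>x. \<bar>e x\<bar>) x + \<bar>e x\<bar>)" for x
  have E_meas [measurable]: "E \<in> borel_measurable borel" unfolding E_def by measurable
  have E_bound: "\<bar>E x\<bar> \<le> 4 * B * (4 * B)" for x
  proof -
    have "\<bar>P (\<lambda>x. \<bar>e x\<bar>) x\<bar> \<le> 2 * B" by (rule P_bound) (use eB in auto)
    then have "\<bar>P (\<lambda>x. \<bar>e x\<bar>) x + \<bar>e x\<bar>\<bar> \<le> 4 * B" using eB[of x] by linarith
    then show ?thesis unfolding E_def abs_mult using B0 by (intro mult_mono) auto
  qed
  have E_lim: "(E \<longlongrightarrow> 0) at_top"
  proof -
    have "(P (\<lambda>x. \<bar>e x\<bar>) \<longlongrightarrow> 0) at_top"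
      unfolding P_def by (rule bounded_tendsto_average[OF \<sigma> sets pos]) (use eB e_lim in auto)
    from tendsto_mult_right_zero[OF tendsto_add_zero[OF this e_lim], of "4 * B"]
    show ?thesis unfolding E_def .
  qed
  have Q_sub: "Q x \<le> P Q x + E x" for x
  proof -
    \<comment> \<open>Up to the harmonicity errors at \<open>x * y\<close> and \<open>x\<close>, the
      increment by the factor \<open>y\<close> at \<open>x\<close> is the average over
      \<open>z\<close> of the increments by \<open>y\<close> at \<open>x * z\<close>. Jensen's
      inequality for this average is the nonnegativity of a variance.\<close>
    have step: "(f (x * y) - f x)\<^sup>2 \<le> (\<integral>z. (f (x * z * y) - f (x * z))\<^sup>2 \<partial>\<sigma>) + 4 * B * (\<bar>e (x * y)\<bar> + \<bar>e x\<bar>)" for y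
    proof -
      define a where "a = (\<integral>z. f (x * z * y) - f (x * z) \<partial>\<sigma>)"
      define r where "r = e (x * y) - e x"
      have i1: "integrable \<sigma> (\<lambda>z. f (x * z * y))"
        using int[of f B "x * y"] fB by (simp add: mult_ac)
      have i2: "integrable \<sigma> (\<lambda>z. f (x * z))" by (rule int[OF f fB])
      have a: "a = P f (x * y) - P f x" unfolding a_def P_def using i1 i2 by (simp add: mult_ac)
      have eq: "f (x * y) - f x = a + r" unfolding a r_def e_def by simp
      have aB: "\<bar>a\<bar> \<le> 2 * B" unfolding a using P_bound[OF f fB, of "x * y"] P_bound[OF f fB, of x] by linarith
      have arB: "\<bar>a + r\<bar> \<le> 2 * B" unfolding eq[symmetric] using fB[of "x * y"] fB[of x] by linarith
      have "(a + r)\<^sup>2 = a\<^sup>2 + r * (a + (a + r))" by (simp add: power2_eq_square algebra_simps)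
      also have "r * (a + (a + r)) \<le> \<bar>r\<bar> * \<bar>a + (a + r)\<bar>" by (metis abs_ge_self abs_mult)
      also have "\<dots> \<le> \<bar>r\<bar> * (4 * B)" using aB arB by (intro mult_left_mono) linarith+
      also have "\<dots> \<le> (\<bar>e (x * y)\<bar> + \<bar>e x\<bar>) * (4 * B)" using B0 by (intro mult_right_mono) (auto simp: r_def)
      also have "a\<^sup>2 \<le> (\<integral>z. (f (x * z * y) - f (x * z))\<^sup>2 \<partial>\<sigma>)"
      proof -
        have "integrable \<sigma> (\<lambda>z. (f (x * z * y) - f (x * z))\<^sup>2)"
          by (rule integrable_const_bound[where B = "(2 * B)\<^sup>2"]) (use osc in auto)
        then have "variance (\<lambda>z. f (x * z * y) - f (x * z)) = (\<integral>z. (f (x * z * y) - f (x * z))\<^sup>2 \<partial>\<sigma>) - a\<^sup>2"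
          unfolding a_def using i1 i2 by (intro variance_eq) auto
        then show ?thesis using variance_positive[of "\<lambda>z. f (x * z * y) - f (x * z)"] by simp
      qed
      finally show ?thesis unfolding eq by (simp add: mult.commute)
    qed
    have m2: "(\<lambda>(y, z). (f (x * z * y) - f (x * z))\<^sup>2) \<in> borel_measurable (\<sigma> \<Otimes>\<^sub>M \<sigma>)" by measurable
    interpret PS: pair_prob_space \<sigma> \<sigma> ..
    have i2: "integrable (\<sigma> \<Otimes>\<^sub>M \<sigma>) (\<lambda>(y, z). (f (x * z * y) - f (x * z))\<^sup>2)"
      by (rule PS.integrable_const_bound[where B = "(2 * B)\<^sup>2"]) (use osc m2 in auto)
    have "Q x \<le> (\<integral>y. (\<integral>z. (f (x * z * y) - f (x * z))\<^sup>2 \<partial>\<sigma>) + 4 * B * (\<bar>e (x * y)\<bar> + \<bar>e x\<bar>) \<partial>\<sigma>)"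
      unfolding Q_def
    proof (rule integral_mono)
      show "integrable \<sigma> (\<lambda>y. (f (x * y) - f x)\<^sup>2)"
        using osc by (intro int[of "\<lambda>z. (f z - f x)\<^sup>2"]) auto
      show "integrable \<sigma> (\<lambda>y. (\<integral>z. (f (x * z * y) - f (x * z))\<^sup>2 \<partial>\<sigma>) + 4 * B * (\<bar>e (x * y)\<bar> + \<bar>e x\<bar>))"
        using PP.integrable_fst'[OF i2] int[of "\<lambda>x. \<bar>e x\<bar>" "2 * B" x] eB
        by (intro Bochner_Integration.integrable_add integrable_mult_right) auto
    qed (rule step)
    also have "\<dots> = (\<integral>y. (\<integral>z. (f (x * z * y) - f (x * z))\<^sup>2 \<partial>\<sigma>) \<partial>\<sigma>) + E x"
      using PP.integrable_fst'[OF i2] int[of "\<lambda>x. \<bar>e x\<bar>" "2 * B" x] eB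
      by (simp add: E_def P_def prob_space)
    also have "(\<integral>y. (\<integral>z. (f (x * z * y) - f (x * z))\<^sup>2 \<partial>\<sigma>) \<partial>\<sigma>) = P Q x"
      using PP.Fubini_integral[OF i2] by (simp add: P_def Q_def)
    finally show ?thesis .
  qed
  \<comment> \<open>\<open>g\<close> stands for the \<open>k\<close>-fold average of
    \<open>f^2\<close> under \<open>P\<close>. In the step, \<open>P\<close> is applied to the
    claim, \<open>Q_sub\<close> is used with factor \<open>k\<close>, and one instance of
    \<open>Q_eq\<close> is added; the terms \<open>P f^2\<close> cancel. So any number of copies of
    \<open>Q\<close> costs only the bounded difference \<open>g - f^2\<close>.\<close>
  have key: "\<exists>g err. g \<in> borel_measurable borel \<and> (\<forall>x. \<bar>g x\<bar> \<le> B\<^sup>2) \<and>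
     err \<in> borel_measurable borel \<and> (\<exists>K. \<forall>x. \<bar>err x\<bar> \<le> K) \<and> (err \<longlongrightarrow> 0) at_top \<and>
     (\<forall>x. real k * Q x \<le> g x - (f x)\<^sup>2 + err x)" for k
  proof (induction k)
    case 0
    show ?case using f2 by (intro exI[of _ "\<lambda>x. (f x)\<^sup>2"] exI[of _ "\<lambda>_. 0"]) auto
  next
    case (Suc k)
    then obtain g err K where g [measurable]: "g \<in> borel_measurable borel" and gB: "\<And>x. \<bar>g x\<bar> \<le> B\<^sup>2"
      and er [measurable]: "err \<in> borel_measurable borel" and erK: "\<And>x. \<bar>err x\<bar> \<le> K" and erlim: "(err \<longlongrightarrow> 0) at_top"
      and IH: "\<And>x. real k * Q x \<le> g x - (f x)\<^sup>2 + err x" by metis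
    define err' where "err' x = P err x + real k * E x + 2 * B * \<bar>e x\<bar>" for x
    have "err' \<in> borel_measurable borel" unfolding err'_def by measurable
    moreover have "\<bar>err' x\<bar> \<le> K + real k * (4 * B * (4 * B)) + 2 * B * (2 * B)" for x
    proof -
      have "\<bar>err' x\<bar> \<le> \<bar>P err x\<bar> + \<bar>real k * E x\<bar> + \<bar>2 * B * \<bar>e x\<bar>\<bar>" unfolding err'_def by linarith
      also have "\<dots> \<le> K + real k * (4 * B * (4 * B)) + 2 * B * (2 * B)"
        unfolding abs_mult using P_bound[OF er erK] E_bound eB B0
        by (intro add_mono mult_mono) auto
      finally show ?thesis .
    qed
    moreover have "(err' \<longlongrightarrow> 0) at_top"
    proof -
      have "(P err \<longlongrightarrow> 0) at_top" unfolding P_def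
        by (rule bounded_tendsto_average[OF \<sigma> sets pos er erK erlim])
      from tendsto_add_zero[OF tendsto_add_zero[OF this tendsto_mult_right_zero[OF E_lim, of "real k"]]
          tendsto_mult_right_zero[OF e_lim, of "2 * B"]]
      show ?thesis unfolding err'_def .
    qed
    moreover have "real (Suc k) * Q x \<le> P g x - (f x)\<^sup>2 + err' x" for x
    proof -
      have "real k * P Q x = P (\<lambda>x. real k * Q x) x" by (simp add: P_def)
      also have "\<dots> \<le> P (\<lambda>x. g x - (f x)\<^sup>2 + err x) x"
      proof (rule P_mono)
        show "\<bar>real k * Q x\<bar> \<le> real k * (2 * B)\<^sup>2" for x using QB[of x] by (simp add: abs_mult mult_left_mono)
        show "\<bar>g x - (f x)\<^sup>2 + err x\<bar> \<le> B\<^sup>2 + B\<^sup>2 + K" for x using gB[of x] f2[of x] erK[of x] by linarith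
      qed (use IH in auto)
      also have "\<dots> = P g x - P (\<lambda>x. (f x)\<^sup>2) x + P err x"
        unfolding P_def using int[OF g gB] int[OF er erK] int[of "\<lambda>x. (f x)\<^sup>2" "B\<^sup>2"] f2 by simp
      finally have 1: "real k * P Q x \<le> P g x - P (\<lambda>x. (f x)\<^sup>2) x + P err x" .
      have "real k * Q x \<le> real k * (P Q x + E x)" by (intro mult_left_mono Q_sub) auto
      then show ?thesis using 1 Q_eq[of x] by (simp add: err'_def algebra_simps)
    qed
    moreover have "\<bar>P g x\<bar> \<le> B\<^sup>2" for x by (rule P_bound[OF g gB])
    ultimately show ?case by (intro exI[of _ "P g"] exI[of _ err']) auto
  qed
  have "(Q \<longlongrightarrow> 0) at_top"
  proof (rule tendstoI)
    fix \<epsilon> :: real assume \<epsilon>: "0 < \<epsilon>"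
    \<comment> \<open>Far out, \<open>key\<close> gives \<open>k * Q \<le> B^2 + 1\<close>, and this
      \<open>k\<close> brings \<open>Q\<close> below \<open>\<epsilon>\<close>.\<close>
    obtain k :: nat where k: "(B\<^sup>2 + 1) / \<epsilon> < real k" using reals_Archimedean2 by blast
    then have k0: "0 < real k" using \<epsilon> by (smt (verit) divide_nonneg_pos zero_le_power2)
    obtain g err where gB: "\<And>x. \<bar>g x\<bar> \<le> B\<^sup>2" and erlim: "(err \<longlongrightarrow> 0) at_top"
      and Qk: "\<And>x. real k * Q x \<le> g x - (f x)\<^sup>2 + err x" using key[of k] by blast
    have "\<forall>\<^sub>F x in at_top. err x < 1" using order_tendstoD(2)[OF erlim, of 1] by simp
    then show "\<forall>\<^sub>F x in at_top. dist (Q x) 0 < \<epsilon>"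
    proof eventually_elim
      case (elim x)
      have "real k * Q x \<le> B\<^sup>2 + 1" using Qk[of x] gB[of x] elim zero_le_power2[of "f x"] by linarith
      also have "\<dots> < real k * \<epsilon>" using k \<epsilon> by (simp add: pos_divide_less_eq)
      finally have "Q x < \<epsilon>" using k0 by simp
      moreover have "0 \<le> Q x" unfolding Q_def by (rule Bochner_Integration.integral_nonneg) simp
      ultimately show ?case by simp
    qed
  qed
  then show ?thesis unfolding Q_def .
qed

section \<open>The toll\<close>

lemma continuous_on_xlnx: "continuous_on {0..1} (\<lambda>x :: real. x * ln x)"
proof (rule continuous_on_subset[of "{0..}"], unfold continuous_on_def, rule ballI)
  fix x :: real assume "x \<in> {0..}"
  show "((\<lambda>x. x * ln x) \<longlongrightarrow> x * ln x) (at x within {0..})"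
  proof (cases "x = 0")
    case True
    have "((\<lambda>x :: real. x * ln x) \<longlongrightarrow> 0) (at_right 0)" by real_asymp
    then show ?thesis using True by (simp add: at_within_Ici_at_right)
  next
    case False
    then show ?thesis by (intro tendsto_intros) auto
  qed
qed auto

context split_parameters
begin

text \<open>A component is chosen with probability equal to its size. The density gives no mass to
  vanishing components, so the law lives on the positive reals, as \<open>choquet_deny_L2\<close>
  requires. Multiplication by such a variable is the limiting step of the size-biased path.\<close>

definition size_biased_law :: "real measure" where
  "size_biased_law = distr (density (count_space UNIV \<Otimes>\<^sub>M D) (\<lambda>x. ennreal (snd x $ fst x))) borel (\<lambda>x. snd x $ fst x)"

lemma measurable_component [measurable]:
  "(\<lambda>x :: 'b \<times> (real ^ 'b). snd x $ fst x) \<in> borel_measurable (count_space UNIV \<Otimes>\<^sub>M D)"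
  by (rule measurable_pair_measure_countable1) (auto intro!: countable_finite)

lemma pair_sf_UNIV: "pair_sigma_finite (count_space (UNIV :: 'b set)) D"
  by (intro pair_sigma_finite.intro sigma_finite_measure_count_space_finite)
    (auto intro: D.sigma_finite_measure)

lemma sets_size_biased_law [measurable_cong]: "sets size_biased_law = sets borel"
  by (simp add: size_biased_law_def)

lemma AE_component_nonneg: "AE x in count_space (UNIV :: 'b set) \<Otimes>\<^sub>M D. 0 \<le> snd x $ fst x"
proof -
  interpret pair_sigma_finite "count_space (UNIV :: 'b set)" D by (rule pair_sf_UNIV)
  show ?thesis
    by (rule AE_pair_measure) (use AE_D_prob_vectors in \<open>auto simp: prob_vectors_def\<close>)
qed

lemma prob_space_size_biased_law: "prob_space size_biased_law"
proof
  interpret pair_sigma_finite "count_space (UNIV :: 'b set)" D by (rule pair_sf_UNIV)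
  let ?N = "count_space (UNIV :: 'b set) \<Otimes>\<^sub>M D"
  have "emeasure size_biased_law (space size_biased_law)
      = emeasure (density ?N (\<lambda>x. ennreal (snd x $ fst x))) (space ?N)"
    unfolding size_biased_law_def by (subst emeasure_distr) (auto simp: space_pair_measure)
  also have "\<dots> = (\<integral>\<^sup>+x. ennreal (snd x $ fst x) * indicator (space ?N) x \<partial>?N)"
    by (rule emeasure_density) auto
  also have "\<dots> = (\<integral>\<^sup>+x. ennreal (snd x $ fst x) \<partial>?N)"
    by (rule nn_integral_cong) simp
  also have "\<dots> = (\<integral>\<^sup>+v. \<integral>\<^sup>+i. ennreal (v $ i) \<partial>count_space UNIV \<partial>D)"
    by (subst nn_integral_snd[symmetric]) auto
  also have "\<dots> = (\<integral>\<^sup>+v. 1 \<partial>D)"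
  proof (rule nn_integral_cong_AE, use AE_D_prob_vectors in eventually_elim)
    case (elim v)
    then show ?case using prob_vectorsD[OF elim] by (simp add: nn_integral_count_space_finite sum_ennreal)
  qed
  also have "\<dots> = 1" using D.emeasure_space_1 by simp
  finally show "emeasure size_biased_law (space size_biased_law) = 1" .
qed

lemma AE_size_biased_law: "AE y in size_biased_law. 0 < y"
  unfolding size_biased_law_def by (subst AE_distr_iff) (auto simp: AE_density)

lemma integral_size_biased_law:
  fixes f :: "real \<Rightarrow> real"
  assumes [measurable]: "f \<in> borel_measurable borel" and B: "\<And>x. \<bar>f x\<bar> \<le> B"
  shows "(\<integral>y. f y \<partial>size_biased_law) = (\<integral>v. (\<Sum>i\<in>UNIV. v $ i * f (v $ i)) \<partial>D)"
proof -
  interpret pair_sigma_finite "count_space (UNIV :: 'b set)" D by (rule pair_sf_UNIV)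
  let ?N = "count_space (UNIV :: 'b set) \<Otimes>\<^sub>M D"
  have "(\<integral>y. f y \<partial>size_biased_law) = (\<integral>x. f (snd x $ fst x) \<partial>density ?N (\<lambda>x. ennreal (snd x $ fst x)))"
    unfolding size_biased_law_def by (rule integral_distr) auto
  also have "\<dots> = (\<integral>x. (snd x $ fst x) *\<^sub>R f (snd x $ fst x) \<partial>?N)"
    by (rule integral_density) (use AE_component_nonneg in auto)
  finally have eq: "(\<integral>y. f y \<partial>size_biased_law) = (\<integral>x. (snd x $ fst x) * f (snd x $ fst x) \<partial>?N)" by simp
  interpret S: prob_space size_biased_law by (rule prob_space_size_biased_law)
  have "integrable size_biased_law f"
    by (rule S.integrable_const_bound[where B = B]) (use B in auto)
  then have "integrable ?N (\<lambda>x. (snd x $ fst x) *\<^sub>R f (snd x $ fst x))"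
    unfolding size_biased_law_def
    by (subst (asm) integrable_distr_eq, simp, simp, subst (asm) integrable_density)
       (use AE_component_nonneg in auto)
  then have int: "integrable ?N (\<lambda>(i, v). v $ i * f (v $ i))" by (simp add: case_prod_beta')
  have intc: "integrable D (\<lambda>v. v $ i * f (v $ i))" for i
  proof (rule integrable_D_bounded[where B = "1 * B"])
    fix v assume "v \<in> prob_vectors"
    then show "norm (v $ i * f (v $ i)) \<le> 1 * B"
      unfolding real_norm_def abs_mult using B prob_vectorsD(1,2)[of v i] by (intro mult_mono) auto
  qed simp
  have "(\<integral>x. (snd x $ fst x) * f (snd x $ fst x) \<partial>?N) = (\<Sum>i\<in>UNIV. \<integral>v. v $ i * f (v $ i) \<partial>D)"
    using integral_fst[OF int] by (simp add: lebesgue_integral_count_space_finite case_prod_beta')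
  then show ?thesis unfolding eq using intc by (simp add: Bochner_Integration.integral_sum)
qed

section \<open>Concentration of the child proportions at the split vector\<close>

lemma joint_square_deviation:
  assumes n: "s < n"
  shows "(\<integral>x. (real (fst x i) / real n - snd x $ i)\<^sup>2 \<partial>joint_law n) \<le> (2 * real n + 2 * (real s + 1)\<^sup>2) / (real n)\<^sup>2"
proof -
  define m where "m = n - s0 - CARD('b) * s1"
  have nm: "n = m + (s0 + CARD('b) * s1)" using balls_bound(3)[OF n] by (simp only: m_def)
  have n0: "0 < real n" using n by simp
  have "(\<integral>x. (real (fst x i) / real n - snd x $ i)\<^sup>2 \<partial>joint_law n)
      = (\<integral>v. multinomial_expectation m v (\<lambda>c. (real (s1 + c i) / real n - v $ i)\<^sup>2) \<partial>D)"
    unfolding m_def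
  proof (subst integral_joint_multinomial[OF n, where B = 1])
    fix c :: "'b \<Rightarrow> nat" and v assume v: "v \<in> prob_vectors" and "c \<in> child_sizes n"
    then have "real (c i) / real n \<le> 1" using n0 by simp
    moreover have "0 \<le> real (c i) / real n" by simp
    ultimately have "\<bar>real (c i) / real n - v $ i\<bar> \<le> 1" using prob_vectorsD(1,2)[OF v, of i] by linarith
    then show "norm ((real (fst (c, v) i) / real n - snd (c, v) $ i)\<^sup>2) \<le> 1"
      using power_mono[of "\<bar>real (c i) / real n - v $ i\<bar>" 1 2] by simp
  qed simp_all
  also have "\<dots> \<le> (\<integral>v. (2 * real n + 2 * (real s + 1)\<^sup>2) / (real n)\<^sup>2 \<partial>D)"
  proof (rule integral_mono_AE')
    have bound: "multinomial_expectation m v (\<lambda>c. (real (s1 + c i) / real n - v $ i)\<^sup>2) \<le> (2 * real n + 2 * (real s + 1)\<^sup>2) / (real n)\<^sup>2"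
      if v: "v \<in> prob_vectors" for v
    proof -
      have v0: "\<And>i. 0 \<le> v $ i" and v1: "(\<Sum>i\<in>UNIV. v $ i) = 1" and vl: "v $ i \<le> 1" using prob_vectorsD[OF v] by auto
      have sb: "real s0 + real CARD('b) * real s1 \<le> real s + 1" using of_nat_mono[OF s_bound, where 'a = real] by simp
      have "s1 \<le> CARD('b) * s1" using b2 by simp
      then have s1: "real s1 \<le> real s + 1" using s_bound by linarith
      define w where "w = (real s0 + real CARD('b) * real s1) * v $ i"
      \<comment> \<open>The deterministic shift caused by stored and preassigned items; both of its
        terms lie between 0 and \<open>s + 1\<close>.\<close>
      define d where "d = real s1 - w"
      have "w \<le> (real s + 1) * 1"
        unfolding w_def using sb vl v0 by (intro mult_mono) auto
      moreover have "0 \<le> w" using v0 by (simp add: w_def)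
      ultimately have "\<bar>d\<bar> \<le> real s + 1" using s1 unfolding d_def by simp
      then have d: "d\<^sup>2 \<le> (real s + 1)\<^sup>2" by (metis abs_ge_zero power2_abs power_mono)
      have pw: "(real (s1 + c i) / real n - v $ i)\<^sup>2 \<le> (2 / (real n)\<^sup>2) * (real (c i) - real m * v $ i)\<^sup>2 + 2 * (real s + 1)\<^sup>2 / (real n)\<^sup>2" for c :: "'b \<Rightarrow> nat"
      proof -
        define y where "y = real (c i) - real m * v $ i"
        have "real (s1 + c i) / real n - v $ i = (y + d) / real n"
          using n0 by (simp add: y_def d_def w_def nm field_simps)
        then have "(real (s1 + c i) / real n - v $ i)\<^sup>2 = (y + d)\<^sup>2 / (real n)\<^sup>2" by (simp add: power_divide)
        also have "(y + d)\<^sup>2 \<le> 2 * y\<^sup>2 + 2 * (real s + 1)\<^sup>2"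
          using d sum_squares_ge_zero[of "y - d" 0] by (simp add: power2_eq_square algebra_simps)
        finally show ?thesis by (simp add: y_def add_divide_distrib divide_right_mono)
      qed
      have "multinomial_expectation m v (\<lambda>c. (real (s1 + c i) / real n - v $ i)\<^sup>2)
        \<le> multinomial_expectation m v (\<lambda>c. (2 / (real n)\<^sup>2) * (real (c i) - real m * v $ i)\<^sup>2 + 2 * (real s + 1)\<^sup>2 / (real n)\<^sup>2)"
        by (intro multinomial_expectation_mono v0 pw)
      also have "\<dots> = (2 / (real n)\<^sup>2) * (real m * v $ i * (1 - v $ i)) + 2 * (real s + 1)\<^sup>2 / (real n)\<^sup>2"
        by (simp only: multinomial_expectation_add multinomial_expectation_cmult multinomial_variance[OF v1] multinomial_expectation_const[OF v1])
      also have "\<dots> \<le> (2 / (real n)\<^sup>2) * (real n * 1 * 1) + 2 * (real s + 1)\<^sup>2 / (real n)\<^sup>2"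
        using v0 vl nm by (intro add_right_mono mult_left_mono mult_mono mult_nonneg_nonneg) auto
      finally show ?thesis by (simp add: add_divide_distrib)
    qed
    show "AE v in D. multinomial_expectation m v (\<lambda>c. (real (s1 + c i) / real n - v $ i)\<^sup>2) \<le> (2 * real n + 2 * (real s + 1)\<^sup>2) / (real n)\<^sup>2"
      using AE_D_prob_vectors bound by auto
    show "AE v in D. 0 \<le> (2 * real n + 2 * (real s + 1)\<^sup>2) / (real n)\<^sup>2" by simp
  qed simp
  finally show ?thesis using D.prob_space by simp
qed

text \<open>Uniform continuity and boundedness of \<open>g\<close> give an estimate
  \<open>\<bar>g x - g y\<bar> \<le> \<epsilon>' + K * (x - y)^2\<close>. The second moment
  therefore suffices, although \<open>x * ln x\<close>, to which this is applied, is not Lipschitz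
  at 0.\<close>

lemma joint_deviation_tendsto:
  fixes g :: "real \<Rightarrow> real"
  assumes g: "continuous_on {0..1} g" and [measurable]: "g \<in> borel_measurable borel"
  shows "(\<lambda>n. \<integral>x. (\<Sum>i\<in>UNIV. \<bar>g (real (fst x i) / real n) - g (snd x $ i)\<bar>) \<partial>joint_law n) \<longlonglongrightarrow> 0"
proof (rule tendstoI)
  fix \<epsilon> :: real assume \<epsilon>: "0 < \<epsilon>"
  have "uniformly_continuous_on {0..1} g" using g by (rule compact_uniformly_continuous) simp
  moreover define \<epsilon>' where "\<epsilon>' = \<epsilon> / (2 * CARD('b))"
  have \<epsilon>': "0 < \<epsilon>'" using \<epsilon> by (simp add: \<epsilon>'_def)
  ultimately obtain \<delta> where \<delta>: "0 < \<delta>"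
    and uc: "\<And>x y. x \<in> {0..1} \<Longrightarrow> y \<in> {0..1} \<Longrightarrow> \<bar>y - x\<bar> < \<delta> \<Longrightarrow> \<bar>g y - g x\<bar> < \<epsilon>'"
    unfolding uniformly_continuous_on_def dist_real_def by metis
  have "compact (g ` {0..1})" using g by (rule compact_continuous_image) simp
  then obtain M where M: "\<And>x. x \<in> {0..1} \<Longrightarrow> \<bar>g x\<bar> \<le> M"
    using compact_imp_bounded bounded_iff by (metis imageI real_norm_def)
  have M0: "0 \<le> M" using M[of 0] by simp
  define K where "K = 2 * M / \<delta>\<^sup>2"
  have K: "\<bar>g x - g y\<bar> \<le> \<epsilon>' + K * (x - y)\<^sup>2" if "x \<in> {0..1}" "y \<in> {0..1}" for x y
  proof (cases "\<bar>x - y\<bar> < \<delta>")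
    case True
    have "0 \<le> K * (x - y)\<^sup>2" using M0 by (simp add: K_def)
    then show ?thesis using uc[OF that(2,1) True] by linarith
  next
    case False
    then have "\<delta>\<^sup>2 \<le> (x - y)\<^sup>2" using \<delta> power_mono[of \<delta> "\<bar>x - y\<bar>" 2] by simp
    then have "2 * M \<le> K * (x - y)\<^sup>2" using \<delta> M0 by (simp add: K_def divide_simps mult_left_mono)
    then show ?thesis using M[OF that(1)] M[OF that(2)] \<epsilon>' by linarith
  qed
  define r where "r n = CARD('b) * \<epsilon>' + CARD('b) * K * ((2 * real n + 2 * (real s + 1)\<^sup>2) / (real n)\<^sup>2)" for n :: nat
  have "r \<longlonglongrightarrow> CARD('b) * \<epsilon>' + CARD('b) * K * 0"
    unfolding r_def by (intro tendsto_intros) real_asymp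
  then have "r \<longlonglongrightarrow> \<epsilon> / 2" by (simp add: \<epsilon>'_def)
  from order_tendstoD(2)[OF this, of \<epsilon>] have "\<forall>\<^sub>F n in sequentially. r n < \<epsilon>" using \<epsilon> by simp
  then show "\<forall>\<^sub>F n in sequentially. dist (\<integral>x. (\<Sum>i\<in>UNIV. \<bar>g (real (fst x i) / real n) - g (snd x $ i)\<bar>) \<partial>joint_law n) 0 < \<epsilon>"
    using eventually_gt_at_top[of s]
  proof eventually_elim
    case (elim n)
    have sq: "integrable (joint_law n) (\<lambda>x. (real (fst x i) / real n - snd x $ i)\<^sup>2)" for i
    proof (rule integrable_joint_bounded[where B = 1])
      fix c :: "'b \<Rightarrow> nat" and v assume v: "v \<in> prob_vectors" and "c \<in> child_sizes n"
      then have "real (c i) / real n \<le> 1" using elim by simp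
      moreover have "0 \<le> real (c i) / real n" by simp
      ultimately have "\<bar>real (c i) / real n - v $ i\<bar> \<le> 1" using prob_vectorsD(1,2)[OF v, of i] by linarith
      then show "norm ((real (fst (c, v) i) / real n - snd (c, v) $ i)\<^sup>2) \<le> 1"
        using power_mono[of "\<bar>real (c i) / real n - v $ i\<bar>" 1 2] by simp
    qed simp
    have "(\<integral>x. (\<Sum>i\<in>UNIV. \<bar>g (real (fst x i) / real n) - g (snd x $ i)\<bar>) \<partial>joint_law n)
      \<le> (\<integral>x. (\<Sum>i\<in>UNIV. \<epsilon>' + K * (real (fst x i) / real n - snd x $ i)\<^sup>2) \<partial>joint_law n)"
    proof (rule integral_mono_AE')
      show "integrable (joint_law n) (\<lambda>x. \<Sum>i\<in>UNIV. \<epsilon>' + K * (real (fst x i) / real n - snd x $ i)\<^sup>2)"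
        using sq by (intro Bochner_Integration.integrable_sum Bochner_Integration.integrable_add integrable_mult_right) auto
      show "AE x in joint_law n. (\<Sum>i\<in>UNIV. \<bar>g (real (fst x i) / real n) - g (snd x $ i)\<bar>)
         \<le> (\<Sum>i\<in>UNIV. \<epsilon>' + K * (real (fst x i) / real n - snd x $ i)\<^sup>2)"
      proof (rule AE_joint_lawI)
        fix c :: "'b \<Rightarrow> nat" and v assume v: "v \<in> prob_vectors" and c: "\<And>i. c i \<le> n"
        show "(\<Sum>i\<in>UNIV. \<bar>g (real (fst (c, v) i) / real n) - g (snd (c, v) $ i)\<bar>)
         \<le> (\<Sum>i\<in>UNIV. \<epsilon>' + K * (real (fst (c, v) i) / real n - snd (c, v) $ i)\<^sup>2)"
          unfolding fst_conv snd_conv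
          by (intro sum_mono K) (use prob_vectorsD[OF v] c elim in auto)
      qed
      show "AE x in joint_law n. 0 \<le> (\<Sum>i\<in>UNIV. \<epsilon>' + K * (real (fst x i) / real n - snd x $ i)\<^sup>2)"
        using \<epsilon>' M0 by (intro AE_I2 sum_nonneg) (auto simp: K_def)
    qed
    also have "\<dots> = (\<Sum>i\<in>UNIV. \<epsilon>' + K * (\<integral>x. (real (fst x i) / real n - snd x $ i)\<^sup>2 \<partial>joint_law n))"
      using sq by (subst Bochner_Integration.integral_sum) (auto simp: J.prob_space)
    also have "\<dots> \<le> (\<Sum>i\<in>(UNIV :: 'b set). \<epsilon>' + K * ((2 * real n + 2 * (real s + 1)\<^sup>2) / (real n)\<^sup>2))"
      using M0 by (intro sum_mono add_left_mono mult_left_mono joint_square_deviation elim) (auto simp: K_def)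
    also have "\<dots> = r n" by (simp add: r_def distrib_left)
    finally have "(\<integral>x. (\<Sum>i\<in>UNIV. \<bar>g (real (fst x i) / real n) - g (snd x $ i)\<bar>) \<partial>joint_law n) < \<epsilon>"
      using elim by simp
    moreover have "0 \<le> (\<integral>x. (\<Sum>i\<in>UNIV. \<bar>g (real (fst x i) / real n) - g (snd x $ i)\<bar>) \<partial>joint_law n)"
      by (intro Bochner_Integration.integral_nonneg sum_nonneg) auto
    ultimately show ?case by simp
  qed
qed

section \<open>The toll of a node and the remainder of the mean path length\<close>

definition toll :: "nat \<Rightarrow> ('b \<Rightarrow> nat) \<Rightarrow> real" where
  "toll n c = (\<Sum>i\<in>UNIV. real (c i) + mean_length (c i)) - mean_length n"

lemma integral_toll: "(\<integral>x. toll n (fst x) \<partial>joint_law n) = 0"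
  using mean_length_joint[of n]
  by (simp add: toll_def integrable_joint_fst[where F = "\<lambda>c. \<Sum>i\<in>UNIV. real (c i) + mean_length (c i)"] J.prob_space)

lemma integrable_split_C [simp]: "integrable D (split_C D)"
  unfolding split_C_eq[abs_def] by simp

lemma split_C_measurable [measurable]: "split_C D \<in> borel_measurable borel"
  unfolding split_C_eq[abs_def] by measurable

lemma integral_split_C: "(\<integral>v. split_C D v \<partial>D) = 0"
  using mu_pos mu_eq D.prob_space unfolding split_C_eq[abs_def] by simp

lemma split_C_bound: "v \<in> prob_vectors \<Longrightarrow> \<bar>split_C D v\<bar> \<le> 1 + CARD('b) / mu"
proof -
  assume v: "v \<in> prob_vectors"
  have "\<bar>entropy_sum v / mu\<bar> \<le> CARD('b) / mu"
    using entropy_sum_bounds(2)[OF v] mu_pos by (simp add: abs_divide divide_right_mono)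
  then show ?thesis unfolding split_C_eq by linarith
qed

definition mean_remainder :: "nat \<Rightarrow> real" where
  "mean_remainder m = mean_length m - real m * ln (real m) / mu"

lemma mean_remainder_0 [simp]: "mean_remainder 0 = 0"
  by (simp add: mean_remainder_def)

text \<open>The increments of \<open>m * ln m / mu\<close> are \<open>(ln (m + 1) + t) / mu\<close>
  with \<open>0 \<le> t \<le> 1\<close>, so \<open>increment_bounded\<close> bounds all increments
  of the remainder.\<close>

lemma mean_remainder_lipschitz:
  "\<exists>L\<ge>0. \<forall>m m'. \<bar>mean_remainder m - mean_remainder m'\<bar> \<le> L * \<bar>real m - real m'\<bar>"
proof -
  obtain B where B: "\<And>n. \<bar>increment n - ln (real n + 1) / mu\<bar> \<le> B" using increment_bounded by blast
  define L where "L = B + 1 / mu"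
  have L0: "0 \<le> L" using mu_pos B[of 0] by (simp add: L_def)
  have step: "\<bar>mean_remainder (Suc m) - mean_remainder m\<bar> \<le> L" for m
  proof -
    define t where "t = real m * (ln (real m + 1) - ln (real m))"
    have t: "0 \<le> t \<and> t \<le> 1"
    proof (cases "m = 0")
      case False
      then have m: "0 < real m" by simp
      have "ln ((real m + 1) / real m) \<le> (real m + 1) / real m - 1" using m by (intro ln_le_minus_one) auto
      then have "ln (real m + 1) - ln (real m) \<le> 1 / real m" using m by (simp add: ln_div field_simps)
      then have "t \<le> real m * (1 / real m)" unfolding t_def using m by (intro mult_left_mono) auto
      moreover have "ln (real m) \<le> ln (real m + 1)" using m by (subst ln_le_cancel_iff) auto
      ultimately show ?thesis using m by (auto simp: t_def)
    qed (simp add: t_def)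
    have "mean_remainder (Suc m) - mean_remainder m = (increment m - ln (real m + 1) / mu) - t / mu"
      using mu_pos by (simp add: mean_remainder_def increment_def t_def field_simps)
    moreover have "0 \<le> t / mu" "t / mu \<le> 1 / mu" using t mu_pos by (auto simp: divide_right_mono)
    ultimately show ?thesis using B[of m] unfolding L_def by linarith
  qed
  have add: "\<bar>mean_remainder (m + k) - mean_remainder m\<bar> \<le> L * real k" for m k
  proof (induction k)
    case (Suc k)
    then show ?case using step[of "m + k"] by (simp add: algebra_simps)
  qed simp
  have "\<bar>mean_remainder m - mean_remainder m'\<bar> \<le> L * \<bar>real m - real m'\<bar>" for m m'
  proof (cases "m \<le> m'")
    case True
    then show ?thesis using add[of m "m' - m"] by (simp add: of_nat_diff abs_minus_commute)
  next
    case False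
    then show ?thesis using add[of m' "m - m'"] by (simp add: of_nat_diff)
  qed
  then show ?thesis using L0 by blast
qed

text \<open>After splitting off the remainder, the terms \<open>c i * ln (c i)\<close> and
  \<open>n * ln n\<close> combine to the entropy of the proportions. The terms with
  \<open>s0\<close> are left because the children hold only \<open>n - s0\<close> items
  together.\<close>

lemma toll_eq:
  assumes n: "s < n" and c: "(\<Sum>i\<in>UNIV. c i) = n - s0"
  shows "toll n c / real n = 1 - real s0 / real n - real s0 * ln (real n) / (mu * real n)
    + (\<Sum>i\<in>UNIV. mean_remainder (c i) / real n) - mean_remainder n / real n
    + (\<Sum>i\<in>UNIV. real (c i) / real n * ln (real (c i) / real n)) / mu"
proof -
  have n0: "0 < real n" using n by simp
  have s0n: "s0 \<le> n" using s_bound n by linarith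
  have cs: "(\<Sum>i\<in>UNIV. real (c i)) = real n - real s0"
    using c s0n by (simp add: of_nat_diff flip: of_nat_sum)
  have "real n * (\<Sum>i\<in>UNIV. real (c i) / real n * ln (real (c i) / real n))
      = (\<Sum>i\<in>UNIV. real (c i) * ln (real (c i)) - real (c i) * ln (real n))"
    unfolding sum_distrib_left
  proof (rule sum.cong)
    fix i
    show "real n * (real (c i) / real n * ln (real (c i) / real n)) = real (c i) * ln (real (c i)) - real (c i) * ln (real n)"
      using n0 by (cases "c i = 0") (auto simp: ln_div algebra_simps)
  qed simp
  also have "\<dots> = (\<Sum>i\<in>UNIV. real (c i) * ln (real (c i))) - (real n - real s0) * ln (real n)"
    using cs by (simp add: sum_subtractf flip: sum_distrib_right)
  finally have ent: "(\<Sum>i\<in>UNIV. real (c i) * ln (real (c i)))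
    = real n * (\<Sum>i\<in>UNIV. real (c i) / real n * ln (real (c i) / real n)) + (real n - real s0) * ln (real n)" by simp
  define H where "H = (\<Sum>i\<in>UNIV. real (c i) / real n * ln (real (c i) / real n))"
  define R where "R = (\<Sum>i\<in>UNIV. mean_remainder (c i))"
  have "toll n c = (real n - real s0) + (R + (\<Sum>i\<in>UNIV. real (c i) * ln (real (c i))) / mu) - (mean_remainder n + real n * ln (real n) / mu)"
    by (simp add: toll_def mean_remainder_def sum.distrib cs R_def sum_subtractf sum_divide_distrib)
  also have "\<dots> = (real n - real s0) + R - mean_remainder n + (real n * H - real s0 * ln (real n)) / mu"
    unfolding ent H_def[symmetric] using mu_pos by (simp add: field_simps)
  finally have "toll n c / real n = 1 - real s0 / real n - real s0 * ln (real n) / (mu * real n) + R / real n - mean_remainder n / real n + H / mu"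
    using n0 by (simp add: add_divide_distrib diff_divide_distrib)
  then show ?thesis by (simp add: H_def R_def sum_divide_distrib)
qed

lemma toll_bounded:
  "\<exists>B\<ge>0. \<forall>n c. s < n \<longrightarrow> (\<Sum>i\<in>UNIV. c i) = n - s0 \<longrightarrow> \<bar>toll n c / real n\<bar> \<le> B"
proof -
  obtain L where L0: "0 \<le> L" and L: "\<And>m m'. \<bar>mean_remainder m - mean_remainder m'\<bar> \<le> L * \<bar>real m - real m'\<bar>"
    using mean_remainder_lipschitz by blast
  have RL: "\<bar>mean_remainder m\<bar> \<le> L * real m" for m using L[of m 0] by simp
  define B where "B = 1 + real s0 + real s0 / mu + CARD('b) * L + L + CARD('b) / mu"
  have "\<bar>toll n c / real n\<bar> \<le> B" if n: "s < n" and c: "(\<Sum>i\<in>UNIV. c i) = n - s0" for n c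
  proof -
    have n0: "0 < real n" "1 \<le> real n" using n by auto
    have cn: "c i \<le> n" for i using member_le_sum[of i UNIV c] c by simp
    have "real s0 / real n \<le> real s0 / 1" "0 \<le> real s0 / real n" using n0 by (intro divide_left_mono) auto
    moreover have "real s0 * ln (real n) / (mu * real n) \<le> real s0 / mu" "0 \<le> real s0 * ln (real n) / (mu * real n)"
    proof -
      have "ln (real n) \<le> real n" using ln_le_minus_one[of "real n"] n0 by linarith
      then have "real s0 / mu * (ln (real n) / real n) \<le> real s0 / mu * 1"
        using mu_pos n0 by (intro mult_left_mono) auto
      then show "real s0 * ln (real n) / (mu * real n) \<le> real s0 / mu" by simp
      show "0 \<le> real s0 * ln (real n) / (mu * real n)" using mu_pos n0 by simp
    qed
    moreover have "\<bar>\<Sum>i\<in>UNIV. mean_remainder (c i) / real n\<bar> \<le> CARD('b) * L"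
    proof -
      have "\<bar>mean_remainder (c i) / real n\<bar> \<le> L" for i
      proof -
        have "\<bar>mean_remainder (c i)\<bar> \<le> L * real n"
          using RL[of "c i"] cn[of i] L0 by (meson mult_left_mono of_nat_mono order_trans)
        then show ?thesis using n0 by (simp add: abs_divide divide_le_eq)
      qed
      then have "\<bar>\<Sum>i\<in>UNIV. mean_remainder (c i) / real n\<bar> \<le> (\<Sum>i\<in>(UNIV :: 'b set). L)"
        by (intro order_trans[OF sum_abs sum_mono])
      then show ?thesis by simp
    qed
    moreover have "\<bar>mean_remainder n / real n\<bar> \<le> L" using RL[of n] n0 by (simp add: abs_divide divide_le_eq)
    moreover have "\<bar>(\<Sum>i\<in>UNIV. real (c i) / real n * ln (real (c i) / real n)) / mu\<bar> \<le> CARD('b) / mu"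
    proof -
      have "\<bar>real (c i) / real n * ln (real (c i) / real n)\<bar> \<le> 1" for i
        using n0 cn[of i] by (intro xlnx_bounds(2)) auto
      then have "\<bar>\<Sum>i\<in>UNIV. real (c i) / real n * ln (real (c i) / real n)\<bar> \<le> (\<Sum>i\<in>(UNIV :: 'b set). 1)"
        by (intro order_trans[OF sum_abs sum_mono])
      then show ?thesis using mu_pos by (simp add: abs_divide divide_right_mono)
    qed
    ultimately show ?thesis unfolding toll_eq[OF n c] B_def by (simp only: abs_le_iff div_by_1) linarith
  qed
  moreover have "0 \<le> B" using mu_pos L0 by (simp add: B_def)
  ultimately show ?thesis by blast
qed

text \<open>The function \<open>g\<close> of the overview, extended to real arguments by rounding
  down and by 0 to nonpositive ones, which makes it bounded and measurable on the whole
  line.\<close>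

definition remainder_rate :: "real \<Rightarrow> real" where
  "remainder_rate x = (if 0 < x then mean_remainder (nat \<lfloor>x\<rfloor>) / x else 0)"

lemma remainder_rate_measurable [measurable]: "remainder_rate \<in> borel_measurable borel"
proof -
  have [measurable]: "mean_remainder \<in> measurable (count_space UNIV) borel" by simp
  show ?thesis unfolding remainder_rate_def[abs_def] by measurable
qed

lemma weighted_remainder_rate:
  assumes "0 < x" "0 \<le> p"
  shows "p * remainder_rate (x * p) = mean_remainder (nat \<lfloor>x * p\<rfloor>) / x"
  using assms by (cases "p = 0") (auto simp: remainder_rate_def)

text \<open>The first-order fluctuation of the toll is \<open>split_C\<close> plus an oscillation of
  \<open>remainder_rate\<close>; taking expectations shows that \<open>remainder_rate\<close> is asymptotically harmonic.\<close>

lemma toll_decomposition_tendsto: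
  "(\<lambda>n. \<integral>x. \<bar>toll n (fst x) / real n - split_C D (snd x)
     - (\<Sum>i\<in>UNIV. snd x $ i * (remainder_rate (real n * snd x $ i) - remainder_rate (real n)))\<bar> \<partial>joint_law n) \<longlonglongrightarrow> 0"
proof -
  obtain L where L0: "0 \<le> L" and L: "\<And>m m'. \<bar>mean_remainder m - mean_remainder m'\<bar> \<le> L * \<bar>real m - real m'\<bar>"
    using mean_remainder_lipschitz by blast
  define F where "F n x = \<bar>toll n (fst x) / real n - split_C D (snd x)
     - (\<Sum>i\<in>UNIV. snd x $ i * (remainder_rate (real n * snd x $ i) - remainder_rate (real n)))\<bar>"
    for n and x :: "('b \<Rightarrow> nat) \<times> (real ^ 'b)"
  define d1 where "d1 n x = (\<Sum>i\<in>UNIV. \<bar>real (fst x i) / real n - snd x $ i\<bar>)"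
    for n and x :: "('b \<Rightarrow> nat) \<times> (real ^ 'b)"
  define d2 where "d2 n x = (\<Sum>i\<in>UNIV. \<bar>real (fst x i) / real n * ln (real (fst x i) / real n) - snd x $ i * ln (snd x $ i)\<bar>)"
    for n and x :: "('b \<Rightarrow> nat) \<times> (real ^ 'b)"
  have bound: "F n (c, v) \<le> real s0 / real n + real s0 * ln (real n) / (mu * real n)
      + (L * d1 n (c, v) + CARD('b) * L / real n) + d2 n (c, v) / mu"
    if v: "v \<in> prob_vectors" and n: "s < n" and c: "(\<Sum>i\<in>UNIV. c i) = n - s0" for n c v
  proof -
    have n0: "0 < real n" "1 \<le> real n" using n by auto
    have "(\<Sum>i\<in>UNIV. v $ i * (remainder_rate (real n * v $ i) - remainder_rate (real n)))
      = (\<Sum>i\<in>UNIV. mean_remainder (nat \<lfloor>real n * v $ i\<rfloor>) / real n) - (\<Sum>i\<in>UNIV. v $ i) * remainder_rate (real n)"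
      using weighted_remainder_rate[OF n0(1) prob_vectorsD(1)[OF v]]
      by (simp add: right_diff_distrib sum_subtractf sum_distrib_right)
    also have "\<dots> = (\<Sum>i\<in>UNIV. mean_remainder (nat \<lfloor>real n * v $ i\<rfloor>) / real n) - mean_remainder n / real n"
      using n0 prob_vectorsD(3)[OF v] by (simp add: remainder_rate_def)
    finally have eq: "F n (c, v) = \<bar>- (real s0 / real n) - real s0 * ln (real n) / (mu * real n)
      + (\<Sum>i\<in>UNIV. (mean_remainder (c i) - mean_remainder (nat \<lfloor>real n * v $ i\<rfloor>)) / real n)
      + (\<Sum>i\<in>UNIV. real (c i) / real n * ln (real (c i) / real n) - v $ i * ln (v $ i)) / mu\<bar>"
      unfolding F_def fst_conv snd_conv toll_eq[OF n c] split_C_eq entropy_sum_def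
      by (simp add: diff_divide_distrib sum_subtractf)
    have "\<bar>\<Sum>i\<in>UNIV. (mean_remainder (c i) - mean_remainder (nat \<lfloor>real n * v $ i\<rfloor>)) / real n\<bar>
      \<le> (\<Sum>i\<in>UNIV. L * \<bar>real (c i) / real n - v $ i\<bar> + L / real n)"
    proof (rule order_trans[OF sum_abs sum_mono])
      fix i
      have "0 \<le> real n * v $ i" using prob_vectorsD(1)[OF v] by simp
      then have "\<bar>real (c i) - real (nat \<lfloor>real n * v $ i\<rfloor>)\<bar> \<le> \<bar>real (c i) - real n * v $ i\<bar> + 1"
        by linarith
      also have "\<bar>real (c i) - real n * v $ i\<bar> = real n * \<bar>real (c i) / real n - v $ i\<bar>"
        using n0 by (subst abs_of_pos[OF n0(1), symmetric], subst abs_mult[symmetric]) (simp add: right_diff_distrib)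
      finally have "L * \<bar>real (c i) - real (nat \<lfloor>real n * v $ i\<rfloor>)\<bar> \<le> L * (real n * \<bar>real (c i) / real n - v $ i\<bar> + 1)"
        using L0 by (intro mult_left_mono)
      with L[of "c i" "nat \<lfloor>real n * v $ i\<rfloor>"]
      have "\<bar>mean_remainder (c i) - mean_remainder (nat \<lfloor>real n * v $ i\<rfloor>)\<bar> \<le> L * (real n * \<bar>real (c i) / real n - v $ i\<bar> + 1)"
        by linarith
      then have "\<bar>mean_remainder (c i) - mean_remainder (nat \<lfloor>real n * v $ i\<rfloor>)\<bar> / real n
        \<le> (L * (real n * \<bar>real (c i) / real n - v $ i\<bar> + 1)) / real n"
        by (rule divide_right_mono) simp
      also have "\<dots> = L * \<bar>real (c i) / real n - v $ i\<bar> + L / real n"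
        using n0 by (simp add: distrib_left add_divide_distrib)
      finally show "\<bar>(mean_remainder (c i) - mean_remainder (nat \<lfloor>real n * v $ i\<rfloor>)) / real n\<bar>
        \<le> L * \<bar>real (c i) / real n - v $ i\<bar> + L / real n" by (simp add: abs_divide)
    qed
    also have "\<dots> = L * d1 n (c, v) + CARD('b) * L / real n"
      by (simp add: d1_def sum.distrib sum_distrib_left)
    finally have A: "\<bar>\<Sum>i\<in>UNIV. (mean_remainder (c i) - mean_remainder (nat \<lfloor>real n * v $ i\<rfloor>)) / real n\<bar>
      \<le> L * d1 n (c, v) + CARD('b) * L / real n" .
    have B: "\<bar>(\<Sum>i\<in>UNIV. real (c i) / real n * ln (real (c i) / real n) - v $ i * ln (v $ i)) / mu\<bar> \<le> d2 n (c, v) / mu"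
      unfolding abs_divide abs_of_pos[OF mu_pos] d2_def fst_conv snd_conv
      by (intro divide_right_mono sum_abs) (use mu_pos in auto)
    have C: "0 \<le> real s0 / real n" "0 \<le> real s0 * ln (real n) / (mu * real n)" using n0 mu_pos by auto
    show ?thesis unfolding eq using A B C by linarith
  qed
  have d1_lim: "(\<lambda>n. \<integral>x. d1 n x \<partial>joint_law n) \<longlonglongrightarrow> 0"
    unfolding d1_def using joint_deviation_tendsto[of "\<lambda>x. x"] by simp
  have d2_lim: "(\<lambda>n. \<integral>x. d2 n x \<partial>joint_law n) \<longlonglongrightarrow> 0"
    unfolding d2_def using joint_deviation_tendsto[OF continuous_on_xlnx] by simp
  define r where "r n = real s0 / real n + real s0 * ln (real n) / (mu * real n)
      + (L * (\<integral>x. d1 n x \<partial>joint_law n) + CARD('b) * L / real n) + (\<integral>x. d2 n x \<partial>joint_law n) / mu" for n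
  have "(\<lambda>n. real s0 * ln (real n) / (mu * real n)) \<longlonglongrightarrow> 0"
    using mu_pos by real_asymp
  then have "r \<longlonglongrightarrow> 0 + 0 + (L * 0 + 0) + 0 / mu"
    unfolding r_def using mu_pos
    by (intro tendsto_intros d1_lim d2_lim lim_const_over_n) auto
  then have r0: "r \<longlonglongrightarrow> 0" by simp
  have "(\<lambda>n. \<integral>x. F n x \<partial>joint_law n) \<longlonglongrightarrow> 0"
  proof (rule tendsto_sandwich[OF _ _ tendsto_const r0])
    show "\<forall>\<^sub>F n in sequentially. 0 \<le> (\<integral>x. F n x \<partial>joint_law n)"
      by (intro always_eventually allI Bochner_Integration.integral_nonneg) (simp add: F_def)
    show "\<forall>\<^sub>F n in sequentially. (\<integral>x. F n x \<partial>joint_law n) \<le> r n"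
      using eventually_gt_at_top[of s]
    proof eventually_elim
      case (elim n)
      have q: "0 \<le> real (c i) / real n \<and> real (c i) / real n \<le> 1" if "c \<in> child_sizes n" for c :: "'b \<Rightarrow> nat" and i
        using that elim by auto
      have i1: "integrable (joint_law n) (d1 n)"
      proof (rule integrable_joint_bounded[where B = "\<Sum>i\<in>(UNIV :: 'b set). 1"])
        fix c :: "'b \<Rightarrow> nat" and v assume v: "v \<in> prob_vectors" and c: "c \<in> child_sizes n"
        have "\<bar>real (c i) / real n - v $ i\<bar> \<le> 1" for i using q[OF c, of i] prob_vectorsD(1,2)[OF v, of i] by linarith
        then have "d1 n (c, v) \<le> (\<Sum>i\<in>(UNIV :: 'b set). 1)" unfolding d1_def by (intro sum_mono) simp
        moreover have "0 \<le> d1 n (c, v)" unfolding d1_def by (intro sum_nonneg) simp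
        ultimately show "norm (d1 n (c, v)) \<le> (\<Sum>i\<in>(UNIV :: 'b set). 1)" by simp
      qed (simp add: d1_def)
      have i2: "integrable (joint_law n) (d2 n)"
      proof (rule integrable_joint_bounded[where B = "\<Sum>i\<in>(UNIV :: 'b set). 1"])
        fix c :: "'b \<Rightarrow> nat" and v assume v: "v \<in> prob_vectors" and c: "c \<in> child_sizes n"
        have "\<bar>real (c i) / real n * ln (real (c i) / real n) - v $ i * ln (v $ i)\<bar> \<le> 1" for i
          using xlnx_bounds(1,2)[of "real (c i) / real n"] xlnx_bounds(1,2)[of "v $ i"]
            q[OF c, of i] prob_vectorsD(1,2)[OF v, of i] by linarith
        then have "d2 n (c, v) \<le> (\<Sum>i\<in>(UNIV :: 'b set). 1)" unfolding d2_def by (intro sum_mono) simp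
        moreover have "0 \<le> d2 n (c, v)" unfolding d2_def by (intro sum_nonneg) simp
        ultimately show "norm (d2 n (c, v)) \<le> (\<Sum>i\<in>(UNIV :: 'b set). 1)" by simp
      qed (simp add: d2_def)
      have "(\<integral>x. F n x \<partial>joint_law n) \<le> (\<integral>x. real s0 / real n + real s0 * ln (real n) / (mu * real n)
        + (L * d1 n x + CARD('b) * L / real n) + d2 n x / mu \<partial>joint_law n)"
      proof (rule integral_mono_AE')
        have "AE x in joint_law n. 0 \<le> F n x \<and> F n x \<le> real s0 / real n + real s0 * ln (real n) / (mu * real n)
            + (L * d1 n x + CARD('b) * L / real n) + d2 n x / mu"
          by (rule AE_joint_lawI) (use bound elim in \<open>auto simp: F_def\<close>)
        then show "AE x in joint_law n. F n x \<le> real s0 / real n + real s0 * ln (real n) / (mu * real n)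
            + (L * d1 n x + CARD('b) * L / real n) + d2 n x / mu"
          "AE x in joint_law n. 0 \<le> real s0 / real n + real s0 * ln (real n) / (mu * real n)
            + (L * d1 n x + CARD('b) * L / real n) + d2 n x / mu"
          by (auto elim: eventually_mono)
      qed (use i1 i2 in simp)
      also have "\<dots> = r n" unfolding r_def using i1 i2 by (simp add: J.prob_space)
      finally show ?case .
    qed
  qed
  then show ?thesis unfolding F_def .
qed

lemma remainder_rate_bound: "\<exists>B. \<forall>x. \<bar>remainder_rate x\<bar> \<le> B"
proof -
  obtain L where L0: "0 \<le> L" and L: "\<And>m m'. \<bar>mean_remainder m - mean_remainder m'\<bar> \<le> L * \<bar>real m - real m'\<bar>"
    using mean_remainder_lipschitz by blast
  have "\<bar>remainder_rate x\<bar> \<le> L" for x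
  proof (cases "0 < x")
    case True
    have "\<bar>mean_remainder (nat \<lfloor>x\<rfloor>)\<bar> \<le> L * real (nat \<lfloor>x\<rfloor>)" using L[of "nat \<lfloor>x\<rfloor>" 0] by simp
    also have "\<dots> \<le> L * x" using True L0 by (intro mult_left_mono) linarith+
    finally show ?thesis using True by (simp add: remainder_rate_def abs_divide divide_le_eq)
  qed (simp add: remainder_rate_def L0)
  then show ?thesis by blast
qed

section \<open>Vanishing oscillation of the remainder\<close>

definition remainder_oscillation :: "real \<Rightarrow> real ^ 'b \<Rightarrow> real" where
  "remainder_oscillation x v = (\<Sum>i\<in>UNIV. v $ i * (remainder_rate (x * v $ i) - remainder_rate x))"

lemma remainder_oscillation_measurable [measurable]: "remainder_oscillation x \<in> borel_measurable borel"
  unfolding remainder_oscillation_def by measurable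

lemma remainder_oscillation_bound: "\<exists>B. \<forall>x. \<forall>v\<in>prob_vectors. \<bar>remainder_oscillation x v\<bar> \<le> B"
proof -
  obtain B where B: "\<And>x. \<bar>remainder_rate x\<bar> \<le> B" using remainder_rate_bound by blast
  have "\<bar>remainder_oscillation x v\<bar> \<le> (\<Sum>i\<in>(UNIV :: 'b set). 1 * (2 * B))" if v: "v \<in> prob_vectors" for x v
    unfolding remainder_oscillation_def
  proof (rule order_trans[OF sum_abs sum_mono])
    fix i
    have "\<bar>remainder_rate (x * v $ i) - remainder_rate x\<bar> \<le> 2 * B" using B[of x] B[of "x * v $ i"] by linarith
    then show "\<bar>v $ i * (remainder_rate (x * v $ i) - remainder_rate x)\<bar> \<le> 1 * (2 * B)"
      unfolding abs_mult using prob_vectorsD(1,2)[OF v, of i] by (intro mult_mono) auto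
  qed
  then show ?thesis by blast
qed

lemma integrable_remainder_oscillation [simp]: "integrable D (remainder_oscillation x)"
proof -
  obtain B where "\<forall>x. \<forall>v\<in>prob_vectors. \<bar>remainder_oscillation x v\<bar> \<le> B" using remainder_oscillation_bound by blast
  then show ?thesis by (intro integrable_D_bounded[where B = B]) auto
qed

lemma toll_diff_integrable:
  assumes n: "s < n" and [measurable]: "h \<in> borel_measurable borel" and h: "\<And>v. v \<in> prob_vectors \<Longrightarrow> \<bar>h v\<bar> \<le> B"
  shows "integrable (joint_law n) (\<lambda>x. toll n (fst x) / real n - split_C D (snd x) - h (snd x))"
proof (intro Bochner_Integration.integrable_diff)
  show "integrable (joint_law n) (\<lambda>x. toll n (fst x) / real n)"
    by (rule integrable_joint_fst[where F = "\<lambda>c. toll n c / real n"])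
  show "integrable (joint_law n) (\<lambda>x. split_C D (snd x))"
    by (rule integrable_joint_bounded[where B = "1 + CARD('b) / mu"]) (use split_C_bound in auto)
  show "integrable (joint_law n) (\<lambda>x. h (snd x))"
    by (rule integrable_joint_bounded[where B = B]) (use h in auto)
qed

lemma remainder_harmonic_nat: "(\<lambda>n. \<integral>v. remainder_oscillation (real n) v \<partial>D) \<longlonglongrightarrow> 0"
proof (rule Lim_null_comparison[OF _ toll_decomposition_tendsto])
  obtain B where B: "\<forall>x. \<forall>v\<in>prob_vectors. \<bar>remainder_oscillation x v\<bar> \<le> B" using remainder_oscillation_bound by blast
  show "\<forall>\<^sub>F n in sequentially. norm (\<integral>v. remainder_oscillation (real n) v \<partial>D) \<le> (\<integral>x. \<bar>toll n (fst x) / real n - split_C D (snd x)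
     - (\<Sum>i\<in>UNIV. snd x $ i * (remainder_rate (real n * snd x $ i) - remainder_rate (real n)))\<bar> \<partial>joint_law n)"
    using eventually_gt_at_top[of s]
  proof eventually_elim
    case (elim n)
    have i1: "integrable (joint_law n) (\<lambda>x. toll n (fst x) / real n)"
      by (rule integrable_joint_fst[where F = "\<lambda>c. toll n c / real n"])
    have i2: "integrable (joint_law n) (\<lambda>x. split_C D (snd x))"
      by (rule integrable_joint_bounded[where B = "1 + CARD('b) / mu"]) (use split_C_bound in auto)
    have i3: "integrable (joint_law n) (\<lambda>x. remainder_oscillation (real n) (snd x))"
      by (rule integrable_joint_bounded[where B = B]) (use B in auto)
    have "(\<integral>x. toll n (fst x) / real n - split_C D (snd x) - remainder_oscillation (real n) (snd x) \<partial>joint_law n)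
      = - (\<integral>v. remainder_oscillation (real n) v \<partial>D)"
      using i1 i2 i3 integral_toll[of n] integral_split_C
      by (simp add: integral_joint_snd)
    then have "norm (\<integral>v. remainder_oscillation (real n) v \<partial>D)
      = norm (\<integral>x. toll n (fst x) / real n - split_C D (snd x) - remainder_oscillation (real n) (snd x) \<partial>joint_law n)"
      by simp
    also have "\<dots> \<le> (\<integral>x. norm (toll n (fst x) / real n - split_C D (snd x) - remainder_oscillation (real n) (snd x)) \<partial>joint_law n)"
      by (rule integral_norm_bound)
    finally show ?case by (simp add: remainder_oscillation_def)
  qed
qed

text \<open>Replacing a real \<open>x\<close> by its integer part changes the mean oscillation only
  by order \<open>1 / x\<close>, because the remainder is Lipschitz. This carries the statement for
  integers over to the real line, on which \<open>choquet_deny_L2\<close> works.\<close>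

lemma remainder_harmonic:
  "((\<lambda>x. remainder_rate x - (\<integral>y. remainder_rate (x * y) \<partial>size_biased_law)) \<longlongrightarrow> 0) at_top"
proof -
  obtain B where B: "\<And>x. \<bar>remainder_rate x\<bar> \<le> B" using remainder_rate_bound by blast
  obtain L where L0: "0 \<le> L" and L: "\<And>m m'. \<bar>mean_remainder m - mean_remainder m'\<bar> \<le> L * \<bar>real m - real m'\<bar>"
    using mean_remainder_lipschitz by blast
  have RL: "\<bar>mean_remainder m\<bar> \<le> L * real m" for m using L[of m 0] by simp
  have e: "remainder_rate x - (\<integral>y. remainder_rate (x * y) \<partial>size_biased_law) = - (\<integral>v. remainder_oscillation x v \<partial>D)" for x
  proof -
    have "(\<integral>v. remainder_oscillation x v \<partial>D) = (\<integral>v. (\<Sum>i\<in>UNIV. v $ i * remainder_rate (x * v $ i)) - remainder_rate x \<partial>D)"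
      by (rule integral_cong_AE)
         (use AE_D_prob_vectors in \<open>auto simp: remainder_oscillation_def right_diff_distrib sum_subtractf prob_vectors_def simp flip: sum_distrib_right elim!: eventually_mono\<close>)
    also have "\<dots> = (\<integral>v. (\<Sum>i\<in>UNIV. v $ i * remainder_rate (x * v $ i)) \<partial>D) - remainder_rate x"
    proof -
      have "integrable D (\<lambda>v. (\<Sum>i\<in>UNIV. v $ i * remainder_rate (x * v $ i)))"
      proof (rule Bochner_Integration.integrable_sum, rule integrable_D_bounded[where B = "1 * B"])
        fix v i assume "v \<in> prob_vectors"
        then show "norm (v $ i * remainder_rate (x * v $ i)) \<le> 1 * B"
          unfolding real_norm_def abs_mult using B prob_vectorsD(1,2)[of v i] by (intro mult_mono) auto
      qed simp
      then show ?thesis using D.prob_space by simp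
    qed
    also have "(\<integral>v. (\<Sum>i\<in>UNIV. v $ i * remainder_rate (x * v $ i)) \<partial>D) = (\<integral>y. remainder_rate (x * y) \<partial>size_biased_law)"
      using B by (intro integral_size_biased_law[symmetric]) auto
    finally show ?thesis by simp
  qed
  \<comment> \<open>Each component costs \<open>2 * L / x\<close>, because the rounded arguments
    differ by at most 2, and \<open>L / x\<close>, because of division by \<open>n\<close> instead
    of \<open>x\<close>. A last \<open>L / x\<close> comes from \<open>remainder_rate x\<close>
    itself.\<close>
  have close: "\<bar>(\<integral>v. remainder_oscillation x v \<partial>D) - (\<integral>v. remainder_oscillation (real (nat \<lfloor>x\<rfloor>)) v \<partial>D)\<bar> \<le> (CARD('b) * (3 * L) + L) / x"
    if x1: "1 \<le> x" for x
  proof -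
    define n where "n = nat \<lfloor>x\<rfloor>"
    have n: "1 \<le> real n" "real n \<le> x" "x - 1 \<le> real n" using x1 by (auto simp: n_def)
    have inv: "0 \<le> 1 / real n - 1 / x" "real n * (1 / real n - 1 / x) \<le> 1 / x"
    proof -
      show "0 \<le> 1 / real n - 1 / x" using n x1 by (simp add: field_simps)
      have "real n * (1 / real n - 1 / x) = (x - real n) / x" using n x1 by (simp add: field_simps)
      also have "\<dots> \<le> 1 / x" using n x1 by (intro divide_right_mono) auto
      finally show "real n * (1 / real n - 1 / x) \<le> 1 / x" .
    qed
    have pw: "\<bar>remainder_oscillation x v - remainder_oscillation (real n) v\<bar> \<le> (CARD('b) * (3 * L) + L) / x" if v: "v \<in> prob_vectors" for v
    proof -
      have ro: "remainder_oscillation y v = (\<Sum>i\<in>UNIV. mean_remainder (nat \<lfloor>y * v $ i\<rfloor>) / y) - remainder_rate y" if "0 < y" for y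
        using weighted_remainder_rate[OF that prob_vectorsD(1)[OF v]] prob_vectorsD(3)[OF v]
        by (simp add: remainder_oscillation_def right_diff_distrib sum_subtractf flip: sum_distrib_right)
      have a: "\<bar>remainder_rate x - remainder_rate (real n)\<bar> \<le> L / x"
      proof -
        have "remainder_rate x - remainder_rate (real n) = - (mean_remainder n * (1 / real n - 1 / x))"
          using x1 n by (simp add: remainder_rate_def n_def[symmetric] right_diff_distrib)
        then have "\<bar>remainder_rate x - remainder_rate (real n)\<bar> = \<bar>mean_remainder n\<bar> * (1 / real n - 1 / x)"
          using inv(1) by (simp add: abs_mult)
        also have "\<dots> \<le> (L * real n) * (1 / real n - 1 / x)" using RL inv(1) by (intro mult_right_mono)
        also have "\<dots> \<le> L * (1 / x)" unfolding mult.assoc using inv(2) L0 by (intro mult_left_mono)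
        finally show ?thesis by simp
      qed
      have bi: "\<bar>mean_remainder (nat \<lfloor>x * v $ i\<rfloor>) / x - mean_remainder (nat \<lfloor>real n * v $ i\<rfloor>) / real n\<bar> \<le> 3 * L / x" for i
      proof -
        define p where "p = v $ i"
        have p: "0 \<le> p" "p \<le> 1" using prob_vectorsD(1,2)[OF v] by (auto simp: p_def)
        define k k' where "k = nat \<lfloor>x * p\<rfloor>" and "k' = nat \<lfloor>real n * p\<rfloor>"
        have np: "0 \<le> real n * p" "real n * p \<le> x * p" using p n by (auto intro: mult_right_mono)
        have "(x - real n) * p \<le> 1 * 1" using p n by (intro mult_mono) auto
        then have "x * p \<le> real n * p + 1" by (simp add: algebra_simps)
        then have kk: "\<bar>real k - real k'\<bar> \<le> 2" unfolding k_def k'_def using np by linarith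
        have "real k' \<le> real n * p" unfolding k'_def using np by linarith
        also have "\<dots> \<le> real n" using p n by (simp add: mult_left_le)
        finally have k'n: "real k' \<le> real n" .
        have "mean_remainder k / x - mean_remainder k' / real n = (mean_remainder k - mean_remainder k') / x - mean_remainder k' * (1 / real n - 1 / x)"
          by (simp add: diff_divide_distrib right_diff_distrib)
        then have "\<bar>mean_remainder k / x - mean_remainder k' / real n\<bar> \<le> \<bar>mean_remainder k - mean_remainder k'\<bar> / x + \<bar>mean_remainder k'\<bar> * (1 / real n - 1 / x)"
          using inv(1) x1 abs_triangle_ineq4[of "(mean_remainder k - mean_remainder k') / x" "mean_remainder k' * (1 / real n - 1 / x)"]
          by (simp add: abs_mult abs_divide)
        also have "\<bar>mean_remainder k - mean_remainder k'\<bar> / x \<le> (L * 2) / x"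
          using order_trans[OF L[of k k'] mult_left_mono[OF kk L0]] x1 by (intro divide_right_mono) auto
        also have "\<bar>mean_remainder k'\<bar> * (1 / real n - 1 / x) \<le> (L * real n) * (1 / real n - 1 / x)"
          using order_trans[OF RL[of k'] mult_left_mono[OF k'n L0]] inv(1) by (intro mult_right_mono)
        also have "\<dots> \<le> L * (1 / x)" unfolding mult.assoc using inv(2) L0 by (intro mult_left_mono)
        finally show ?thesis by (simp add: k_def k'_def p_def add_divide_distrib)
      qed
      have "\<bar>remainder_oscillation x v - remainder_oscillation (real n) v\<bar>
        \<le> \<bar>\<Sum>i\<in>UNIV. mean_remainder (nat \<lfloor>x * v $ i\<rfloor>) / x - mean_remainder (nat \<lfloor>real n * v $ i\<rfloor>) / real n\<bar> + \<bar>remainder_rate x - remainder_rate (real n)\<bar>"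
        using x1 n by (simp add: ro sum_subtractf)
      also have "\<bar>\<Sum>i\<in>UNIV. mean_remainder (nat \<lfloor>x * v $ i\<rfloor>) / x - mean_remainder (nat \<lfloor>real n * v $ i\<rfloor>) / real n\<bar> \<le> (\<Sum>i\<in>(UNIV :: 'b set). 3 * L / x)"
        by (rule order_trans[OF sum_abs sum_mono]) (rule bi)
      finally show ?thesis using a by (simp add: add_divide_distrib)
    qed
    have "\<bar>(\<integral>v. remainder_oscillation x v \<partial>D) - (\<integral>v. remainder_oscillation (real n) v \<partial>D)\<bar>
      = \<bar>\<integral>v. remainder_oscillation x v - remainder_oscillation (real n) v \<partial>D\<bar>" by simp
    also have "\<dots> \<le> (\<integral>v. \<bar>remainder_oscillation x v - remainder_oscillation (real n) v\<bar> \<partial>D)"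
      by (rule integral_abs_bound)
    also have "\<dots> \<le> (\<integral>v. (CARD('b) * (3 * L) + L) / x \<partial>D)"
      by (rule integral_mono_AE) (use pw AE_D_prob_vectors in auto)
    finally show ?thesis using D.prob_space by (simp add: n_def)
  qed
  have nf: "filterlim (\<lambda>x :: real. nat \<lfloor>x\<rfloor>) at_top at_top" by real_asymp
  have "((\<lambda>x. \<bar>\<integral>v. remainder_oscillation (real (nat \<lfloor>x\<rfloor>)) v \<partial>D\<bar> + (CARD('b) * (3 * L) + L) / x) \<longlongrightarrow> 0 + 0) at_top"
  proof (rule tendsto_add)
    show "((\<lambda>x :: real. \<bar>\<integral>v. remainder_oscillation (real (nat \<lfloor>x\<rfloor>)) v \<partial>D\<bar>) \<longlongrightarrow> 0) at_top"
      using filterlim_compose[OF remainder_harmonic_nat nf] by (simp add: tendsto_rabs_zero_iff)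
    show "((\<lambda>x. (CARD('b) * (3 * L) + L) / x) \<longlongrightarrow> 0) at_top" by real_asymp
  qed
  then have lim: "((\<lambda>x. \<bar>\<integral>v. remainder_oscillation (real (nat \<lfloor>x\<rfloor>)) v \<partial>D\<bar> + (CARD('b) * (3 * L) + L) / x) \<longlongrightarrow> 0) at_top" by simp
  show ?thesis
  proof (rule Lim_null_comparison[OF _ lim])
    show "\<forall>\<^sub>F x in at_top. norm (remainder_rate x - (\<integral>y. remainder_rate (x * y) \<partial>size_biased_law))
       \<le> \<bar>\<integral>v. remainder_oscillation (real (nat \<lfloor>x\<rfloor>)) v \<partial>D\<bar> + (CARD('b) * (3 * L) + L) / x"
      using eventually_ge_at_top[of 1]
    proof eventually_elim
      case (elim x)
      then show ?case using close[of x] unfolding e real_norm_def by linarith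
    qed
  qed
qed

text \<open>The mean square oscillation under \<open>size_biased_law\<close> carries the same
  weights \<open>v $ i\<close> as \<open>remainder_oscillation\<close>, so its convergence to 0
  implies the convergence of the first absolute moment.\<close>

lemma remainder_oscillation_tendsto: "(\<lambda>n. \<integral>v. \<bar>remainder_oscillation (real n) v\<bar> \<partial>D) \<longlonglongrightarrow> 0"
proof (rule tendstoI)
  fix \<epsilon> :: real assume \<epsilon>: "0 < \<epsilon>"
  obtain B where B: "\<And>x. \<bar>remainder_rate x\<bar> \<le> B" using remainder_rate_bound by blast
  have B0: "0 \<le> B" using B[of 0] by simp
  define Q where "Q x = (\<integral>y. (remainder_rate (x * y) - remainder_rate x)\<^sup>2 \<partial>size_biased_law)" for x
  have "(Q \<longlongrightarrow> 0) at_top"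
    unfolding Q_def
    by (rule choquet_deny_L2[OF prob_space_size_biased_law sets_size_biased_law AE_size_biased_law
          remainder_rate_measurable B remainder_harmonic])
  then have "(\<lambda>n. Q (real n)) \<longlonglongrightarrow> 0" using filterlim_real_sequentially by (rule filterlim_compose)
  \<comment> \<open>The threshold fits the inequality
    \<open>y \<le> \<epsilon> / 2 + 2 * y^2 / \<epsilon>\<close> used below: its last term then has
    mean below \<open>\<epsilon> / 2\<close>.\<close>
  moreover have "0 < \<epsilon> * \<epsilon> / 4" using \<epsilon> by simp
  ultimately have "\<forall>\<^sub>F n in sequentially. Q (real n) < \<epsilon> * \<epsilon> / 4" by (rule order_tendstoD(2))
  then show "\<forall>\<^sub>F n in sequentially. dist (\<integral>v. \<bar>remainder_oscillation (real n) v\<bar> \<partial>D) 0 < \<epsilon>"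
  proof eventually_elim
    case (elim n)
    have sqB: "\<bar>(remainder_rate y - remainder_rate z)\<^sup>2\<bar> \<le> (2 * B)\<^sup>2" for y z
    proof -
      have "\<bar>remainder_rate y - remainder_rate z\<bar> \<le> 2 * B" using B[of y] B[of z] by linarith
      then show ?thesis using power_mono[of "\<bar>remainder_rate y - remainder_rate z\<bar>" "2 * B" 2] by simp
    qed
    have Q: "Q (real n) = (\<integral>v. (\<Sum>i\<in>UNIV. v $ i * (remainder_rate (real n * v $ i) - remainder_rate (real n))\<^sup>2) \<partial>D)"
      unfolding Q_def by (rule integral_size_biased_law) (use sqB in auto)
    have intQ: "integrable D (\<lambda>v. (\<Sum>i\<in>UNIV. v $ i * (remainder_rate (real n * v $ i) - remainder_rate (real n))\<^sup>2))"
    proof (rule Bochner_Integration.integrable_sum, rule integrable_D_bounded[where B = "1 * (2 * B)\<^sup>2"])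
      fix v i assume "v \<in> prob_vectors"
      then show "norm (v $ i * (remainder_rate (real n * v $ i) - remainder_rate (real n))\<^sup>2) \<le> 1 * (2 * B)\<^sup>2"
        unfolding real_norm_def abs_mult[of "v $ i"] using sqB prob_vectorsD(1,2)[of v i] by (intro mult_mono) auto
    qed simp
    have pw: "\<bar>remainder_oscillation (real n) v\<bar> \<le> \<epsilon> / 2 + (\<Sum>i\<in>UNIV. v $ i * (remainder_rate (real n * v $ i) - remainder_rate (real n))\<^sup>2) * (1 / \<epsilon>) * 2"
      if v: "v \<in> prob_vectors" for v
    proof -
      have "\<bar>remainder_oscillation (real n) v\<bar> \<le> (\<Sum>i\<in>UNIV. v $ i * (\<epsilon> / 2 + 2 * (remainder_rate (real n * v $ i) - remainder_rate (real n))\<^sup>2 / \<epsilon>))"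
        unfolding remainder_oscillation_def
      proof (rule order_trans[OF sum_abs sum_mono])
        fix i
        define y where "y = \<bar>remainder_rate (real n * v $ i) - remainder_rate (real n)\<bar>"
        have "y \<le> \<epsilon> / 2 + 2 * y\<^sup>2 / \<epsilon>"
        proof -
          have "(2 * y - \<epsilon> / 2)\<^sup>2 = 4 * y\<^sup>2 - 2 * (y * \<epsilon>) + \<epsilon> * \<epsilon> / 4"
            by (simp add: power2_eq_square algebra_simps)
          moreover have "0 \<le> (2 * y - \<epsilon> / 2)\<^sup>2" "0 < \<epsilon> * \<epsilon>" using \<epsilon> by auto
          ultimately have "y * \<epsilon> \<le> \<epsilon> * \<epsilon> / 2 + 2 * y\<^sup>2" by linarith
          then show ?thesis using \<epsilon> by (simp add: field_simps)
        qed
        then show "\<bar>v $ i * (remainder_rate (real n * v $ i) - remainder_rate (real n))\<bar>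
          \<le> v $ i * (\<epsilon> / 2 + 2 * (remainder_rate (real n * v $ i) - remainder_rate (real n))\<^sup>2 / \<epsilon>)"
          unfolding abs_mult prob_vectorsD(4)[OF v] using prob_vectorsD(1)[OF v]
          by (intro mult_left_mono) (auto simp: y_def)
      qed
      also have "\<dots> = (\<Sum>i\<in>UNIV. v $ i) * (\<epsilon> / 2) + (\<Sum>i\<in>UNIV. v $ i * (remainder_rate (real n * v $ i) - remainder_rate (real n))\<^sup>2) * (1 / \<epsilon>) * 2"
        by (simp add: distrib_left sum.distrib sum_distrib_right sum_distrib_left sum_divide_distrib mult_ac)
      finally show ?thesis using prob_vectorsD(3)[OF v] by simp
    qed
    have "(\<integral>v. \<bar>remainder_oscillation (real n) v\<bar> \<partial>D)
      \<le> (\<integral>v. \<epsilon> / 2 + (\<Sum>i\<in>UNIV. v $ i * (remainder_rate (real n * v $ i) - remainder_rate (real n))\<^sup>2) * (1 / \<epsilon>) * 2 \<partial>D)"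
      by (rule integral_mono_AE) (use pw AE_D_prob_vectors intQ in \<open>auto intro!: Bochner_Integration.integrable_add integrable_mult_left\<close>)
    also have "\<dots> = \<epsilon> / 2 + Q (real n) * (1 / \<epsilon>) * 2"
      unfolding Q using intQ D.prob_space by simp
    also have "\<dots> < \<epsilon>" using elim \<epsilon> by (simp add: field_simps)
    finally show ?case by (simp add: Bochner_Integration.integral_nonneg)
  qed
qed

lemma toll_tendsto:
  "(\<lambda>n. \<integral>x. \<bar>toll n (fst x) / real n - split_C D (snd x)\<bar> \<partial>joint_law n) \<longlonglongrightarrow> 0"
proof -
  obtain B where B: "\<forall>x. \<forall>v\<in>prob_vectors. \<bar>remainder_oscillation x v\<bar> \<le> B" using remainder_oscillation_bound by blast
  let ?r = "\<lambda>n. (\<integral>x. \<bar>toll n (fst x) / real n - split_C D (snd x) - remainder_oscillation (real n) (snd x)\<bar> \<partial>joint_law n)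
     + (\<integral>v. \<bar>remainder_oscillation (real n) v\<bar> \<partial>D)"
  have "?r \<longlonglongrightarrow> 0 + 0"
    using toll_decomposition_tendsto[folded remainder_oscillation_def] remainder_oscillation_tendsto by (rule tendsto_add)
  then have r: "?r \<longlonglongrightarrow> 0" by simp
  show ?thesis
  proof (rule Lim_null_comparison[OF _ r])
    show "\<forall>\<^sub>F n in sequentially. norm (\<integral>x. \<bar>toll n (fst x) / real n - split_C D (snd x)\<bar> \<partial>joint_law n) \<le> ?r n"
      using eventually_gt_at_top[of s]
    proof eventually_elim
      case (elim n)
      have i0: "integrable (joint_law n) (\<lambda>x. toll n (fst x) / real n - split_C D (snd x))"
        using toll_diff_integrable[OF elim, of "\<lambda>_. 0" 0] by simp
      have i1: "integrable (joint_law n) (\<lambda>x. toll n (fst x) / real n - split_C D (snd x) - remainder_oscillation (real n) (snd x))"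
        by (rule toll_diff_integrable[OF elim, where B = B]) (use B in auto)
      have i2: "integrable (joint_law n) (\<lambda>x. remainder_oscillation (real n) (snd x))"
        by (rule integrable_joint_bounded[where B = B]) (use B in auto)
      have "(\<integral>x. \<bar>toll n (fst x) / real n - split_C D (snd x)\<bar> \<partial>joint_law n)
        \<le> (\<integral>x. \<bar>toll n (fst x) / real n - split_C D (snd x) - remainder_oscillation (real n) (snd x)\<bar> + \<bar>remainder_oscillation (real n) (snd x)\<bar> \<partial>joint_law n)"
        by (rule integral_mono) (use i0 i1 i2 in auto)
      also have "\<dots> = ?r n"
        using i1 i2 by (simp add: integral_joint_snd[where f = "\<lambda>v. \<bar>remainder_oscillation (real n) v\<bar>"])
      finally show ?case by (simp add: Bochner_Integration.integral_nonneg)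
    qed
  qed
qed

end

section \<open>Exponential moments\<close>

lemma exp_le_quadratic:
  fixes x :: real
  assumes "\<bar>x\<bar> \<le> 1"
  shows "exp x \<le> 1 + x + x\<^sup>2"
proof (cases "0 \<le> x")
  case True
  then show ?thesis using exp_bound[of x] assms by simp
next
  case False
  define y where "y = - x"
  have y: "0 \<le> y" using False by (simp add: y_def)
  have q: "0 < 1 + y + y\<^sup>2 / 2" using y by (intro add_pos_nonneg) auto
  \<comment> \<open>Multiplying the claimed bound by the quadratic lower bound of
    \<open>exp y\<close> leaves only nonnegative terms besides 1.\<close>
  have "(1 - y + y\<^sup>2) * (1 + y + y\<^sup>2 / 2) = 1 + (y\<^sup>2 + y ^ 3 + y ^ 4) / 2"
    by (simp add: field_simps power2_eq_square power3_eq_cube power4_eq_xxxx)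
  then have "1 \<le> (1 - y + y\<^sup>2) * (1 + y + y\<^sup>2 / 2)" using y by simp
  then have "1 / (1 + y + y\<^sup>2 / 2) \<le> 1 - y + y\<^sup>2" using q by (simp add: pos_divide_le_eq)
  moreover have "exp x \<le> 1 / (1 + y + y\<^sup>2 / 2)"
    using exp_lower_Taylor_quadratic[OF y] q by (simp add: y_def exp_minus field_simps)
  ultimately show ?thesis by (simp add: y_def)
qed

lemma exp_diff_le:
  fixes x y :: real
  assumes "x \<le> M" "y \<le> M"
  shows "\<bar>exp x - exp y\<bar> \<le> exp M * \<bar>x - y\<bar>"
proof -
  have *: "exp a - exp b \<le> exp M * (a - b)" if "b \<le> a" "a \<le> M" for a b
  proof -
    have "1 - exp (b - a) \<le> a - b" using exp_ge_add_one_self[of "b - a"] by linarith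
    then have "exp a * (1 - exp (b - a)) \<le> exp a * (a - b)" by (intro mult_left_mono) auto
    also have "\<dots> \<le> exp M * (a - b)" using that by (intro mult_right_mono) auto
    finally show ?thesis by (simp add: right_diff_distrib flip: exp_add)
  qed
  show ?thesis
  proof (cases "x \<le> y")
    case True
    then have "exp x \<le> exp y" by simp
    then show ?thesis using *[OF True assms(2)] True by simp
  next
    case False
    then have "y \<le> x" "exp y \<le> exp x" by auto
    then show ?thesis using *[of y x] assms by simp
  qed
qed

text \<open>Convexity between 0 and \<open>y\<close>: the tangent at \<open>z = q * y\<close> lies
  below \<open>exp\<close> at both end points, and with weights \<open>1 - q\<close> and
  \<open>q\<close> the linear terms cancel.\<close>

lemma exp_le_chord:
  fixes q y :: real
  assumes "0 \<le> q" "q \<le> 1"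
  shows "exp (q * y) \<le> 1 - q + q * exp y"
proof -
  define z where "z = q * y"
  have 1: "exp z * (1 - z) \<le> 1"
  proof -
    have "exp z * (1 - z) \<le> exp z * exp (- z)"
      using exp_ge_add_one_self[of "- z"] by (intro mult_left_mono) auto
    then show ?thesis by (simp flip: exp_add)
  qed
  have 2: "exp z * (1 + (y - z)) \<le> exp y"
  proof -
    have "exp z * (1 + (y - z)) \<le> exp z * exp (y - z)"
      using exp_ge_add_one_self[of "y - z"] by (intro mult_left_mono) auto
    then show ?thesis by (simp flip: exp_add)
  qed
  have "exp z = (1 - q) * (exp z * (1 - z)) + q * (exp z * (1 + (y - z)))"
    by (simp add: z_def algebra_simps)
  also have "\<dots> \<le> (1 - q) * 1 + q * exp y"
    using 1 2 assms by (intro add_mono mult_left_mono) auto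
  finally show ?thesis by (simp add: z_def)
qed

context split_parameters
begin

text \<open>The transform of the sum of tolls above depth \<open>k\<close>, as
  \<open>expectation_exp_martingale\<close> shows. A general field lets one recursion cover moment
  generating functions for real \<open>w\<close> and characteristic functions for imaginary
  \<open>w\<close>; the truncation makes it a finite sum.\<close>

primrec tree_mgf :: "nat \<Rightarrow> 'f::{real_normed_field, banach} \<Rightarrow> nat \<Rightarrow> 'f" where
  "tree_mgf 0 w n = 1"
| "tree_mgf (Suc k) w n = (\<Sum>c\<in>child_sizes n. of_real (offspring_prob n c) *
     (exp (w * of_real (toll n c)) * (\<Prod>i\<in>UNIV. tree_mgf k w (c i))))"

lemma tree_mgf_joint:
  fixes w :: "'f::{real_normed_field, banach, second_countable_topology}"
  shows "tree_mgf (Suc k) w n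
    = (\<integral>x. exp (w * of_real (toll n (fst x))) * (\<Prod>i\<in>UNIV. tree_mgf k w (fst x i)) \<partial>joint_law n)"
  using integral_joint_fst[of n "\<lambda>c. exp (w * of_real (toll n c)) * (\<Prod>i\<in>UNIV. tree_mgf k w (c i))"]
  by (simp add: scaleR_conv_of_real)

lemma tree_mgf_small: "n \<le> s \<Longrightarrow> tree_mgf k w n = 1"
proof (induction k arbitrary: n)
  case (Suc k)
  have "tree_mgf (Suc k) w n = (\<Sum>c\<in>child_sizes n. of_real (offspring_prob n c))"
    unfolding tree_mgf.simps
  proof (rule sum.cong)
    fix c assume "c \<in> child_sizes n"
    show "of_real (offspring_prob n c) * (exp (w * of_real (toll n c)) * (\<Prod>i\<in>UNIV. tree_mgf k w (c i)))
      = of_real (offspring_prob n c)"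
    proof (cases "offspring_prob n c = 0")
      case False
      then have c: "c i = 0" for i using offspring_support(3) Suc.prems by blast
      then have "toll n c = 0" using Suc.prems by (simp add: toll_def)
      then show ?thesis using c Suc.IH[of 0] by simp
    qed simp
  qed simp
  then show ?case by (simp add: offspring_prob_sum flip: of_real_sum)
qed simp

section \<open>Contraction of the squared proportions\<close>

definition square_sum :: "nat \<Rightarrow> ('b \<Rightarrow> nat) \<Rightarrow> real" where
  "square_sum n c = (\<Sum>i\<in>UNIV. (real (c i) / real n)\<^sup>2)"

lemma square_sum_le_1:
  assumes "0 < n" "(\<Sum>i\<in>UNIV. c i) \<le> n"
  shows "0 \<le> square_sum n c" "square_sum n c \<le> 1"
proof -
  show "0 \<le> square_sum n c" unfolding square_sum_def by (intro sum_nonneg) simp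
  have "square_sum n c \<le> (\<Sum>i\<in>UNIV. real (c i) / real n)"
    unfolding square_sum_def
  proof (rule sum_mono)
    fix i
    have "c i \<le> n" using member_le_sum[of i UNIV c] assms by simp
    then have "real (c i) / real n \<le> 1" using assms by simp
    then show "(real (c i) / real n)\<^sup>2 \<le> real (c i) / real n"
      unfolding power2_eq_square by (intro mult_left_le) auto
  qed
  also have "\<dots> = real (\<Sum>i\<in>UNIV. c i) / real n" by (simp add: sum_divide_distrib)
  also have "\<dots> \<le> 1" using assms by (simp del: of_nat_sum)
  finally show "square_sum n c \<le> 1" .
qed

text \<open>If no child holds all \<open>n\<close> items, every proportion is at most
  \<open>1 - 1 / n\<close>, and this bound is used for one of the two factors of each
  square.\<close>

lemma square_sum_stay:
  assumes "0 < n" "(\<Sum>i\<in>UNIV. c i) \<le> n"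
  shows "square_sum n c \<le> 1 - (1 - of_bool (\<exists>i. c i = n)) / real n"
proof (cases "\<exists>i. c i = n")
  case True
  then show ?thesis using square_sum_le_1[OF assms] by simp
next
  case False
  have "square_sum n c \<le> (\<Sum>i\<in>UNIV. (1 - 1 / real n) * (real (c i) / real n))"
    unfolding square_sum_def
  proof (rule sum_mono)
    fix i
    have "c i < n" using member_le_sum[of i UNIV c] assms False by (metis UNIV_I finite le_neq_implies_less le_trans zero_le)
    then have "real (c i) \<le> real n - 1" by linarith
    then have "real (c i) / real n \<le> 1 - 1 / real n" using assms by (simp add: field_simps)
    then show "(real (c i) / real n)\<^sup>2 \<le> (1 - 1 / real n) * (real (c i) / real n)"
      unfolding power2_eq_square by (intro mult_right_mono) auto
  qed
  also have "\<dots> = (1 - 1 / real n) * (real (\<Sum>i\<in>UNIV. c i) / real n)"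
    by (simp add: sum_divide_distrib sum_distrib_left)
  also have "\<dots> \<le> (1 - 1 / real n) * 1" using assms by (intro mult_left_mono) (auto simp del: of_nat_sum)
  finally show ?thesis using False by simp
qed

lemma square_sum_tendsto:
  "(\<lambda>n. \<integral>x. \<bar>square_sum n (fst x) - (\<Sum>i\<in>UNIV. (snd x $ i)\<^sup>2)\<bar> \<partial>joint_law n) \<longlonglongrightarrow> 0"
proof (rule Lim_null_comparison[OF _ joint_deviation_tendsto[of "\<lambda>x. x\<^sup>2"]])
  show "\<forall>\<^sub>F n in sequentially. norm (\<integral>x. \<bar>square_sum n (fst x) - (\<Sum>i\<in>UNIV. (snd x $ i)\<^sup>2)\<bar> \<partial>joint_law n)
    \<le> (\<integral>x. (\<Sum>i\<in>UNIV. \<bar>(real (fst x i) / real n)\<^sup>2 - (snd x $ i)\<^sup>2\<bar>) \<partial>joint_law n)"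
    using eventually_gt_at_top[of s]
  proof eventually_elim
    case (elim n)
    have b: "\<bar>(real (c i) / real n)\<^sup>2 - (v $ i)\<^sup>2\<bar> \<le> 1" if v: "v \<in> prob_vectors" and "c \<in> child_sizes n" for c :: "'b \<Rightarrow> nat" and v i
    proof -
      have "0 \<le> real (c i) / real n" "real (c i) / real n \<le> 1" using that elim by auto
      then have "(real (c i) / real n)\<^sup>2 \<le> 1" "0 \<le> (real (c i) / real n)\<^sup>2" by (auto simp: power_le_one)
      moreover have "(v $ i)\<^sup>2 \<le> 1" "0 \<le> (v $ i)\<^sup>2" using prob_vectorsD[OF v] by (auto simp: power_le_one)
      ultimately show ?thesis by linarith
    qed
    have "(\<integral>x. \<bar>square_sum n (fst x) - (\<Sum>i\<in>UNIV. (snd x $ i)\<^sup>2)\<bar> \<partial>joint_law n)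
      \<le> (\<integral>x. (\<Sum>i\<in>UNIV. \<bar>(real (fst x i) / real n)\<^sup>2 - (snd x $ i)\<^sup>2\<bar>) \<partial>joint_law n)"
    proof (rule integral_mono_AE')
      show "integrable (joint_law n) (\<lambda>x. \<Sum>i\<in>UNIV. \<bar>(real (fst x i) / real n)\<^sup>2 - (snd x $ i)\<^sup>2\<bar>)"
        by (rule Bochner_Integration.integrable_sum, rule integrable_joint_bounded[where B = 1]) (use b in auto)
      show "AE x in joint_law n. \<bar>square_sum n (fst x) - (\<Sum>i\<in>UNIV. (snd x $ i)\<^sup>2)\<bar>
         \<le> (\<Sum>i\<in>UNIV. \<bar>(real (fst x i) / real n)\<^sup>2 - (snd x $ i)\<^sup>2\<bar>)"
        unfolding square_sum_def sum_subtractf[symmetric] by (intro AE_I2 sum_abs)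
    qed (auto intro!: AE_I2 sum_nonneg)
    then show ?case by (simp add: Bochner_Integration.integral_nonneg)
  qed
qed (auto intro!: continuous_intros)

lemma square_sum_mean_tendsto:
  "(\<lambda>n. \<integral>x. square_sum n (fst x) \<partial>joint_law n) \<longlonglongrightarrow> (\<integral>v. (\<Sum>i\<in>UNIV. (v $ i)\<^sup>2) \<partial>D)"
proof (subst LIM_zero_iff[symmetric], rule Lim_null_comparison[OF _ square_sum_tendsto])
  show "\<forall>\<^sub>F n in sequentially. norm ((\<integral>x. square_sum n (fst x) \<partial>joint_law n) - (\<integral>v. (\<Sum>i\<in>UNIV. (v $ i)\<^sup>2) \<partial>D))
    \<le> (\<integral>x. \<bar>square_sum n (fst x) - (\<Sum>i\<in>UNIV. (snd x $ i)\<^sup>2)\<bar> \<partial>joint_law n)"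
  proof (intro always_eventually allI)
    fix n
    have i2: "integrable (joint_law n) (\<lambda>x. (\<Sum>i\<in>UNIV. (snd x $ i)\<^sup>2))"
      by (rule integrable_joint_bounded[where B = 1]) (use sum_square_le_1 in \<open>auto simp: sum_nonneg\<close>)
    have "(\<integral>x. square_sum n (fst x) \<partial>joint_law n) - (\<integral>v. (\<Sum>i\<in>UNIV. (v $ i)\<^sup>2) \<partial>D)
      = (\<integral>x. square_sum n (fst x) - (\<Sum>i\<in>UNIV. (snd x $ i)\<^sup>2) \<partial>joint_law n)"
      using i2 integral_joint_snd[of "\<lambda>v. \<Sum>i\<in>UNIV. (v $ i)\<^sup>2" n]
      by (simp add: integrable_joint_fst[where F = "square_sum n"])
    then show "norm ((\<integral>x. square_sum n (fst x) \<partial>joint_law n) - (\<integral>v. (\<Sum>i\<in>UNIV. (v $ i)\<^sup>2) \<partial>D))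
    \<le> (\<integral>x. \<bar>square_sum n (fst x) - (\<Sum>i\<in>UNIV. (snd x $ i)\<^sup>2)\<bar> \<partial>joint_law n)"
      using integral_norm_bound[of "joint_law n" "\<lambda>x. square_sum n (fst x) - (\<Sum>i\<in>UNIV. (snd x $ i)\<^sup>2)"] by simp
  qed
qed

text \<open>For large \<open>n\<close> the mean is near its limit, which is below 1; each of the
  finitely many other \<open>n\<close> is handled by \<open>stay_prob\<close>. One
  \<open>\<eta>\<close> for all \<open>n > s\<close> is wanted because inductions over the depth
  meet all cardinalities.\<close>

lemma square_sum_contraction:
  "\<exists>\<eta>>0. \<eta> \<le> 1 \<and> (\<forall>n>s. (\<integral>x. square_sum n (fst x) \<partial>joint_law n) \<le> 1 - \<eta>)"
proof -
  define S where "S n = (\<integral>x. square_sum n (fst x) \<partial>joint_law n)" for n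
  have S1: "S n < 1" if n: "s < n" for n
  proof -
    have n0: "0 < n" using n by simp
    let ?p = "\<integral>x. of_bool (\<exists>i. fst x i = n) \<partial>joint_law n :: real"
    have "S n \<le> (\<integral>x. 1 - (1 - of_bool (\<exists>i. fst x i = n)) / real n \<partial>joint_law n)"
      unfolding S_def
    proof (rule integral_mono_AE)
      show "AE x in joint_law n. square_sum n (fst x) \<le> 1 - (1 - of_bool (\<exists>i. fst x i = n)) / real n"
        by (rule AE_joint_lawI) (use square_sum_stay[OF n0] n in auto)
    qed (simp_all add: integrable_joint_fst[where F = "square_sum n"]
          integrable_joint_fst[where F = "\<lambda>c :: 'b \<Rightarrow> nat. 1 - (1 - of_bool (\<exists>i. c i = n)) / real n"])
    also have "\<dots> = 1 - (1 - ?p) / real n"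
      by (simp add: integrable_joint_fst[where F = "\<lambda>c :: 'b \<Rightarrow> nat. of_bool (\<exists>i. c i = n)"] J.prob_space)
    also have "\<dots> < 1" using stay_prob[OF n] n0 by simp
    finally show ?thesis .
  qed
  define \<kappa> where "\<kappa> = (\<integral>v. (\<Sum>i\<in>UNIV. (v $ i)\<^sup>2) \<partial>D)"
  have \<kappa>: "\<kappa> < 1" unfolding \<kappa>_def by (rule sum_square_mean)
  have "S \<longlonglongrightarrow> \<kappa>" unfolding S_def \<kappa>_def by (rule square_sum_mean_tendsto)
  moreover have "\<kappa> < (1 + \<kappa>) / 2" using \<kappa> by simp
  ultimately have "\<forall>\<^sub>F n in sequentially. S n < (1 + \<kappa>) / 2" by (rule order_tendstoD(2))
  then obtain N where N: "\<And>n. N \<le> n \<Longrightarrow> S n < (1 + \<kappa>) / 2" by (auto simp: eventually_sequentially)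
  define M where "M = Max (insert 0 (insert ((1 + \<kappa>) / 2) (S ` {s<..<N})))"
  have M1: "M < 1" unfolding M_def using S1 \<kappa> by (subst Max_less_iff) auto
  have "S n \<le> M" if "s < n" for n
  proof (cases "N \<le> n")
    case True
    then have "S n \<le> (1 + \<kappa>) / 2" using N by (simp add: less_imp_le)
    also have "\<dots> \<le> M" unfolding M_def by (intro Max_ge) auto
    finally show ?thesis .
  next
    case False
    then show ?thesis unfolding M_def using that by (intro Max_ge) auto
  qed
  moreover have "0 \<le> M" unfolding M_def by (intro Max_ge) auto
  ultimately show ?thesis using M1 unfolding S_def by (intro exI[of _ "1 - M"]) auto
qed

section \<open>Bounds for moment generating functions uniform in the depth\<close>

lemma tree_mgf_nonneg: "0 \<le> tree_mgf k (w :: real) n"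
  by (induction k arbitrary: n) (auto intro!: sum_nonneg mult_nonneg_nonneg prod_nonneg offspring_prob_nonneg)

text \<open>Bounds of Gaussian form multiply: the children together give
  \<open>exp (K * (w * n)^2 * square_sum n c)\<close>. With \<open>t = w * n\<close> the induction
  step thus becomes an inequality for a single node, in which the nonpositive
  \<open>square_sum n c - 1\<close> pays for the fluctuation of the toll.\<close>

lemma tree_mgf_step:
  fixes w :: real
  assumes n: "s < n" and K: "\<And>i c. c \<in> child_sizes n \<Longrightarrow> tree_mgf k w (c i) \<le> exp (K * w\<^sup>2 * (real (c i))\<^sup>2)"
    and le: "(\<integral>x. exp (w * real n * (toll n (fst x) / real n) + K * (w * real n)\<^sup>2 * (square_sum n (fst x) - 1)) \<partial>joint_law n) \<le> 1"
  shows "tree_mgf (Suc k) w n \<le> exp (K * w\<^sup>2 * (real n)\<^sup>2)"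
proof -
  have n0: "0 < real n" using n by simp
  let ?F = "\<lambda>c. exp (w * real n * (toll n c / real n) + K * (w * real n)\<^sup>2 * (square_sum n c - 1))"
  have "tree_mgf (Suc k) w n \<le> (\<integral>x. exp (K * w\<^sup>2 * (real n)\<^sup>2) * ?F (fst x) \<partial>joint_law n)"
    unfolding tree_mgf_joint
  proof (rule integral_mono_AE)
    show "AE x in joint_law n. exp (w * of_real (toll n (fst x))) * (\<Prod>i\<in>UNIV. tree_mgf k w (fst x i)) \<le> exp (K * w\<^sup>2 * (real n)\<^sup>2) * ?F (fst x)"
    proof (rule AE_joint_lawI)
      fix c :: "'b \<Rightarrow> nat" and v :: "real ^ 'b" assume c: "\<And>i. c i \<le> n"
      have "(\<Prod>i\<in>UNIV. tree_mgf k w (c i)) \<le> (\<Prod>i\<in>UNIV. exp (K * w\<^sup>2 * (real (c i))\<^sup>2))"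
        using c by (intro prod_mono conjI tree_mgf_nonneg K) auto
      also have "\<dots> = exp (\<Sum>i\<in>UNIV. K * w\<^sup>2 * (real (c i))\<^sup>2)" by (simp add: exp_sum)
      also have "(\<Sum>i\<in>UNIV. K * w\<^sup>2 * (real (c i))\<^sup>2) = K * (w * real n)\<^sup>2 * square_sum n c"
        unfolding square_sum_def sum_distrib_left
        using n0 by (intro sum.cong) (auto simp: power_divide power_mult_distrib)
      finally have "exp (w * toll n c) * (\<Prod>i\<in>UNIV. tree_mgf k w (c i)) \<le> exp (w * toll n c) * exp (K * (w * real n)\<^sup>2 * square_sum n c)"
        by (intro mult_left_mono) auto
      also have "\<dots> = exp (K * w\<^sup>2 * (real n)\<^sup>2) * ?F c"
        unfolding exp_add[symmetric] using n0 by (simp add: algebra_simps power_mult_distrib)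
      finally show "exp (w * of_real (toll n (fst (c, v)))) * (\<Prod>i\<in>UNIV. tree_mgf k w (fst (c, v) i)) \<le> exp (K * w\<^sup>2 * (real n)\<^sup>2) * ?F (fst (c, v))"
        by simp
    qed
  qed (rule integrable_joint_fst[where F = "\<lambda>c. exp (w * of_real (toll n c)) * (\<Prod>i\<in>UNIV. tree_mgf k w (c i))"],
        rule integrable_joint_fst[where F = "\<lambda>c. exp (K * w\<^sup>2 * (real n)\<^sup>2) * ?F c"])
  also have "\<dots> = exp (K * w\<^sup>2 * (real n)\<^sup>2) * (\<integral>x. ?F (fst x) \<partial>joint_law n)" by simp
  also have "\<dots> \<le> exp (K * w\<^sup>2 * (real n)\<^sup>2) * 1" using le by (intro mult_left_mono) auto
  finally show ?thesis by simp
qed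

text \<open>Second-order expansion at one node: the linear term vanishes because the toll is
  centred, and the quadratic error is outweighed by the mean of
  \<open>K * t^2 * (square_sum n c - 1)\<close>. The condition on \<open>\<bar>w\<bar> * n\<close>
  is inherited by the children.\<close>

lemma tree_mgf_bound_near_0:
  "\<exists>K\<ge>0. \<exists>t0>0. \<forall>k n w. \<bar>w\<bar> * real n \<le> t0 \<longrightarrow> tree_mgf k w n \<le> exp (K * w\<^sup>2 * (real n)\<^sup>2)"
proof -
  obtain B' where B': "0 \<le> B'" "\<And>n c. s < n \<Longrightarrow> (\<Sum>i\<in>UNIV. c i) = n - s0 \<Longrightarrow> \<bar>toll n c / real n\<bar> \<le> B'"
    using toll_bounded by metis
  define B where "B = B' + 1"
  have B1: "1 \<le> B" using B' by (simp add: B_def)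
  have B: "\<bar>toll n c / real n\<bar> \<le> B" if "s < n" "(\<Sum>i\<in>UNIV. c i) = n - s0" for n c
    using B'(2)[OF that] by (simp add: B_def)
  obtain \<eta> where \<eta>: "0 < \<eta>" and S: "\<And>n. s < n \<Longrightarrow> (\<integral>x. square_sum n (fst x) \<partial>joint_law n) \<le> 1 - \<eta>"
    using square_sum_contraction by blast
  \<comment> \<open>\<open>K * \<eta> = 4 * B^2\<close> balances gain and error exactly;
    \<open>t0\<close> then keeps the exponents in the range of
    \<open>exp_le_quadratic\<close>.\<close>
  define K where "K = 4 * B\<^sup>2 / \<eta>"
  have K0: "0 \<le> K" using \<eta> by (simp add: K_def)
  define t0 where "t0 = 1 / (2 * B + 2 * K + 2)"
  have den: "0 < 2 * B + 2 * K + 2" using B1 K0 by simp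
  have t0: "0 < t0" using den by (simp add: t0_def)
  have t0B: "t0 * B \<le> 1 / 2" "t0 * K \<le> 1 / 2" "t0 \<le> 1 / 2"
    using den B1 K0 by (auto simp: t0_def field_simps)
  have main: "(\<integral>x. exp (t * (toll n (fst x) / real n) + K * t\<^sup>2 * (square_sum n (fst x) - 1)) \<partial>joint_law n) \<le> 1"
    if n: "s < n" and t: "\<bar>t\<bar> \<le> t0" for n t
  proof -
    let ?C = "\<lambda>c. toll n c / real n" and ?U = "\<lambda>c. square_sum n c - 1"
    have "(\<integral>x. exp (t * ?C (fst x) + K * t\<^sup>2 * ?U (fst x)) \<partial>joint_law n)
      \<le> (\<integral>x. 1 + t * ?C (fst x) + K * t\<^sup>2 * ?U (fst x) + 4 * B\<^sup>2 * t\<^sup>2 \<partial>joint_law n)"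
    proof (rule integral_mono_AE)
      show "AE x in joint_law n. exp (t * ?C (fst x) + K * t\<^sup>2 * ?U (fst x))
         \<le> 1 + t * ?C (fst x) + K * t\<^sup>2 * ?U (fst x) + 4 * B\<^sup>2 * t\<^sup>2"
      proof (rule AE_joint_lawI)
        fix c :: "'b \<Rightarrow> nat" and v :: "real ^ 'b" assume c: "s < n \<Longrightarrow> (\<Sum>i\<in>UNIV. c i) = n - s0"
        have C: "\<bar>?C c\<bar> \<le> B" by (rule B[OF n c[OF n]])
        have U: "\<bar>?U c\<bar> \<le> 1" using square_sum_le_1[of n c] c[OF n] n by simp
        define T a u where "T = \<bar>t\<bar>" and "a = t * ?C c" and "u = K * t\<^sup>2 * ?U c"
        have T: "0 \<le> T" "T \<le> t0" using t by (auto simp: T_def)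
        have tC: "\<bar>a\<bar> \<le> T * B" unfolding a_def T_def abs_mult using C by (intro mult_left_mono) auto
        have "K * t\<^sup>2 = (K * T) * T" by (simp add: T_def power2_eq_square)
        also have "\<dots> \<le> (1 / 2) * T"
          using T t0B(2) mult_left_mono[OF T(2) K0] by (intro mult_right_mono) (auto simp: mult.commute)
        finally have Kt: "K * t\<^sup>2 \<le> T / 2" by simp
        have KtU: "\<bar>u\<bar> \<le> T / 2"
        proof -
          have "\<bar>K * t\<^sup>2 * ?U c\<bar> = (K * t\<^sup>2) * \<bar>?U c\<bar>" using K0 by (simp add: abs_mult)
          also have "\<dots> \<le> (K * t\<^sup>2) * 1" using U K0 by (intro mult_left_mono) auto
          finally show ?thesis using Kt by (simp add: u_def)
        qed
        have "T * B \<le> t0 * B" using T(2) B1 by (intro mult_right_mono) auto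
        then have TB: "T * B \<le> 1 / 2" using t0B(1) by (rule order_trans)
        then have "\<bar>a + u\<bar> \<le> 1" using tC KtU T t0B(3) by linarith
        then have "exp (a + u) \<le> 1 + (a + u) + (a + u)\<^sup>2" by (rule exp_le_quadratic)
        also have "(a + u)\<^sup>2 \<le> (2 * T * B)\<^sup>2"
        proof -
          have "T * 1 \<le> T * B" using B1 T(1) by (rule mult_left_mono)
          then have "\<bar>a + u\<bar> \<le> 2 * (T * B)" using tC KtU T(1) by linarith
          then show ?thesis using power_mono[of "\<bar>a + u\<bar>" "2 * T * B" 2] by simp
        qed
        finally show "exp (t * ?C (fst (c, v)) + K * t\<^sup>2 * ?U (fst (c, v)))
         \<le> 1 + t * ?C (fst (c, v)) + K * t\<^sup>2 * ?U (fst (c, v)) + 4 * B\<^sup>2 * t\<^sup>2"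
          by (simp add: power_mult_distrib mult_ac a_def u_def T_def)
      qed
    qed (rule integrable_joint_fst[where F = "\<lambda>c. exp (t * ?C c + K * t\<^sup>2 * ?U c)"],
        rule integrable_joint_fst[where F = "\<lambda>c. 1 + t * ?C c + K * t\<^sup>2 * ?U c + 4 * B\<^sup>2 * t\<^sup>2"])
    also have "\<dots> = 1 + K * t\<^sup>2 * ((\<integral>x. square_sum n (fst x) \<partial>joint_law n) - 1) + 4 * B\<^sup>2 * t\<^sup>2"
      using integral_toll[of n]
      by (simp add: integrable_joint_fst[where F = "square_sum n"] integrable_joint_fst[where F = "toll n"] J.prob_space)
    also have "\<dots> \<le> 1 + K * t\<^sup>2 * (- \<eta>) + 4 * B\<^sup>2 * t\<^sup>2"
      using S[OF n] K0 by (intro add_mono mult_left_mono) auto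
    also have "\<dots> = 1" using \<eta> by (simp add: K_def)
    finally show ?thesis .
  qed
  have "tree_mgf k w n \<le> exp (K * w\<^sup>2 * (real n)\<^sup>2)" if "\<bar>w\<bar> * real n \<le> t0" for k n w
    using that
  proof (induction k arbitrary: n)
    case 0
    then show ?case using K0 by simp
  next
    case (Suc k)
    show ?case
    proof (cases "s < n")
      case True
      show ?thesis
      proof (rule tree_mgf_step[OF True])
        show "tree_mgf k w (c i) \<le> exp (K * w\<^sup>2 * (real (c i))\<^sup>2)" if "c \<in> child_sizes n" for c i
        proof (rule Suc.IH)
          have "\<bar>w\<bar> * real (c i) \<le> \<bar>w\<bar> * real n" using that by (intro mult_left_mono) auto
          then show "\<bar>w\<bar> * real (c i) \<le> t0" using Suc.prems by linarith
        qed
        show "(\<integral>x. exp (w * real n * (toll n (fst x) / real n) + K * (w * real n)\<^sup>2 * (square_sum n (fst x) - 1)) \<partial>joint_law n) \<le> 1"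
          using Suc.prems by (intro main True) (simp add: abs_mult)
      qed
    next
      case False
      then show ?thesis using K0 by (subst tree_mgf_small) auto
    qed
  qed
  then show ?thesis using K0 t0 by blast
qed

section \<open>Exponents away from 0 and the vertices of the simplex\<close>

text \<open>As \<open>K\<close> tends to infinity only the vertices of the simplex contribute, where \<open>split_C\<close> is 1.\<close>

lemma vertex_dominates:
  assumes "measure D {v. \<exists>i. v $ i = 1} * exp \<theta> < 1"
  shows "\<exists>K\<ge>0. (\<integral>v. exp (\<theta> * split_C D v + K * ((\<Sum>i\<in>UNIV. (v $ i)\<^sup>2) - 1)) \<partial>D) < 1"
proof -
  let ?V = "{v :: real ^ 'b. \<exists>i. v $ i = 1}"
  let ?U = "\<lambda>v :: real ^ 'b. (\<Sum>i\<in>UNIV. (v $ i)\<^sup>2) - 1"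
  define M where "M = \<bar>\<theta>\<bar> * (1 + CARD('b) / mu)"
  have vertex: "split_C D v = 1 \<and> ?U v = 0" if v: "v \<in> prob_vectors" and i: "v $ i = 1" for v i
  proof -
    note o = prob_vector_vertex[OF v i]
    have "(\<Sum>j\<in>UNIV - {i}. v $ j * ln (v $ j)) = 0" "(\<Sum>j\<in>UNIV - {i}. (v $ j)\<^sup>2) = 0"
      by (rule sum.neutral, use o in simp)+
    then show ?thesis using i by (simp add: split_C_eq entropy_sum_def sum.remove[of UNIV i])
  qed
  have V [measurable]: "?V \<in> sets borel" by measurable
  have "(\<lambda>k. \<integral>v. exp (\<theta> * split_C D v + real k * ?U v) \<partial>D) \<longlonglongrightarrow> (\<integral>v. exp \<theta> * indicator ?V v \<partial>D)"
  proof (rule integral_dominated_convergence[where w = "\<lambda>_. exp M"])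
    show "AE v in D. (\<lambda>k. exp (\<theta> * split_C D v + real k * ?U v)) \<longlonglongrightarrow> exp \<theta> * indicator ?V v"
      using AE_D_prob_vectors
    proof eventually_elim
      case (elim v)
      show ?case
      proof (cases "v \<in> ?V")
        case True
        then obtain i where "v $ i = 1" by blast
        from vertex[OF elim this] True show ?thesis by simp
      next
        case False
        then have "?U v < 0" using sum_square_le_1[OF elim] sum_square_eq_1[OF elim] by force
        moreover define a where "a = - ?U v"
        ultimately have "0 < a" by simp
        then have "filterlim (\<lambda>k. \<theta> * split_C D v - real k * a) at_bot sequentially" by real_asymp
        then have "filterlim (\<lambda>k. \<theta> * split_C D v + real k * ?U v) at_bot sequentially"
          by (simp only: a_def mult_minus_right diff_minus_eq_add)
        from filterlim_compose[OF exp_at_bot this] show ?thesis using False by simp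
      qed
    qed
    show "AE v in D. norm (exp (\<theta> * split_C D v + real k * ?U v)) \<le> exp M" for k
      using AE_D_prob_vectors
    proof eventually_elim
      case (elim v)
      have "\<theta> * split_C D v \<le> \<bar>\<theta>\<bar> * \<bar>split_C D v\<bar>" by (metis abs_ge_self abs_mult)
      also have "\<dots> \<le> M" unfolding M_def using split_C_bound[OF elim] by (intro mult_left_mono) auto
      finally have "\<theta> * split_C D v + real k * ?U v \<le> M + 0"
        using sum_square_le_1[OF elim] by (intro add_mono) (auto simp: mult_nonneg_nonpos)
      then show ?case by simp
    qed
  qed auto
  also have "(\<integral>v. exp \<theta> * indicator ?V v \<partial>D) = exp \<theta> * measure D ?V" by simp
  finally have "\<forall>\<^sub>F k in sequentially. (\<integral>v. exp (\<theta> * split_C D v + real k * ?U v) \<partial>D) < 1"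
    using assms by (intro order_tendstoD(2)) (auto simp: mult.commute)
  then obtain k where "(\<integral>v. exp (\<theta> * split_C D v + real k * ?U v) \<partial>D) < 1"
    by (auto simp: eventually_sequentially)
  then show ?thesis by (intro exI[of _ "real k"]) simp
qed

text \<open>Both exponents stay below a common \<open>M\<close>, where \<open>exp\<close> is
  Lipschitz. The convergence in mean of the toll and of the square sum therefore transfers the
  strict inequality of \<open>vertex_dominates\<close> to all large \<open>n\<close>.\<close>

lemma toll_exponential_eventually:
  assumes "measure D {v. \<exists>i. v $ i = 1} * exp \<theta> < 1"
  shows "\<exists>K\<ge>0. \<exists>n1>s. \<forall>n\<ge>n1. (\<integral>x. exp (\<theta> * (toll n (fst x) / real n) + K * (square_sum n (fst x) - 1)) \<partial>joint_law n) \<le> 1"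
proof -
  obtain K where K: "0 \<le> K" and lt: "(\<integral>v. exp (\<theta> * split_C D v + K * ((\<Sum>i\<in>UNIV. (v $ i)\<^sup>2) - 1)) \<partial>D) < 1"
    using vertex_dominates[OF assms] by blast
  obtain B where B0: "0 \<le> B" and B: "\<And>n c. s < n \<Longrightarrow> (\<Sum>i\<in>UNIV. c i) = n - s0 \<Longrightarrow> \<bar>toll n c / real n\<bar> \<le> B"
    using toll_bounded by metis
  define M where "M = \<bar>\<theta>\<bar> * (B + (1 + CARD('b) / mu))"
  have M1: "\<theta> * y \<le> M" if "\<bar>y\<bar> \<le> B \<or> \<bar>y\<bar> \<le> 1 + CARD('b) / mu" for y
  proof -
    have "0 \<le> CARD('b) / mu" using mu_pos by simp
    then have "\<bar>y\<bar> \<le> B + (1 + CARD('b) / mu)" using that B0 by linarith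
    then have "\<bar>\<theta>\<bar> * \<bar>y\<bar> \<le> M" unfolding M_def by (intro mult_left_mono) auto
    then show ?thesis by (metis abs_ge_self abs_mult order_trans)
  qed
  let ?E = "\<lambda>v :: real ^ 'b. exp (\<theta> * split_C D v + K * ((\<Sum>i\<in>UNIV. (v $ i)\<^sup>2) - 1))"
  let ?En = "\<lambda>n c. exp (\<theta> * (toll n c / real n) + K * (square_sum n c - 1))"
  have E_le: "?E v \<le> exp M" if v: "v \<in> prob_vectors" for v
  proof -
    have "K * ((\<Sum>i\<in>UNIV. (v $ i)\<^sup>2) - 1) \<le> 0" using sum_square_le_1[OF v] K by (simp add: mult_nonneg_nonpos)
    then show ?thesis using M1[of "split_C D v"] split_C_bound[OF v] by simp
  qed
  have "(\<lambda>n. exp M * (\<bar>\<theta>\<bar> * (\<integral>x. \<bar>toll n (fst x) / real n - split_C D (snd x)\<bar> \<partial>joint_law n)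
     + K * (\<integral>x. \<bar>square_sum n (fst x) - (\<Sum>i\<in>UNIV. (snd x $ i)\<^sup>2)\<bar> \<partial>joint_law n)))
     \<longlonglongrightarrow> exp M * (\<bar>\<theta>\<bar> * 0 + K * 0)"
    by (intro tendsto_intros toll_tendsto square_sum_tendsto)
  then have lim: "(\<lambda>n. exp M * (\<bar>\<theta>\<bar> * (\<integral>x. \<bar>toll n (fst x) / real n - split_C D (snd x)\<bar> \<partial>joint_law n)
     + K * (\<integral>x. \<bar>square_sum n (fst x) - (\<Sum>i\<in>UNIV. (snd x $ i)\<^sup>2)\<bar> \<partial>joint_law n))) \<longlonglongrightarrow> 0" by simp
  have gap: "0 < 1 - (\<integral>v. ?E v \<partial>D)" using lt by simp
  have "\<forall>\<^sub>F n in sequentially. (\<integral>x. ?En n (fst x) \<partial>joint_law n) \<le> 1"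
    using order_tendstoD(2)[OF lim gap] eventually_gt_at_top[of s]
  proof eventually_elim
    case (elim n)
    have i1: "integrable (joint_law n) (\<lambda>x. toll n (fst x) / real n - split_C D (snd x))"
      using toll_diff_integrable[OF elim(2), of "\<lambda>_. 0" 0] by simp
    have i2: "integrable (joint_law n) (\<lambda>x. square_sum n (fst x) - (\<Sum>i\<in>UNIV. (snd x $ i)\<^sup>2))"
      by (intro Bochner_Integration.integrable_diff integrable_joint_fst integrable_joint_bounded[where B = 1])
         (use sum_square_le_1 in \<open>auto simp: sum_nonneg\<close>)
    have i3: "integrable (joint_law n) (\<lambda>x. ?E (snd x))"
      by (rule integrable_joint_bounded[where B = "exp M"]) (use E_le in auto)
    have "(\<integral>x. ?En n (fst x) \<partial>joint_law n)
      \<le> (\<integral>x. ?E (snd x) + exp M * (\<bar>\<theta>\<bar> * \<bar>toll n (fst x) / real n - split_C D (snd x)\<bar>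
          + K * \<bar>square_sum n (fst x) - (\<Sum>i\<in>UNIV. (snd x $ i)\<^sup>2)\<bar>) \<partial>joint_law n)"
    proof (rule integral_mono_AE)
      show "integrable (joint_law n) (\<lambda>x. ?En n (fst x))" by (rule integrable_joint_fst[where F = "?En n"])
      show "integrable (joint_law n) (\<lambda>x. ?E (snd x) + exp M * (\<bar>\<theta>\<bar> * \<bar>toll n (fst x) / real n - split_C D (snd x)\<bar>
          + K * \<bar>square_sum n (fst x) - (\<Sum>i\<in>UNIV. (snd x $ i)\<^sup>2)\<bar>))"
        using i1 i2 i3 by (intro Bochner_Integration.integrable_add integrable_mult_right integrable_abs)
      show "AE x in joint_law n. ?En n (fst x) \<le> ?E (snd x) + exp M * (\<bar>\<theta>\<bar> * \<bar>toll n (fst x) / real n - split_C D (snd x)\<bar>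
          + K * \<bar>square_sum n (fst x) - (\<Sum>i\<in>UNIV. (snd x $ i)\<^sup>2)\<bar>)"
      proof (rule AE_joint_lawI)
        fix c :: "'b \<Rightarrow> nat" and v :: "real ^ 'b"
        assume v: "v \<in> prob_vectors" and c: "s < n \<Longrightarrow> (\<Sum>i\<in>UNIV. c i) = n - s0"
        define a a' u u' where "a = toll n c / real n" and "a' = split_C D v" and "u = square_sum n c" and "u' = (\<Sum>i\<in>UNIV. (v $ i)\<^sup>2)"
        have u: "K * (u - 1) \<le> 0" "K * (u' - 1) \<le> 0"
          using square_sum_le_1[of n c] c elim(2) sum_square_le_1[OF v] K by (auto simp: u_def u'_def mult_nonneg_nonpos)
        have 1: "\<theta> * a + K * (u - 1) \<le> M" using u(1) M1[of a] B[OF elim(2) c] elim(2) by (simp add: a_def)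
        have 2: "\<theta> * a' + K * (u' - 1) \<le> M" using u(2) M1[of a'] split_C_bound[OF v] by (simp add: a'_def)
        have "\<bar>exp (\<theta> * a + K * (u - 1)) - exp (\<theta> * a' + K * (u' - 1))\<bar> \<le> exp M * \<bar>(\<theta> * a + K * (u - 1)) - (\<theta> * a' + K * (u' - 1))\<bar>"
          by (rule exp_diff_le[OF 1 2])
        also have "(\<theta> * a + K * (u - 1)) - (\<theta> * a' + K * (u' - 1)) = \<theta> * (a - a') + K * (u - u')"
          by (simp add: algebra_simps)
        also have "exp M * \<bar>\<theta> * (a - a') + K * (u - u')\<bar> \<le> exp M * (\<bar>\<theta>\<bar> * \<bar>a - a'\<bar> + K * \<bar>u - u'\<bar>)"
          using K abs_triangle_ineq[of "\<theta> * (a - a')" "K * (u - u')"] by (intro mult_left_mono) (auto simp: abs_mult)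
        finally show "?En n (fst (c, v)) \<le> ?E (snd (c, v)) + exp M * (\<bar>\<theta>\<bar> * \<bar>toll n (fst (c, v)) / real n - split_C D (snd (c, v))\<bar>
          + K * \<bar>square_sum n (fst (c, v)) - (\<Sum>i\<in>UNIV. (snd (c, v) $ i)\<^sup>2)\<bar>)"
          unfolding a_def a'_def u_def u'_def by simp
      qed
    qed
    also have "\<dots> = (\<integral>v. ?E v \<partial>D) + exp M * (\<bar>\<theta>\<bar> * (\<integral>x. \<bar>toll n (fst x) / real n - split_C D (snd x)\<bar> \<partial>joint_law n)
     + K * (\<integral>x. \<bar>square_sum n (fst x) - (\<Sum>i\<in>UNIV. (snd x $ i)\<^sup>2)\<bar> \<partial>joint_law n))"
      using i1 i2 i3 integral_joint_snd[of ?E n] by simp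
    also have "\<dots> \<le> 1" using elim(1) by simp
    finally show ?case .
  qed
  then obtain n1 where n1: "\<And>n. n1 \<le> n \<Longrightarrow> (\<integral>x. ?En n (fst x) \<partial>joint_law n) \<le> 1"
    by (auto simp: eventually_sequentially)
  then show ?thesis using K by (intro exI[of _ K] conjI exI[of _ "max n1 (Suc s)"]) auto
qed

text \<open>The conditions on \<open>r\<close> and \<open>r * n\<close> are inherited by all descendants, which makes the
  induction over the depth work; convexity reduces all exponents to the extreme one.\<close>

lemma tree_mgf_bound:
  assumes "measure D {v. \<exists>i. v $ i = 1} * exp \<theta> < 1"
  shows "\<exists>K. \<exists>\<rho>>0. \<forall>k n r. 0 \<le> r \<longrightarrow> r \<le> \<rho> \<longrightarrow> r * real n \<le> 1 \<longrightarrow> tree_mgf k (r * \<theta>) n \<le> K"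
proof -
  obtain K1 t0 where K1: "0 \<le> K1" and t0: "0 < t0"
    and near: "\<And>k n w. \<bar>w\<bar> * real n \<le> t0 \<Longrightarrow> tree_mgf k w n \<le> exp (K1 * w\<^sup>2 * (real n)\<^sup>2)"
    using tree_mgf_bound_near_0 by blast
  obtain K2 n1 where K2: "0 \<le> K2" and n1: "s < n1"
    and far: "\<And>n. n1 \<le> n \<Longrightarrow> (\<integral>x. exp (\<theta> * (toll n (fst x) / real n) + K2 * (square_sum n (fst x) - 1)) \<partial>joint_law n) \<le> 1"
    using toll_exponential_eventually[OF assms] by blast
  \<comment> \<open>\<open>K1\<close> serves the range
    \<open>\<bar>r * \<theta>\<bar> * n \<le> t0\<close>. Outside it
    \<open>(r * \<theta> * n)^2\<close> is at least \<open>t0^2\<close>, and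
    \<open>K2 / t0^2\<close> makes the available coefficient of the square sum at least
    \<open>K2\<close>.\<close>
  define K where "K = max K1 (K2 / t0\<^sup>2)"
  have K: "0 \<le> K" "K1 \<le> K" "K2 \<le> K * t0\<^sup>2" using K1 K2 t0 by (auto simp: K_def max_def field_simps)
  \<comment> \<open>For \<open>r \<le> \<rho>\<close> a node outside the first range has more than
    \<open>n1\<close> items, so that \<open>far\<close> applies to it.\<close>
  define \<rho> where "\<rho> = t0 / (real n1 * (\<bar>\<theta>\<bar> + 1))"
  have \<rho>: "0 < \<rho>" using t0 n1 by (auto simp: \<rho>_def intro!: divide_pos_pos mult_pos_pos)
  have bound: "tree_mgf k (r * \<theta>) n \<le> exp (K * (r * \<theta>)\<^sup>2 * (real n)\<^sup>2)"
    if r: "0 \<le> r" "r \<le> \<rho>" and rn: "r * real n \<le> 1" for k n r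
    using rn
  proof (induction k arbitrary: n)
    case 0
    then show ?case using K by simp
  next
    case (Suc k)
    show ?case
    proof (cases "\<bar>r * \<theta>\<bar> * real n \<le> t0")
      case True
      have "tree_mgf (Suc k) (r * \<theta>) n \<le> exp (K1 * (r * \<theta>)\<^sup>2 * (real n)\<^sup>2)" by (rule near[OF True])
      also have "\<dots> \<le> exp (K * (r * \<theta>)\<^sup>2 * (real n)\<^sup>2)" using K by (simp add: mult_right_mono)
      finally show ?thesis .
    next
      case False
      have "\<bar>r * \<theta>\<bar> \<le> \<rho> * (\<bar>\<theta>\<bar> + 1)" unfolding abs_mult using r by (intro mult_mono) auto
      also have "\<dots> = t0 / real n1" by (simp add: \<rho>_def)
      finally have "\<bar>r * \<theta>\<bar> * real n \<le> t0 / real n1 * real n" by (intro mult_right_mono) auto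
      then have "t0 < t0 * (real n / real n1)" using False by simp
      then have "1 < real n / real n1"
        using mult_less_cancel_left_pos[OF t0, of 1 "real n / real n1"] by (simp only: mult_1_right)
      then have n: "n1 \<le> n" "s < n" using n1 by (auto simp: less_divide_eq split: if_splits)
      show ?thesis
      proof (rule tree_mgf_step[OF n(2)])
        show "tree_mgf k (r * \<theta>) (c i) \<le> exp (K * (r * \<theta>)\<^sup>2 * (real (c i))\<^sup>2)" if "c \<in> child_sizes n" for c i
        proof (rule Suc.IH)
          have "r * real (c i) \<le> r * real n" using that r by (intro mult_left_mono) auto
          then show "r * real (c i) \<le> 1" using Suc.prems by linarith
        qed
        define q where "q = r * real n"
        have q: "0 \<le> q" "q \<le> 1" using Suc.prems r by (auto simp: q_def)
        have qt: "t0\<^sup>2 \<le> (r * \<theta> * real n)\<^sup>2"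
          using False t0 power_mono[of t0 "\<bar>r * \<theta>\<bar> * real n" 2] by (simp add: power_mult_distrib)
        have "K2 \<le> K * (r * \<theta> * real n)\<^sup>2" using K(3) mult_left_mono[OF qt K(1)] by linarith
        let ?E = "\<lambda>c. exp (\<theta> * (toll n c / real n) + K2 * (square_sum n c - 1))"
        have "(\<integral>x. exp (r * \<theta> * real n * (toll n (fst x) / real n) + K * (r * \<theta> * real n)\<^sup>2 * (square_sum n (fst x) - 1)) \<partial>joint_law n)
          \<le> (\<integral>x. (1 - q) + q * ?E (fst x) \<partial>joint_law n)"
        proof (rule integral_mono_AE)
          show "AE x in joint_law n. exp (r * \<theta> * real n * (toll n (fst x) / real n) + K * (r * \<theta> * real n)\<^sup>2 * (square_sum n (fst x) - 1))
             \<le> (1 - q) + q * ?E (fst x)"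
          proof (rule AE_joint_lawI)
            fix c :: "'b \<Rightarrow> nat" and v :: "real ^ 'b" assume c: "s < n \<Longrightarrow> (\<Sum>i\<in>UNIV. c i) = n - s0"
            define y u where "y = \<theta> * (toll n c / real n)" and "u = square_sum n c - 1"
            have u: "u \<le> 0" using square_sum_le_1[of n c] c n by (auto simp: u_def)
            have "K * (r * \<theta> * real n)\<^sup>2 * u \<le> K2 * u"
              using \<open>K2 \<le> K * (r * \<theta> * real n)\<^sup>2\<close> u by (rule mult_right_mono_neg)
            then have "exp (q * y + K * (r * \<theta> * real n)\<^sup>2 * u) \<le> exp (q * y) * exp (K2 * u)"
              by (simp flip: exp_add)
            also have "\<dots> \<le> (1 - q + q * exp y) * exp (K2 * u)"
              using exp_le_chord[OF q] by (intro mult_right_mono) auto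
            also have "\<dots> = (1 - q) * exp (K2 * u) + q * exp (y + K2 * u)" by (simp add: algebra_simps exp_add)
            also have "\<dots> \<le> (1 - q) * 1 + q * exp (y + K2 * u)"
              using q K2 u by (intro add_right_mono mult_left_mono) (auto simp: mult_nonneg_nonpos)
            finally show "exp (r * \<theta> * real n * (toll n (fst (c, v)) / real n) + K * (r * \<theta> * real n)\<^sup>2 * (square_sum n (fst (c, v)) - 1))
             \<le> (1 - q) + q * ?E (fst (c, v))"
              by (simp add: y_def u_def q_def mult_ac)
          qed
        qed (rule integrable_joint_fst[where F = "\<lambda>c. exp (r * \<theta> * real n * (toll n c / real n) + K * (r * \<theta> * real n)\<^sup>2 * (square_sum n c - 1))"],
            rule integrable_joint_fst[where F = "\<lambda>c. (1 - q) + q * ?E c"])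
        also have "\<dots> = (1 - q) + q * (\<integral>x. ?E (fst x) \<partial>joint_law n)"
          using integrable_joint_fst[where F = "?E" and n = n] by (simp add: J.prob_space)
        also have "\<dots> \<le> (1 - q) + q * 1" using far[OF n(1)] q by (intro add_left_mono mult_left_mono) auto
        finally show "(\<integral>x. exp (r * \<theta> * real n * (toll n (fst x) / real n) + K * (r * \<theta> * real n)\<^sup>2 * (square_sum n (fst x) - 1)) \<partial>joint_law n) \<le> 1"
          by simp
      qed
    qed
  qed
  have "tree_mgf k (r * \<theta>) n \<le> exp (K * \<theta>\<^sup>2)" if r: "0 \<le> r" "r \<le> \<rho>" and rn: "r * real n \<le> 1" for k n r
  proof -
    have "(r * real n)\<^sup>2 \<le> 1" using r rn by (simp add: power_le_one)
    then have "K * \<theta>\<^sup>2 * (r * real n)\<^sup>2 \<le> K * \<theta>\<^sup>2 * 1" using K by (intro mult_left_mono) auto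
    then have "exp (K * (r * \<theta>)\<^sup>2 * (real n)\<^sup>2) \<le> exp (K * \<theta>\<^sup>2)"
      by (simp add: power_mult_distrib mult_ac)
    then show ?thesis using bound[OF that, of k] by linarith
  qed
  then show ?thesis using \<rho> by blast
qed

end

section \<open>The fixed-point equation\<close>

lemma iexp_remainder_bound: "cmod (iexp x - 1 - \<i> * x) \<le> x\<^sup>2 / 2"
proof -
  have "(\<Sum>k\<le>Suc 0. (\<i> * complex_of_real x) ^ k / fact k) = 1 + \<i> * x" by simp
  then show ?thesis
    using iexp_approx1[of x 1] by (simp add: diff_diff_eq power2_eq_square numeral_2_eq_2)
qed

lemma iexp_diff_bound: "cmod (iexp x - iexp y) \<le> \<bar>x - y\<bar>"
proof -
  have "iexp x - iexp y = iexp y * (iexp (x - y) - 1)"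
    by (simp add: right_diff_distrib algebra_simps flip: exp_add)
  then have "cmod (iexp x - iexp y) = cmod (iexp (x - y) - 1)" by (simp add: norm_mult)
  also have "\<dots> \<le> \<bar>x - y\<bar>" using iexp_approx1[of "x - y" 0] by simp
  finally show ?thesis .
qed

text \<open>The remainder after the linear term is Lipschitz with a constant proportional to the
  size of its arguments. For arguments proportional to \<open>t\<close> this gives a bound of order
  \<open>t^2\<close>, as the metric for characteristic functions demands.\<close>

lemma iexp_linear_diff_bound:
  "cmod ((iexp x - 1 - \<i> * x) - (iexp y - 1 - \<i> * y)) \<le> 2 * (\<bar>x\<bar> + \<bar>y\<bar>) * \<bar>x - y\<bar>"
proof -
  define d where "d = x - y"
  have "iexp y * iexp d = iexp x" unfolding d_def by (simp add: algebra_simps flip: exp_add)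
  then have eq: "(iexp x - 1 - \<i> * x) - (iexp y - 1 - \<i> * y)
     = iexp y * (iexp d - 1 - \<i> * d) + \<i> * d * (iexp y - iexp 0)"
    by (simp add: d_def algebra_simps)
  have "cmod ((iexp x - 1 - \<i> * x) - (iexp y - 1 - \<i> * y)) \<le> cmod (iexp d - 1 - \<i> * d) + \<bar>d\<bar> * cmod (iexp y - iexp 0)"
    unfolding eq by (rule order_trans[OF norm_triangle_ineq]) (simp add: norm_mult)
  also have "\<dots> \<le> d\<^sup>2 / 2 + \<bar>d\<bar> * \<bar>y - 0\<bar>"
    by (intro add_mono iexp_remainder_bound mult_left_mono iexp_diff_bound) auto
  also have "d\<^sup>2 / 2 \<le> (\<bar>x\<bar> + \<bar>y\<bar>) * \<bar>d\<bar>"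
  proof -
    have "\<bar>d\<bar> \<le> \<bar>x\<bar> + \<bar>y\<bar>" by (simp add: d_def)
    then have "\<bar>d\<bar> * \<bar>d\<bar> \<le> (\<bar>x\<bar> + \<bar>y\<bar>) * \<bar>d\<bar>" by (intro mult_right_mono) auto
    moreover have "0 \<le> \<bar>d\<bar> * \<bar>d\<bar>" by simp
    ultimately show ?thesis unfolding power2_eq_square abs_mult_self_eq by linarith
  qed
  finally have "cmod ((iexp x - 1 - \<i> * x) - (iexp y - 1 - \<i> * y)) \<le> (\<bar>x\<bar> + \<bar>y\<bar>) * \<bar>d\<bar> + \<bar>d\<bar> * \<bar>y - 0\<bar>"
    by simp
  also have "\<dots> \<le> 2 * (\<bar>x\<bar> + \<bar>y\<bar>) * \<bar>d\<bar>"
  proof -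
    have "0 \<le> \<bar>d\<bar> * \<bar>x\<bar>" "0 \<le> \<bar>d\<bar> * \<bar>y\<bar>" by simp_all
    then show ?thesis by (simp add: algebra_simps)
  qed
  finally show ?thesis by (simp add: d_def)
qed

section \<open>Characteristic functions of centred laws with finite variance\<close>

context real_distribution
begin

lemma prob_UNIV [simp]: "prob UNIV = 1"
  using prob_space by simp

lemma integrable_iexp_scaled [simp]: "integrable M (\<lambda>x. iexp (t * x))"
  using integrable_iexp[of "\<lambda>x. complex_of_real (t * x)"] by simp

lemma char_centered:
  assumes "integrable M (\<lambda>x. x)" "expectation (\<lambda>x. x) = 0"
  shows "char M t - 1 = (\<integral>x. iexp (t * x) - 1 - \<i> * (t * x) \<partial>M)"
    and "integrable M (\<lambda>x. iexp (t * x) - 1 - \<i> * (t * x))"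
proof -
  have i: "integrable M (\<lambda>x. complex_of_real x)" using assms(1) by simp
  then have i2: "integrable M (\<lambda>x. \<i> * (complex_of_real t * complex_of_real x))"
    by (intro integrable_mult_right)
  have "(\<integral>x. \<i> * (complex_of_real t * complex_of_real x) \<partial>M) = 0"
    using assms by simp
  then show "char M t - 1 = (\<integral>x. iexp (t * x) - 1 - \<i> * (t * x) \<partial>M)"
    unfolding char_def using i2 integrable_iexp_scaled[of t] by (simp add: prob_space)
  show "integrable M (\<lambda>x. iexp (t * x) - 1 - \<i> * (t * x))"
    using i2 integrable_iexp_scaled[of t] by simp
qed

lemma char_quadratic_bound:
  assumes "integrable M (\<lambda>x. x)" "expectation (\<lambda>x. x) = 0" "integrable M (\<lambda>x. x\<^sup>2)"
  shows "cmod (char M t - 1) \<le> expectation (\<lambda>x. x\<^sup>2) / 2 * t\<^sup>2"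
proof -
  have "cmod (char M t - 1) \<le> (\<integral>x. cmod (iexp (t * x) - 1 - \<i> * (t * x)) \<partial>M)"
    unfolding char_centered(1)[OF assms(1,2)] by (rule integral_norm_bound)
  also have "\<dots> \<le> (\<integral>x. t\<^sup>2 / 2 * x\<^sup>2 \<partial>M)"
  proof (rule integral_mono)
    show "integrable M (\<lambda>x. cmod (iexp (t * x) - 1 - \<i> * (t * x)))"
      using char_centered(2)[OF assms(1,2)] by (rule integrable_norm)
    show "integrable M (\<lambda>x. t\<^sup>2 / 2 * x\<^sup>2)" using assms(3) by simp
    show "cmod (iexp (t * x) - 1 - \<i> * (t * x)) \<le> t\<^sup>2 / 2 * x\<^sup>2" for x
      using iexp_remainder_bound[of "t * x"] by (simp add: power_mult_distrib)
  qed
  finally show ?thesis by (simp add: mult.commute)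
qed

text \<open>Because the mean is zero the linear terms can be subtracted, which gains a second factor
  of the size of \<open>t\<close> and \<open>u\<close>. With it, replacing \<open>c i / n\<close> by
  \<open>v $ i\<close> in the argument costs only order
  \<open>t^2 * \<bar>c i / n - v $ i\<bar>\<close>.\<close>

lemma char_increment_bound:
  assumes "integrable M (\<lambda>x. x)" "expectation (\<lambda>x. x) = 0" "integrable M (\<lambda>x. x\<^sup>2)"
  shows "cmod (char M t - char M u) \<le> expectation (\<lambda>x. x\<^sup>2) * (2 * (\<bar>t\<bar> + \<bar>u\<bar>) * \<bar>t - u\<bar>)"
proof -
  note c = char_centered[OF assms(1,2)]
  have "char M t - char M u = (char M t - 1) - (char M u - 1)" by simp
  also have "\<dots> = (\<integral>x. (iexp (t * x) - 1 - \<i> * (t * x)) - (iexp (u * x) - 1 - \<i> * (u * x)) \<partial>M)"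
    unfolding c(1) using c(2) by (intro Bochner_Integration.integral_diff[symmetric])
  finally have eq: "char M t - char M u = (\<integral>x. (iexp (t * x) - 1 - \<i> * (t * x)) - (iexp (u * x) - 1 - \<i> * (u * x)) \<partial>M)" .
  have "cmod (char M t - char M u) \<le> (\<integral>x. cmod ((iexp (t * x) - 1 - \<i> * (t * x)) - (iexp (u * x) - 1 - \<i> * (u * x))) \<partial>M)"
    unfolding eq by (rule integral_norm_bound)
  also have "\<dots> \<le> (\<integral>x. x\<^sup>2 * (2 * (\<bar>t\<bar> + \<bar>u\<bar>) * \<bar>t - u\<bar>) \<partial>M)"
  proof (rule integral_mono)
    show "integrable M (\<lambda>x. cmod ((iexp (t * x) - 1 - \<i> * (t * x)) - (iexp (u * x) - 1 - \<i> * (u * x))))"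
      by (rule integrable_norm[OF Bochner_Integration.integrable_diff[OF c(2) c(2)]])
    show "integrable M (\<lambda>x. x\<^sup>2 * (2 * (\<bar>t\<bar> + \<bar>u\<bar>) * \<bar>t - u\<bar>))" using assms(3) by simp
    fix x
    have "t * x - u * x = (t - u) * x" by (simp add: algebra_simps)
    then have ab: "\<bar>t * x\<bar> = \<bar>t\<bar> * \<bar>x\<bar>" "\<bar>u * x\<bar> = \<bar>u\<bar> * \<bar>x\<bar>" "\<bar>t * x - u * x\<bar> = \<bar>t - u\<bar> * \<bar>x\<bar>"
      by (simp_all only: abs_mult)
    have "2 * (\<bar>t * x\<bar> + \<bar>u * x\<bar>) * \<bar>t * x - u * x\<bar> = (2 * (\<bar>t\<bar> + \<bar>u\<bar>) * \<bar>t - u\<bar>) * (\<bar>x\<bar> * \<bar>x\<bar>)"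
      unfolding ab by (simp only: algebra_simps)
    also have "\<bar>x\<bar> * \<bar>x\<bar> = x\<^sup>2" by (simp add: power2_eq_square)
    finally have eq: "2 * (\<bar>t * x\<bar> + \<bar>u * x\<bar>) * \<bar>t * x - u * x\<bar> = (2 * (\<bar>t\<bar> + \<bar>u\<bar>) * \<bar>t - u\<bar>) * x\<^sup>2" .
    show "cmod ((iexp (t * x) - 1 - \<i> * (t * x)) - (iexp (u * x) - 1 - \<i> * (u * x))) \<le> x\<^sup>2 * (2 * (\<bar>t\<bar> + \<bar>u\<bar>) * \<bar>t - u\<bar>)"
      using iexp_linear_diff_bound[of "t * x" "u * x"] unfolding eq by (simp add: mult.commute)
  qed
  finally show ?thesis by simp
qed

text \<open>A converse to \<open>char_quadratic_bound\<close>: Fatou's lemma applied to \<open>(1 - cos (t x)) / t\<^sup>2\<close>.\<close>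

lemma char_quadratic_imp_moments:
  assumes K: "\<And>t. cmod (char M t - 1) \<le> K * t\<^sup>2"
  shows "integrable M (\<lambda>x. x)" "expectation (\<lambda>x. x) = 0" "integrable M (\<lambda>x. x\<^sup>2)" "expectation (\<lambda>x. x\<^sup>2) \<le> 2 * K"
proof -
  have K0: "0 \<le> K" using order_trans[OF norm_ge_zero K[of 1]] by simp
  define t where "t n = 1 / real (Suc n)" for n
  have t0: "t n \<noteq> 0" for n by (simp add: t_def)
  have bound: "(\<integral>\<^sup>+x. ennreal ((1 - cos (t n * x)) / (t n)\<^sup>2) \<partial>M) \<le> ennreal K" for n
  proof -
    have i: "integrable M (\<lambda>x. cos (t n * x))" by (rule integrable_const_bound[where B = 1]) auto
    have "Re (char M (t n)) = (\<integral>x. Re (iexp (t n * x)) \<partial>M)"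
      unfolding char_def by (rule integral_Re[symmetric]) (rule integrable_iexp_scaled)
    then have "Re (char M (t n)) = (\<integral>x. cos (t n * x) \<partial>M)" by (simp add: Re_exp)
    then have "(\<integral>x. (1 - cos (t n * x)) / (t n)\<^sup>2 \<partial>M) = Re (1 - char M (t n)) / (t n)\<^sup>2"
      using i by (simp add: prob_space)
    also have "\<dots> \<le> K"
    proof -
      have "Re (1 - char M (t n)) \<le> K * (t n)\<^sup>2"
        using complex_Re_le_cmod[of "1 - char M (t n)"] K[of "t n"] by (simp add: norm_minus_commute)
      then show ?thesis using t0[of n] by (simp add: divide_le_eq)
    qed
    finally show ?thesis using i by (subst nn_integral_eq_integral) (auto intro!: ennreal_leI)
  qed
  have lim: "(\<lambda>n. (1 - cos (t n * x)) / (t n)\<^sup>2) \<longlonglongrightarrow> x\<^sup>2 / 2" for x :: real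
  proof -
    have "((\<lambda>h. (1 - cos (h * x)) / h\<^sup>2) \<longlongrightarrow> x * x / 2) (at_right 0)" by real_asymp
    then have "((\<lambda>h. (1 - cos (h * x)) / h\<^sup>2) \<longlongrightarrow> x\<^sup>2 / 2) (at_right 0)" by (simp add: power2_eq_square)
    moreover have "filterlim t (at_right 0) sequentially" unfolding t_def by real_asymp
    ultimately show ?thesis by (rule filterlim_compose)
  qed
  have "(\<integral>\<^sup>+x. ennreal (x\<^sup>2 / 2) \<partial>M) = (\<integral>\<^sup>+x. liminf (\<lambda>n. ennreal ((1 - cos (t n * x)) / (t n)\<^sup>2)) \<partial>M)"
  proof (rule nn_integral_cong)
    fix x
    have "(\<lambda>n. ennreal ((1 - cos (t n * x)) / (t n)\<^sup>2)) \<longlonglongrightarrow> ennreal (x\<^sup>2 / 2)"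
      using lim by (intro tendsto_ennrealI)
    then show "ennreal (x\<^sup>2 / 2) = liminf (\<lambda>n. ennreal ((1 - cos (t n * x)) / (t n)\<^sup>2))"
      by (intro lim_imp_Liminf[symmetric]) simp_all
  qed
  also have "\<dots> \<le> liminf (\<lambda>n. \<integral>\<^sup>+x. ennreal ((1 - cos (t n * x)) / (t n)\<^sup>2) \<partial>M)"
    by (rule nn_integral_liminf) simp
  also have "\<dots> \<le> ennreal K"
    by (rule Liminf_le, simp, rule always_eventually, rule allI, rule bound)
  finally have fin: "(\<integral>\<^sup>+x. ennreal (x\<^sup>2 / 2) \<partial>M) \<le> ennreal K" .
  then have i2: "integrable M (\<lambda>x. x\<^sup>2 / 2)"
    by (intro integrableI_bounded) (auto simp: le_less_trans)
  from integrable_mult_right[OF this, of 2] show int2: "integrable M (\<lambda>x. x\<^sup>2)" by simp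
  have "ennreal (\<integral>x. x\<^sup>2 / 2 \<partial>M) \<le> ennreal K"
    using fin i2 by (subst nn_integral_eq_integral[symmetric]) auto
  then have "(\<integral>x. x\<^sup>2 / 2 \<partial>M) \<le> K" using K0 by (simp add: ennreal_le_iff)
  then show ex2: "expectation (\<lambda>x. x\<^sup>2) \<le> 2 * K" by simp
  show int1: "integrable M (\<lambda>x. x)"
    by (rule square_integrable_imp_integrable) (use int2 in auto)
  show "expectation (\<lambda>x. x) = 0"
  proof (rule ccontr)
    define m where "m = expectation (\<lambda>x. x)"
    assume "expectation (\<lambda>x. x) \<noteq> 0"
    then have m: "0 < \<bar>m\<bar>" by (simp add: m_def)
    \<comment> \<open>A nonzero mean would make \<open>char M h - 1\<close> linear in
      \<open>h\<close> near 0, against the assumed quadratic bound; the witness \<open>h\<close>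
      chosen afterwards is small enough to expose this.\<close>
    have le: "\<bar>h\<bar> * \<bar>m\<bar> \<le> 2 * K * h\<^sup>2" for h
    proof -
      have i: "integrable M (\<lambda>x. \<i> * (complex_of_real h * complex_of_real x))"
        using int1 by (intro integrable_mult_right) simp
      have eq: "char M h - 1 - \<i> * h * m = (\<integral>x. iexp (h * x) - 1 - \<i> * (h * x) \<partial>M)"
        unfolding char_def m_def using i integrable_iexp_scaled[of h] int1 by (simp add: prob_space)
      have "cmod (char M h - 1 - \<i> * h * m) \<le> (\<integral>x. cmod (iexp (h * x) - 1 - \<i> * (h * x)) \<partial>M)"
        unfolding eq by (rule integral_norm_bound)
      also have "\<dots> \<le> (\<integral>x. h\<^sup>2 / 2 * x\<^sup>2 \<partial>M)"
      proof (rule integral_mono)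
        show "integrable M (\<lambda>x. cmod (iexp (h * x) - 1 - \<i> * (h * x)))"
          using i integrable_iexp_scaled[of h] by (intro integrable_norm) simp
        show "cmod (iexp (h * x) - 1 - \<i> * (h * x)) \<le> h\<^sup>2 / 2 * x\<^sup>2" for x
          using iexp_remainder_bound[of "h * x"] by (simp add: power_mult_distrib)
      qed (use int2 in simp)
      also have "\<dots> \<le> K * h\<^sup>2" using mult_left_mono[OF ex2, of "h\<^sup>2 / 2"] by (simp add: mult_ac)
      finally have 1: "cmod (char M h - 1 - \<i> * h * m) \<le> K * h\<^sup>2" .
      have "cmod (\<i> * h * m) \<le> cmod (char M h - 1) + cmod (char M h - 1 - \<i> * h * m)"
        using norm_triangle_ineq4[of "char M h - 1" "char M h - 1 - \<i> * h * m"] by simp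
      then show ?thesis using 1 K[of h] by (simp add: norm_mult)
    qed
    define h where "h = \<bar>m\<bar> / (2 * K + 1)"
    have h: "0 < h" using m K0 by (simp add: h_def)
    have "h * \<bar>m\<bar> \<le> (2 * K * h) * h" using le[of h] h by (simp add: power2_eq_square)
    then have "\<bar>m\<bar> \<le> 2 * K * h" using h by (simp add: mult.commute)
    moreover have "(2 * K + 1) * h = \<bar>m\<bar>" using K0 by (simp add: h_def)
    ultimately show False using h by (simp add: algebra_simps)
  qed
qed

end

context split_parameters
begin

section \<open>The smoothing transformation behind the fixed-point equation\<close>

definition smoothing :: "real measure \<Rightarrow> real measure" where
  "smoothing L = distr (D \<Otimes>\<^sub>M Pi\<^sub>M (UNIV :: 'b set) (\<lambda>_. L)) borel
     (\<lambda>(v, x). (\<Sum>k\<in>UNIV. v $ k * x k) + split_C D v)"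

text \<open>The action of \<open>smoothing\<close> on characteristic functions, defined for
  arbitrary \<open>\<phi>\<close> so that contraction and invariance can be stated for functions
  alone.\<close>

definition smooth_char :: "(real \<Rightarrow> complex) \<Rightarrow> real \<Rightarrow> complex" where
  "smooth_char \<phi> t = (\<integral>v. iexp (t * split_C D v) * (\<Prod>k\<in>UNIV. \<phi> (t * v $ k)) \<partial>D)"

lemma smoothing_measurable:
  assumes "sets L = sets borel"
  shows "(\<lambda>(v, x). (\<Sum>k\<in>UNIV. v $ k * x k) + split_C D v) \<in> borel_measurable (D \<Otimes>\<^sub>M Pi\<^sub>M (UNIV :: 'b set) (\<lambda>_. L))"
proof -
  let ?P = "D \<Otimes>\<^sub>M Pi\<^sub>M (UNIV :: 'b set) (\<lambda>_. L)"
  have f: "fst \<in> measurable ?P borel"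
    using measurable_fst[of D "Pi\<^sub>M (UNIV :: 'b set) (\<lambda>_. L)"] measurable_cong_sets[OF refl sets_D] by blast
  have s: "(\<lambda>z. snd z k) \<in> borel_measurable ?P" for k
    using measurable_compose[OF measurable_snd measurable_component_singleton[of k UNIV "\<lambda>_. L"]]
      measurable_cong_sets[OF refl assms] by blast
  have "(\<lambda>z. fst z $ k) \<in> borel_measurable ?P" for k
    by (rule measurable_compose[OF f]) simp
  moreover have "(\<lambda>z. split_C D (fst z)) \<in> borel_measurable ?P"
    by (rule measurable_compose[OF f]) simp
  ultimately show ?thesis
    unfolding case_prod_beta' using s
    by (intro borel_measurable_add borel_measurable_sum borel_measurable_times) auto
qed

lemma real_distribution_smoothing:
  assumes L: "real_distribution L"
  shows "real_distribution (smoothing L)"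
proof -
  interpret L: real_distribution L by fact
  interpret PL: product_prob_space "\<lambda>_ :: 'b. L" UNIV ..
  interpret P: pair_prob_space D "Pi\<^sub>M (UNIV :: 'b set) (\<lambda>_. L)" ..
  show ?thesis unfolding smoothing_def
    by (intro P.P.real_distribution_distr smoothing_measurable) simp
qed

lemma char_smoothing:
  assumes L: "real_distribution L"
  shows "char (smoothing L) t = smooth_char (char L) t"
proof -
  interpret L: real_distribution L by fact
  interpret PL: product_prob_space "\<lambda>_ :: 'b. L" UNIV ..
  interpret P: pair_prob_space D "Pi\<^sub>M (UNIV :: 'b set) (\<lambda>_. L)" ..
  let ?f = "\<lambda>(v :: real ^ 'b, x). (\<Sum>k\<in>UNIV. v $ k * x k) + split_C D v"
  have [measurable]: "?f \<in> borel_measurable (D \<Otimes>\<^sub>M Pi\<^sub>M (UNIV :: 'b set) (\<lambda>_. L))"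
    by (rule smoothing_measurable) simp
  have int: "integrable (D \<Otimes>\<^sub>M Pi\<^sub>M (UNIV :: 'b set) (\<lambda>_. L)) (\<lambda>z. iexp (t * ?f z))"
    by (rule P.P.integrable_const_bound[where B = 1]) auto
  have "char (smoothing L) t = (\<integral>z. iexp (t * ?f z) \<partial>(D \<Otimes>\<^sub>M Pi\<^sub>M (UNIV :: 'b set) (\<lambda>_. L)))"
    unfolding char_def smoothing_def by (subst integral_distr) auto
  also have "\<dots> = (\<integral>v. \<integral>x. iexp (t * ?f (v, x)) \<partial>Pi\<^sub>M (UNIV :: 'b set) (\<lambda>_. L) \<partial>D)"
    using P.integral_fst'[OF int] by simp
  also have "\<dots> = smooth_char (char L) t"
    unfolding smooth_char_def
  proof (rule Bochner_Integration.integral_cong)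
    fix v :: "real ^ 'b"
    have "iexp (t * ?f (v, x)) = iexp (t * split_C D v) * (\<Prod>k\<in>UNIV. iexp (t * v $ k * x k))" for x :: "'b \<Rightarrow> real"
    proof -
      have "\<i> * complex_of_real (t * ?f (v, x)) = \<i> * (t * split_C D v) + (\<Sum>k\<in>UNIV. \<i> * complex_of_real (t * v $ k * x k))"
        by (simp add: algebra_simps sum_distrib_left)
      then show ?thesis by (simp add: exp_add exp_sum)
    qed
    then have "(\<integral>x. iexp (t * ?f (v, x)) \<partial>Pi\<^sub>M (UNIV :: 'b set) (\<lambda>_. L))
      = iexp (t * split_C D v) * (\<integral>x. (\<Prod>k\<in>UNIV. iexp (t * v $ k * x k)) \<partial>Pi\<^sub>M (UNIV :: 'b set) (\<lambda>_. L))"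
      by simp
    also have "(\<integral>x. (\<Prod>k\<in>UNIV. iexp (t * v $ k * x k)) \<partial>Pi\<^sub>M (UNIV :: 'b set) (\<lambda>_. L))
      = (\<Prod>k\<in>UNIV. \<integral>y. iexp (t * v $ k * y) \<partial>L)"
      by (intro PL.product_integral_prod L.integrable_iexp_scaled) auto
    finally show "(\<integral>x. iexp (t * ?f (v, x)) \<partial>Pi\<^sub>M (UNIV :: 'b set) (\<lambda>_. L))
      = iexp (t * split_C D v) * (\<Prod>k\<in>UNIV. char L (t * v $ k))"
      by (simp add: char_def)
  qed simp
  finally show ?thesis .
qed

lemma smooth_char_integrable:
  assumes [measurable]: "\<phi> \<in> borel_measurable borel" and "\<And>t. cmod (\<phi> t) \<le> 1"
  shows "integrable D (\<lambda>v. iexp (t * split_C D v) * (\<Prod>k\<in>UNIV. \<phi> (t * v $ k)))"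
proof (rule integrable_D_bounded[where B = 1])
  fix v :: "real ^ 'b"
  have "cmod (\<Prod>k\<in>UNIV. \<phi> (t * v $ k)) \<le> 1"
    unfolding prod_norm[symmetric] by (intro prod_le_1 conjI assms(2)) auto
  then show "norm (iexp (t * split_C D v) * (\<Prod>k\<in>UNIV. \<phi> (t * v $ k))) \<le> 1" by (simp add: norm_mult)
qed simp

abbreviation "contraction_factor \<equiv> (\<integral>v. (\<Sum>i\<in>UNIV. (v $ i)\<^sup>2) \<partial>D)"

lemma contraction_factor_nonneg: "0 \<le> contraction_factor"
  by (intro Bochner_Integration.integral_nonneg sum_nonneg) simp

lemma integrable_square_sum: "integrable D (\<lambda>v. (\<Sum>i\<in>UNIV. (v $ i)\<^sup>2))"
  by (rule integrable_D_bounded[where B = 1]) (use sum_square_le_1 in \<open>auto simp: sum_nonneg\<close>)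

text \<open>Products of numbers in the unit disc differ by at most the sum of the differences of the
  factors, and the argument \<open>t * v $ k\<close> contributes \<open>(v $ k)^2\<close> to the
  weight \<open>t^2\<close>.\<close>

lemma smooth_char_contraction:
  assumes [measurable]: "\<phi> \<in> borel_measurable borel" and 1: "\<And>t. cmod (\<phi> t) \<le> 1"
    and [measurable]: "\<psi> \<in> borel_measurable borel" and 2: "\<And>t. cmod (\<psi> t) \<le> 1"
    and A: "\<And>t. cmod (\<phi> t - \<psi> t) \<le> A * t\<^sup>2"
  shows "cmod (smooth_char \<phi> t - smooth_char \<psi> t) \<le> contraction_factor * A * t\<^sup>2"
proof -
  have i: "integrable D (\<lambda>v. iexp (t * split_C D v) * (\<Prod>k\<in>UNIV. \<phi> (t * v $ k)) - iexp (t * split_C D v) * (\<Prod>k\<in>UNIV. \<psi> (t * v $ k)))"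
    using 1 2 by (intro Bochner_Integration.integrable_diff smooth_char_integrable) auto
  have eq: "smooth_char \<phi> t - smooth_char \<psi> t = (\<integral>v. iexp (t * split_C D v) * (\<Prod>k\<in>UNIV. \<phi> (t * v $ k)) - iexp (t * split_C D v) * (\<Prod>k\<in>UNIV. \<psi> (t * v $ k)) \<partial>D)"
    unfolding smooth_char_def using 1 2 by (intro Bochner_Integration.integral_diff[symmetric] smooth_char_integrable) auto
  have "cmod (smooth_char \<phi> t - smooth_char \<psi> t) \<le> (\<integral>v. cmod (iexp (t * split_C D v) * (\<Prod>k\<in>UNIV. \<phi> (t * v $ k)) - iexp (t * split_C D v) * (\<Prod>k\<in>UNIV. \<psi> (t * v $ k))) \<partial>D)"
    unfolding eq by (rule integral_norm_bound)
  also have "\<dots> \<le> (\<integral>v. (\<Sum>i\<in>UNIV. (v $ i)\<^sup>2) * (A * t\<^sup>2) \<partial>D)"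
  proof (rule integral_mono)
    show "integrable D (\<lambda>v. cmod (iexp (t * split_C D v) * (\<Prod>k\<in>UNIV. \<phi> (t * v $ k)) - iexp (t * split_C D v) * (\<Prod>k\<in>UNIV. \<psi> (t * v $ k))))"
      using i by (rule integrable_norm)
    show "integrable D (\<lambda>v. (\<Sum>i\<in>UNIV. (v $ i)\<^sup>2) * (A * t\<^sup>2))" using integrable_square_sum by simp
    fix v :: "real ^ 'b"
    have "cmod (iexp (t * split_C D v) * (\<Prod>k\<in>UNIV. \<phi> (t * v $ k)) - iexp (t * split_C D v) * (\<Prod>k\<in>UNIV. \<psi> (t * v $ k)))
      = cmod ((\<Prod>k\<in>UNIV. \<phi> (t * v $ k)) - (\<Prod>k\<in>UNIV. \<psi> (t * v $ k)))"
      by (simp add: norm_mult flip: right_diff_distrib)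
    also have "\<dots> \<le> (\<Sum>k\<in>UNIV. cmod (\<phi> (t * v $ k) - \<psi> (t * v $ k)))"
      by (intro norm_prod_diff 1 2)
    also have "\<dots> \<le> (\<Sum>k\<in>UNIV. A * (t * v $ k)\<^sup>2)" by (intro sum_mono A)
    also have "\<dots> = (\<Sum>i\<in>UNIV. (v $ i)\<^sup>2) * (A * t\<^sup>2)"
      by (simp add: sum_distrib_right sum_distrib_left power_mult_distrib mult_ac)
    finally show "cmod (iexp (t * split_C D v) * (\<Prod>k\<in>UNIV. \<phi> (t * v $ k)) - iexp (t * split_C D v) * (\<Prod>k\<in>UNIV. \<psi> (t * v $ k)))
      \<le> (\<Sum>i\<in>UNIV. (v $ i)\<^sup>2) * (A * t\<^sup>2)" .
  qed
  finally show ?thesis by simp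
qed

text \<open>The solution of \<open>K = contraction_factor * K + (1 + b / mu)^2 / 2\<close>, where
  the last term comes from the bound on \<open>split_C\<close>. With this radius the ball around the
  constant 1 is mapped into itself.\<close>

definition char_constant :: real where
  "char_constant = (1 + CARD('b) / mu)\<^sup>2 / 2 / (1 - contraction_factor)"

lemma char_constant_nonneg: "0 \<le> char_constant"
  unfolding char_constant_def using sum_square_mean by simp

lemma smooth_char_quadratic:
  assumes [measurable]: "\<phi> \<in> borel_measurable borel" and 1: "\<And>t. cmod (\<phi> t) \<le> 1"
    and A: "\<And>t. cmod (\<phi> t - 1) \<le> char_constant * t\<^sup>2"
  shows "cmod (smooth_char \<phi> t - 1) \<le> char_constant * t\<^sup>2"
proof -
  have const: "smooth_char (\<lambda>_. 1) t - 1 = (\<integral>v. iexp (t * split_C D v) - 1 - \<i> * (t * split_C D v) \<partial>D)"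
    and int: "integrable D (\<lambda>v. iexp (t * split_C D v) - 1 - \<i> * (t * split_C D v))"
  proof -
    have i1: "integrable D (\<lambda>v. iexp (t * split_C D v))"
      using smooth_char_integrable[of "\<lambda>_. 1" t] by simp
    have i2: "integrable D (\<lambda>v. complex_of_real (split_C D v))" by simp
    then have i3: "integrable D (\<lambda>v. \<i> * (complex_of_real t * complex_of_real (split_C D v)))"
      by (intro integrable_mult_right)
    have "(\<integral>v. \<i> * (complex_of_real t * complex_of_real (split_C D v)) \<partial>D) = 0"
      using integral_split_C by simp
    then show "smooth_char (\<lambda>_. 1) t - 1 = (\<integral>v. iexp (t * split_C D v) - 1 - \<i> * (t * split_C D v) \<partial>D)"
      unfolding smooth_char_def using i1 i3 D.prob_space by simp
    show "integrable D (\<lambda>v. iexp (t * split_C D v) - 1 - \<i> * (t * split_C D v))"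
      using i1 i3 by simp
  qed
  have "cmod (smooth_char (\<lambda>_. 1) t - 1) \<le> (\<integral>v. cmod (iexp (t * split_C D v) - 1 - \<i> * (t * split_C D v)) \<partial>D)"
    unfolding const by (rule integral_norm_bound)
  also have "\<dots> \<le> (\<integral>v. (1 + CARD('b) / mu)\<^sup>2 / 2 * t\<^sup>2 \<partial>D)"
  proof (rule integral_mono_AE)
    show "integrable D (\<lambda>v. cmod (iexp (t * split_C D v) - 1 - \<i> * (t * split_C D v)))"
      using int by (rule integrable_norm)
    show "AE v in D. cmod (iexp (t * split_C D v) - 1 - \<i> * (t * split_C D v)) \<le> (1 + CARD('b) / mu)\<^sup>2 / 2 * t\<^sup>2"
      using AE_D_prob_vectors
    proof eventually_elim
      case (elim v)
      have "cmod (iexp (t * split_C D v) - 1 - \<i> * (t * split_C D v)) \<le> (t * split_C D v)\<^sup>2 / 2"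
        using iexp_remainder_bound[of "t * split_C D v"] by simp
      also have "(t * split_C D v)\<^sup>2 = t\<^sup>2 * \<bar>split_C D v\<bar>\<^sup>2" by (simp add: power_mult_distrib)
      also have "t\<^sup>2 * \<bar>split_C D v\<bar>\<^sup>2 / 2 \<le> t\<^sup>2 * (1 + CARD('b) / mu)\<^sup>2 / 2"
        using split_C_bound[OF elim] by (intro divide_right_mono mult_left_mono power_mono) auto
      finally show ?case by (simp add: mult.commute)
    qed
  qed simp
  also have "\<dots> = (1 + CARD('b) / mu)\<^sup>2 / 2 * t\<^sup>2" using D.prob_space by simp
  also have "(1 + CARD('b) / mu)\<^sup>2 / 2 = (1 - contraction_factor) * char_constant"
  proof -
    have nz: "1 - contraction_factor \<noteq> 0" using sum_square_mean by simp
    have "x / 2 = k * (x / 2 / k)" if "k \<noteq> 0" for x k :: real using that by simp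
    then show ?thesis unfolding char_constant_def using nz by blast
  qed
  finally have a: "cmod (smooth_char (\<lambda>_. 1) t - 1) \<le> (1 - contraction_factor) * char_constant * t\<^sup>2" .
  have b: "cmod (smooth_char \<phi> t - smooth_char (\<lambda>_. 1) t) \<le> contraction_factor * char_constant * t\<^sup>2"
    by (rule smooth_char_contraction) (use 1 A in auto)
  have "cmod (smooth_char \<phi> t - 1) \<le> cmod (smooth_char \<phi> t - smooth_char (\<lambda>_. 1) t) + cmod (smooth_char (\<lambda>_. 1) t - 1)"
    using norm_triangle_ineq[of "smooth_char \<phi> t - smooth_char (\<lambda>_. 1) t" "smooth_char (\<lambda>_. 1) t - 1"] by simp
  also have "\<dots> \<le> contraction_factor * char_constant * t\<^sup>2 + (1 - contraction_factor) * char_constant * t\<^sup>2"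
    using a b by (rule add_mono[rotated])
  finally show ?thesis by (simp add: algebra_simps)
qed

lemma fixed_point_law_iff:
  "fixed_point_law D L \<longleftrightarrow> real_distribution L \<and> integrable L (\<lambda>x. x) \<and> (\<integral>x. x \<partial>L) = 0 \<and>
     integrable L (\<lambda>x. x\<^sup>2) \<and> L = smoothing L"
proof -
  have "prob_space L \<and> sets L = sets borel \<longleftrightarrow> real_distribution L"
    using real_distribution.axioms sets_eq_imp_space_eq[of L borel]
    by (auto simp: real_distribution_def real_distribution_axioms_def)
  then show ?thesis unfolding fixed_point_law_def smoothing_def by blast
qed

text \<open>Mean zero and finite variance make the distance between the two characteristic functions
  finite, so the contraction can be iterated to show that it is 0.\<close>

lemma fixed_point_law_unique:
  assumes "fixed_point_law D L" "fixed_point_law D L'"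
  shows "L' = L"
proof -
  have L: "real_distribution L" "L = smoothing L" and L': "real_distribution L'" "L' = smoothing L'"
    using assms by (auto simp: fixed_point_law_iff)
  interpret L: real_distribution L by (rule L)
  interpret L': real_distribution L' by (rule L')
  define A where "A = L.expectation (\<lambda>x. x\<^sup>2) / 2 + L'.expectation (\<lambda>x. x\<^sup>2) / 2"
  have "cmod (char L t - char L' t) \<le> contraction_factor ^ k * A * t\<^sup>2" for k t
  proof (induction k arbitrary: t)
    case 0
    have "cmod (char L t - char L' t) \<le> cmod (char L t - 1) + cmod (char L' t - 1)"
      using norm_triangle_ineq4[of "char L t - 1" "char L' t - 1"] by simp
    also have "\<dots> \<le> L.expectation (\<lambda>x. x\<^sup>2) / 2 * t\<^sup>2 + L'.expectation (\<lambda>x. x\<^sup>2) / 2 * t\<^sup>2"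
      using assms by (intro add_mono L.char_quadratic_bound L'.char_quadratic_bound) (auto simp: fixed_point_law_iff)
    finally show ?case by (simp add: A_def algebra_simps)
  next
    case (Suc k)
    have "cmod (smooth_char (char L) t - smooth_char (char L') t) \<le> contraction_factor * (contraction_factor ^ k * A) * t\<^sup>2"
      using Suc.IH by (intro smooth_char_contraction L.cmod_char_le_1 L'.cmod_char_le_1) (auto simp: mult_ac)
    then show ?case
      using char_smoothing[OF L(1), of t] char_smoothing[OF L'(1), of t] L(2) L'(2) by (simp add: mult_ac)
  qed
  moreover have "(\<lambda>k. contraction_factor ^ k * A * t\<^sup>2) \<longlonglongrightarrow> 0 * A * t\<^sup>2" for t
    by (intro tendsto_intros LIMSEQ_power_zero) (use sum_square_mean contraction_factor_nonneg in simp)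
  ultimately have "cmod (char L t - char L' t) \<le> 0" for t
    by (intro LIMSEQ_le_const[of "\<lambda>k. contraction_factor ^ k * A * t\<^sup>2"]) auto
  then have "char L = char L'" by (intro ext) simp
  then show ?thesis using Levy_uniqueness[OF L(1) L'(1)] by simp
qed

text \<open>\<open>smoothing\<close> is iterated from the unit mass at 0, and the contraction makes
  the characteristic functions converge pointwise. Tightness shows that the limit belongs to a law,
  and the uniform quadratic bound returns its moments through
  \<open>char_quadratic_imp_moments\<close>.\<close>

lemma fixed_point_law_exists: "\<exists>L. fixed_point_law D L"
proof -
  define \<mu> where "\<mu> k = (smoothing ^^ k) (return borel 0)" for k
  have \<mu>_Suc: "\<mu> (Suc k) = smoothing (\<mu> k)" for k by (simp add: \<mu>_def)
  have rd: "real_distribution (\<mu> k)" for k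
  proof (induction k)
    case 0
    have "prob_space (return borel (0 :: real))" by (rule prob_space_return) simp
    then show ?case by (simp add: \<mu>_def real_distribution_def real_distribution_axioms_def)
  qed (simp add: \<mu>_Suc real_distribution_smoothing)
  have m [measurable]: "char (\<mu> k) \<in> borel_measurable borel" for k by (rule real_distribution.char_measurable[OF rd])
  have le1: "cmod (char (\<mu> k) t) \<le> 1" for k t by (rule real_distribution.cmod_char_le_1[OF rd])
  have char0: "char (\<mu> 0) t = 1" for t by (simp add: \<mu>_def char_def integral_return)
  have quad: "cmod (char (\<mu> k) t - 1) \<le> char_constant * t\<^sup>2" for k t
  proof (induction k arbitrary: t)
    case 0
    then show ?case by (simp add: char0 char_constant_nonneg)
  next
    case (Suc k)
    then show ?case unfolding \<mu>_Suc char_smoothing[OF rd] by (intro smooth_char_quadratic le1) auto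
  qed
  have diff: "cmod (char (\<mu> (Suc k)) t - char (\<mu> k) t) \<le> contraction_factor ^ k * char_constant * t\<^sup>2" for k t
  proof (induction k arbitrary: t)
    case 0
    then show ?case using quad[of 1 t] by (simp add: char0)
  next
    case (Suc k)
    have "cmod (smooth_char (char (\<mu> (Suc k))) t - smooth_char (char (\<mu> k)) t) \<le> contraction_factor * (contraction_factor ^ k * char_constant) * t\<^sup>2"
      using Suc.IH by (intro smooth_char_contraction le1) (auto simp: mult_ac)
    then show ?case by (simp add: \<mu>_Suc[of "Suc k"] \<mu>_Suc[of k] char_smoothing rd real_distribution_smoothing mult_ac)
  qed
  define \<phi> where "\<phi> t = lim (\<lambda>k. char (\<mu> k) t)" for t
  have lim: "(\<lambda>k. char (\<mu> k) t) \<longlonglongrightarrow> \<phi> t" for t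
  proof -
    have "summable (\<lambda>k. contraction_factor ^ k * (char_constant * t\<^sup>2))"
      using sum_square_mean contraction_factor_nonneg by (intro summable_mult2 summable_geometric) simp
    then have "summable (\<lambda>k. char (\<mu> (Suc k)) t - char (\<mu> k) t)"
      by (rule summable_comparison_test'[where N = 0]) (use diff in \<open>simp add: mult.assoc\<close>)
    then have "convergent (\<lambda>n. \<Sum>k<n. char (\<mu> (Suc k)) t - char (\<mu> k) t)"
      by (simp add: summable_iff_convergent)
    then have "convergent (\<lambda>n. char (\<mu> n) t - char (\<mu> 0) t)"
      by (simp only: sum_lessThan_telescope[of "\<lambda>k. char (\<mu> k) t"])
    then have "convergent (\<lambda>n. char (\<mu> n) t)" by (simp add: convergent_diff_const_right_iff)
    then show ?thesis unfolding \<phi>_def by (simp add: convergent_LIMSEQ_iff)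
  qed
  have "tight \<mu>"
    unfolding tight_def
  proof (intro conjI allI impI rd)
    fix \<epsilon> :: real assume \<epsilon>: "0 < \<epsilon>"
    \<comment> \<open>Chosen so that Markov's inequality for \<open>x^2\<close>, whose mean is at
      most \<open>2 * char_constant\<close>, gives less than \<open>\<epsilon>\<close>. As
      \<open>a \<ge> 1\<close>, the bound \<open>x^2 < a\<close> also gives
      \<open>\<bar>x\<bar> < a\<close>.\<close>
    define a where "a = 1 + 2 * char_constant / \<epsilon>"
    have a1: "1 \<le> a" using char_constant_nonneg \<epsilon> by (simp add: a_def)
    have "1 - \<epsilon> < measure (\<mu> k) {-a - 1<..a + 1}" for k
    proof -
      interpret real_distribution "\<mu> k" by (rule rd)
      note mo = char_quadratic_imp_moments[OF quad]
      have "measure (\<mu> k) {x \<in> space (\<mu> k). a \<le> x\<^sup>2} \<le> expectation (\<lambda>x. x\<^sup>2) / a"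
        using a1 mo(3) by (intro integral_Markov_inequality_measure[where A = "{}"]) auto
      also have "\<dots> \<le> 2 * char_constant / a" using mo(4) a1 by (intro divide_right_mono) auto
      also have "\<dots> < \<epsilon>" using \<epsilon> a1 by (simp add: a_def field_simps)
      finally have lt: "measure (\<mu> k) {x. a \<le> x\<^sup>2} < \<epsilon>" by simp
      have "1 - measure (\<mu> k) {x. a \<le> x\<^sup>2} = measure (\<mu> k) (space (\<mu> k) - {x. a \<le> x\<^sup>2})"
        by (rule prob_compl[symmetric]) simp
      also have "\<dots> \<le> measure (\<mu> k) {-a - 1<..a + 1}"
      proof (rule finite_measure_mono)
        show "space (\<mu> k) - {x. a \<le> x\<^sup>2} \<subseteq> {-a - 1<..a + 1}"
        proof
          fix x assume "x \<in> space (\<mu> k) - {x. a \<le> x\<^sup>2}"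
          then have "x\<^sup>2 < a" by simp
          also have "a \<le> a\<^sup>2" using a1 by (simp add: power2_eq_square)
          finally have "\<bar>x\<bar> < a" using a1 by (metis abs_of_pos less_le_trans power2_abs power_less_imp_less_base zero_less_one less_imp_le)
          then show "x \<in> {-a - 1<..a + 1}" by auto
        qed
      qed simp
      finally show ?thesis using lt by simp
    qed
    then show "\<exists>a b. a < b \<and> (\<forall>k. 1 - \<epsilon> < measure (\<mu> k) {a<..b})"
      using a1 by (intro exI[of _ "-a - 1"] exI[of _ "a + 1"]) auto
  qed
  from tight_imp_convergent_subsubsequence[OF this strict_mono_id]
  obtain r L where r: "strict_mono r" and L: "real_distribution L" and wc: "weak_conv_m (\<mu> \<circ> id \<circ> r) L"
    by blast
  interpret L: real_distribution L by (rule L)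
  have charL: "char L t = \<phi> t" for t
  proof (rule LIMSEQ_unique)
    show "(\<lambda>k. char ((\<mu> \<circ> id \<circ> r) k) t) \<longlonglongrightarrow> char L t"
      by (rule levy_continuity1[OF _ L wc]) (simp add: rd)
    show "(\<lambda>k. char ((\<mu> \<circ> id \<circ> r) k) t) \<longlonglongrightarrow> \<phi> t"
      using LIMSEQ_subseq_LIMSEQ[OF lim[of t] r] by (simp add: comp_def)
  qed
  have "cmod (char L t - 1) \<le> char_constant * t\<^sup>2" for t
  proof (rule LIMSEQ_le_const2)
    show "(\<lambda>k. cmod (char (\<mu> k) t - 1)) \<longlonglongrightarrow> cmod (char L t - 1)"
      unfolding charL by (intro tendsto_intros lim)
  qed (use quad in auto)
  note mo = L.char_quadratic_imp_moments[OF this]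
  have "char L t = char (smoothing L) t" for t
  proof (rule LIMSEQ_unique)
    show "(\<lambda>k. char (\<mu> (Suc k)) t) \<longlonglongrightarrow> char L t"
      unfolding charL using lim by (rule LIMSEQ_Suc)
    show "(\<lambda>k. char (\<mu> (Suc k)) t) \<longlonglongrightarrow> char (smoothing L) t"
      unfolding \<mu>_Suc char_smoothing[OF rd] char_smoothing[OF L] smooth_char_def
    proof (rule integral_dominated_convergence[where w = "\<lambda>_. 1"])
      show "AE v in D. (\<lambda>k. iexp (t * split_C D v) * (\<Prod>i\<in>UNIV. char (\<mu> k) (t * v $ i)))
          \<longlonglongrightarrow> iexp (t * split_C D v) * (\<Prod>i\<in>UNIV. char L (t * v $ i))"
        unfolding charL by (intro AE_I2 tendsto_intros lim)
      show "AE v in D. norm (iexp (t * split_C D v) * (\<Prod>i\<in>UNIV. char (\<mu> k) (t * v $ i))) \<le> 1" for k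
      proof (intro AE_I2)
        fix v :: "real ^ 'b"
        have "cmod (\<Prod>i\<in>UNIV. char (\<mu> k) (t * v $ i)) \<le> 1"
          unfolding prod_norm[symmetric] by (intro prod_le_1 conjI le1) auto
        then show "norm (iexp (t * split_C D v) * (\<Prod>i\<in>UNIV. char (\<mu> k) (t * v $ i))) \<le> 1" by (simp add: norm_mult)
      qed
    qed auto
  qed
  then have "L = smoothing L"
    by (intro Levy_uniqueness L real_distribution_smoothing ext)
  then show ?thesis using mo L unfolding fixed_point_law_iff by blast
qed

end

section \<open>Convergence of characteristic functions\<close>

context split_parameters
begin

lemma norm_tree_mgf_imaginary: "cmod (tree_mgf k (\<i> * complex_of_real w) n) \<le> 1"
proof (induction k arbitrary: n)
  case (Suc k)
  let ?F = "\<lambda>c. exp (\<i> * complex_of_real w * of_real (toll n c)) * (\<Prod>i\<in>UNIV. tree_mgf k (\<i> * complex_of_real w) (c i))"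
  have F: "cmod (?F c) \<le> 1" for c
  proof -
    have "exp (\<i> * complex_of_real w * of_real (toll n c)) = iexp (w * toll n c)" by (simp add: mult.assoc)
    then have "cmod (exp (\<i> * complex_of_real w * of_real (toll n c))) = 1" by (simp only: norm_exp_i_times)
    moreover have "cmod (\<Prod>i\<in>UNIV. tree_mgf k (\<i> * complex_of_real w) (c i)) \<le> 1"
      unfolding prod_norm[symmetric] by (intro prod_le_1 conjI Suc.IH) auto
    ultimately show ?thesis by (simp add: norm_mult)
  qed
  have "cmod (tree_mgf (Suc k) (\<i> * complex_of_real w) n) \<le> (\<integral>x. cmod (?F (fst x)) \<partial>joint_law n)"
    unfolding tree_mgf_joint by (rule integral_norm_bound)
  also have "\<dots> \<le> (\<integral>x. 1 \<partial>joint_law n)"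
    by (intro integral_mono F integrable_norm) (simp_all only: integrable_joint_fst[where F = ?F] integrable_joint_fst[where F = "\<lambda>_. 1 :: real"])
  finally show ?case by (simp add: J.prob_space)
qed simp

text \<open>The constant reproduces itself: the toll contributes \<open>B^2 / 2 = K * \<eta>\<close>
  and the children at most \<open>K * (1 - \<eta>)\<close>. Being uniform in the depth, the bound
  survives the passage to the whole tree.\<close>

lemma tree_mgf_imaginary_quadratic:
  "\<exists>K\<ge>0. \<forall>k w n. cmod (tree_mgf k (\<i> * complex_of_real w) n - 1) \<le> K * (w * real n)\<^sup>2"
proof -
  obtain B where B0: "0 \<le> B" and B: "\<And>n c. s < n \<Longrightarrow> (\<Sum>i\<in>UNIV. c i) = n - s0 \<Longrightarrow> \<bar>toll n c / real n\<bar> \<le> B"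
    using toll_bounded by blast
  obtain \<eta> where \<eta>: "0 < \<eta>" and S: "\<And>n. s < n \<Longrightarrow> (\<integral>x. square_sum n (fst x) \<partial>joint_law n) \<le> 1 - \<eta>"
    using square_sum_contraction by blast
  define K where "K = B\<^sup>2 / 2 / \<eta>"
  have K0: "0 \<le> K" and K: "B\<^sup>2 / 2 = K * \<eta>" using \<eta> by (auto simp: K_def)
  have "cmod (tree_mgf k (\<i> * complex_of_real w) n - 1) \<le> K * (w * real n)\<^sup>2" for k w n
  proof (induction k arbitrary: n)
    case (Suc k)
    show ?case
    proof (cases "s < n")
      case n: True
      then have n0: "0 < real n" by simp
      let ?g = "\<lambda>c. \<Prod>i\<in>UNIV. tree_mgf k (\<i> * complex_of_real w) (c i)"
      let ?A = "\<lambda>c. iexp (w * toll n c) - 1 - \<i> * complex_of_real (w * toll n c)"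
      let ?B = "\<lambda>c. iexp (w * toll n c) * (?g c - 1)"
      have "(\<integral>x. \<i> * complex_of_real (w * toll n (fst x)) \<partial>joint_law n) = \<i> * complex_of_real (\<integral>x. w * toll n (fst x) \<partial>joint_law n)"
        by (subst integral_mult_right_zero, subst integral_of_real)
           (rule integrable_joint_fst[where F = "\<lambda>c. w * toll n c"], rule refl)
      also have "\<dots> = 0" using integral_toll[of n] by simp
      finally have T0: "(\<integral>x. \<i> * complex_of_real (w * toll n (fst x)) \<partial>joint_law n) = 0" .
      have "tree_mgf (Suc k) (\<i> * complex_of_real w) n = (\<integral>x. iexp (w * toll n (fst x)) * ?g (fst x) \<partial>joint_law n)"
        unfolding tree_mgf_joint by (simp add: mult.assoc)
      also have "\<dots> = (\<integral>x. 1 + (\<i> * complex_of_real (w * toll n (fst x)) + (?A (fst x) + ?B (fst x))) \<partial>joint_law n)"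
        by (simp add: algebra_simps)
      also have "\<dots> = 1 + (0 + ((\<integral>x. ?A (fst x) \<partial>joint_law n) + (\<integral>x. ?B (fst x) \<partial>joint_law n)))"
        unfolding T0[symmetric]
        by (subst Bochner_Integration.integral_add,
            rule integrable_joint_fst[where F = "\<lambda>_. 1"],
            rule integrable_joint_fst[where F = "\<lambda>c. \<i> * complex_of_real (w * toll n c) + (?A c + ?B c)"],
            subst Bochner_Integration.integral_add,
            rule integrable_joint_fst[where F = "\<lambda>c. \<i> * complex_of_real (w * toll n c)"],
            rule integrable_joint_fst[where F = "\<lambda>c. ?A c + ?B c"],
            subst Bochner_Integration.integral_add,
            rule integrable_joint_fst[where F = ?A],
            rule integrable_joint_fst[where F = ?B]) (simp add: J.prob_space)
      finally have eq: "tree_mgf (Suc k) (\<i> * complex_of_real w) n - 1 = (\<integral>x. ?A (fst x) \<partial>joint_law n) + (\<integral>x. ?B (fst x) \<partial>joint_law n)"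
        by simp
      have a: "cmod (\<integral>x. ?A (fst x) \<partial>joint_law n) \<le> K * \<eta> * (w * real n)\<^sup>2"
      proof -
        have "cmod (\<integral>x. ?A (fst x) \<partial>joint_law n) \<le> (\<integral>x. cmod (?A (fst x)) \<partial>joint_law n)" by (rule integral_norm_bound)
        also have "\<dots> \<le> (\<integral>x. B\<^sup>2 / 2 * (w * real n)\<^sup>2 \<partial>joint_law n)"
        proof (rule integral_mono_AE)
          show "AE x in joint_law n. cmod (?A (fst x)) \<le> B\<^sup>2 / 2 * (w * real n)\<^sup>2"
          proof (rule AE_joint_lawI)
            fix c :: "'b \<Rightarrow> nat" and v :: "real ^ 'b" assume c: "s < n \<Longrightarrow> (\<Sum>i\<in>UNIV. c i) = n - s0"
            have "cmod (?A c) \<le> (w * toll n c)\<^sup>2 / 2" by (rule iexp_remainder_bound)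
            also have "(w * toll n c)\<^sup>2 = (w * real n)\<^sup>2 * \<bar>toll n c / real n\<bar>\<^sup>2"
              using n0 by (simp add: power_mult_distrib power_divide)
            also have "(w * real n)\<^sup>2 * \<bar>toll n c / real n\<bar>\<^sup>2 / 2 \<le> (w * real n)\<^sup>2 * B\<^sup>2 / 2"
              using B[OF n c[OF n]] by (intro divide_right_mono mult_left_mono power_mono) auto
            finally show "cmod (?A (fst (c, v))) \<le> B\<^sup>2 / 2 * (w * real n)\<^sup>2" by (simp add: mult_ac)
          qed
        qed (rule integrable_joint_fst[where F = "\<lambda>c. cmod (?A c)"], simp)
        also have "\<dots> = K * \<eta> * (w * real n)\<^sup>2" unfolding K by (simp add: J.prob_space)
        finally show ?thesis .
      qed
      have b: "cmod (\<integral>x. ?B (fst x) \<partial>joint_law n) \<le> K * (1 - \<eta>) * (w * real n)\<^sup>2"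
      proof -
        have "cmod (\<integral>x. ?B (fst x) \<partial>joint_law n) \<le> (\<integral>x. cmod (?B (fst x)) \<partial>joint_law n)" by (rule integral_norm_bound)
        also have "\<dots> \<le> (\<integral>x. K * (w * real n)\<^sup>2 * square_sum n (fst x) \<partial>joint_law n)"
        proof (rule integral_mono)
          fix x
          have "cmod (?B (fst x)) = cmod ((\<Prod>i\<in>UNIV. tree_mgf k (\<i> * complex_of_real w) (fst x i)) - (\<Prod>i\<in>(UNIV :: 'b set). 1))"
            by (simp add: norm_mult)
          also have "\<dots> \<le> (\<Sum>i\<in>UNIV. cmod (tree_mgf k (\<i> * complex_of_real w) (fst x i) - 1))"
            by (intro norm_prod_diff norm_tree_mgf_imaginary) simp
          also have "\<dots> \<le> (\<Sum>i\<in>UNIV. K * (w * real (fst x i))\<^sup>2)" by (intro sum_mono Suc.IH)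
          also have "\<dots> = K * (w * real n)\<^sup>2 * square_sum n (fst x)"
            unfolding square_sum_def sum_distrib_left using n0
            by (intro sum.cong) (auto simp: power_mult_distrib power_divide)
          finally show "cmod (?B (fst x)) \<le> K * (w * real n)\<^sup>2 * square_sum n (fst x)" .
        qed (rule integrable_joint_fst[where F = "\<lambda>c. cmod (?B c)"],
             rule integrable_joint_fst[where F = "\<lambda>c. K * (w * real n)\<^sup>2 * square_sum n c"])
        also have "\<dots> = K * (w * real n)\<^sup>2 * (\<integral>x. square_sum n (fst x) \<partial>joint_law n)" by simp
        also have "\<dots> \<le> K * (w * real n)\<^sup>2 * (1 - \<eta>)" using S[OF n] K0 by (intro mult_left_mono) auto
        finally show ?thesis by (simp add: mult_ac)
      qed
      have "cmod (tree_mgf (Suc k) (\<i> * complex_of_real w) n - 1) \<le> K * \<eta> * (w * real n)\<^sup>2 + K * (1 - \<eta>) * (w * real n)\<^sup>2"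
        unfolding eq using norm_triangle_ineq a b by (rule order_trans[OF _ add_mono])
      then show ?thesis by (simp add: algebra_simps)
    next
      case False
      then show ?thesis using K0 by (subst tree_mgf_small) auto
    qed
  qed (simp add: K0)
  then show ?thesis using K0 by blast
qed

text \<open>Both sides satisfy the fixed-point recursion, the left one only asymptotically; the error is
  measured in the metric \<open>sup |\<phi>(t) - \<psi>(t)| / t\<^sup>2\<close>.\<close>

lemma recursive_char_difference:
  fixes G :: "real \<Rightarrow> nat \<Rightarrow> complex"
  assumes G1: "\<And>w n. cmod (G w n) \<le> 1"
    and rec: "\<And>w n. G w n = (\<integral>x. iexp (w * toll n (fst x)) * (\<Prod>i\<in>UNIV. G w (fst x i)) \<partial>joint_law n)"
    and L: "fixed_point_law D L"
  shows "\<exists>\<epsilon>. \<epsilon> \<longlonglongrightarrow> 0 \<and> (\<forall>n>s. \<forall>w. cmod (G w n - char L (w * real n))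
     \<le> (\<integral>x. (\<Sum>i\<in>UNIV. cmod (G w (fst x i) - char L (w * real (fst x i)))) \<partial>joint_law n) + \<epsilon> n * (w * real n)\<^sup>2)"
proof -
  have Lrd: "real_distribution L" and Lm: "integrable L (\<lambda>x. x)" "(\<integral>x. x \<partial>L) = 0" "integrable L (\<lambda>x. x\<^sup>2)" and Lfix: "L = smoothing L"
    using L by (auto simp: fixed_point_law_iff)
  interpret L: real_distribution L by (rule Lrd)
  define \<phi> where "\<phi> = char L"
  have \<phi>1: "cmod (\<phi> t) \<le> 1" for t unfolding \<phi>_def by (rule L.cmod_char_le_1)
  have \<phi>m [measurable]: "\<phi> \<in> borel_measurable borel" unfolding \<phi>_def by (rule L.char_measurable)
  define \<sigma>2 where "\<sigma>2 = L.expectation (\<lambda>x. x\<^sup>2)"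
  have \<sigma>0: "0 \<le> \<sigma>2" unfolding \<sigma>2_def by (intro Bochner_Integration.integral_nonneg) simp
  have \<phi>q: "cmod (\<phi> t - 1) \<le> \<sigma>2 / 2 * t\<^sup>2" for t
    unfolding \<phi>_def \<sigma>2_def by (rule L.char_quadratic_bound[OF Lm])
  have \<phi>d: "cmod (\<phi> t - \<phi> u) \<le> \<sigma>2 * (2 * (\<bar>t\<bar> + \<bar>u\<bar>) * \<bar>t - u\<bar>)" for t u
    unfolding \<phi>_def \<sigma>2_def by (rule L.char_increment_bound[OF Lm])
  have \<phi>fix: "\<phi> t = (\<integral>x. iexp (t * split_C D (snd x)) * (\<Prod>i\<in>UNIV. \<phi> (t * snd x $ i)) \<partial>joint_law n)" for t n
  proof -
    have "\<phi> t = smooth_char \<phi> t" unfolding \<phi>_def using char_smoothing[OF Lrd, of t] Lfix by simp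
    also have "\<dots> = (\<integral>x. iexp (t * split_C D (snd x)) * (\<Prod>i\<in>UNIV. \<phi> (t * snd x $ i)) \<partial>joint_law n)"
      unfolding smooth_char_def by (rule integral_joint_snd[symmetric]) measurable
    finally show ?thesis .
  qed
  obtain B1 where B10: "0 \<le> B1" and B1: "\<And>n c. s < n \<Longrightarrow> (\<Sum>i\<in>UNIV. c i) = n - s0 \<Longrightarrow> \<bar>toll n c / real n\<bar> \<le> B1"
    using toll_bounded by blast
  define B where "B = B1 + (1 + CARD('b) / mu)"
  have Bn: "\<bar>toll n c / real n\<bar> \<le> B" if "s < n" "(\<Sum>i\<in>UNIV. c i) = n - s0" for n c
    using B1[OF that] mu_pos by (simp add: B_def add_increasing2)
  have BC: "\<bar>split_C D v\<bar> \<le> B" if "v \<in> prob_vectors" for v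
    using split_C_bound[OF that] B10 by (simp add: B_def)
  \<comment> \<open>\<open>4 * B\<close> and \<open>\<sigma>2 + 2\<close> are the coefficients in
    the estimates 2 and 3 below, \<open>\<beta>\<close> is the one in estimate 4.\<close>
  define \<alpha> \<beta> where "\<alpha> = 4 * B + \<sigma>2 + 2" and "\<beta> = 4 * \<sigma>2"
  define d where "d n x = (\<Sum>i\<in>UNIV. \<bar>real (fst x i) / real n - snd x $ i\<bar>)" for n and x :: "('b \<Rightarrow> nat) \<times> (real ^ 'b)"
  define \<epsilon> where "\<epsilon> n = \<alpha> * (\<integral>x. \<bar>toll n (fst x) / real n - split_C D (snd x)\<bar> \<partial>joint_law n) + \<beta> * (\<integral>x. d n x \<partial>joint_law n)" for n
  have d_lim: "(\<lambda>n. \<integral>x. d n x \<partial>joint_law n) \<longlonglongrightarrow> 0"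
    unfolding d_def using joint_deviation_tendsto[of "\<lambda>x. x"] by simp
  have "\<epsilon> \<longlonglongrightarrow> \<alpha> * 0 + \<beta> * 0" unfolding \<epsilon>_def by (intro tendsto_intros toll_tendsto d_lim)
  then have lim: "\<epsilon> \<longlonglongrightarrow> 0" by simp
  have "cmod (G w n - \<phi> (w * real n))
     \<le> (\<integral>x. (\<Sum>i\<in>UNIV. cmod (G w (fst x i) - \<phi> (w * real (fst x i)))) \<partial>joint_law n) + \<epsilon> n * (w * real n)\<^sup>2"
    if n: "s < n" for n w
  proof -
    define t where "t = w * real n"
    have n0: "0 < real n" using n by simp
    define a where "a c = iexp (w * toll n c)" for c
    define b where "b v = iexp (t * split_C D v)" for v
    define P where "P c = (\<Prod>i\<in>UNIV. \<phi> (w * real (c i)))" for c :: "'b \<Rightarrow> nat"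
    define Q where "Q v = (\<Prod>i\<in>UNIV. \<phi> (t * v $ i))" for v :: "real ^ 'b"
    \<comment> \<open>The first-order difference of the two exponents. It has mean zero since the
      toll and \<open>split_C\<close> are centred, and subtracting it leaves errors quadratic in
      \<open>t\<close>.\<close>
    define lin where "lin c v = \<i> * complex_of_real (w * toll n c) - \<i> * complex_of_real (t * split_C D v)" for c v
    have [measurable]: "b \<in> borel_measurable borel" "Q \<in> borel_measurable borel" unfolding b_def Q_def by measurable
    have ab1: "cmod (a c) = 1" "cmod (b v) = 1" for c v by (simp_all only: a_def b_def norm_exp_i_times)
    have P1: "cmod (P c) \<le> 1" for c unfolding P_def prod_norm[symmetric] by (intro prod_le_1 conjI \<phi>1) auto
    have Q1: "cmod (Q v) \<le> 1" for v unfolding Q_def prod_norm[symmetric] by (intro prod_le_1 conjI \<phi>1) auto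
    have wt: "w * toll n c = t * (toll n c / real n)" for c using n0 by (simp add: t_def)
    have wc: "w * real (c i) = t * (real (c i) / real n)" for c :: "'b \<Rightarrow> nat" and i using n0 by (simp add: t_def)
    have iG: "integrable (joint_law n) (\<lambda>x. a (fst x) * (\<Prod>i\<in>UNIV. G w (fst x i)))"
      by (rule integrable_joint_fst[where F = "\<lambda>c. a c * (\<Prod>i\<in>UNIV. G w (c i))"])
    have iP: "integrable (joint_law n) (\<lambda>x. a (fst x) * P (fst x))"
      by (rule integrable_joint_fst[where F = "\<lambda>c. a c * P c"])
    have iQ: "integrable (joint_law n) (\<lambda>x. b (snd x) * Q (snd x))"
      by (rule integrable_joint_bounded[where B = 1]) (use Q1 ab1 in \<open>auto simp: norm_mult\<close>)
    have il: "integrable (joint_law n) (\<lambda>x. lin (fst x) (snd x))"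
      and l0: "(\<integral>x. lin (fst x) (snd x) \<partial>joint_law n) = 0"
    proof -
      have i1: "integrable (joint_law n) (\<lambda>x. \<i> * complex_of_real (w * toll n (fst x)))"
        by (rule integrable_joint_fst[where F = "\<lambda>c. \<i> * complex_of_real (w * toll n c)"])
      have iC: "integrable (joint_law n) (\<lambda>x. split_C D (snd x))"
        by (rule integrable_joint_bounded[where B = B]) (use BC in auto)
      then have i2: "integrable (joint_law n) (\<lambda>x. \<i> * complex_of_real (t * split_C D (snd x)))"
        by (intro integrable_mult_right integrable_of_real)
      show "integrable (joint_law n) (\<lambda>x. lin (fst x) (snd x))"
        unfolding lin_def using i1 i2 by (rule Bochner_Integration.integrable_diff)
      have "(\<integral>x. split_C D (snd x) \<partial>joint_law n) = 0"
        using integral_joint_snd[of "split_C D" n] integral_split_C by simp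
      then have "(\<integral>x. \<i> * complex_of_real (t * split_C D (snd x)) \<partial>joint_law n) = 0"
        by (simp only: integral_mult_right_zero integral_of_real) simp
      moreover have "(\<integral>x. \<i> * complex_of_real (w * toll n (fst x)) \<partial>joint_law n) = 0"
        using integral_toll[of n] by (simp only: integral_mult_right_zero integral_of_real) simp
      ultimately show "(\<integral>x. lin (fst x) (snd x) \<partial>joint_law n) = 0"
        unfolding lin_def using i1 i2 by (simp only: Bochner_Integration.integral_diff) simp
    qed
    have id: "integrable (joint_law n) (d n)"
    proof (rule integrable_joint_bounded[where B = "\<Sum>i\<in>(UNIV :: 'b set). 1"])
      fix c :: "'b \<Rightarrow> nat" and v assume v: "v \<in> prob_vectors" and c: "c \<in> child_sizes n"
      have "\<bar>real (c i) / real n - v $ i\<bar> \<le> 1" for i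
      proof -
        have "0 \<le> real (c i) / real n" "real (c i) / real n \<le> 1" using c n0 by auto
        then show ?thesis using prob_vectorsD(1,2)[OF v, of i] by linarith
      qed
      then have "d n (c, v) \<le> (\<Sum>i\<in>(UNIV :: 'b set). 1)" unfolding d_def by (intro sum_mono) simp
      moreover have "0 \<le> d n (c, v)" unfolding d_def by (intro sum_nonneg) simp
      ultimately show "norm (d n (c, v)) \<le> (\<Sum>i\<in>(UNIV :: 'b set). 1)" by simp
    qed (simp add: d_def)
    have iT: "integrable (joint_law n) (\<lambda>x. \<bar>toll n (fst x) / real n - split_C D (snd x)\<bar>)"
      using toll_diff_integrable[OF n, of "\<lambda>_. 0" 0] by simp
    have eq: "G w n - \<phi> (w * real n)
      = (\<integral>x. (a (fst x) * (\<Prod>i\<in>UNIV. G w (fst x i)) - a (fst x) * P (fst x)) + ((a (fst x) * P (fst x) - b (snd x) * Q (snd x)) - lin (fst x) (snd x)) \<partial>joint_law n)"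
    proof -
      have "G w n = (\<integral>x. a (fst x) * (\<Prod>i\<in>UNIV. G w (fst x i)) \<partial>joint_law n)"
        unfolding a_def by (rule rec)
      moreover have "\<phi> (w * real n) = (\<integral>x. b (snd x) * Q (snd x) \<partial>joint_law n)"
        using \<phi>fix[of t n] by (simp add: b_def Q_def t_def)
      ultimately show ?thesis using iG iP iQ il l0 by simp
    qed
    have "cmod (G w n - \<phi> (w * real n)) \<le> (\<integral>x. cmod ((a (fst x) * (\<Prod>i\<in>UNIV. G w (fst x i)) - a (fst x) * P (fst x)) + ((a (fst x) * P (fst x) - b (snd x) * Q (snd x)) - lin (fst x) (snd x))) \<partial>joint_law n)"
      unfolding eq by (rule integral_norm_bound)
    also have "\<dots> \<le> (\<integral>x. (\<Sum>i\<in>UNIV. cmod (G w (fst x i) - \<phi> (w * real (fst x i))))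
        + (\<alpha> * \<bar>toll n (fst x) / real n - split_C D (snd x)\<bar> + \<beta> * d n x) * t\<^sup>2 \<partial>joint_law n)"
    proof (rule integral_mono_AE)
      show "integrable (joint_law n) (\<lambda>x. cmod ((a (fst x) * (\<Prod>i\<in>UNIV. G w (fst x i)) - a (fst x) * P (fst x)) + ((a (fst x) * P (fst x) - b (snd x) * Q (snd x)) - lin (fst x) (snd x))))"
        using iG iP iQ il by (intro integrable_norm Bochner_Integration.integrable_add Bochner_Integration.integrable_diff)
      show "integrable (joint_law n) (\<lambda>x. (\<Sum>i\<in>UNIV. cmod (G w (fst x i) - \<phi> (w * real (fst x i))))
        + (\<alpha> * \<bar>toll n (fst x) / real n - split_C D (snd x)\<bar> + \<beta> * d n x) * t\<^sup>2)"
        using id iT integrable_joint_fst[where F = "\<lambda>c. \<Sum>i\<in>UNIV. cmod (G w (c i) - \<phi> (w * real (c i)))"]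
        by (intro Bochner_Integration.integrable_add integrable_mult_left integrable_mult_right)
      show "AE x in joint_law n. cmod ((a (fst x) * (\<Prod>i\<in>UNIV. G w (fst x i)) - a (fst x) * P (fst x)) + ((a (fst x) * P (fst x) - b (snd x) * Q (snd x)) - lin (fst x) (snd x)))
        \<le> (\<Sum>i\<in>UNIV. cmod (G w (fst x i) - \<phi> (w * real (fst x i))))
        + (\<alpha> * \<bar>toll n (fst x) / real n - split_C D (snd x)\<bar> + \<beta> * d n x) * t\<^sup>2"
      proof (rule AE_joint_lawI)
        fix c :: "'b \<Rightarrow> nat" and v assume v: "v \<in> prob_vectors" and c: "s < n \<Longrightarrow> (\<Sum>i\<in>UNIV. c i) = n - s0"
          and cn: "\<And>i. c i \<le> n"
        define e where "e = \<bar>toll n c / real n - split_C D v\<bar>"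
        have x01: "0 \<le> real (c i) / real n" "real (c i) / real n \<le> 1" for i using cn[of i] n0 by auto
        have 1: "cmod (a c * (\<Prod>i\<in>UNIV. G w (c i)) - a c * P c) \<le> (\<Sum>i\<in>UNIV. cmod (G w (c i) - \<phi> (w * real (c i))))"
        proof -
          have "cmod (a c * (\<Prod>i\<in>UNIV. G w (c i)) - a c * P c) = cmod ((\<Prod>i\<in>UNIV. G w (c i)) - P c)"
            by (simp add: norm_mult ab1 flip: right_diff_distrib)
          also have "\<dots> \<le> (\<Sum>i\<in>UNIV. cmod (G w (c i) - \<phi> (w * real (c i))))"
            unfolding P_def by (intro norm_prod_diff G1 \<phi>1)
          finally show ?thesis .
        qed
        have 2: "cmod ((a c - 1 - \<i> * complex_of_real (w * toll n c)) - (b v - 1 - \<i> * complex_of_real (t * split_C D v))) \<le> 4 * B * e * t\<^sup>2"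
        proof -
          have "cmod ((a c - 1 - \<i> * complex_of_real (w * toll n c)) - (b v - 1 - \<i> * complex_of_real (t * split_C D v)))
            \<le> 2 * (\<bar>w * toll n c\<bar> + \<bar>t * split_C D v\<bar>) * \<bar>w * toll n c - t * split_C D v\<bar>"
            unfolding a_def b_def by (rule iexp_linear_diff_bound)
          also have "\<bar>w * toll n c - t * split_C D v\<bar> = \<bar>t\<bar> * e"
            unfolding wt e_def abs_mult[symmetric] by (simp add: right_diff_distrib)
          also have "2 * (\<bar>w * toll n c\<bar> + \<bar>t * split_C D v\<bar>) * (\<bar>t\<bar> * e) \<le> 2 * (\<bar>t\<bar> * B + \<bar>t\<bar> * B) * (\<bar>t\<bar> * e)"
            unfolding wt abs_mult[of t] using Bn[OF n c[OF n]] BC[OF v]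
            by (intro mult_right_mono mult_left_mono add_mono) (auto simp: e_def)
          also have "\<dots> = 4 * B * e * (\<bar>t\<bar> * \<bar>t\<bar>)" by (simp only: algebra_simps)
          finally show ?thesis by (simp add: power2_eq_square)
        qed
        \<comment> \<open>Each factor supplies one power of \<open>t\<close>. For the second one the
          quadratic bound is used when \<open>\<bar>t\<bar> \<le> 1\<close> and the trivial bound 2
          otherwise.\<close>
        have 3: "cmod ((a c - b v) * (P c - 1)) \<le> (\<sigma>2 + 2) * e * t\<^sup>2"
        proof -
          have "cmod (a c - b v) \<le> \<bar>w * toll n c - t * split_C D v\<bar>"
            unfolding a_def b_def by (rule iexp_diff_bound)
          also have "\<dots> = \<bar>t\<bar> * e" unfolding wt e_def abs_mult[symmetric] by (simp add: right_diff_distrib)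
          finally have A: "cmod (a c - b v) \<le> \<bar>t\<bar> * e" .
          have "cmod (P c - 1) = cmod ((\<Prod>i\<in>UNIV. \<phi> (w * real (c i))) - (\<Prod>i\<in>(UNIV :: 'b set). 1))"
            by (simp add: P_def)
          also have "\<dots> \<le> (\<Sum>i\<in>UNIV. cmod (\<phi> (w * real (c i)) - 1))" by (intro norm_prod_diff \<phi>1) simp
          also have "\<dots> \<le> (\<Sum>i\<in>UNIV. \<sigma>2 / 2 * (t * (real (c i) / real n))\<^sup>2)"
            unfolding wc by (intro sum_mono \<phi>q)
          also have "\<dots> = \<sigma>2 / 2 * t\<^sup>2 * square_sum n c"
            by (simp add: square_sum_def sum_distrib_left power_mult_distrib power_divide mult_ac)
          also have "\<dots> \<le> \<sigma>2 / 2 * t\<^sup>2 * 1"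
            using \<sigma>0 square_sum_le_1(2)[of n c] c[OF n] n by (intro mult_left_mono) auto
          finally have q: "cmod (P c - 1) \<le> \<sigma>2 / 2 * t\<^sup>2" by simp
          have p2: "cmod (P c - 1) \<le> 2" using norm_triangle_ineq4[of "P c" 1] P1[of c] by simp
          have "cmod (P c - 1) \<le> (\<sigma>2 + 2) * \<bar>t\<bar>"
          proof (cases "\<bar>t\<bar> \<le> 1")
            case True
            have "t\<^sup>2 = \<bar>t\<bar> * \<bar>t\<bar>" by (simp add: power2_eq_square)
            also have "\<dots> \<le> \<bar>t\<bar> * 1" using True by (intro mult_left_mono) auto
            finally have "\<sigma>2 / 2 * t\<^sup>2 \<le> \<sigma>2 / 2 * \<bar>t\<bar>" using \<sigma>0 by (intro mult_left_mono) auto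
            also have "\<dots> \<le> (\<sigma>2 + 2) * \<bar>t\<bar>" using \<sigma>0 by (intro mult_right_mono) auto
            finally show ?thesis using q by linarith
          next
            case False
            then have "2 * 1 \<le> (\<sigma>2 + 2) * \<bar>t\<bar>" using \<sigma>0 by (intro mult_mono) auto
            then show ?thesis using p2 by linarith
          qed
          then have "cmod ((a c - b v) * (P c - 1)) \<le> (\<bar>t\<bar> * e) * ((\<sigma>2 + 2) * \<bar>t\<bar>)"
            unfolding norm_mult using A by (intro mult_mono) (auto simp: e_def)
          also have "\<dots> = (\<sigma>2 + 2) * e * (\<bar>t\<bar> * \<bar>t\<bar>)" by (simp only: mult_ac)
          finally show ?thesis by (simp add: power2_eq_square)
        qed
        have 4: "cmod (b v * (P c - Q v)) \<le> \<beta> * d n (c, v) * t\<^sup>2"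
        proof -
          have "cmod (b v * (P c - Q v)) = cmod (P c - Q v)" by (simp add: norm_mult ab1)
          also have "\<dots> \<le> (\<Sum>i\<in>UNIV. cmod (\<phi> (t * (real (c i) / real n)) - \<phi> (t * v $ i)))"
            unfolding P_def Q_def wc by (intro norm_prod_diff \<phi>1)
          also have "\<dots> \<le> (\<Sum>i\<in>UNIV. \<beta> * t\<^sup>2 * \<bar>real (c i) / real n - v $ i\<bar>)"
          proof (rule sum_mono)
            fix i
            define x y where "x = real (c i) / real n" and "y = v $ i"
            have xy: "\<bar>x\<bar> \<le> 1" "\<bar>y\<bar> \<le> 1" using x01[of i] prob_vectorsD(1,2)[OF v, of i] by (auto simp: x_def y_def)
            have "cmod (\<phi> (t * x) - \<phi> (t * y)) \<le> \<sigma>2 * (2 * (\<bar>t * x\<bar> + \<bar>t * y\<bar>) * \<bar>t * x - t * y\<bar>)" by (rule \<phi>d)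
            also have "\<dots> = \<sigma>2 * (2 * (\<bar>t\<bar> * \<bar>x\<bar> + \<bar>t\<bar> * \<bar>y\<bar>) * (\<bar>t\<bar> * \<bar>x - y\<bar>))"
              by (simp only: abs_mult right_diff_distrib[symmetric])
            also have "\<dots> \<le> \<sigma>2 * (2 * (\<bar>t\<bar> * 1 + \<bar>t\<bar> * 1) * (\<bar>t\<bar> * \<bar>x - y\<bar>))"
              using \<sigma>0 xy by (intro mult_left_mono mult_right_mono add_mono) auto
            also have "\<dots> = \<beta> * (\<bar>t\<bar> * \<bar>t\<bar>) * \<bar>x - y\<bar>" unfolding \<beta>_def by (simp only: algebra_simps)
            finally show "cmod (\<phi> (t * (real (c i) / real n)) - \<phi> (t * v $ i)) \<le> \<beta> * t\<^sup>2 * \<bar>real (c i) / real n - v $ i\<bar>"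
              by (simp add: x_def y_def power2_eq_square)
          qed
          also have "\<dots> = \<beta> * d n (c, v) * t\<^sup>2" by (simp add: d_def sum_distrib_left mult_ac)
          finally show ?thesis .
        qed
        \<comment> \<open>Arranged so that the exponentials meet their linear parts, and that
          \<open>a c - b v\<close>, which is only of first order, is multiplied by the small
          \<open>P c - 1\<close>.\<close>
        have split: "(a c * P c - b v * Q v) - lin c v
           = ((a c - 1 - \<i> * complex_of_real (w * toll n c)) - (b v - 1 - \<i> * complex_of_real (t * split_C D v)))
             + ((a c - b v) * (P c - 1) + b v * (P c - Q v))"
          unfolding lin_def by (simp add: algebra_simps)
        have "cmod ((a c * P c - b v * Q v) - lin c v) \<le> 4 * B * e * t\<^sup>2 + ((\<sigma>2 + 2) * e * t\<^sup>2 + \<beta> * d n (c, v) * t\<^sup>2)"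
          unfolding split
          by (rule order_trans[OF norm_triangle_ineq add_mono[OF 2 order_trans[OF norm_triangle_ineq add_mono[OF 3 4]]]])
        also have "\<dots> = (\<alpha> * e + \<beta> * d n (c, v)) * t\<^sup>2" by (simp add: \<alpha>_def algebra_simps)
        finally have "cmod ((a c * P c - b v * Q v) - lin c v) \<le> (\<alpha> * e + \<beta> * d n (c, v)) * t\<^sup>2" .
        from order_trans[OF norm_triangle_ineq add_mono[OF 1 this]]
        show "cmod ((a (fst (c, v)) * (\<Prod>i\<in>UNIV. G w (fst (c, v) i)) - a (fst (c, v)) * P (fst (c, v))) + ((a (fst (c, v)) * P (fst (c, v)) - b (snd (c, v)) * Q (snd (c, v))) - lin (fst (c, v)) (snd (c, v))))
          \<le> (\<Sum>i\<in>UNIV. cmod (G w (fst (c, v) i) - \<phi> (w * real (fst (c, v) i))))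
          + (\<alpha> * \<bar>toll n (fst (c, v)) / real n - split_C D (snd (c, v))\<bar> + \<beta> * d n (c, v)) * t\<^sup>2"
          by (simp add: e_def)
      qed
    qed
    also have "\<dots> = (\<integral>x. (\<Sum>i\<in>UNIV. cmod (G w (fst x i) - \<phi> (w * real (fst x i)))) \<partial>joint_law n) + \<epsilon> n * t\<^sup>2"
      using id iT integrable_joint_fst[where F = "\<lambda>c. \<Sum>i\<in>UNIV. cmod (G w (c i) - \<phi> (w * real (c i)))" and n = n]
      by (simp add: \<epsilon>_def)
    finally show ?thesis unfolding t_def .
  qed
  then show ?thesis using lim unfolding \<phi>_def by blast
qed

text \<open>Uniformly in \<open>w\<close>, the distance beyond a threshold in \<open>n\<close> is
  improved by the factor \<open>1 - \<eta> / 2\<close> in each round: the contraction gives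
  \<open>1 - \<eta>\<close>, and half of the gain is spent on the errors. The threshold may depend
  on the round.\<close>

lemma recursive_char_tendsto:
  fixes G :: "real \<Rightarrow> nat \<Rightarrow> complex"
  assumes G1: "\<And>w n. cmod (G w n) \<le> 1"
    and GK: "\<And>w n. cmod (G w n - 1) \<le> K * (w * real n)\<^sup>2"
    and rec: "\<And>w n. G w n = (\<integral>x. iexp (w * toll n (fst x)) * (\<Prod>i\<in>UNIV. G w (fst x i)) \<partial>joint_law n)"
    and L: "fixed_point_law D L"
  shows "(\<lambda>n. G (t / real n) n) \<longlonglongrightarrow> char L t"
proof -
  obtain \<epsilon> where \<epsilon>: "\<epsilon> \<longlonglongrightarrow> 0" and diff: "\<And>n w. s < n \<Longrightarrow> cmod (G w n - char L (w * real n))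
     \<le> (\<integral>x. (\<Sum>i\<in>UNIV. cmod (G w (fst x i) - char L (w * real (fst x i)))) \<partial>joint_law n) + \<epsilon> n * (w * real n)\<^sup>2"
    using recursive_char_difference[OF G1 rec L] by blast
  obtain \<eta> where \<eta>: "0 < \<eta>" "\<eta> \<le> 1" and S: "\<And>n. s < n \<Longrightarrow> (\<integral>x. square_sum n (fst x) \<partial>joint_law n) \<le> 1 - \<eta>"
    using square_sum_contraction by blast
  interpret L: real_distribution L using L by (simp add: fixed_point_law_iff)
  define B where "B = max K 0 + L.expectation (\<lambda>x. x\<^sup>2) / 2 + 1"
  have B0: "0 < B"
  proof -
    have "0 \<le> L.expectation (\<lambda>x. x\<^sup>2)" by (intro Bochner_Integration.integral_nonneg) simp
    moreover have "0 \<le> max K 0" by simp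
    ultimately show ?thesis unfolding B_def by linarith
  qed
  have base: "cmod (G w n - char L (w * real n)) \<le> B * (w * real n)\<^sup>2" for w n
  proof -
    have "cmod (G w n - char L (w * real n)) \<le> cmod (G w n - 1) + cmod (char L (w * real n) - 1)"
      using norm_triangle_ineq4[of "G w n - 1" "char L (w * real n) - 1"] by simp
    also have "\<dots> \<le> K * (w * real n)\<^sup>2 + L.expectation (\<lambda>x. x\<^sup>2) / 2 * (w * real n)\<^sup>2"
      using L by (intro add_mono GK L.char_quadratic_bound) (auto simp: fixed_point_law_iff)
    also have "\<dots> = (K + L.expectation (\<lambda>x. x\<^sup>2) / 2) * (w * real n)\<^sup>2" by (simp add: distrib_right)
    also have "\<dots> \<le> B * (w * real n)\<^sup>2" by (intro mult_right_mono) (auto simp: B_def)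
    finally show ?thesis .
  qed
  have step: "\<exists>N. \<forall>n\<ge>N. \<forall>w. cmod (G w n - char L (w * real n)) \<le> (1 - \<eta> / 2) ^ j * B * (w * real n)\<^sup>2" for j
  proof (induction j)
    case 0
    then show ?case using base by simp
  next
    case (Suc j)
    then obtain N where N: "\<And>n w. N \<le> n \<Longrightarrow> cmod (G w n - char L (w * real n)) \<le> (1 - \<eta> / 2) ^ j * B * (w * real n)\<^sup>2" by blast
    define Bj where "Bj = (1 - \<eta> / 2) ^ j * B"
    have Bj: "0 < Bj" using B0 \<eta> by (simp add: Bj_def)
    \<comment> \<open>The errors relative to \<open>(w * n)^2\<close>. A child with fewer than
      \<open>N\<close> items obeys only the base bound, which is at most
      \<open>B * w^2 * N^2\<close>; the other term comes from
      \<open>recursive_char_difference\<close>.\<close>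
    have "(\<lambda>n. CARD('b) * B * (real N)\<^sup>2 / (real n)\<^sup>2 + \<epsilon> n) \<longlonglongrightarrow> 0 + 0"
      by (intro tendsto_add \<epsilon>) real_asymp
    moreover have "0 + 0 < Bj * (\<eta> / 2)" using Bj \<eta> by simp
    ultimately have "\<forall>\<^sub>F n in sequentially. CARD('b) * B * (real N)\<^sup>2 / (real n)\<^sup>2 + \<epsilon> n < Bj * (\<eta> / 2)"
      by (rule order_tendstoD(2))
    then have "\<forall>\<^sub>F n in sequentially. \<forall>w. cmod (G w n - char L (w * real n)) \<le> (1 - \<eta> / 2) ^ Suc j * B * (w * real n)\<^sup>2"
      using eventually_gt_at_top[of s]
    proof eventually_elim
      case (elim n)
      have n: "s < n" and n0: "0 < real n" using elim by auto
      show ?case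
      proof
        fix w
        have pw: "cmod (G w (c i) - char L (w * real (c i))) \<le> Bj * (w * real n)\<^sup>2 * (real (c i) / real n)\<^sup>2 + B * w\<^sup>2 * (real N)\<^sup>2" for c :: "'b \<Rightarrow> nat" and i
        proof -
          have wc: "w * real (c i) = (w * real n) * (real (c i) / real n)" using n0 by simp
          have eqs: "Bj * (w * real (c i))\<^sup>2 = Bj * (w * real n)\<^sup>2 * (real (c i) / real n)\<^sup>2"
            unfolding wc by (simp only: power_mult_distrib mult.assoc)
          have nn: "0 \<le> B * w\<^sup>2 * (real N)\<^sup>2" "0 \<le> Bj * (w * real n)\<^sup>2 * (real (c i) / real n)\<^sup>2" using B0 Bj by auto
          show ?thesis
          proof (cases "N \<le> c i")
            case True
            have "cmod (G w (c i) - char L (w * real (c i))) \<le> Bj * (w * real (c i))\<^sup>2"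
              using N[OF True, of w] by (simp add: Bj_def)
            then show ?thesis unfolding eqs using nn(1) by linarith
          next
            case False
            have "cmod (G w (c i) - char L (w * real (c i))) \<le> B * (w * real (c i))\<^sup>2" by (rule base)
            also have "\<dots> = B * w\<^sup>2 * (real (c i))\<^sup>2" by (simp add: power_mult_distrib)
            also have "\<dots> \<le> B * w\<^sup>2 * (real N)\<^sup>2" using False B0 by (intro mult_left_mono power_mono) auto
            finally show ?thesis using nn(2) by linarith
          qed
        qed
        have "(\<integral>x. (\<Sum>i\<in>UNIV. cmod (G w (fst x i) - char L (w * real (fst x i)))) \<partial>joint_law n)
          \<le> (\<integral>x. Bj * (w * real n)\<^sup>2 * square_sum n (fst x) + CARD('b) * (B * w\<^sup>2 * (real N)\<^sup>2) \<partial>joint_law n)"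
        proof (rule integral_mono)
          fix x :: "('b \<Rightarrow> nat) \<times> (real ^ 'b)"
          have "(\<Sum>i\<in>UNIV. cmod (G w (fst x i) - char L (w * real (fst x i))))
            \<le> (\<Sum>i\<in>UNIV. Bj * (w * real n)\<^sup>2 * (real (fst x i) / real n)\<^sup>2 + B * w\<^sup>2 * (real N)\<^sup>2)"
            by (intro sum_mono pw)
          also have "\<dots> = Bj * (w * real n)\<^sup>2 * square_sum n (fst x) + CARD('b) * (B * w\<^sup>2 * (real N)\<^sup>2)"
            by (simp add: square_sum_def sum.distrib sum_distrib_left)
          finally show "(\<Sum>i\<in>UNIV. cmod (G w (fst x i) - char L (w * real (fst x i))))
            \<le> Bj * (w * real n)\<^sup>2 * square_sum n (fst x) + CARD('b) * (B * w\<^sup>2 * (real N)\<^sup>2)" .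
        qed (rule integrable_joint_fst[where F = "\<lambda>c. \<Sum>i\<in>UNIV. cmod (G w (c i) - char L (w * real (c i)))"],
             rule integrable_joint_fst[where F = "\<lambda>c. Bj * (w * real n)\<^sup>2 * square_sum n c + CARD('b) * (B * w\<^sup>2 * (real N)\<^sup>2)"])
        also have "\<dots> = Bj * (w * real n)\<^sup>2 * (\<integral>x. square_sum n (fst x) \<partial>joint_law n) + CARD('b) * (B * w\<^sup>2 * (real N)\<^sup>2)"
          using integrable_joint_fst[where F = "square_sum n" and n = n] by (simp add: J.prob_space)
        also have "\<dots> \<le> Bj * (w * real n)\<^sup>2 * (1 - \<eta>) + CARD('b) * (B * w\<^sup>2 * (real N)\<^sup>2)"
          using S[OF n] Bj by (intro add_right_mono mult_left_mono) auto
        also have "CARD('b) * (B * w\<^sup>2 * (real N)\<^sup>2) = CARD('b) * B * (real N)\<^sup>2 / (real n)\<^sup>2 * (w * real n)\<^sup>2"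
          using n0 by (simp add: power_mult_distrib)
        finally have "cmod (G w n - char L (w * real n))
          \<le> Bj * (w * real n)\<^sup>2 * (1 - \<eta>) + CARD('b) * B * (real N)\<^sup>2 / (real n)\<^sup>2 * (w * real n)\<^sup>2 + \<epsilon> n * (w * real n)\<^sup>2"
          using diff[OF n, of w] by linarith
        also have "\<dots> = (Bj * (1 - \<eta>) + (CARD('b) * B * (real N)\<^sup>2 / (real n)\<^sup>2 + \<epsilon> n)) * (w * real n)\<^sup>2"
          by (simp only: algebra_simps)
        also have "\<dots> \<le> (Bj * (1 - \<eta>) + Bj * (\<eta> / 2)) * (w * real n)\<^sup>2"
          using elim(1) by (intro mult_right_mono add_left_mono) auto
        also have "\<dots> = (1 - \<eta> / 2) ^ Suc j * B * (w * real n)\<^sup>2"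
          by (simp add: Bj_def algebra_simps)
        finally show "cmod (G w n - char L (w * real n)) \<le> (1 - \<eta> / 2) ^ Suc j * B * (w * real n)\<^sup>2" .
      qed
    qed
    then show ?case by (simp only: eventually_sequentially)
  qed
  show ?thesis
  proof (rule LIMSEQ_I)
    fix r :: real assume r: "0 < r"
    have "(\<lambda>j. (1 - \<eta> / 2) ^ j * B * t\<^sup>2) \<longlonglongrightarrow> 0 * B * t\<^sup>2"
      using \<eta> by (intro tendsto_intros LIMSEQ_power_zero) auto
    then have "\<forall>\<^sub>F j in sequentially. (1 - \<eta> / 2) ^ j * B * t\<^sup>2 < r" using r by (intro order_tendstoD(2)) auto
    then obtain j where j: "(1 - \<eta> / 2) ^ j * B * t\<^sup>2 < r" by (auto simp: eventually_sequentially)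
    obtain N where N: "\<And>n w. N \<le> n \<Longrightarrow> cmod (G w n - char L (w * real n)) \<le> (1 - \<eta> / 2) ^ j * B * (w * real n)\<^sup>2"
      using step[of j] by blast
    have "norm (G (t / real n) n - char L t) < r" if "max N 1 \<le> n" for n
    proof -
      have "t / real n * real n = t" using that by simp
      then show ?thesis using N[of n "t / real n"] that j by simp
    qed
    then show "\<exists>no. \<forall>n\<ge>no. norm (G (t / real n) n - char L t) < r" by blast
  qed
qed

end

section \<open>The martingale of a split tree\<close>

lemma finite_level [simp]: "finite {u :: 'b::finite list. length u = k}"
  using finite_lists_length_eq[of "UNIV :: 'b set" k] by simp

lemma finite_levels_le [simp]: "finite {u :: 'b::finite list. length u \<le> k}"
  using finite_lists_length_le[of "UNIV :: 'b set" k] by simp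

lemma finite_levels_less [simp]: "finite {u :: 'b::finite list. length u < k}"
  by (rule finite_subset[OF _ finite_levels_le[of k]]) auto

lemma prod_levels_Suc:
  "(\<Prod>u | length u < Suc k. f u) = (\<Prod>u | length u < k. f u) * (\<Prod>u | length u = k. f (u :: 'b::finite list))"
proof -
  have "{u :: 'b list. length u < Suc k} = {u. length u < k} \<union> {u. length u = k}" by auto
  then show ?thesis by (simp add: prod.union_disjoint disjoint_iff)
qed

lemma sum_levels_Suc:
  "(\<Sum>u | length u < Suc k. f u) = (\<Sum>u | length u < k. f u) + (\<Sum>u | length u = k. f (u :: 'b::finite list))"
proof -
  have "{u :: 'b list. length u < Suc k} = {u. length u < k} \<union> {u. length u = k}" by auto
  then show ?thesis by (simp add: sum.union_disjoint disjoint_iff)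
qed

lemma level_Suc_image: "{u :: 'b list. length u = Suc k} = (\<lambda>(u, i). u @ [i]) ` ({u. length u = k} \<times> UNIV)"
proof (intro set_eqI iffI)
  fix u :: "'b list" assume "u \<in> {u. length u = Suc k}"
  then show "u \<in> (\<lambda>(u, i). u @ [i]) ` ({u. length u = k} \<times> UNIV)"
    by (cases u rule: rev_cases) auto
qed auto

lemma inj_snoc: "inj_on (\<lambda>(u, i). u @ [i]) A"
  by (auto simp: inj_on_def)

lemma prod_level_Suc:
  "(\<Prod>u | length u = Suc k. f u) = (\<Prod>u | length u = k. \<Prod>i\<in>UNIV. f (u @ [i :: 'b::finite]))"
  unfolding level_Suc_image prod.reindex[OF inj_snoc]
  by (simp add: prod.cartesian_product case_prod_beta')

lemma sum_level_Suc:
  "(\<Sum>u | length u = Suc k. f u) = (\<Sum>u | length u = k. \<Sum>i\<in>UNIV. f (u @ [i :: 'b::finite]))"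
  unfolding level_Suc_image sum.reindex[OF inj_snoc]
  by (simp add: sum.cartesian_product case_prod_beta')

locale split_tree_model =
  split_parameters D s s0 s1 + split_tree M D s s0 s1 n V N
  for M :: "'a measure" and D :: "(real ^ 'b::finite) measure" and s s0 s1 n :: nat
    and V :: "'b list \<Rightarrow> 'a \<Rightarrow> real ^ 'b" and N :: "'b list \<Rightarrow> 'a \<Rightarrow> nat"
begin

declare V_measurable [measurable] N_measurable [measurable]

definition children :: "'b list \<Rightarrow> 'a \<Rightarrow> 'b \<Rightarrow> nat" where
  "children u \<omega> = (\<lambda>i. N (u @ [i]) \<omega>)"

lemma children_measurable [measurable]: "children u \<in> measurable M (count_space UNIV)"
proof (rule measurable_count_space_eq_countable[THEN iffD2], simp, intro conjI ballI)
  fix c :: "'b \<Rightarrow> nat"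
  have "children u -` {c} \<inter> space M = {\<omega> \<in> space M. \<forall>i. N (u @ [i]) \<omega> = c i}"
    by (auto simp: children_def fun_eq_iff)
  also have "\<dots> \<in> sets M" by measurable
  finally show "children u -` {c} \<inter> space M \<in> sets M" .
qed auto

lemma node_measurable: "(\<lambda>\<omega>. (N u \<omega>, children u \<omega>)) \<in> measurable M (count_space UNIV)"
proof (rule measurable_count_space_eq_countable[THEN iffD2], simp, intro conjI ballI)
  fix p :: "nat \<times> ('b \<Rightarrow> nat)"
  have "(\<lambda>\<omega>. (N u \<omega>, children u \<omega>)) -` {p} \<inter> space M
      = {\<omega> \<in> space M. N u \<omega> = fst p \<and> children u \<omega> = snd p}"
    by (cases p) auto
  also have "\<dots> \<in> sets M" by measurable
  finally show "(\<lambda>\<omega>. (N u \<omega>, children u \<omega>)) -` {p} \<inter> space M \<in> sets M" .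
qed auto

section \<open>Probabilities of finite histories\<close>

definition history_event :: "nat \<Rightarrow> ('b list \<Rightarrow> nat) \<Rightarrow> 'a set" where
  "history_event k \<nu> = {\<omega> \<in> space M. \<forall>u\<in>{u. length u \<le> k}. N u \<omega> = \<nu> u}"

lemma history_event_sets [measurable]: "history_event k \<nu> \<in> sets M"
  unfolding history_event_def by (intro sets.sets_Collect_finite_All) auto

definition path_prob :: "nat \<Rightarrow> ('b list \<Rightarrow> nat) \<Rightarrow> real" where
  "path_prob k \<nu> = of_bool (\<nu> [] = n) * (\<Prod>u | length u < k. offspring_prob (\<nu> u) (\<lambda>i. \<nu> (u @ [i])))"

lemma history_space: "space (split_history M V N k) = space M"
  unfolding split_history_def by (simp add: space_measure_of_conv)

lemma history_sets:
  "sets (split_history M V N k) = sigma_sets (space M)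
     ({V u -` B \<inter> space M | u B. B \<in> sets borel} \<union> {N u -` B \<inter> space M | u B. length u \<le> k})"
  unfolding split_history_def by (rule sets_measure_of) auto

lemma history_subalgebra: "subalgebra M (split_history M V N k)"
  unfolding subalgebra_def history_space history_sets
proof (intro conjI refl sets.sigma_sets_subset)
  show "{V u -` B \<inter> space M | u B. B \<in> sets borel} \<union> {N u -` B \<inter> space M | u B. length u \<le> k} \<subseteq> sets M"
    using measurable_sets[OF V_measurable] measurable_sets[OF N_measurable] by auto
qed

lemma V_history: "V u \<in> borel_measurable (split_history M V N k)"
  by (rule measurableI) (auto simp: history_space history_sets intro!: sigma_sets.Basic)

lemma N_history:
  assumes "length u \<le> k"
  shows "N u \<in> measurable (split_history M V N k) (count_space UNIV)"
proof (rule measurableI)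
  fix B :: "nat set"
  show "N u -` B \<inter> space (split_history M V N k) \<in> sets (split_history M V N k)"
    unfolding history_space history_sets using assms by (intro sigma_sets.Basic UnI2) blast
qed simp

lemma AE_V_prob_vectors: "AE \<omega> in M. V u \<omega> \<in> prob_vectors"
proof -
  have "AE v in distr M borel (V u). v \<in> prob_vectors" using AE_D_prob_vectors by (simp only: V_law)
  then show ?thesis by (subst (asm) AE_distr_iff) (auto simp: prob_vectors_def)
qed

lemma prod_bound_1: "(\<And>u. u \<in> F \<Longrightarrow> \<bar>f u\<bar> \<le> 1) \<Longrightarrow> \<bar>\<Prod>u\<in>F. f u\<bar> \<le> (1 :: real)"
  unfolding abs_prod by (rule prod_le_1) auto

text \<open>The functional form is needed for the induction: conditioning on level \<open>k\<close> turns the event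
  about level \<open>k + 1\<close> into functions of the split vectors at level \<open>k\<close>, which are independent of the history.\<close>

lemma history_expectation:
  fixes \<psi> :: "'b list \<Rightarrow> real ^ 'b \<Rightarrow> real"
  assumes "finite F" "\<And>u. u \<in> F \<Longrightarrow> k \<le> length u"
    and "\<And>u. \<psi> u \<in> borel_measurable borel"
    and "\<And>u v. v \<in> prob_vectors \<Longrightarrow> \<bar>\<psi> u v\<bar> \<le> 1"
  shows "(\<integral>\<omega>. indicator (history_event k \<nu>) \<omega> * (\<Prod>u\<in>F. \<psi> u (V u \<omega>)) \<partial>M)
    = path_prob k \<nu> * (\<Prod>u\<in>F. \<integral>v. \<psi> u v \<partial>D)"
  using assms
proof (induction k arbitrary: F \<psi> \<nu>)
  case 0
  note 0(3)[measurable]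
  have root_eq: "AE \<omega> in M. indicator (history_event 0 \<nu>) \<omega> * (\<Prod>u\<in>F. \<psi> u (V u \<omega>)) = of_bool (\<nu> [] = n) * (\<Prod>u\<in>F. \<psi> u (V u \<omega>))"
    using root AE_space by eventually_elim (auto simp: history_event_def)
  have int: "integrable M (\<lambda>\<omega>. \<psi> u (V u \<omega>))" for u
    by (rule integrable_const_bound[where B = 1]) (use AE_V_prob_vectors[of u] 0(4) in auto)
  have "(\<integral>\<omega>. indicator (history_event 0 \<nu>) \<omega> * (\<Prod>u\<in>F. \<psi> u (V u \<omega>)) \<partial>M) = of_bool (\<nu> [] = n) * (\<integral>\<omega>. (\<Prod>u\<in>F. \<psi> u (V u \<omega>)) \<partial>M)"
    by (subst integral_cong_AE[OF _ _ root_eq]) auto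
  also have "(\<integral>\<omega>. (\<Prod>u\<in>F. \<psi> u (V u \<omega>)) \<partial>M) = (\<Prod>u\<in>F. \<integral>\<omega>. \<psi> u (V u \<omega>) \<partial>M)"
  proof (rule indep_vars_lebesgue_integral[OF 0(1) _ int])
    show "indep_vars (\<lambda>_. borel) (\<lambda>u \<omega>. \<psi> u (V u \<omega>)) F"
      by (rule indep_vars_compose2[OF indep_vars_subset[OF V_indep]]) (use 0(3) in auto)
  qed
  also have "\<dots> = (\<Prod>u\<in>F. \<integral>v. \<psi> u v \<partial>D)"
  proof (rule prod.cong)
    fix u
    have "(\<integral>v. \<psi> u v \<partial>D) = (\<integral>v. \<psi> u v \<partial>distr M borel (V u))" by (simp add: V_law)
    also have "\<dots> = (\<integral>\<omega>. \<psi> u (V u \<omega>) \<partial>M)" by (rule integral_distr) auto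
    finally show "(\<integral>\<omega>. \<psi> u (V u \<omega>) \<partial>M) = (\<integral>v. \<psi> u v \<partial>D)" ..
  qed simp
  finally show ?case by (simp add: path_prob_def)
next
  case (Suc k)
  note Suc.prems(3)[measurable]
  interpret S: finite_measure_subalgebra M "split_history M V N k"
    by unfold_locales (rule history_subalgebra)
  define A where "A = {\<omega> \<in> space M. \<forall>u i. length u = k \<longrightarrow> N (u @ [i]) \<omega> = \<nu> (u @ [i])}"
  have A [measurable]: "A \<in> sets M"
  proof -
    have "A = {\<omega> \<in> space M. \<forall>u\<in>{u. length u = k}. \<forall>i\<in>UNIV. N (u @ [i]) \<omega> = \<nu> (u @ [i])}" by (auto simp: A_def)
    also have "\<dots> \<in> sets M" by (intro sets.sets_Collect_finite_All finite_level) auto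
    finally show ?thesis .
  qed
  have hist: "history_event (Suc k) \<nu> = history_event k \<nu> \<inter> A"
  proof (intro set_eqI iffI)
    fix \<omega> assume h: "\<omega> \<in> history_event k \<nu> \<inter> A"
    show "\<omega> \<in> history_event (Suc k) \<nu>"
      unfolding history_event_def
    proof (intro CollectI conjI ballI)
      show "\<omega> \<in> space M" using h by (simp add: A_def)
      fix u :: "'b list" assume "u \<in> {u. length u \<le> Suc k}"
      then show "N u \<omega> = \<nu> u" using h
        by (cases u rule: rev_cases) (auto simp: history_event_def A_def le_Suc_eq)
    qed
  qed (auto simp: history_event_def A_def)
  define f where "f \<omega> = indicator (history_event k \<nu>) \<omega> * (\<Prod>u\<in>F. \<psi> u (V u \<omega>))" for \<omega>
  \<comment> \<open>\<open>f\<close> involves split vectors, all of which belong to the history, and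
    cardinalities down to depth \<open>k\<close>. It can therefore be taken out of the conditional
    expectation.\<close>
  have f_meas: "f \<in> borel_measurable (split_history M V N k)"
  proof -
    have "history_event k \<nu> \<in> sets (split_history M V N k)"
    proof -
      have "{\<omega> \<in> space (split_history M V N k). \<forall>u\<in>{u. length u \<le> k}. N u \<omega> = \<nu> u} \<in> sets (split_history M V N k)"
      proof (intro sets.sets_Collect_finite_All finite_levels_le)
        fix u :: "'b list" assume "u \<in> {u. length u \<le> k}"
        then have [measurable]: "N u \<in> measurable (split_history M V N k) (count_space UNIV)" by (intro N_history) simp
        show "{\<omega> \<in> space (split_history M V N k). N u \<omega> = \<nu> u} \<in> sets (split_history M V N k)" by measurable
      qed
      then show ?thesis unfolding history_event_def history_space .
    qed
    moreover have "(\<lambda>\<omega>. \<psi> u (V u \<omega>)) \<in> borel_measurable (split_history M V N k)" for u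
      by (rule measurable_compose[OF V_history Suc.prems(3)])
    ultimately show ?thesis unfolding f_def
      by (intro borel_measurable_times borel_measurable_indicator borel_measurable_prod)
  qed
  have bound: "AE \<omega> in M. norm (f \<omega> * indicator A \<omega>) \<le> 1"
  proof -
    have "AE \<omega> in M. \<forall>u\<in>F. V u \<omega> \<in> prob_vectors"
      using Suc.prems(1) AE_V_prob_vectors by (simp add: AE_finite_all)
    then show ?thesis
    proof eventually_elim
      case (elim \<omega>)
      have "\<bar>\<Prod>u\<in>F. \<psi> u (V u \<omega>)\<bar> \<le> 1" by (rule prod_bound_1) (use elim Suc.prems(4) in auto)
      then show ?case by (auto simp: f_def indicator_def)
    qed
  qed
  have [measurable]: "f \<in> borel_measurable M"
    by (rule measurable_from_subalg[OF history_subalgebra f_meas])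
  have int: "integrable M (\<lambda>\<omega>. f \<omega> * indicator A \<omega>)"
    by (rule integrable_const_bound[OF bound]) measurable
  \<comment> \<open>On the history event the factor of a node \<open>u\<close> at depth
    \<open>k\<close> in \<open>children_law\<close> depends on \<open>V u\<close> alone, so it joins
    the functions to which the induction hypothesis applies.\<close>
  define \<psi>' where "\<psi>' u = (if length u = k then (\<lambda>v. child_prob s s0 s1 (\<nu> u) v (\<lambda>i. \<nu> (u @ [i]))) else \<psi> u)" for u
  let ?L = "{u :: 'b list. length u = k}"
  have disj: "F \<inter> ?L = {}" using Suc.prems(2) by fastforce
  have F\<psi>': "\<psi>' u = \<psi> u" if "u \<in> F" for u using that Suc.prems(2)[OF that] by (simp add: \<psi>'_def)
  have "(\<integral>\<omega>. indicator (history_event (Suc k) \<nu>) \<omega> * (\<Prod>u\<in>F. \<psi> u (V u \<omega>)) \<partial>M) = (\<integral>\<omega>. f \<omega> * indicator A \<omega> \<partial>M)"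
    unfolding hist f_def by (rule Bochner_Integration.integral_cong) (auto simp: indicator_def)
  also have "\<dots> = (\<integral>\<omega>. f \<omega> * real_cond_exp M (split_history M V N k) (indicator A) \<omega> \<partial>M)"
    by (rule S.real_cond_exp_intg(2)[symmetric, OF int f_meas]) simp
  also have "\<dots> = (\<integral>\<omega>. indicator (history_event k \<nu>) \<omega> * (\<Prod>u\<in>F \<union> ?L. \<psi>' u (V u \<omega>)) \<partial>M)"
  proof (rule integral_cong_AE)
    show "(\<lambda>\<omega>. f \<omega> * real_cond_exp M (split_history M V N k) (indicator A) \<omega>) \<in> borel_measurable M" by measurable
    show "(\<lambda>\<omega>. indicator (history_event k \<nu>) \<omega> * (\<Prod>u\<in>F \<union> ?L. \<psi>' u (V u \<omega>))) \<in> borel_measurable M"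
    proof -
      have "\<psi>' u \<in> borel_measurable borel" for u unfolding \<psi>'_def using Suc.prems(3) by auto
      note this[measurable]
      show ?thesis by measurable
    qed
    have "AE \<omega> in M. real_cond_exp M (split_history M V N k) (indicator A) \<omega>
        = (\<Prod>u | length u = k. child_prob s s0 s1 (N u \<omega>) (V u \<omega>) (\<lambda>i. \<nu> (u @ [i])))"
      unfolding A_def by (rule children_law[of k "\<lambda>u i. \<nu> (u @ [i])"])
    then show "AE \<omega> in M. f \<omega> * real_cond_exp M (split_history M V N k) (indicator A) \<omega>
        = indicator (history_event k \<nu>) \<omega> * (\<Prod>u\<in>F \<union> ?L. \<psi>' u (V u \<omega>))"
    proof eventually_elim
      case (elim \<omega>)
      show ?case
      proof (cases "\<omega> \<in> history_event k \<nu>")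
        case True
        have "(\<Prod>u\<in>F \<union> ?L. \<psi>' u (V u \<omega>)) = (\<Prod>u\<in>F. \<psi>' u (V u \<omega>)) * (\<Prod>u\<in>?L. \<psi>' u (V u \<omega>))"
          using Suc.prems(1) disj by (intro prod.union_disjoint) auto
        also have "(\<Prod>u\<in>F. \<psi>' u (V u \<omega>)) = (\<Prod>u\<in>F. \<psi> u (V u \<omega>))"
          by (rule prod.cong) (simp_all add: F\<psi>')
        also have "(\<Prod>u\<in>?L. \<psi>' u (V u \<omega>)) = (\<Prod>u | length u = k. child_prob s s0 s1 (N u \<omega>) (V u \<omega>) (\<lambda>i. \<nu> (u @ [i])))"
          by (rule prod.cong) (use True in \<open>auto simp: \<psi>'_def history_event_def\<close>)
        finally show ?thesis unfolding elim f_def using True by simp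
      qed (simp add: f_def)
    qed
  qed
  also have "\<dots> = path_prob k \<nu> * (\<Prod>u\<in>F \<union> ?L. \<integral>v. \<psi>' u v \<partial>D)"
  proof (rule Suc.IH)
    show "finite (F \<union> ?L)" using Suc.prems(1) by simp
    show "k \<le> length u" if "u \<in> F \<union> ?L" for u using that Suc.prems(2)[of u] by auto
    show "\<psi>' u \<in> borel_measurable borel" for u unfolding \<psi>'_def using Suc.prems(3) by auto
    show "\<bar>\<psi>' u v\<bar> \<le> 1" if "v \<in> prob_vectors" for u v
      using child_prob_le_1[OF that] child_prob_vector_nonneg[OF that] Suc.prems(4)[OF that] by (simp add: \<psi>'_def)
  qed
  also have "(\<Prod>u\<in>F \<union> ?L. \<integral>v. \<psi>' u v \<partial>D) = (\<Prod>u\<in>F. \<integral>v. \<psi>' u v \<partial>D) * (\<Prod>u\<in>?L. \<integral>v. \<psi>' u v \<partial>D)"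
    using Suc.prems(1) disj by (intro prod.union_disjoint) auto
  also have "(\<Prod>u\<in>F. \<integral>v. \<psi>' u v \<partial>D) = (\<Prod>u\<in>F. \<integral>v. \<psi> u v \<partial>D)"
    by (rule prod.cong) (simp_all add: F\<psi>')
  also have "(\<Prod>u\<in>?L. \<integral>v. \<psi>' u v \<partial>D) = (\<Prod>u\<in>?L. offspring_prob (\<nu> u) (\<lambda>i. \<nu> (u @ [i])))"
    by (rule prod.cong) (simp_all add: \<psi>'_def offspring_prob_def)
  finally show ?case by (simp add: path_prob_def prod_levels_Suc)
qed

lemma prob_history_event: "prob (history_event k \<nu>) = path_prob k \<nu>"
  using history_expectation[of "{}" k "\<lambda>_ _. 0" \<nu>] by simp

text \<open>A history of probability 0 is a null event, and for each depth there are only countably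
  many histories. This yields one null set outside of which all splits obey the deterministic rules
  of \<open>offspring_support\<close>.\<close>

lemma AE_history_positive:
  "AE \<omega> in M. N [] \<omega> = n \<and> (\<forall>u. offspring_prob (N u \<omega>) (children u \<omega>) \<noteq> 0)"
proof -
  have "AE \<omega> in M. path_prob k (\<lambda>u. N u \<omega>) \<noteq> 0" for k
  proof -
    \<comment> \<open>Extensional functions on finitely many nodes: they represent every history,
      and there are countably many of them.\<close>
    let ?S = "PiE {u :: 'b list. length u \<le> k} (\<lambda>_. UNIV :: nat set)"
    have "countable ?S" by (rule countable_PiE) auto
    moreover have "AE \<omega> in M. path_prob k \<nu> = 0 \<longrightarrow> \<omega> \<notin> history_event k \<nu>" for \<nu>
    proof (cases "path_prob k \<nu> = 0")
      case True
      then have "history_event k \<nu> \<in> null_sets M"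
        using prob_history_event[of k \<nu>] by (auto simp: null_sets_def emeasure_eq_measure)
      from AE_not_in[OF this] show ?thesis by simp
    qed simp
    ultimately have "AE \<omega> in M. \<forall>\<nu>\<in>?S. path_prob k \<nu> = 0 \<longrightarrow> \<omega> \<notin> history_event k \<nu>"
      by (simp add: AE_ball_countable)
    then show ?thesis using AE_space
    proof eventually_elim
      case (elim \<omega>)
      define \<nu> where "\<nu> = restrict (\<lambda>u. N u \<omega>) {u. length u \<le> k}"
      have "\<nu> \<in> ?S" "\<omega> \<in> history_event k \<nu>" using elim(2) by (auto simp: \<nu>_def history_event_def)
      with elim(1) have "path_prob k \<nu> \<noteq> 0" by blast
      also have "path_prob k \<nu> = path_prob k (\<lambda>u. N u \<omega>)"
        unfolding path_prob_def by (intro arg_cong2[where f = "(*)"] prod.cong) (auto simp: \<nu>_def)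
      finally show ?case .
    qed
  qed
  then have "AE \<omega> in M. \<forall>k. path_prob k (\<lambda>u. N u \<omega>) \<noteq> 0" by (simp add: AE_all_countable)
  then show ?thesis
  proof eventually_elim
    case (elim \<omega>)
    have "offspring_prob (N u \<omega>) (children u \<omega>) \<noteq> 0" for u
    proof
      assume 0: "offspring_prob (N u \<omega>) (children u \<omega>) = 0"
      have "(\<Prod>w | length w < Suc (length u). offspring_prob (N w \<omega>) (children w \<omega>)) = 0"
        by (rule prod_zero) (use 0 in auto)
      then show False using spec[OF elim, of "Suc (length u)"] by (simp add: path_prob_def children_def)
    qed
    then show ?case using spec[OF elim, of 0] by (simp add: path_prob_def)
  qed
qed

definition typical :: "'a \<Rightarrow> bool" where
  "typical \<omega> \<longleftrightarrow> \<omega> \<in> space M \<and> N [] \<omega> = n \<and> (\<forall>u. offspring_prob (N u \<omega>) (children u \<omega>) \<noteq> 0)"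

lemma AE_typical: "AE \<omega> in M. typical \<omega>"
  using AE_history_positive AE_space by eventually_elim (simp add: typical_def)

lemma typical_N_le: "typical \<omega> \<Longrightarrow> N u \<omega> \<le> n"
proof (induction u rule: rev_induct)
  case (snoc i u)
  have "children u \<omega> i \<le> N u \<omega>"
    using snoc.prems by (intro offspring_support(4)) (simp add: typical_def)
  then show ?case using snoc by (simp add: children_def)
qed (simp add: typical_def)

lemma typical_children: "typical \<omega> \<Longrightarrow> children u \<omega> \<in> child_sizes n"
  using typical_N_le[of \<omega>] by (auto simp: children_def)

lemma prob_history_children:
  "prob (history_event k \<nu> \<inter> {\<omega> \<in> space M. \<forall>u\<in>{u. length u = k}. children u \<omega> = c u})
    = prob (history_event k \<nu>) * (\<Prod>u | length u = k. offspring_prob (\<nu> u) (c u))"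
proof -
  \<comment> \<open>A configuration down to depth \<open>Suc k\<close>: a node on the last level
    reads its value from its parent \<open>butlast u\<close> and its child index
    \<open>last u\<close>.\<close>
  define \<nu>' where "\<nu>' u = (if length u \<le> k then \<nu> u else c (butlast u) (last u))" for u
  have "history_event k \<nu> \<inter> {\<omega> \<in> space M. \<forall>u\<in>{u. length u = k}. children u \<omega> = c u} = history_event (Suc k) \<nu>'"
  proof (intro set_eqI iffI)
    fix \<omega> assume h: "\<omega> \<in> history_event k \<nu> \<inter> {\<omega> \<in> space M. \<forall>u\<in>{u. length u = k}. children u \<omega> = c u}"
    show "\<omega> \<in> history_event (Suc k) \<nu>'"
      unfolding history_event_def
    proof (intro CollectI conjI ballI)
      show "\<omega> \<in> space M" using h by blast
      fix u :: "'b list" assume u: "u \<in> {u. length u \<le> Suc k}"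
      show "N u \<omega> = \<nu>' u"
      proof (cases "length u \<le> k")
        case True
        then show ?thesis using h by (simp add: history_event_def \<nu>'_def)
      next
        case False
        then obtain w i where w: "u = w @ [i]" "length w = k" using u by (cases u rule: rev_cases) auto
        then have "children w \<omega> = c w" using h by simp
        then show ?thesis using w by (simp add: \<nu>'_def children_def fun_eq_iff)
      qed
    qed
  next
    fix \<omega> assume h: "\<omega> \<in> history_event (Suc k) \<nu>'"
    then have "N (u @ [i]) \<omega> = c u i" if "length u = k" for u i
      using that by (auto simp: history_event_def \<nu>'_def dest: bspec[of _ _ "u @ [i]"])
    then show "\<omega> \<in> history_event k \<nu> \<inter> {\<omega> \<in> space M. \<forall>u\<in>{u. length u = k}. children u \<omega> = c u}"
      using h by (auto simp: history_event_def \<nu>'_def children_def fun_eq_iff)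
  qed
  then have "prob (history_event k \<nu> \<inter> {\<omega> \<in> space M. \<forall>u\<in>{u. length u = k}. children u \<omega> = c u}) = path_prob (Suc k) \<nu>'"
    by (simp add: prob_history_event)
  also have "\<dots> = path_prob k \<nu>' * (\<Prod>u | length u = k. offspring_prob (\<nu>' u) (\<lambda>i. \<nu>' (u @ [i])))"
    by (simp add: path_prob_def prod_levels_Suc)
  also have "(\<Prod>u | length u = k. offspring_prob (\<nu>' u) (\<lambda>i. \<nu>' (u @ [i]))) = (\<Prod>u | length u = k. offspring_prob (\<nu> u) (c u))"
    by (rule prod.cong) (auto simp: \<nu>'_def)
  also have "path_prob k \<nu>' = path_prob k \<nu>"
    unfolding path_prob_def by (intro arg_cong2[where f = "(*)"] prod.cong) (auto simp: \<nu>'_def)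
  finally show ?thesis by (simp add: prob_history_event)
qed

lemma integral_indicator_scaleR:
  fixes x :: "'f::{banach, second_countable_topology}"
  assumes "A \<in> sets M"
  shows "integrable M (\<lambda>\<omega>. indicator A \<omega> *\<^sub>R x)" "(\<integral>\<omega>. indicator A \<omega> *\<^sub>R x \<partial>M) = prob A *\<^sub>R x"
proof -
  have i: "integrable M (indicator A :: _ \<Rightarrow> real)"
    by (rule integrable_real_indicator) (use assms in \<open>auto simp: emeasure_eq_measure\<close>)
  then show "integrable M (\<lambda>\<omega>. indicator A \<omega> *\<^sub>R x)" by (intro integrable_scaleR_left)
  show "(\<integral>\<omega>. indicator A \<omega> *\<^sub>R x \<partial>M) = prob A *\<^sub>R x"
    using assms i by (subst integral_scaleR_left) auto
qed

text \<open>Conditional independence of the splits on one level, in integrated form. Typical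
  cardinalities are at most \<open>n\<close>, so the finite range \<open>child_sizes n\<close>
  serves all nodes of the level.\<close>

lemma expectation_children_given_history:
  fixes \<Phi> :: "'b list \<Rightarrow> ('b \<Rightarrow> nat) \<Rightarrow> 'f::{real_normed_field, banach, second_countable_topology}"
  shows "(\<integral>\<omega>. indicator (history_event k \<nu>) \<omega> *\<^sub>R (\<Prod>u | length u = k. \<Phi> u (children u \<omega>)) \<partial>M)
    = prob (history_event k \<nu>) *\<^sub>R (\<Prod>u | length u = k. \<Sum>c\<in>child_sizes n. of_real (offspring_prob (\<nu> u) c) * \<Phi> u c)"
proof -
  let ?L = "{u :: 'b list. length u = k}"
  let ?S = "PiE ?L (\<lambda>_. child_sizes n)"
  define A where "A c = history_event k \<nu> \<inter> {\<omega> \<in> space M. \<forall>u\<in>?L. children u \<omega> = c u}" for c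
  have A [measurable]: "A c \<in> sets M" for c
  proof -
    have "{\<omega> \<in> space M. \<forall>u\<in>?L. children u \<omega> = c u} \<in> sets M"
    proof (intro sets.sets_Collect_finite_All finite_level)
      fix u :: "'b list"
      show "{\<omega> \<in> space M. children u \<omega> = c u} \<in> sets M" by measurable
    qed
    then show ?thesis unfolding A_def by (intro sets.Int history_event_sets)
  qed
  have fin: "finite ?S" by (intro finite_PiE) auto
  have eq: "AE \<omega> in M. indicator (history_event k \<nu>) \<omega> *\<^sub>R (\<Prod>u\<in>?L. \<Phi> u (children u \<omega>))
     = (\<Sum>c\<in>?S. indicator (A c) \<omega> *\<^sub>R (\<Prod>u\<in>?L. \<Phi> u (c u)))"
    using AE_typical
  proof eventually_elim
    case (elim \<omega>)
    define c0 where "c0 = restrict (\<lambda>u. children u \<omega>) ?L"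
    have c0: "c0 \<in> ?S" using typical_children[OF elim] by (auto simp: c0_def)
    have "(\<Sum>c\<in>?S. indicator (A c) \<omega> *\<^sub>R (\<Prod>u\<in>?L. \<Phi> u (c u))) = (\<Sum>c\<in>{c0}. indicator (A c) \<omega> *\<^sub>R (\<Prod>u\<in>?L. \<Phi> u (c u)))"
    proof (rule sum.mono_neutral_right[OF fin])
      show "\<forall>c\<in>?S - {c0}. indicator (A c) \<omega> *\<^sub>R (\<Prod>u\<in>?L. \<Phi> u (c u)) = 0"
      proof
        fix c assume c: "c \<in> ?S - {c0}"
        have "\<omega> \<notin> A c"
        proof
          assume "\<omega> \<in> A c"
          then have "c = c0" using c by (intro extensionalityI[of _ ?L]) (auto simp: A_def c0_def PiE_def)
          with c show False by simp
        qed
        then show "indicator (A c) \<omega> *\<^sub>R (\<Prod>u\<in>?L. \<Phi> u (c u)) = 0" by simp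
      qed
    qed (use c0 in simp)
    also have "\<dots> = indicator (history_event k \<nu>) \<omega> *\<^sub>R (\<Prod>u\<in>?L. \<Phi> u (children u \<omega>))"
    proof -
      have "indicator (A c0) \<omega> = (indicator (history_event k \<nu>) \<omega> :: real)"
        using elim by (auto simp: A_def c0_def typical_def indicator_def)
      then show ?thesis by (simp add: c0_def)
    qed
    finally show ?case ..
  qed
  have "(\<integral>\<omega>. indicator (history_event k \<nu>) \<omega> *\<^sub>R (\<Prod>u\<in>?L. \<Phi> u (children u \<omega>)) \<partial>M)
    = (\<integral>\<omega>. (\<Sum>c\<in>?S. indicator (A c) \<omega> *\<^sub>R (\<Prod>u\<in>?L. \<Phi> u (c u))) \<partial>M)"
    by (rule integral_cong_AE[OF _ _ eq]) measurable
  also have "\<dots> = (\<Sum>c\<in>?S. prob (A c) *\<^sub>R (\<Prod>u\<in>?L. \<Phi> u (c u)))"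
    by (subst Bochner_Integration.integral_sum) (auto simp: integral_indicator_scaleR)
  also have "\<dots> = (\<Sum>c\<in>?S. prob (history_event k \<nu>) *\<^sub>R (\<Prod>u\<in>?L. of_real (offspring_prob (\<nu> u) (c u)) * \<Phi> u (c u)))"
    unfolding A_def prob_history_children by (simp add: prod.distrib scaleR_conv_of_real mult_ac)
  also have "\<dots> = prob (history_event k \<nu>) *\<^sub>R (\<Prod>u\<in>?L. \<Sum>c\<in>child_sizes n. of_real (offspring_prob (\<nu> u) c) * \<Phi> u c)"
    by (subst prod_sum_PiE) (auto simp: scaleR_sum_right)
  finally show ?thesis .
qed

section \<open>Averaging out one level of the tree\<close>

definition history :: "nat \<Rightarrow> 'a \<Rightarrow> 'b list \<Rightarrow> nat" where
  "history k \<omega> = restrict (\<lambda>u. N u \<omega>) {u. length u \<le> k}"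

definition offspring_mean :: "(('b \<Rightarrow> nat) \<Rightarrow> 'f::{real_normed_field, banach, second_countable_topology}) \<Rightarrow> nat \<Rightarrow> 'f" where
  "offspring_mean F m = (\<Sum>c\<in>child_sizes m. of_real (offspring_prob m c) * F c)"

lemma offspring_mean_larger:
  assumes "m \<le> n"
  shows "(\<Sum>c\<in>child_sizes n. of_real (offspring_prob m c) * F c) = offspring_mean F m"
  unfolding offspring_mean_def
  by (rule sum.mono_neutral_right) (use assms offspring_support(4)[of m] in \<open>auto intro: le_trans\<close>)

text \<open>Takes the place of conditioning on the first \<open>k\<close> levels: the nodes of level
  \<open>k\<close> are replaced by their one-step means while an arbitrary function of the history
  is kept. Typically only finitely many histories occur, so the statement reduces to single history
  events.\<close>

lemma expectation_peel_level:
  fixes h :: "('b list \<Rightarrow> nat) \<Rightarrow> 'f::{real_normed_field, banach, second_countable_topology}"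
    and \<Phi> :: "'b list \<Rightarrow> nat \<Rightarrow> ('b \<Rightarrow> nat) \<Rightarrow> 'f"
  shows "(\<integral>\<omega>. h (history k \<omega>) * (\<Prod>u | length u = k. \<Phi> u (N u \<omega>) (children u \<omega>)) \<partial>M)
    = (\<integral>\<omega>. h (history k \<omega>) * (\<Prod>u | length u = k. offspring_mean (\<Phi> u (N u \<omega>)) (N u \<omega>)) \<partial>M)"
    and "integrable M (\<lambda>\<omega>. h (history k \<omega>) * (\<Prod>u | length u = k. \<Phi> u (N u \<omega>) (children u \<omega>)))"
proof -
  let ?L = "{u :: 'b list. length u = k}"
  let ?S = "PiE {u :: 'b list. length u \<le> k} (\<lambda>_. {..n})"
  have fin: "finite ?S" by (intro finite_PiE) auto
  have decomp: "G (history k \<omega>) \<omega> = (\<Sum>\<nu>\<in>?S. indicator (history_event k \<nu>) \<omega> *\<^sub>R G \<nu> \<omega>)"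
    if "typical \<omega>" for G :: "('b list \<Rightarrow> nat) \<Rightarrow> 'a \<Rightarrow> 'f" and \<omega>
  proof -
    have \<nu>0: "history k \<omega> \<in> ?S" using typical_N_le[OF that] by (auto simp: history_def)
    have "(\<Sum>\<nu>\<in>?S. indicator (history_event k \<nu>) \<omega> *\<^sub>R G \<nu> \<omega>) = (\<Sum>\<nu>\<in>{history k \<omega>}. indicator (history_event k \<nu>) \<omega> *\<^sub>R G \<nu> \<omega>)"
    proof (rule sum.mono_neutral_right[OF fin])
      show "\<forall>\<nu>\<in>?S - {history k \<omega>}. indicator (history_event k \<nu>) \<omega> *\<^sub>R G \<nu> \<omega> = 0"
      proof
        fix \<nu> assume \<nu>: "\<nu> \<in> ?S - {history k \<omega>}"
        have "\<omega> \<notin> history_event k \<nu>"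
        proof
          assume "\<omega> \<in> history_event k \<nu>"
          then have "\<nu> = history k \<omega>" using \<nu>
            by (intro extensionalityI[of _ "{u. length u \<le> k}"]) (auto simp: history_event_def history_def PiE_def)
          with \<nu> show False by simp
        qed
        then show "indicator (history_event k \<nu>) \<omega> *\<^sub>R G \<nu> \<omega> = 0" by simp
      qed
    qed (use \<nu>0 in simp)
    moreover have "\<omega> \<in> history_event k (history k \<omega>)"
      using that by (simp add: history_event_def history_def typical_def)
    ultimately show ?thesis by simp
  qed
  define W where "W \<nu> \<omega> = h \<nu> * (\<Prod>u\<in>?L. \<Phi> u (\<nu> u) (children u \<omega>))" for \<nu> \<omega>
  define R where "R \<nu> = h \<nu> * (\<Prod>u\<in>?L. offspring_mean (\<Phi> u (\<nu> u)) (\<nu> u))" for \<nu>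
  \<comment> \<open>The type of all functions on nodes is uncountable, but restricted histories take
    only countably many values, and their fibres are history events.\<close>
  have meas: "history k \<in> measurable M (count_space UNIV)"
  proof (rule measurableI)
    fix B :: "('b list \<Rightarrow> nat) set"
    let ?R = "range (history k) \<inter> B"
    have "history k \<omega> = \<nu>" if "\<nu> \<in> range (history k)" "\<omega> \<in> history_event k \<nu>" for \<nu> \<omega>
    proof -
      from that(1) obtain \<omega>0 where "\<nu> = history k \<omega>0" by blast
      then show ?thesis using that(2) by (auto simp: history_event_def history_def fun_eq_iff)
    qed
    moreover have "\<omega> \<in> history_event k (history k \<omega>)" if "\<omega> \<in> space M" for \<omega>
      using that by (simp add: history_event_def history_def)
    moreover have "history_event k \<nu> \<subseteq> space M" for \<nu> by (auto simp: history_event_def)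
    ultimately have "history k -` B \<inter> space M = (\<Union>\<nu>\<in>?R. history_event k \<nu>)" by blast
    also have "\<dots> \<in> sets M"
    proof (rule sets.countable_UN'')
      have "range (history k) \<subseteq> PiE {u :: 'b list. length u \<le> k} (\<lambda>_. UNIV)"
        by (intro image_subsetI) (simp add: history_def restrict_PiE_iff)
      then have "countable (range (history k))" by (rule countable_subset) (intro countable_PiE, auto)
      then show "countable ?R" by (rule countable_subset[rotated]) auto
    qed simp
    finally show "history k -` B \<inter> space M \<in> sets M" .
  qed simp
  have iW: "integrable M (\<lambda>\<omega>. indicator (history_event k \<nu>) \<omega> *\<^sub>R W \<nu> \<omega>)" for \<nu>
  proof (rule integrable_const_bound)
    define B where "B = (\<Sum>c\<in>PiE ?L (\<lambda>_. child_sizes n). norm (h \<nu> * (\<Prod>u\<in>?L. \<Phi> u (\<nu> u) (c u))))"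
    show "AE \<omega> in M. norm (indicator (history_event k \<nu>) \<omega> *\<^sub>R W \<nu> \<omega>) \<le> B"
      using AE_typical
    proof eventually_elim
      case (elim \<omega>)
      let ?c = "restrict (\<lambda>u. children u \<omega>) ?L"
      have "norm (h \<nu> * (\<Prod>u\<in>?L. \<Phi> u (\<nu> u) (?c u))) \<le> B"
        unfolding B_def
        by (rule member_le_sum[where f = "\<lambda>c. norm (h \<nu> * (\<Prod>u\<in>?L. \<Phi> u (\<nu> u) (c u)))"])
           (use typical_children[OF elim] in \<open>auto intro!: finite_PiE\<close>)
      then have "norm (W \<nu> \<omega>) \<le> B" by (simp add: W_def)
      moreover have "norm (indicator (history_event k \<nu>) \<omega> *\<^sub>R W \<nu> \<omega>) \<le> norm (W \<nu> \<omega>)"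
        by (simp add: indicator_def)
      ultimately show ?case by linarith
    qed
    show "(\<lambda>\<omega>. indicator (history_event k \<nu>) \<omega> *\<^sub>R W \<nu> \<omega>) \<in> borel_measurable M"
      unfolding W_def by measurable
  qed
  have EW: "(\<integral>\<omega>. indicator (history_event k \<nu>) \<omega> *\<^sub>R W \<nu> \<omega> \<partial>M) = (\<integral>\<omega>. indicator (history_event k \<nu>) \<omega> *\<^sub>R R \<nu> \<partial>M)" if "\<nu> \<in> ?S" for \<nu>
  proof -
    have "(\<integral>\<omega>. indicator (history_event k \<nu>) \<omega> *\<^sub>R W \<nu> \<omega> \<partial>M)
      = h \<nu> * (\<integral>\<omega>. indicator (history_event k \<nu>) \<omega> *\<^sub>R (\<Prod>u\<in>?L. \<Phi> u (\<nu> u) (children u \<omega>)) \<partial>M)"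
      by (subst integral_mult_right_zero[symmetric]) (simp add: W_def)
    also have "\<dots> = h \<nu> * (prob (history_event k \<nu>) *\<^sub>R (\<Prod>u\<in>?L. \<Sum>c\<in>child_sizes n. of_real (offspring_prob (\<nu> u) c) * \<Phi> u (\<nu> u) c))"
      by (subst expectation_children_given_history) simp
    also have "(\<Prod>u\<in>?L. \<Sum>c\<in>child_sizes n. of_real (offspring_prob (\<nu> u) c) * \<Phi> u (\<nu> u) c) = (\<Prod>u\<in>?L. offspring_mean (\<Phi> u (\<nu> u)) (\<nu> u))"
      by (intro prod.cong offspring_mean_larger) (use that in \<open>auto simp: PiE_def Pi_def\<close>)
    also have "h \<nu> * (prob (history_event k \<nu>) *\<^sub>R (\<Prod>u\<in>?L. offspring_mean (\<Phi> u (\<nu> u)) (\<nu> u))) = (\<integral>\<omega>. indicator (history_event k \<nu>) \<omega> *\<^sub>R R \<nu> \<partial>M)"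
      by (simp add: R_def integral_indicator_scaleR)
    finally show ?thesis .
  qed
  have WAE: "AE \<omega> in M. h (history k \<omega>) * (\<Prod>u\<in>?L. \<Phi> u (N u \<omega>) (children u \<omega>)) = (\<Sum>\<nu>\<in>?S. indicator (history_event k \<nu>) \<omega> *\<^sub>R W \<nu> \<omega>)"
    using AE_typical
  proof eventually_elim
    case (elim \<omega>)
    have "h (history k \<omega>) * (\<Prod>u\<in>?L. \<Phi> u (N u \<omega>) (children u \<omega>)) = W (history k \<omega>) \<omega>"
      unfolding W_def by (simp add: history_def)
    then show ?case using decomp[OF elim, of W] by simp
  qed
  have RAE: "AE \<omega> in M. h (history k \<omega>) * (\<Prod>u\<in>?L. offspring_mean (\<Phi> u (N u \<omega>)) (N u \<omega>)) = (\<Sum>\<nu>\<in>?S. indicator (history_event k \<nu>) \<omega> *\<^sub>R R \<nu>)"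
    using AE_typical
  proof eventually_elim
    case (elim \<omega>)
    have "h (history k \<omega>) * (\<Prod>u\<in>?L. offspring_mean (\<Phi> u (N u \<omega>)) (N u \<omega>)) = R (history k \<omega>)"
      unfolding R_def by (simp add: history_def)
    then show ?case using decomp[OF elim, of "\<lambda>\<nu> _. R \<nu>"] by simp
  qed
  have m1: "(\<lambda>\<omega>. h (history k \<omega>) * (\<Prod>u\<in>?L. \<Phi> u (N u \<omega>) (children u \<omega>))) \<in> borel_measurable M"
  proof -
    note meas[measurable]
    have [measurable]: "(\<lambda>\<omega>. h (history k \<omega>)) \<in> borel_measurable M" by (rule measurable_compose[OF meas]) simp
    have "(\<lambda>\<omega>. case_prod (\<Phi> u) (N u \<omega>, children u \<omega>)) \<in> borel_measurable M" for u
      by (rule measurable_compose[OF node_measurable]) simp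
    then have [measurable]: "(\<lambda>\<omega>. \<Phi> u (N u \<omega>) (children u \<omega>)) \<in> borel_measurable M" for u by simp
    show ?thesis by measurable
  qed
  have m2: "(\<lambda>\<omega>. h (history k \<omega>) * (\<Prod>u\<in>?L. offspring_mean (\<Phi> u (N u \<omega>)) (N u \<omega>))) \<in> borel_measurable M"
  proof -
    have [measurable]: "(\<lambda>\<omega>. h (history k \<omega>)) \<in> borel_measurable M" by (rule measurable_compose[OF meas]) simp
    have [measurable]: "(\<lambda>\<omega>. offspring_mean (\<Phi> u (N u \<omega>)) (N u \<omega>)) \<in> borel_measurable M" for u
      by (rule measurable_compose[OF N_measurable[of u]]) simp
    show ?thesis by measurable
  qed
  have mW: "(\<lambda>\<omega>. \<Sum>\<nu>\<in>?S. indicator (history_event k \<nu>) \<omega> *\<^sub>R W \<nu> \<omega>) \<in> borel_measurable M"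
    by (intro borel_measurable_sum borel_measurable_integrable[OF iW])
  show "integrable M (\<lambda>\<omega>. h (history k \<omega>) * (\<Prod>u\<in>?L. \<Phi> u (N u \<omega>) (children u \<omega>)))"
    by (rule integrable_cong_AE_imp[OF _ m1 WAE[THEN AE_symmetric]]) (intro Bochner_Integration.integrable_sum iW)
  have "(\<integral>\<omega>. h (history k \<omega>) * (\<Prod>u\<in>?L. \<Phi> u (N u \<omega>) (children u \<omega>)) \<partial>M) = (\<integral>\<omega>. (\<Sum>\<nu>\<in>?S. indicator (history_event k \<nu>) \<omega> *\<^sub>R W \<nu> \<omega>) \<partial>M)"
    by (rule integral_cong_AE[OF m1 mW WAE])
  also have "\<dots> = (\<Sum>\<nu>\<in>?S. \<integral>\<omega>. indicator (history_event k \<nu>) \<omega> *\<^sub>R W \<nu> \<omega> \<partial>M)"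
    by (rule Bochner_Integration.integral_sum) (rule iW)
  also have "\<dots> = (\<Sum>\<nu>\<in>?S. \<integral>\<omega>. indicator (history_event k \<nu>) \<omega> *\<^sub>R R \<nu> \<partial>M)"
    by (rule sum.cong[OF refl EW])
  also have "\<dots> = (\<integral>\<omega>. (\<Sum>\<nu>\<in>?S. indicator (history_event k \<nu>) \<omega> *\<^sub>R R \<nu>) \<partial>M)"
    by (rule Bochner_Integration.integral_sum[symmetric]) (rule integral_indicator_scaleR(1), simp)
  also have "\<dots> = (\<integral>\<omega>. h (history k \<omega>) * (\<Prod>u\<in>?L. offspring_mean (\<Phi> u (N u \<omega>)) (N u \<omega>)) \<partial>M)"
    by (rule integral_cong_AE[OF _ m2 RAE[THEN AE_symmetric]]) measurable
  finally show "(\<integral>\<omega>. h (history k \<omega>) * (\<Prod>u\<in>?L. \<Phi> u (N u \<omega>) (children u \<omega>)) \<partial>M)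
    = (\<integral>\<omega>. h (history k \<omega>) * (\<Prod>u\<in>?L. offspring_mean (\<Phi> u (N u \<omega>)) (N u \<omega>)) \<partial>M)" .
qed

section \<open>The sum of the tolls above a given depth\<close>

definition martingale :: "nat \<Rightarrow> 'a \<Rightarrow> real" where
  "martingale k \<omega> = (\<Sum>u | length u < k. toll (N u \<omega>) (children u \<omega>))"

lemma martingale_history:
  "martingale k \<omega> = (\<Sum>u | length u < k. toll (history k \<omega> u) (\<lambda>i. history k \<omega> (u @ [i])))"
  unfolding martingale_def by (rule sum.cong) (auto simp: history_def children_def)

lemma martingale_measurable [measurable]: "martingale k \<in> borel_measurable M"
proof -
  have "(\<lambda>\<omega>. case_prod toll (N u \<omega>, children u \<omega>)) \<in> borel_measurable M" for u
    by (rule measurable_compose[OF node_measurable]) simp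
  then have [measurable]: "(\<lambda>\<omega>. toll (N u \<omega>) (children u \<omega>)) \<in> borel_measurable M" for u by simp
  show ?thesis unfolding martingale_def by measurable
qed

text \<open>The terminal function \<open>f\<close> is arbitrary because averaging out the last level
  replaces \<open>f\<close> by one step of the recursion applied to it; this closes the induction on
  the depth.\<close>

lemma expectation_martingale_exp:
  fixes w :: "'f::{real_normed_field, banach, second_countable_topology}"
  shows "(\<integral>\<omega>. exp (w * of_real (martingale k \<omega>)) * (\<Prod>u | length u = k. f (N u \<omega>)) \<partial>M)
    = ((\<lambda>f m. \<Sum>c\<in>child_sizes m. of_real (offspring_prob m c) * (exp (w * of_real (toll m c)) * (\<Prod>i\<in>UNIV. f (c i)))) ^^ k) f n"
    (is "_ = (?R ^^ k) f n")
proof (induction k arbitrary: f)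
  case 0
  have "(\<integral>\<omega>. exp (w * of_real (martingale 0 \<omega>)) * (\<Prod>u | length u = 0. f (N u \<omega>)) \<partial>M) = (\<integral>\<omega>. f n \<partial>M)"
  proof (rule integral_cong_AE)
    show "AE \<omega> in M. exp (w * of_real (martingale 0 \<omega>)) * (\<Prod>u | length u = 0. f (N u \<omega>)) = f n"
      using AE_typical by eventually_elim (simp add: martingale_def typical_def)
    show "(\<lambda>\<omega>. exp (w * of_real (martingale 0 \<omega>)) * (\<Prod>u | length u = 0. f (N u \<omega>))) \<in> borel_measurable M"
      by (simp add: martingale_def)
  qed simp
  then show ?case using prob_space by simp
next
  case (Suc k)
  define h where "h \<nu> = exp (w * of_real (\<Sum>u | length u < k. toll (\<nu> u) (\<lambda>i. \<nu> (u @ [i]))))" for \<nu> :: "'b list \<Rightarrow> nat"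
  define \<Phi> where "\<Phi> m c = exp (w * of_real (toll m c)) * (\<Prod>i\<in>UNIV. f (c i))" for m and c :: "'b \<Rightarrow> nat"
  have "exp (w * of_real (martingale (Suc k) \<omega>)) * (\<Prod>u | length u = Suc k. f (N u \<omega>))
    = h (history k \<omega>) * (\<Prod>u | length u = k. \<Phi> (N u \<omega>) (children u \<omega>))" for \<omega>
  proof -
    have "martingale (Suc k) \<omega> = martingale k \<omega> + (\<Sum>u | length u = k. toll (N u \<omega>) (children u \<omega>))"
      by (simp add: martingale_def sum_levels_Suc)
    then have "exp (w * of_real (martingale (Suc k) \<omega>)) = h (history k \<omega>) * (\<Prod>u | length u = k. exp (w * of_real (toll (N u \<omega>) (children u \<omega>))))"
      by (simp add: h_def martingale_history distrib_left exp_add sum_distrib_left flip: exp_sum)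
    then show ?thesis
      by (simp add: prod_level_Suc \<Phi>_def prod.distrib children_def mult.assoc)
  qed
  then have "(\<integral>\<omega>. exp (w * of_real (martingale (Suc k) \<omega>)) * (\<Prod>u | length u = Suc k. f (N u \<omega>)) \<partial>M)
    = (\<integral>\<omega>. h (history k \<omega>) * (\<Prod>u | length u = k. \<Phi> (N u \<omega>) (children u \<omega>)) \<partial>M)" by simp
  also have "\<dots> = (\<integral>\<omega>. h (history k \<omega>) * (\<Prod>u | length u = k. offspring_mean (\<Phi> (N u \<omega>)) (N u \<omega>)) \<partial>M)"
    by (rule expectation_peel_level(1)[where \<Phi> = "\<lambda>_. \<Phi>"])
  also have "\<dots> = (\<integral>\<omega>. exp (w * of_real (martingale k \<omega>)) * (\<Prod>u | length u = k. ?R f (N u \<omega>)) \<partial>M)"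
    by (simp add: h_def martingale_history offspring_mean_def \<Phi>_def)
  also have "\<dots> = (?R ^^ k) (?R f) n" by (rule Suc.IH)
  also have "\<dots> = (?R ^^ Suc k) f n" by (simp only: funpow_Suc_right comp_apply)
  finally show ?case .
qed

lemma expectation_exp_martingale:
  fixes w :: "'f::{real_normed_field, banach, second_countable_topology}"
  shows "(\<integral>\<omega>. exp (w * of_real (martingale k \<omega>)) \<partial>M) = tree_mgf k w n"
    and "integrable M (\<lambda>\<omega>. exp (w * of_real (martingale k \<omega>)))"
proof -
  let ?R = "\<lambda>f m. \<Sum>c\<in>child_sizes m. of_real (offspring_prob m c) * (exp (w * of_real (toll m c)) * (\<Prod>i\<in>UNIV. f (c i)))"
  have R: "(?R ^^ k) (\<lambda>_. 1) = tree_mgf k w" for k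
    by (induction k) (auto simp: fun_eq_iff)
  show "(\<integral>\<omega>. exp (w * of_real (martingale k \<omega>)) \<partial>M) = tree_mgf k w n"
    using expectation_martingale_exp[of w k "\<lambda>_. 1"] by (simp add: R)
  show "integrable M (\<lambda>\<omega>. exp (w * of_real (martingale k \<omega>)))"
    using expectation_peel_level(2)[where \<Phi> = "\<lambda>_ _ _. 1" and k = k
      and h = "\<lambda>\<nu>. exp (w * of_real (\<Sum>u | length u < k. toll (\<nu> u) (\<lambda>i. \<nu> (u @ [i]))))"]
    by (simp add: martingale_history)
qed

lemma expectation_toll: "(\<integral>\<omega>. toll (N u \<omega>) (children u \<omega>) \<partial>M) = 0" "integrable M (\<lambda>\<omega>. toll (N u \<omega>) (children u \<omega>))"
proof -
  \<comment> \<open>All other nodes of the level get the constant 1, so the product over the level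
    is the toll at \<open>u\<close>, and its average contains the factor
    \<open>integral_toll\<close>.\<close>
  define \<Phi> where "\<Phi> w m c = (if w = u then toll m c else 1)" for w m c
  have p: "(\<Prod>w | length w = length u. \<Phi> w (N w \<omega>) (children w \<omega>)) = toll (N u \<omega>) (children u \<omega>)" for \<omega>
    unfolding \<Phi>_def by (subst prod.remove[of _ u]) auto
  have z: "(\<Prod>w | length w = length u. offspring_mean (\<Phi> w (N w \<omega>)) (N w \<omega>)) = 0" for \<omega>
  proof (rule prod_zero)
    have "offspring_mean (\<Phi> u (N u \<omega>)) (N u \<omega>) = (\<integral>x. toll (N u \<omega>) (fst x) \<partial>joint_law (N u \<omega>))"
      unfolding offspring_mean_def \<Phi>_def using integral_joint_fst[of "N u \<omega>" "toll (N u \<omega>)"] by simp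
    then show "\<exists>w\<in>{w. length w = length u}. offspring_mean (\<Phi> w (N w \<omega>)) (N w \<omega>) = 0"
      by (intro bexI[of _ u]) (simp_all add: integral_toll)
  qed simp
  show "(\<integral>\<omega>. toll (N u \<omega>) (children u \<omega>) \<partial>M) = 0"
    using expectation_peel_level(1)[of "\<lambda>_. 1" "length u" \<Phi>] by (simp add: p z)
  show "integrable M (\<lambda>\<omega>. toll (N u \<omega>) (children u \<omega>))"
    using expectation_peel_level(2)[of "\<lambda>_. 1" "length u" \<Phi>] by (simp add: p)
qed

lemma expectation_martingale: "(\<integral>\<omega>. martingale k \<omega> \<partial>M) = 0" "integrable M (martingale k)"
  unfolding martingale_def using expectation_toll by (simp_all add: Bochner_Integration.integral_sum)

section \<open>Level sizes and finiteness of the height\<close>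

definition level_size :: "nat \<Rightarrow> 'a \<Rightarrow> nat" where
  "level_size j \<omega> = (\<Sum>u | length u = j. N u \<omega>)"

lemma level_size_measurable [measurable]: "level_size j \<in> measurable M (count_space UNIV)"
  unfolding level_size_def by measurable

text \<open>The tolls of one level telescope: they add the size of the next level and exchange the
  mean lengths of the level for those of the next one.\<close>

lemma martingale_eq:
  assumes "typical \<omega>"
  shows "martingale k \<omega> = (\<Sum>j<k. real (level_size (Suc j) \<omega>)) + (\<Sum>u | length u = k. mean_length (N u \<omega>)) - mean_length n"
proof (induction k)
  case 0
  then show ?case using assms by (simp add: martingale_def typical_def)
next
  case (Suc k)
  have "(\<Sum>u | length u = k. toll (N u \<omega>) (children u \<omega>))
    = real (level_size (Suc k) \<omega>) + (\<Sum>u | length u = Suc k. mean_length (N u \<omega>)) - (\<Sum>u | length u = k. mean_length (N u \<omega>))"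
    by (simp add: toll_def level_size_def sum_level_Suc sum_subtractf sum.distrib children_def)
  moreover have "martingale (Suc k) \<omega> = martingale k \<omega> + (\<Sum>u | length u = k. toll (N u \<omega>) (children u \<omega>))"
    by (simp add: martingale_def sum_levels_Suc)
  ultimately show ?case using Suc.IH by simp
qed

lemma expectation_level_sizes:
  "integrable M (\<lambda>\<omega>. \<Sum>j<k. real (level_size (Suc j) \<omega>))"
  "(\<integral>\<omega>. (\<Sum>j<k. real (level_size (Suc j) \<omega>)) \<partial>M) \<le> mean_length n"
proof -
  have eq: "AE \<omega> in M. (\<Sum>j<k. real (level_size (Suc j) \<omega>)) \<le> martingale k \<omega> + mean_length n"
    using AE_typical
  proof eventually_elim
    case (elim \<omega>)
    have "0 \<le> (\<Sum>u :: 'b list | length u = k. mean_length (N u \<omega>))" by (intro sum_nonneg mean_length_nonneg)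
    then show ?case unfolding martingale_eq[OF elim] by simp
  qed
  have i: "integrable M (\<lambda>\<omega>. martingale k \<omega> + mean_length n)" using expectation_martingale(2) by simp
  show int: "integrable M (\<lambda>\<omega>. \<Sum>j<k. real (level_size (Suc j) \<omega>))"
  proof (rule Bochner_Integration.integrable_bound[OF i])
    show "AE \<omega> in M. norm (\<Sum>j<k. real (level_size (Suc j) \<omega>)) \<le> norm (martingale k \<omega> + mean_length n)"
      using eq
    proof eventually_elim
      case (elim \<omega>)
      have "0 \<le> (\<Sum>j<k. real (level_size (Suc j) \<omega>))" by (intro sum_nonneg) simp
      then show ?case using elim by simp
    qed
  qed measurable
  have "(\<integral>\<omega>. (\<Sum>j<k. real (level_size (Suc j) \<omega>)) \<partial>M) \<le> (\<integral>\<omega>. martingale k \<omega> + mean_length n \<partial>M)"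
    using int i eq by (rule integral_mono_AE)
  also have "\<dots> = mean_length n" using expectation_martingale[of k] prob_space by simp
  finally show "(\<integral>\<omega>. (\<Sum>j<k. real (level_size (Suc j) \<omega>)) \<partial>M) \<le> mean_length n" .
qed

text \<open>The level sizes below the root have a sum of finite mean, and a summable sequence of
  natural numbers is eventually 0.\<close>

lemma AE_finite_height: "AE \<omega> in M. \<exists>j0. \<forall>j\<ge>j0. level_size j \<omega> = 0"
proof -
  have "(\<integral>\<^sup>+\<omega>. (\<Sum>j. ennreal (real (level_size (Suc j) \<omega>))) \<partial>M) = (\<Sum>j. \<integral>\<^sup>+\<omega>. ennreal (real (level_size (Suc j) \<omega>)) \<partial>M)"
    by (rule nn_integral_suminf) measurable
  also have "\<dots> \<le> ennreal (mean_length n)"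
  proof (rule suminf_le_const)
    fix k
    have "(\<Sum>j<k. \<integral>\<^sup>+\<omega>. ennreal (real (level_size (Suc j) \<omega>)) \<partial>M) = (\<integral>\<^sup>+\<omega>. ennreal (\<Sum>j<k. real (level_size (Suc j) \<omega>)) \<partial>M)"
      by (subst nn_integral_sum[symmetric]) (auto simp: sum_ennreal)
    also have "\<dots> = ennreal (\<integral>\<omega>. (\<Sum>j<k. real (level_size (Suc j) \<omega>)) \<partial>M)"
      by (rule nn_integral_eq_integral[OF expectation_level_sizes(1)]) (auto intro!: AE_I2 sum_nonneg)
    also have "\<dots> \<le> ennreal (mean_length n)" by (intro ennreal_leI expectation_level_sizes(2))
    finally show "(\<Sum>j<k. \<integral>\<^sup>+\<omega>. ennreal (real (level_size (Suc j) \<omega>)) \<partial>M) \<le> ennreal (mean_length n)" .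
  qed simp
  also have "\<dots> < \<infinity>" by simp
  finally have "AE \<omega> in M. (\<Sum>j. ennreal (real (level_size (Suc j) \<omega>))) \<noteq> \<infinity>"
    by (intro nn_integral_PInf_AE) (auto simp: less_top)
  then show ?thesis
  proof eventually_elim
    case (elim \<omega>)
    then have "summable (\<lambda>j. real (level_size (Suc j) \<omega>))"
      by (intro summable_suminf_not_top) auto
    then have "(\<lambda>j. real (level_size (Suc j) \<omega>)) \<longlonglongrightarrow> 0" by (rule summable_LIMSEQ_zero)
    then have "\<forall>\<^sub>F j in sequentially. real (level_size (Suc j) \<omega>) < 1" by (intro order_tendstoD(2)) auto
    then obtain j0 where "\<And>j. j0 \<le> j \<Longrightarrow> level_size (Suc j) \<omega> = 0" by (auto simp: eventually_sequentially)
    then have "level_size j \<omega> = 0" if "Suc j0 \<le> j" for j using that by (cases j) auto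
    then show ?case by blast
  qed
qed

end

section \<open>The path length\<close>

lemma stored_0 [simp]: "stored s s0 0 = 0"
  by (simp add: stored_def)

lemma total_path_length_UNIV:
  "total_path_length s s0 N = infsum (\<lambda>u. real (length u) * real (stored s s0 (N u))) UNIV"
  unfolding total_path_length_def by (rule infsum_cong_neutral) (auto simp: tree_nodes_def)

text \<open>Expresses the infinite sum by a sequence of finite ones, including the default value 0
  in the divergent case. In this form the path length is seen to be measurable.\<close>

lemma infsum_lists_eq_lim:
  fixes g :: "'b::finite list \<Rightarrow> real"
  assumes g: "\<And>u. 0 \<le> g u"
  shows "infsum g UNIV = (if Cauchy (\<lambda>k. \<Sum>u | length u < k. g u) then lim (\<lambda>k. \<Sum>u | length u < k. g u) else 0)"
proof -
  define S where "S k = (\<Sum>u | length u < k. g u)" for k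
  have inc: "incseq S" unfolding S_def by (intro incseq_SucI sum_mono2) (auto simp: g)
  have "infsum g UNIV = lim S" if c: "convergent S"
  proof -
    have lim: "S \<longlonglongrightarrow> lim S" using c by (simp add: convergent_LIMSEQ_iff)
    have fin: "sum g F \<le> lim S" if "finite F" for F
    proof -
      define k where "k = Suc (Max (insert 0 (length ` F)))"
      have "F \<subseteq> {u. length u < k}" using that by (auto simp: k_def less_Suc_eq_le)
      then have "sum g F \<le> S k" unfolding S_def by (intro sum_mono2) (auto simp: g)
      also have "\<dots> \<le> lim S" by (rule incseq_le[OF inc lim])
      finally show ?thesis .
    qed
    have sm: "g summable_on UNIV"
      by (rule nonneg_bdd_above_summable_on) (use g fin in \<open>auto intro!: bdd_aboveI\<close>)
    show ?thesis
    proof (rule antisym)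
      show "infsum g UNIV \<le> lim S" by (rule infsum_le_finite_sums[OF sm]) (rule fin)
      show "lim S \<le> infsum g UNIV"
        by (rule LIMSEQ_le_const2[OF lim]) (auto simp: S_def g intro!: finite_sum_le_infsum[OF sm])
    qed
  qed
  moreover have "convergent S" if sm: "g summable_on UNIV"
  proof -
    have "S k \<le> infsum g UNIV" for k
      unfolding S_def by (rule finite_sum_le_infsum[OF sm]) (auto simp: g)
    with inc show ?thesis by (metis convergentI incseq_convergent)
  qed
  ultimately show ?thesis
    unfolding S_def[symmetric] Cauchy_convergent_iff
    by (cases "convergent S") (auto intro: infsum_not_exists)
qed

context split_tree_model
begin

abbreviation path_length :: "'a \<Rightarrow> real" where
  "path_length \<omega> \<equiv> total_path_length s s0 (\<lambda>u. N u \<omega>)"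

lemma path_length_measurable [measurable]: "path_length \<in> borel_measurable M"
proof -
  define S where "S k \<omega> = (\<Sum>u :: 'b list | length u < k. real (length u) * real (stored s s0 (N u \<omega>)))" for k \<omega>
  have [measurable]: "(\<lambda>\<omega>. real (stored s s0 (N u \<omega>))) \<in> borel_measurable M" for u
    by (rule measurable_compose[OF N_measurable[of u]]) simp
  have S [measurable]: "S k \<in> borel_measurable M" for k unfolding S_def by measurable
  have "path_length \<omega> = (if Cauchy (\<lambda>k. S k \<omega>) then lim (\<lambda>k. S k \<omega>) else 0)" for \<omega>
    unfolding total_path_length_UNIV S_def by (rule infsum_lists_eq_lim) simp
  then show ?thesis by simp
qed

definition finite_height :: "'a \<Rightarrow> bool" where
  "finite_height \<omega> \<longleftrightarrow> typical \<omega> \<and> (\<exists>j0. \<forall>j\<ge>j0. level_size j \<omega> = 0)"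

lemma AE_finite_tree: "AE \<omega> in M. finite_height \<omega>"
  using AE_typical AE_finite_height by eventually_elim (simp add: finite_height_def)

lemma typical_split:
  assumes "typical \<omega>"
  shows "N u \<omega> = stored s s0 (N u \<omega>) + (\<Sum>i\<in>UNIV. N (u @ [i]) \<omega>)"
proof -
  have q: "offspring_prob (N u \<omega>) (children u \<omega>) \<noteq> 0" using assms by (simp add: typical_def)
  show ?thesis
  proof (cases "s < N u \<omega>")
    case True
    then have "s0 \<le> N u \<omega>" using s_bound by linarith
    then show ?thesis using offspring_support(1)[OF q True] True by (simp add: stored_def children_def)
  next
    case False
    then show ?thesis using offspring_support(3)[OF q] by (simp add: stored_def children_def)
  qed
qed

text \<open>The items stored at depth \<open>j\<close> are the difference of two consecutive level
  sizes, and summation by parts turns the sum of depths into the sum of the subtree sizes of all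
  nodes but the root.\<close>

lemma path_length_eq_levels:
  assumes "typical \<omega>" and j0: "\<And>j. j0 \<le> j \<Longrightarrow> level_size j \<omega> = 0"
  shows "path_length \<omega> = (\<Sum>j<j0. real (level_size (Suc j) \<omega>))"
proof -
  let ?st = "\<lambda>j. \<Sum>u :: 'b list | length u = j. real (stored s s0 (N u \<omega>))"
  have level: "real (level_size j \<omega>) = ?st j + real (level_size (Suc j) \<omega>)" for j
  proof -
    have "level_size j \<omega> = (\<Sum>u :: 'b list | length u = j. stored s s0 (N u \<omega>) + (\<Sum>i\<in>UNIV. N (u @ [i]) \<omega>))"
      unfolding level_size_def by (rule sum.cong) (auto intro: typical_split[OF assms(1)])
    then show ?thesis by (simp add: level_size_def sum_level_Suc sum.distrib)
  qed
  have zero: "N u \<omega> = 0" if "j0 \<le> length u" for u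
    using j0[OF that] by (simp add: level_size_def)
  have "path_length \<omega> = infsum (\<lambda>u. real (length u) * real (stored s s0 (N u \<omega>))) {u :: 'b list. length u < j0}"
    unfolding total_path_length_UNIV by (rule infsum_cong_neutral) (auto simp: zero)
  also have "\<dots> = (\<Sum>u :: 'b list | length u < j0. real (length u) * real (stored s s0 (N u \<omega>)))"
    by (rule infsum_finite) simp
  also have "\<dots> = (\<Sum>j<j0. real j * ?st j)"
  proof (induction j0)
    case (Suc k)
    then show ?case by (simp add: sum_levels_Suc sum_distrib_left)
  qed simp
  also have "\<dots> = (\<Sum>j<j0. real j * (real (level_size j \<omega>) - real (level_size (Suc j) \<omega>)))"
  proof -
    have "?st j = real (level_size j \<omega>) - real (level_size (Suc j) \<omega>)" for j using level[of j] by linarith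
    then show ?thesis by (simp only:)
  qed
  also have "\<dots> = (\<Sum>j<j0. real (level_size (Suc j) \<omega>)) - real j0 * real (level_size j0 \<omega>)"
    by (induction j0) (simp_all add: algebra_simps)
  finally show ?thesis using j0[of j0] by simp
qed

lemma path_length_levels_le:
  assumes "finite_height \<omega>"
  shows "(\<Sum>j<k. real (level_size (Suc j) \<omega>)) \<le> path_length \<omega>"
proof -
  obtain j0 where t: "typical \<omega>" and j0: "\<And>j. j0 \<le> j \<Longrightarrow> level_size j \<omega> = 0"
    using assms by (auto simp: finite_height_def)
  have "(\<Sum>j<k. real (level_size (Suc j) \<omega>)) \<le> (\<Sum>j<max k j0. real (level_size (Suc j) \<omega>))"
    by (rule sum_mono2) auto
  also have "\<dots> = path_length \<omega>"
    by (rule path_length_eq_levels[OF t, symmetric]) (use j0 in auto)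
  finally show ?thesis .
qed

lemma martingale_tendsto:
  assumes "finite_height \<omega>"
  shows "(\<lambda>k. martingale k \<omega>) \<longlonglongrightarrow> path_length \<omega> - mean_length n"
proof -
  obtain j0 where t: "typical \<omega>" and j0: "\<And>j. j0 \<le> j \<Longrightarrow> level_size j \<omega> = 0"
    using assms by (auto simp: finite_height_def)
  have "martingale k \<omega> = path_length \<omega> - mean_length n" if "j0 \<le> k" for k
  proof -
    have zero: "N u \<omega> = 0" if "length u = k" for u
      using j0[OF \<open>j0 \<le> k\<close>] that by (simp add: level_size_def)
    have "(\<Sum>u :: 'b list | length u = k. mean_length (N u \<omega>)) = 0"
      by (rule sum.neutral) (use zero in simp)
    moreover have "path_length \<omega> = (\<Sum>j<k. real (level_size (Suc j) \<omega>))"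
      by (rule path_length_eq_levels[OF t]) (rule j0, use that in linarith)
    ultimately show ?thesis using martingale_eq[OF t, of k] by linarith
  qed
  then show ?thesis by (intro tendsto_eventually) (auto simp: eventually_sequentially)
qed

lemma path_length_nonneg: "0 \<le> path_length \<omega>"
  unfolding total_path_length_def by (rule infsum_nonneg) simp

text \<open>The martingale has mean 0 at every depth and converges to
  \<open>path_length - mean_length n\<close>. Integrability is shown beforehand by Fatou's lemma,
  since the path length itself enters the dominating function.\<close>

lemma expectation_path_length:
  "integrable M path_length" "(\<integral>\<omega>. path_length \<omega> \<partial>M) = mean_length n"
proof -
  have lev: "AE \<omega> in M. (\<lambda>k. \<Sum>j<k. real (level_size (Suc j) \<omega>)) \<longlonglongrightarrow> path_length \<omega>"
    using AE_finite_tree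
  proof eventually_elim
    case (elim \<omega>)
    then obtain j0 where t: "typical \<omega>" and j0: "\<And>j. j0 \<le> j \<Longrightarrow> level_size j \<omega> = 0"
      by (auto simp: finite_height_def)
    have "(\<Sum>j<k. real (level_size (Suc j) \<omega>)) = path_length \<omega>" if "j0 \<le> k" for k
      by (rule path_length_eq_levels[OF t, symmetric]) (use j0 that in auto)
    then show ?case by (intro tendsto_eventually) (auto simp: eventually_sequentially)
  qed
  have "(\<integral>\<^sup>+\<omega>. ennreal (path_length \<omega>) \<partial>M) = (\<integral>\<^sup>+\<omega>. liminf (\<lambda>k. ennreal (\<Sum>j<k. real (level_size (Suc j) \<omega>))) \<partial>M)"
  proof (rule nn_integral_cong_AE, use lev in eventually_elim)
    case (elim \<omega>)
    then show ?case by (intro lim_imp_Liminf[symmetric] tendsto_ennrealI) simp_all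
  qed
  also have "\<dots> \<le> liminf (\<lambda>k. \<integral>\<^sup>+\<omega>. ennreal (\<Sum>j<k. real (level_size (Suc j) \<omega>)) \<partial>M)"
    by (rule nn_integral_liminf) measurable
  also have "\<dots> \<le> ennreal (mean_length n)"
  proof (rule Liminf_le, simp, rule always_eventually, rule allI)
    fix k
    have "(\<integral>\<^sup>+\<omega>. ennreal (\<Sum>j<k. real (level_size (Suc j) \<omega>)) \<partial>M) = ennreal (\<integral>\<omega>. (\<Sum>j<k. real (level_size (Suc j) \<omega>)) \<partial>M)"
      by (rule nn_integral_eq_integral[OF expectation_level_sizes(1)]) (auto intro!: AE_I2 sum_nonneg)
    then show "(\<integral>\<^sup>+\<omega>. ennreal (\<Sum>j<k. real (level_size (Suc j) \<omega>)) \<partial>M) \<le> ennreal (mean_length n)"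
      using expectation_level_sizes(2)[of k] by (simp add: ennreal_leI)
  qed
  finally have "(\<integral>\<^sup>+\<omega>. ennreal (path_length \<omega>) \<partial>M) < \<infinity>" by (auto simp: le_less_trans)
  then show int: "integrable M path_length"
    by (intro integrableI_bounded) (auto simp: path_length_nonneg abs_of_nonneg)
  \<comment> \<open>Only cardinalities up to \<open>n\<close> occur, so a linear bound on
    \<open>mean_length\<close> is available from finitely many values.\<close>
  define K where "K = (\<Sum>m\<le>n. mean_length m)"
  have K: "mean_length m \<le> K * real m" if "m \<le> n" for m
  proof (cases "m = 0")
    case False
    have "mean_length m \<le> K" unfolding K_def
      by (rule member_le_sum) (use that mean_length_nonneg in auto)
    moreover have "0 \<le> K" unfolding K_def by (intro sum_nonneg mean_length_nonneg)
    ultimately show ?thesis using mult_left_mono[of 1 "real m" K] False by simp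
  qed simp
  have K0: "0 \<le> K" unfolding K_def by (intro sum_nonneg mean_length_nonneg)
  \<comment> \<open>Starting at depth 1 matters: the sizes of all levels below the root are part of
    the path length, that of level 0 is not.\<close>
  have dom: "AE \<omega> in M. norm (martingale (Suc k) \<omega>) \<le> (1 + K) * path_length \<omega> + mean_length n" for k
    using AE_finite_tree
  proof eventually_elim
    case (elim \<omega>)
    then have t: "typical \<omega>" by (simp add: finite_height_def)
    have "(\<Sum>u :: 'b list | length u = Suc k. mean_length (N u \<omega>)) \<le> (\<Sum>u :: 'b list | length u = Suc k. K * real (N u \<omega>))"
      by (intro sum_mono K typical_N_le t)
    also have "\<dots> = K * real (level_size (Suc k) \<omega>)" by (simp add: level_size_def sum_distrib_left)
    also have "real (level_size (Suc k) \<omega>) \<le> (\<Sum>j<Suc k. real (level_size (Suc j) \<omega>))"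
      by (rule member_le_sum) auto
    also have "\<dots> \<le> path_length \<omega>" by (rule path_length_levels_le[OF elim])
    finally have "(\<Sum>u :: 'b list | length u = Suc k. mean_length (N u \<omega>)) \<le> K * path_length \<omega>"
      using K0 by (simp add: mult_left_mono)
    moreover have "0 \<le> (\<Sum>u :: 'b list | length u = Suc k. mean_length (N u \<omega>))" by (intro sum_nonneg mean_length_nonneg)
    moreover have "0 \<le> (\<Sum>j<Suc k. real (level_size (Suc j) \<omega>))" by (intro sum_nonneg) simp
    ultimately have "\<bar>martingale (Suc k) \<omega>\<bar> \<le> path_length \<omega> + K * path_length \<omega> + mean_length n"
      using martingale_eq[OF t, of "Suc k"] path_length_levels_le[OF elim, of "Suc k"] mean_length_nonneg[of n]
      by linarith
    then show ?case by (simp add: distrib_right)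
  qed
  have "(\<lambda>k. \<integral>\<omega>. martingale (Suc k) \<omega> \<partial>M) \<longlonglongrightarrow> (\<integral>\<omega>. path_length \<omega> - mean_length n \<partial>M)"
  proof (rule integral_dominated_convergence[OF _ _ _ _ dom])
    show "integrable M (\<lambda>\<omega>. (1 + K) * path_length \<omega> + mean_length n)" using int by simp
    show "AE \<omega> in M. (\<lambda>k. martingale (Suc k) \<omega>) \<longlonglongrightarrow> path_length \<omega> - mean_length n"
      using AE_finite_tree by eventually_elim (intro LIMSEQ_Suc martingale_tendsto)
  qed measurable
  then have "(\<integral>\<omega>. path_length \<omega> - mean_length n \<partial>M) = 0"
    by (simp add: expectation_martingale LIMSEQ_const_iff)
  then show "(\<integral>\<omega>. path_length \<omega> \<partial>M) = mean_length n"
    using int prob_space by simp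
qed

lemma tree_mgf_tendsto_imaginary:
  "(\<lambda>k. tree_mgf k (\<i> * complex_of_real w) n) \<longlonglongrightarrow> (\<integral>\<omega>. iexp (w * (path_length \<omega> - mean_length n)) \<partial>M)"
  unfolding expectation_exp_martingale(1)[symmetric]
proof (rule integral_dominated_convergence[where w = "\<lambda>_. 1"])
  show "AE \<omega> in M. (\<lambda>k. exp (\<i> * complex_of_real w * of_real (martingale k \<omega>))) \<longlonglongrightarrow> iexp (w * (path_length \<omega> - mean_length n))"
    using AE_finite_tree
  proof eventually_elim
    case (elim \<omega>)
    have "(\<lambda>k. iexp (w * martingale k \<omega>)) \<longlonglongrightarrow> iexp (w * (path_length \<omega> - mean_length n))"
      by (intro tendsto_intros martingale_tendsto elim)
    then show ?case by (simp add: mult.assoc)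
  qed
  show "AE \<omega> in M. norm (exp (\<i> * complex_of_real w * of_real (martingale k \<omega>))) \<le> 1" for k
  proof (rule AE_I2)
    fix \<omega>
    have "exp (\<i> * complex_of_real w * of_real (martingale k \<omega>)) = iexp (w * martingale k \<omega>)" by (simp add: mult.assoc)
    then show "norm (exp (\<i> * complex_of_real w * of_real (martingale k \<omega>))) \<le> 1" by (simp only: norm_exp_i_times)
  qed
qed measurable

lemma exp_path_length_bound:
  assumes "\<And>k. tree_mgf k w n \<le> K"
  shows "(\<integral>\<^sup>+\<omega>. ennreal (exp (w * (path_length \<omega> - mean_length n))) \<partial>M) \<le> ennreal K"
proof -
  have "(\<integral>\<^sup>+\<omega>. ennreal (exp (w * (path_length \<omega> - mean_length n))) \<partial>M)
    = (\<integral>\<^sup>+\<omega>. liminf (\<lambda>k. ennreal (exp (w * martingale k \<omega>))) \<partial>M)"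
  proof (rule nn_integral_cong_AE, use AE_finite_tree in eventually_elim)
    case (elim \<omega>)
    then show ?case
      by (intro lim_imp_Liminf[symmetric] tendsto_ennrealI tendsto_intros martingale_tendsto) simp_all
  qed
  also have "\<dots> \<le> liminf (\<lambda>k. \<integral>\<^sup>+\<omega>. ennreal (exp (w * martingale k \<omega>)) \<partial>M)"
    by (rule nn_integral_liminf) measurable
  also have "\<dots> \<le> ennreal K"
  proof (rule Liminf_le, simp, rule always_eventually, rule allI)
    fix k
    have "(\<integral>\<^sup>+\<omega>. ennreal (exp (w * martingale k \<omega>)) \<partial>M) = ennreal (tree_mgf k w n)"
      using nn_integral_eq_integral[of M "\<lambda>\<omega>. exp (w * martingale k \<omega>)"]
        expectation_exp_martingale[of w k] by simp
    then show "(\<integral>\<^sup>+\<omega>. ennreal (exp (w * martingale k \<omega>)) \<partial>M) \<le> ennreal K"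
      using assms by (simp add: ennreal_leI)
  qed
  finally show ?thesis .
qed

text \<open>By \<open>child_less\<close> the cardinalities decrease strictly along every path, so
  the height is below \<open>n\<close> for nonzero \<open>n\<close>, and no level holds more than
  \<open>n\<close> items.\<close>

lemma path_length_bounded:
  assumes pos: "0 < s0 \<or> 0 < s1"
  shows "AE \<omega> in M. path_length \<omega> \<le> real n * real n"
  using AE_typical
proof eventually_elim
  case (elim \<omega>)
  have depth: "N u \<omega> \<noteq> 0 \<Longrightarrow> N u \<omega> + length u \<le> n" for u
  proof (induction u rule: rev_induct)
    case Nil
    then show ?case using elim by (simp add: typical_def)
  next
    case (snoc i u)
    have q: "offspring_prob (N u \<omega>) (children u \<omega>) \<noteq> 0" using elim by (simp add: typical_def)
    have c: "children u \<omega> i \<noteq> 0" using snoc.prems by (simp add: children_def)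
    then have "s < N u \<omega>" using offspring_support(3)[OF q, of i] by (metis not_le)
    from child_less[OF this offspring_support(1)[OF q this] offspring_support(2)[OF q this] pos, of i]
    have "children u \<omega> i < N u \<omega>" .
    with snoc.IH show ?case by (simp add: children_def)
  qed
  have zero: "level_size j \<omega> = 0" if "n \<le> j" for j
  proof -
    have "N u \<omega> = 0" if "length u = j" for u using depth[of u] that \<open>n \<le> j\<close> by fastforce
    then show ?thesis by (simp add: level_size_def)
  qed
  have le: "level_size j \<omega> \<le> n" for j
  proof (induction j)
    case 0
    then show ?case using elim by (simp add: level_size_def typical_def)
  next
    case (Suc j)
    have "level_size (Suc j) \<omega> \<le> level_size j \<omega>"
      unfolding level_size_def sum_level_Suc
    proof (rule sum_mono)
      fix u :: "'b list"
      show "(\<Sum>i\<in>UNIV. N (u @ [i]) \<omega>) \<le> N u \<omega>" using typical_split[OF elim, of u] by linarith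
    qed
    then show ?case using Suc by simp
  qed
  have "path_length \<omega> = (\<Sum>j<n. real (level_size (Suc j) \<omega>))"
    by (rule path_length_eq_levels[OF elim zero])
  also have "\<dots> \<le> (\<Sum>j<n. real n)" by (intro sum_mono) (use le in simp)
  finally show ?case by simp
qed

end

text \<open>On the vertices of the simplex the fixed-point equation adds 1 to a copy of itself, so the
  moment generating function cannot be finite once \<open>p exp t \<ge> 1\<close>.\<close>

lemma (in split_parameters) fixed_point_law_exp_infinite:
  assumes L: "fixed_point_law D L" and ge: "1 \<le> measure D {v. \<exists>i. v $ i = 1} * exp t"
  shows "(\<integral>\<^sup>+x. ennreal (exp (t * x)) \<partial>L) = \<infinity>"
proof (rule ccontr)
  assume "(\<integral>\<^sup>+x. ennreal (exp (t * x)) \<partial>L) \<noteq> \<infinity>"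
  define m where "m = (\<integral>\<^sup>+x. ennreal (exp (t * x)) \<partial>L)"
  have mfin: "m \<noteq> \<infinity>" using \<open>_ \<noteq> \<infinity>\<close> by (simp add: m_def)
  let ?V = "{v :: real ^ 'b. \<exists>i. v $ i = 1}"
  have Lrd: "real_distribution L" and Lfix: "L = smoothing L" using L by (auto simp: fixed_point_law_iff)
  interpret L: real_distribution L by (rule Lrd)
  interpret PL: product_prob_space "\<lambda>_ :: 'b. L" UNIV ..
  interpret P: pair_prob_space D "Pi\<^sub>M (UNIV :: 'b set) (\<lambda>_. L)" ..
  let ?PL = "Pi\<^sub>M (UNIV :: 'b set) (\<lambda>_. L)"
  let ?f = "\<lambda>(v :: real ^ 'b, x). (\<Sum>k\<in>UNIV. v $ k * x k) + split_C D v"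
  have Q: "sigma_finite_measure ?PL"
    by (intro prob_space_imp_sigma_finite prob_space_PiM L.prob_space_axioms)
  define I where "I v = (\<integral>\<^sup>+x. ennreal (exp (t * ?f (v, x))) \<partial>?PL)" for v
  have [measurable]: "?f \<in> borel_measurable (D \<Otimes>\<^sub>M ?PL)" by (rule smoothing_measurable) simp
  have "m = (\<integral>\<^sup>+z. ennreal (exp (t * ?f z)) \<partial>(D \<Otimes>\<^sub>M ?PL))"
    unfolding m_def by (subst Lfix, unfold smoothing_def, subst nn_integral_distr) auto
  also have "\<dots> = (\<integral>\<^sup>+v. I v \<partial>D)"
    unfolding I_def by (subst sigma_finite_measure.nn_integral_fst[OF Q, symmetric]) auto
  finally have mI: "m = (\<integral>\<^sup>+v. I v \<partial>D)" .
  have I_meas [measurable]: "I \<in> borel_measurable D"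
    unfolding I_def by (rule sigma_finite_measure.borel_measurable_nn_integral_fst[OF Q]) simp
  have V [measurable]: "?V \<in> sets borel" by measurable
  have IV: "I v = ennreal (exp t) * m" if v: "v \<in> prob_vectors" "v \<in> ?V" for v
  proof -
    from v(2) obtain i where i: "v $ i = 1" by blast
    have o: "v $ j = 0" if "j \<noteq> i" for j by (rule prob_vector_vertex[OF v(1) i that])
    have C: "split_C D v = 1"
    proof -
      have "(\<Sum>j\<in>UNIV - {i}. v $ j * ln (v $ j)) = 0" by (rule sum.neutral) (use o in simp)
      then show ?thesis using i by (simp add: split_C_eq entropy_sum_def sum.remove[of UNIV i])
    qed
    have "?f (v, x) = x i + 1" for x :: "'b \<Rightarrow> real"
    proof -
      have "(\<Sum>j\<in>UNIV - {i}. v $ j * x j) = 0" by (rule sum.neutral) (use o in simp)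
      then show ?thesis using i C by (simp add: sum.remove[of UNIV i])
    qed
    then have "I v = (\<integral>\<^sup>+x. ennreal (exp t) * ennreal (exp (t * x i)) \<partial>?PL)"
      unfolding I_def by (simp add: distrib_left exp_add mult.commute flip: ennreal_mult')
    also have "\<dots> = ennreal (exp t) * (\<integral>\<^sup>+x. ennreal (exp (t * x i)) \<partial>?PL)"
      by (rule nn_integral_cmult) measurable
    also have "(\<integral>\<^sup>+x. ennreal (exp (t * x i)) \<partial>?PL) = (\<integral>\<^sup>+y. ennreal (exp (t * y)) \<partial>distr ?PL L (\<lambda>x. x i))"
      by (rule nn_integral_distr[symmetric]) measurable
    also have "distr ?PL L (\<lambda>x. x i) = L" by (rule PL.PiM_component) simp
    finally show ?thesis by (simp add: m_def)
  qed
  have split: "m = (\<integral>\<^sup>+v. I v * indicator ?V v \<partial>D) + (\<integral>\<^sup>+v. I v * indicator (- ?V) v \<partial>D)"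
    unfolding mI by (subst nn_integral_add[symmetric]) (auto intro!: nn_integral_cong split: split_indicator)
  have "(\<integral>\<^sup>+v. I v * indicator ?V v \<partial>D) = (\<integral>\<^sup>+v. (ennreal (exp t) * m) * indicator ?V v \<partial>D)"
    by (rule nn_integral_cong_AE, use AE_D_prob_vectors in eventually_elim) (auto simp: IV split: split_indicator)
  also have "\<dots> = ennreal (exp t) * m * emeasure D ?V" by (rule nn_integral_cmult_indicator) simp
  also have "\<dots> = ennreal (measure D ?V * exp t) * m"
    by (simp add: D.emeasure_eq_measure ennreal_mult'' mult_ac)
  finally have A: "(\<integral>\<^sup>+v. I v * indicator ?V v \<partial>D) = ennreal (measure D ?V * exp t) * m" .
  \<comment> \<open>The vertices alone account for the whole finite value \<open>m\<close>, so the
    integral of \<open>I\<close> over the other vectors is 0. As \<open>I\<close> never vanishes,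
    \<open>D\<close> would be concentrated on the vertices.\<close>
  have "m \<le> ennreal (measure D ?V * exp t) * m"
    using mult_right_mono[of 1 "ennreal (measure D ?V * exp t)" m] ge by simp
  then have "m + (\<integral>\<^sup>+v. I v * indicator (- ?V) v \<partial>D)
      \<le> ennreal (measure D ?V * exp t) * m + (\<integral>\<^sup>+v. I v * indicator (- ?V) v \<partial>D)"
    by (rule add_right_mono)
  also have "\<dots> = m + 0" using split[unfolded A, symmetric] by (simp only: add_0_right)
  finally have z: "(\<integral>\<^sup>+v. I v * indicator (- ?V) v \<partial>D) = 0"
    unfolding ennreal_add_left_cancel_le using mfin by simp
  then have "AE v in D. I v * indicator (- ?V) v = 0"
    by (subst (asm) nn_integral_0_iff_AE) auto
  moreover have "I v \<noteq> 0" for v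
  proof
    assume "I v = 0"
    then have "AE x in ?PL. ennreal (exp (t * ?f (v, x))) = 0"
      unfolding I_def
      by (subst (asm) nn_integral_0_iff_AE) auto
    then have "AE x in ?PL. False" by simp
    then show False using prob_space.AE_False[OF prob_space_PiM[OF L.prob_space_axioms]] by simp
  qed
  ultimately have "AE v in D. v \<in> ?V" by (simp add: indicator_def)
  then have "measure D ?V = 1" by (subst D.prob_eq_1) auto
  with D_vertex show False by simp
qed

section \<open>Weak convergence and exponential moments\<close>

text \<open>Fatou's lemma under weak convergence: the truncations \<open>min (f x) k\<close> are
  bounded continuous test functions and increase to \<open>f\<close>.\<close>

lemma weak_conv_nn_integral_le_liminf:
  fixes f :: "real \<Rightarrow> real"
  assumes \<mu>: "\<And>n. real_distribution (\<mu> n)" and L: "real_distribution L" and wc: "weak_conv_m \<mu> L"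
    and cont: "\<And>x. isCont f x" and nn: "\<And>x. 0 \<le> f x"
  shows "(\<integral>\<^sup>+x. ennreal (f x) \<partial>L) \<le> liminf (\<lambda>n. \<integral>\<^sup>+x. ennreal (f x) \<partial>\<mu> n)"
proof -
  interpret L: real_distribution L by (rule L)
  have [measurable]: "f \<in> borel_measurable borel"
    by (intro borel_measurable_continuous_onI continuous_at_imp_continuous_on ballI cont)
  have trunc: "(\<integral>\<^sup>+x. ennreal (min (f x) (real k)) \<partial>\<nu>) = ennreal (\<integral>x. min (f x) (real k) \<partial>\<nu>)"
    if "real_distribution \<nu>" for \<nu> k
  proof -
    interpret \<nu>: real_distribution \<nu> by (rule that)
    show ?thesis
      by (intro nn_integral_eq_integral \<nu>.integrable_const_bound[where B = "real k"]) (auto simp: nn)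
  qed
  have le: "(\<integral>\<^sup>+x. ennreal (min (f x) (real k)) \<partial>L) \<le> liminf (\<lambda>n. \<integral>\<^sup>+x. ennreal (f x) \<partial>\<mu> n)" for k
  proof -
    have "(\<lambda>n. \<integral>x. min (f x) (real k) \<partial>\<mu> n) \<longlonglongrightarrow> (\<integral>x. min (f x) (real k) \<partial>L)"
    proof (rule weak_conv_imp_integral_bdd_continuous_conv[OF \<mu> L wc])
      show "isCont (\<lambda>x. min (f x) (real k)) x" for x by (intro continuous_min cont continuous_const)
      show "norm (min (f x) (real k)) \<le> real k" for x by (simp add: nn)
    qed
    then have "(\<lambda>n. \<integral>\<^sup>+x. ennreal (min (f x) (real k)) \<partial>\<mu> n) \<longlonglongrightarrow> (\<integral>\<^sup>+x. ennreal (min (f x) (real k)) \<partial>L)"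
      unfolding trunc[OF L] trunc[OF \<mu>] by (rule tendsto_ennrealI)
    then have "(\<integral>\<^sup>+x. ennreal (min (f x) (real k)) \<partial>L) = liminf (\<lambda>n. \<integral>\<^sup>+x. ennreal (min (f x) (real k)) \<partial>\<mu> n)"
      by (intro lim_imp_Liminf[symmetric]) simp_all
    also have "\<dots> \<le> liminf (\<lambda>n. \<integral>\<^sup>+x. ennreal (f x) \<partial>\<mu> n)"
      by (intro Liminf_mono always_eventually allI nn_integral_mono ennreal_leI) simp
    finally show ?thesis .
  qed
  have "(\<integral>\<^sup>+x. ennreal (f x) \<partial>L) = (\<integral>\<^sup>+x. liminf (\<lambda>k. ennreal (min (f x) (real k))) \<partial>L)"
  proof (rule nn_integral_cong)
    fix x
    obtain j :: nat where "f x \<le> real j" using real_arch_simple by blast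
    then have "(\<lambda>k. ennreal (min (f x) (real k))) \<longlonglongrightarrow> ennreal (f x)"
      by (intro tendsto_eventually) (auto simp: eventually_sequentially intro!: exI[of _ j] arg_cong[where f = ennreal])
    then show "ennreal (f x) = liminf (\<lambda>k. ennreal (min (f x) (real k)))"
      by (intro lim_imp_Liminf[symmetric]) simp_all
  qed
  also have "\<dots> \<le> liminf (\<lambda>k. \<integral>\<^sup>+x. ennreal (min (f x) (real k)) \<partial>L)"
    by (rule nn_integral_liminf) measurable
  also have "\<dots> \<le> liminf (\<lambda>n. \<integral>\<^sup>+x. ennreal (f x) \<partial>\<mu> n)"
    by (rule Liminf_le, simp, rule always_eventually, rule allI, rule le)
  finally show ?thesis .
qed

text \<open>Where \<open>t * x > R\<close>, the factor \<open>exp (\<delta> * (t * x - R))\<close>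
  is at least 1, so a moment of the slightly larger order \<open>(1 + \<delta>) * t\<close> controls
  the part cut off, uniformly over all laws with the same \<open>K\<close>.\<close>

lemma exp_truncation:
  assumes \<nu>: "real_distribution \<nu>" and \<delta>: "0 < \<delta>" and K0: "0 \<le> K"
    and K: "(\<integral>\<^sup>+x. ennreal (exp ((1 + \<delta>) * t * x)) \<partial>\<nu>) \<le> ennreal K"
  shows "integrable \<nu> (\<lambda>x. exp (t * x))"
    and "\<bar>(\<integral>x. exp (t * x) \<partial>\<nu>) - (\<integral>x. min (exp (t * x)) (exp R) \<partial>\<nu>)\<bar> \<le> K * exp (- (\<delta> * R))"
proof -
  interpret \<nu>: real_distribution \<nu> by (rule \<nu>)
  have g: "integrable \<nu> (\<lambda>x. exp ((1 + \<delta>) * t * x))"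
    by (rule integrableI_bounded) (use K in \<open>auto simp: le_less_trans\<close>)
  have gK: "(\<integral>x. exp ((1 + \<delta>) * t * x) \<partial>\<nu>) \<le> K"
    using K K0 nn_integral_eq_integral[OF g] by simp
  have tail: "exp (t * x) - min (exp (t * x)) (exp R) \<le> exp (- (\<delta> * R)) * exp ((1 + \<delta>) * t * x)" for x R
  proof (cases "t * x \<le> R")
    case False
    then have "\<delta> * R \<le> \<delta> * (t * x)" using \<delta> by simp
    then have "t * x \<le> - (\<delta> * R) + (1 + \<delta>) * t * x" by (simp add: algebra_simps)
    then have "exp (t * x) \<le> exp (- (\<delta> * R)) * exp ((1 + \<delta>) * t * x)"
      by (metis exp_add exp_le_cancel_iff)
    moreover have "0 \<le> min (exp (t * x)) (exp R)" by simp
    ultimately show ?thesis by linarith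
  qed simp
  have m: "integrable \<nu> (\<lambda>x. min (exp (t * x)) (exp R))" for R
    by (rule \<nu>.integrable_const_bound[where B = "exp R"]) auto
  show f: "integrable \<nu> (\<lambda>x. exp (t * x))"
  proof (rule Bochner_Integration.integrable_bound)
    show "integrable \<nu> (\<lambda>x. 1 + exp ((1 + \<delta>) * t * x))" using g by simp
    show "AE x in \<nu>. norm (exp (t * x)) \<le> norm (1 + exp ((1 + \<delta>) * t * x))"
    proof (rule AE_I2)
      fix x
      have "exp (t * x) - min (exp (t * x)) 1 \<le> exp ((1 + \<delta>) * t * x)"
        using tail[of x 0] by (simp only: mult_zero_right minus_zero exp_zero mult_1)
      then have "exp (t * x) - 1 \<le> exp ((1 + \<delta>) * t * x)" by linarith
      then show "norm (exp (t * x)) \<le> norm (1 + exp ((1 + \<delta>) * t * x))" by simp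
    qed
  qed simp
  have "(\<integral>x. exp (t * x) \<partial>\<nu>) - (\<integral>x. min (exp (t * x)) (exp R) \<partial>\<nu>) = (\<integral>x. exp (t * x) - min (exp (t * x)) (exp R) \<partial>\<nu>)"
    using f m by simp
  also have "\<dots> \<le> (\<integral>x. exp (- (\<delta> * R)) * exp ((1 + \<delta>) * t * x) \<partial>\<nu>)"
    using f m g by (intro integral_mono tail) auto
  also have "\<dots> \<le> K * exp (- (\<delta> * R))"
    using gK by (simp add: mult.commute)
  finally have "(\<integral>x. exp (t * x) \<partial>\<nu>) - (\<integral>x. min (exp (t * x)) (exp R) \<partial>\<nu>) \<le> K * exp (- (\<delta> * R))" .
  moreover have "(\<integral>x. min (exp (t * x)) (exp R) \<partial>\<nu>) \<le> (\<integral>x. exp (t * x) \<partial>\<nu>)"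
    using f m by (intro integral_mono) auto
  ultimately show "\<bar>(\<integral>x. exp (t * x) \<partial>\<nu>) - (\<integral>x. min (exp (t * x)) (exp R) \<partial>\<nu>)\<bar> \<le> K * exp (- (\<delta> * R))"
    by linarith
qed

lemma weak_conv_exp_moments:
  assumes \<mu>: "\<And>n. real_distribution (\<mu> n)" and L: "real_distribution L" and wc: "weak_conv_m \<mu> L"
    and \<delta>: "0 < \<delta>" and K0: "0 \<le> K"
    and K: "\<forall>\<^sub>F n in sequentially. (\<integral>\<^sup>+x. ennreal (exp ((1 + \<delta>) * t * x)) \<partial>\<mu> n) \<le> ennreal K"
  shows "\<forall>\<^sub>F n in sequentially. integrable (\<mu> n) (\<lambda>x. exp (t * x))"
    and "integrable L (\<lambda>x. exp (t * x))"
    and "(\<lambda>n. \<integral>x. exp (t * x) \<partial>\<mu> n) \<longlonglongrightarrow> (\<integral>x. exp (t * x) \<partial>L)"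
proof -
  have "(\<integral>\<^sup>+x. ennreal (exp ((1 + \<delta>) * t * x)) \<partial>L) \<le> liminf (\<lambda>n. \<integral>\<^sup>+x. ennreal (exp ((1 + \<delta>) * t * x)) \<partial>\<mu> n)"
    by (rule weak_conv_nn_integral_le_liminf[OF \<mu> L wc]) (auto intro!: continuous_intros)
  also have "\<dots> \<le> ennreal K" by (rule Liminf_le[OF _ K]) simp
  finally have LK: "(\<integral>\<^sup>+x. ennreal (exp ((1 + \<delta>) * t * x)) \<partial>L) \<le> ennreal K" .
  show "\<forall>\<^sub>F n in sequentially. integrable (\<mu> n) (\<lambda>x. exp (t * x))"
    using K by eventually_elim (rule exp_truncation(1)[OF \<mu> \<delta> K0])
  show "integrable L (\<lambda>x. exp (t * x))" by (rule exp_truncation(1)[OF L \<delta> K0 LK])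
  show "(\<lambda>n. \<integral>x. exp (t * x) \<partial>\<mu> n) \<longlonglongrightarrow> (\<integral>x. exp (t * x) \<partial>L)"
  proof (rule tendstoI)
    fix e :: real assume e: "0 < e"
    have "((\<lambda>R. K * exp (- (\<delta> * R))) \<longlongrightarrow> 0) at_top" using \<delta> by real_asymp
    then have "\<forall>\<^sub>F R in at_top. K * exp (- (\<delta> * R)) < e / 3" by (rule order_tendstoD(2)) (use e in simp)
    then obtain R where R: "K * exp (- (\<delta> * R)) < e / 3" using eventually_happens by force
    have "(\<lambda>n. \<integral>x. min (exp (t * x)) (exp R) \<partial>\<mu> n) \<longlonglongrightarrow> (\<integral>x. min (exp (t * x)) (exp R) \<partial>L)"
    proof (rule weak_conv_imp_integral_bdd_continuous_conv[OF \<mu> L wc])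
      show "isCont (\<lambda>x. min (exp (t * x)) (exp R)) x" for x by (intro continuous_intros)
      show "norm (min (exp (t * x)) (exp R)) \<le> exp R" for x by simp
    qed
    then have "\<forall>\<^sub>F n in sequentially. dist (\<integral>x. min (exp (t * x)) (exp R) \<partial>\<mu> n) (\<integral>x. min (exp (t * x)) (exp R) \<partial>L) < e / 3"
      by (rule tendstoD) (use e in simp)
    with K show "\<forall>\<^sub>F n in sequentially. dist (\<integral>x. exp (t * x) \<partial>\<mu> n) (\<integral>x. exp (t * x) \<partial>L) < e"
    proof eventually_elim
      case (elim n)
      show ?case
        using elim(2) exp_truncation(2)[OF \<mu> \<delta> K0 elim(1), of R] exp_truncation(2)[OF L \<delta> K0 LK, of R] R
        unfolding dist_real_def by linarith
    qed
  qed
qed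

text \<open>The recursion of \<open>tree_mgf\<close> is a finite sum, so its limit in the depth
  satisfies the exact recursion and inherits the bounds that are uniform in the depth.
  \<open>G\<close> is abstract because trees of different cardinality live on unrelated probability
  spaces.\<close>

lemma (in split_parameters) tree_mgf_limit_char:
  assumes lim: "\<And>w n. (\<lambda>k. tree_mgf k (\<i> * complex_of_real w) n) \<longlonglongrightarrow> G w n"
    and L: "fixed_point_law D L"
  shows "(\<lambda>n. G (t / real n) n) \<longlonglongrightarrow> char L t"
proof -
  obtain K where K: "\<And>k w n. cmod (tree_mgf k (\<i> * complex_of_real w) n - 1) \<le> K * (w * real n)\<^sup>2"
    using tree_mgf_imaginary_quadratic by blast
  show ?thesis
  proof (rule recursive_char_tendsto[OF _ _ _ L])
    show "cmod (G w n) \<le> 1" for w n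
      by (rule LIMSEQ_le_const2[OF tendsto_norm[OF lim]]) (auto simp: norm_tree_mgf_imaginary)
    show "cmod (G w n - 1) \<le> K * (w * real n)\<^sup>2" for w n
      by (rule LIMSEQ_le_const2[OF tendsto_norm[OF tendsto_diff[OF lim tendsto_const]]]) (auto simp: K)
    show "G w n = (\<integral>x. iexp (w * toll n (fst x)) * (\<Prod>i\<in>UNIV. G w (fst x i)) \<partial>joint_law n)" for w n
    proof -
      have "(\<lambda>k. tree_mgf (Suc k) (\<i> * complex_of_real w) n) \<longlonglongrightarrow>
        (\<Sum>c\<in>child_sizes n. of_real (offspring_prob n c) *
          (exp (\<i> * complex_of_real w * of_real (toll n c)) * (\<Prod>i\<in>UNIV. G w (c i))))"
        unfolding tree_mgf.simps by (intro tendsto_intros lim)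
      then have "G w n = (\<Sum>c\<in>child_sizes n. of_real (offspring_prob n c) *
          (exp (\<i> * complex_of_real w * of_real (toll n c)) * (\<Prod>i\<in>UNIV. G w (c i))))"
        using LIMSEQ_Suc[OF lim[of w n]] by (blast intro: LIMSEQ_unique)
      also have "\<dots> = (\<integral>x. exp (\<i> * complex_of_real w * of_real (toll n (fst x))) * (\<Prod>i\<in>UNIV. G w (fst x i)) \<partial>joint_law n)"
        using integral_joint_fst[of n "\<lambda>c. exp (\<i> * complex_of_real w * of_real (toll n c)) * (\<Prod>i\<in>UNIV. G w (c i))"]
        by (simp add: scaleR_conv_of_real)
      finally show ?thesis by (simp add: mult.assoc)
    qed
  qed
qed

lemma (in split_tree_model) normalized_path_length_eq:
  "normalized_path_length M s s0 n N \<omega> = (path_length \<omega> - mean_length n) / real n"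
  by (simp add: normalized_path_length_def expectation_path_length)

text \<open>The convergence is stated for integrals in \<open>ennreal\<close>, where it makes sense
  for every \<open>t\<close>: for \<open>s0 = s1 = 0\<close> the path length can be unbounded, and
  the limit law has an infinite moment once the vertex mass times \<open>exp t\<close> reaches 1.
  Below this threshold the last conjunct gives the statement for finite real moments.\<close>

theorem theorem2p1:
  fixes D :: "(real ^ 'b::finite) measure"
    and s s0 s1 :: nat
    and M :: "nat \<Rightarrow> 'a measure"
    and V :: "nat \<Rightarrow> 'b list \<Rightarrow> 'a \<Rightarrow> real ^ 'b"
    and N :: "nat \<Rightarrow> 'b list \<Rightarrow> 'a \<Rightarrow> nat"
    and X :: "nat \<Rightarrow> 'a \<Rightarrow> real"
  defines "X \<equiv> \<lambda>n. normalized_path_length (M n) s s0 n (N n)"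
  assumes "2 \<le> CARD('b)"
    and "s0 + CARD('b) * s1 \<le> s + 1"
    and "(s, s0) \<noteq> (0, 0)"
    and "split_vector_law D"
    and "measure D {v. \<exists>i. v $ i = 1} < 1"
    and "\<And>n. split_tree (M n) D s s0 s1 n (V n) (N n)"
    and "0 < measure D {v. split_C D v \<noteq> 0}"
  shows "\<exists>L. fixed_point_law D L \<and> (\<forall>L'. fixed_point_law D L' \<longrightarrow> L' = L) \<and>
           weak_conv_m (\<lambda>n. distr (M n) borel (X n)) L \<and>
           (\<forall>t::real.
              ((\<lambda>n. \<integral>\<^sup>+\<omega>. ennreal (exp (t * X n \<omega>)) \<partial>M n) \<longlonglongrightarrow> (\<integral>\<^sup>+x. ennreal (exp (t * x)) \<partial>L)) \<and>
              (0 < s0 \<or> 0 < s1 \<longrightarrow> (\<forall>n. integrable (M n) (\<lambda>\<omega>. exp (t * X n \<omega>)))) \<and>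
              (measure D {v. \<exists>i. v $ i = 1} * exp t < 1 \<longrightarrow>
                 (\<forall>\<^sub>F n in sequentially. integrable (M n) (\<lambda>\<omega>. exp (t * X n \<omega>))) \<and>
                 integrable L (\<lambda>x. exp (t * x)) \<and>
                 (\<lambda>n. \<integral>\<omega>. exp (t * X n \<omega>) \<partial>M n) \<longlonglongrightarrow> (\<integral>x. exp (t * x) \<partial>L)))"
proof -
  interpret split_parameters D s s0 s1 by unfold_locales (use assms in auto)
  have model: "split_tree_model (M n) D s s0 s1 n (V n) (N n)" for n
    by (intro split_tree_model.intro assms(7)) unfold_locales
  let ?p = "measure D {v. \<exists>i. v $ i = 1}"
  let ?P = "\<lambda>n \<omega>. total_path_length s s0 (\<lambda>u. N n u \<omega>)"
  note meas [measurable] = split_tree_model.path_length_measurable[OF model]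
  have X: "X n \<omega> = (?P n \<omega> - mean_length n) / real n" for n \<omega>
    unfolding X_def by (rule split_tree_model.normalized_path_length_eq[OF model])
  have X_meas [measurable]: "X n \<in> borel_measurable (M n)" for n
    unfolding X[abs_def] by measurable
  have prob: "prob_space (M n)" for n
    using assms(7)[of n] by (simp add: split_tree_def)
  obtain L where fpL: "fixed_point_law D L" using fixed_point_law_exists by blast
  then have L: "real_distribution L" by (simp add: fixed_point_law_iff)
  define \<mu> where "\<mu> n = distr (M n) borel (X n)" for n
  have \<mu>: "real_distribution (\<mu> n)" for n
    unfolding \<mu>_def by (rule prob_space.real_distribution_distr[OF prob X_meas])
  have wc: "weak_conv_m \<mu> L"
  proof (rule levy_continuity[OF \<mu> L])
    fix t
    define G where "G w n = (\<integral>\<omega>. iexp (w * (?P n \<omega> - mean_length n)) \<partial>M n)" for w n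
    have "(\<lambda>n. G (t / real n) n) \<longlonglongrightarrow> char L t"
      unfolding G_def
      by (rule tree_mgf_limit_char[OF _ fpL]) (rule split_tree_model.tree_mgf_tendsto_imaginary[OF model])
    moreover have "char (\<mu> n) t = G (t / real n) n" for n
      unfolding char_def \<mu>_def G_def by (subst integral_distr) (auto simp: X)
    ultimately show "(\<lambda>n. char (\<mu> n) t) \<longlonglongrightarrow> char L t" by simp
  qed
  have nn: "(\<integral>\<^sup>+\<omega>. ennreal (exp (t * X n \<omega>)) \<partial>M n) = (\<integral>\<^sup>+x. ennreal (exp (t * x)) \<partial>\<mu> n)" for t n
    unfolding \<mu>_def by (subst nn_integral_distr) auto
  have int: "integrable (M n) (\<lambda>\<omega>. exp (t * X n \<omega>)) \<longleftrightarrow> integrable (\<mu> n) (\<lambda>x. exp (t * x))" for t n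
    unfolding \<mu>_def by (subst integrable_distr_eq) auto
  have eqi: "(\<integral>\<omega>. exp (t * X n \<omega>) \<partial>M n) = (\<integral>x. exp (t * x) \<partial>\<mu> n)" for t n
    unfolding \<mu>_def by (subst integral_distr) auto
  have A: "(\<forall>\<^sub>F n in sequentially. integrable (M n) (\<lambda>\<omega>. exp (t * X n \<omega>))) \<and>
      integrable L (\<lambda>x. exp (t * x)) \<and> (\<lambda>n. \<integral>\<omega>. exp (t * X n \<omega>) \<partial>M n) \<longlonglongrightarrow> (\<integral>x. exp (t * x) \<partial>L)"
    if p: "?p * exp t < 1" for t
  proof -
    \<comment> \<open>The condition is open in \<open>t\<close>, so it still holds for some larger
      exponent \<open>(1 + \<delta>) * t\<close>, as \<open>weak_conv_exp_moments\<close>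
      requires.\<close>
    have "((\<lambda>\<delta>. ?p * exp ((1 + \<delta>) * t)) \<longlongrightarrow> ?p * exp ((1 + 0) * t)) (at_right 0)"
      by (intro tendsto_intros)
    then have "\<forall>\<^sub>F \<delta> in at_right 0. ?p * exp ((1 + \<delta>) * t) < 1"
      by (rule order_tendstoD(2)) (use p in simp)
    then have "\<forall>\<^sub>F \<delta> in at_right 0. 0 < \<delta> \<and> ?p * exp ((1 + \<delta>) * t) < 1"
      using eventually_at_right_less by (rule eventually_elim2) simp
    then obtain \<delta> where \<delta>: "0 < \<delta>" "?p * exp ((1 + \<delta>) * t) < 1"
      using eventually_happens by force
    obtain K \<rho> where \<rho>: "0 < \<rho>" and K: "\<And>k n r. 0 \<le> r \<Longrightarrow> r \<le> \<rho> \<Longrightarrow> r * real n \<le> 1 \<Longrightarrow>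
        tree_mgf k (r * ((1 + \<delta>) * t)) n \<le> K"
      using tree_mgf_bound[OF \<delta>(2)] by blast
    have bound: "(\<integral>\<^sup>+x. ennreal (exp ((1 + \<delta>) * t * x)) \<partial>\<mu> n) \<le> ennreal (max K 0)" if n: "1 / \<rho> \<le> real n" for n
    proof -
      have n0: "0 < real n" using n \<rho> by (metis less_le_trans zero_less_divide_1_iff)
      \<comment> \<open>The normalisation by \<open>n\<close> corresponds to
        \<open>r = 1 / n\<close>: then \<open>r * n = 1\<close>, and \<open>r \<le> \<rho>\<close>
        holds as soon as \<open>n \<ge> 1 / \<rho>\<close>.\<close>
      have "1 / real n \<le> \<rho>" using n n0 \<rho> by (simp add: field_simps)
      then have "tree_mgf k (1 / real n * ((1 + \<delta>) * t)) n \<le> K" for k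
        by (intro K) (use n0 in auto)
      from split_tree_model.exp_path_length_bound[OF model this]
      have "(\<integral>\<^sup>+\<omega>. ennreal (exp (1 / real n * ((1 + \<delta>) * t) * (?P n \<omega> - mean_length n))) \<partial>M n) \<le> ennreal K" .
      then have "(\<integral>\<^sup>+\<omega>. ennreal (exp ((1 + \<delta>) * t * X n \<omega>)) \<partial>M n) \<le> ennreal K"
        by (simp add: X)
      also have "\<dots> \<le> ennreal (max K 0)" by (intro ennreal_leI) simp
      finally show ?thesis unfolding nn .
    qed
    obtain n0 :: nat where "1 / \<rho> \<le> real n0" using real_arch_simple by blast
    then have "\<forall>\<^sub>F n in sequentially. (\<integral>\<^sup>+x. ennreal (exp ((1 + \<delta>) * t * x)) \<partial>\<mu> n) \<le> ennreal (max K 0)"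
      by (intro eventually_sequentiallyI[of n0] bound) (use of_nat_mono in \<open>fastforce intro: order_trans\<close>)
    from weak_conv_exp_moments[OF \<mu> L wc \<delta>(1) _ this] show ?thesis unfolding int eqi by simp
  qed
  have B: "(\<lambda>n. \<integral>\<^sup>+\<omega>. ennreal (exp (t * X n \<omega>)) \<partial>M n) \<longlonglongrightarrow> (\<integral>\<^sup>+x. ennreal (exp (t * x)) \<partial>L)" for t
  proof (cases "?p * exp t < 1")
    case True
    have "(\<lambda>n. ennreal (\<integral>\<omega>. exp (t * X n \<omega>) \<partial>M n)) \<longlonglongrightarrow> ennreal (\<integral>x. exp (t * x) \<partial>L)"
      using A[OF True] by (intro tendsto_ennrealI) simp
    moreover have "\<forall>\<^sub>F n in sequentially. ennreal (\<integral>\<omega>. exp (t * X n \<omega>) \<partial>M n) = (\<integral>\<^sup>+\<omega>. ennreal (exp (t * X n \<omega>)) \<partial>M n)"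
      using A[OF True, THEN conjunct1] by eventually_elim (simp add: nn_integral_eq_integral)
    ultimately have "(\<lambda>n. \<integral>\<^sup>+\<omega>. ennreal (exp (t * X n \<omega>)) \<partial>M n) \<longlonglongrightarrow> ennreal (\<integral>x. exp (t * x) \<partial>L)"
      by (rule Lim_transform_eventually)
    then show ?thesis using A[OF True] by (simp add: nn_integral_eq_integral)
  next
    case False
    \<comment> \<open>The limit moment is infinite, and lower semicontinuity under weak convergence
      forces the moments of \<open>X n\<close> to infinity as well.\<close>
    have inf: "(\<integral>\<^sup>+x. ennreal (exp (t * x)) \<partial>L) = \<infinity>"
      by (rule fixed_point_law_exp_infinite[OF fpL]) (use False in simp)
    have "(\<integral>\<^sup>+x. ennreal (exp (t * x)) \<partial>L) \<le> liminf (\<lambda>n. \<integral>\<^sup>+x. ennreal (exp (t * x)) \<partial>\<mu> n)"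
      by (rule weak_conv_nn_integral_le_liminf[OF \<mu> L wc]) (auto intro!: continuous_intros)
    then have 1: "liminf (\<lambda>n. \<integral>\<^sup>+x. ennreal (exp (t * x)) \<partial>\<mu> n) = top" using inf by (simp add: top_unique)
    then have "limsup (\<lambda>n. \<integral>\<^sup>+x. ennreal (exp (t * x)) \<partial>\<mu> n) = top"
      using Liminf_le_Limsup[of sequentially "\<lambda>n. \<integral>\<^sup>+x. ennreal (exp (t * x)) \<partial>\<mu> n"] by (simp add: top_unique)
    with 1 show ?thesis unfolding nn inf infinity_ennreal_def by (intro Liminf_eq_Limsup) simp_all
  qed
  have C: "integrable (M n) (\<lambda>\<omega>. exp (t * X n \<omega>))" if pos: "0 < s0 \<or> 0 < s1" for t n
  proof -
    interpret prob_space "M n" by (rule prob)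
    define B where "B = \<bar>t\<bar> * ((real n * real n + mean_length n) / real n)"
    have "AE \<omega> in M n. norm (exp (t * X n \<omega>)) \<le> exp B"
      using split_tree_model.path_length_bounded[OF model[of n] pos]
    proof eventually_elim
      case (elim \<omega>)
      have "\<bar>?P n \<omega> - mean_length n\<bar> \<le> real n * real n + mean_length n"
        using elim split_tree_model.path_length_nonneg[OF model[of n], of \<omega>] mean_length_nonneg[of n] by linarith
      then have "\<bar>X n \<omega>\<bar> \<le> (real n * real n + mean_length n) / real n"
        unfolding X by (simp add: abs_divide divide_right_mono)
      then have "\<bar>t * X n \<omega>\<bar> \<le> B"
        unfolding B_def abs_mult by (intro mult_left_mono) auto
      then show ?case by simp
    qed
    then show ?thesis by (intro integrable_const_bound) auto
  qed
  have wc': "weak_conv_m (\<lambda>n. distr (M n) borel (X n)) L" using wc unfolding \<mu>_def .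
  show ?thesis
    using fpL fixed_point_law_unique[OF fpL] wc' A B C by blast
qed

end
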